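(* Let $(\Lambda,d)$ be a finitely aligned $k$-graph, and suppose that $\mathcal{E}\subset\mathrm{FE}(\Lambda)$ is satiated. Let $\{t_\lambda:\lambda\in\Lambda\}$ be a relative Cuntz-Krieger $(\Lambda;\mathcal{E})$-family. The homomorphism $\pi^{\mathcal{E}}_t$ is injective on $C^*(\Lambda;\mathcal{E})^\gamma$ if and only if (1) $t_v\neq0$ for all $v\in\Lambda^0$, and (2) $\prod_{\lambda\in F}(t_{r(F)}-t_\lambda t_\lambda^* )\neq0$ for all $F\in\mathrm{FE}(\Lambda)\setminus\mathcal{E}$.
   Context: $k$-graphs. $\mathbb{N}$ contains $0$; $\mathbb{N}^k$ is ordered coordinatewise, $m\vee n$ is the coordinatewise maximum, and $0<n$ means $n \ge 0$, $n\neq 0$. For $k\in\mathbb{N}\setminus\{0\}$, a $k$-graph is a pair $(\Lambda,d)$ where $\Lambda$ is a countable category and $d:\Lambda\to\mathbb{N}^k$ is a functor satisfying the factorisation property: for every morphism $\lambda$ and all $m,n\in\mathbb{N}^k$ with $d(\lambda)=m+n$ there are unique morphisms $\mu,\nu$ with $d(\mu)=m$, $d(\nu)=n$, $\lambda=\mu\nu$. Write $\lambda\in\Lambda$ for morphisms ("paths"), $r,s$ for codomain and domain (so $\lambda\mu$ is defined when $s(\lambda)=r(\mu)$); objects ("vertices") are identified with the elements of $\Lambda^0=\{\lambda: d(\lambda)=0\}$. For $v\in\Lambda^0$, $v\Lambda=\{\lambda: r(\lambda)=v\}$. For $E\subset\Lambda$, $\lambda E=\{\lambda\mu:\mu\in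 E, r(\mu)=s(\lambda)\}$ and $E\Lambda=\{\lambda\mu:\lambda\in E,\ \mu \in s(\lambda)\Lambda\}$. For $l\le m\le d(\lambda)$, $\lambda(l,m)$ is the unique path of degree $m-l$ with $\lambda=\lambda(0,l)\lambda(l,m)\lambda(m,d(\lambda))$. Finite exhaustive sets. For $\mu,\nu\in\Lambda$, $\mathrm{MCE}(\mu,\nu)$ is the set of $\lambda$ with $d(\lambda)=d(\mu)\vee d(\nu)$, $\lambda(0,d(\mu))=\mu$, $\lambda(0,d(\nu))=\nu$; $\Lambda^{\min}(\mu,\nu)=\{(\alpha,\beta)\in \Lambda\times\Lambda:\mu\alpha=\nu\beta\in\mathrm{MCE}(\mu,\nu)\}$. $\Lambda$ is finitely aligned if every $\mathrm{MCE}(\mu,\nu)$ is finite (possibly empty). For $E\subset\Lambda$, $\mathrm{Ext}(\mu;E)=\{\alpha\in s(\mu)\Lambda:(\alpha,\beta)\in\Lambda^{\min}(\mu,\nu)\text{ for some }\nu\in E \text{ and some } \beta\}$. A set $E\subset v\Lambda$ is exhaustive if $\mathrm{Ext}(\lambda;E)\neq\emptyset$ for all $\lambda\in v\Lambda$. $\mathrm{FE}(\Lambda)=\bigcup_{v\in\Lambda^0}\{E\subset v\Lambda\setminus\{v\}: E\text{ finite and exhaustive}\}$; for $E\in\mathrm{FE}(\Lambda)$, $r(E)$ is the vertex $v$ with $E\subset v\Lambda$. Relative Cuntz-Krieger algebras. For $\mathcal{E}\subset\mathrm{FE}(\Lambda)$, a relative Cuntz-Krieger $(\Lambda;\mathcal{E})$-family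 is a collection $\{t_\lambda:\lambda\in\Lambda\}$ of partial isometries in a $C^*$-algebra such that: (TCK1) $\{t_v:v\in\Lambda^0\}$ are mutually orthogonal projections; (TCK2) $t_\lambda t_\mu=t_{\lambda\mu}$ whenever $s(\lambda)=r(\mu)$; (TCK3) $t_\lambda^*t_\mu=\sum_{(\alpha,\beta)\in\Lambda^{\min}(\lambda,\mu)}t_\alpha t_\beta^*$ for all $\lambda,\mu$ (empty sum $=0$); (CK) $\prod_{\lambda\in E}(t_{r(E)}-t_\lambda t_\lambda^* )=0$ for all $E\in\mathcal{E}$. (By (TCK3) the projections $t_\lambda t_\lambda^*$ commute, so products are well defined.) $C^*(\Lambda;\mathcal{E})$ is the universal $C^*$-algebra generated by a relative Cuntz-Krieger $(\Lambda;\mathcal{E})$-family $\{s_{\mathcal{E}}(\lambda)\}$; given a relative Cuntz-Krieger $(\Lambda;\mathcal{E})$-family $\{t_\lambda\}$ in a $C^*$-algebra $B$, $\pi^{\mathcal{E}}_t:C^*(\Lambda;\mathcal{E})\to B$ is the unique homomorphism with $\pi^{\mathcal{E}}_t(s_{\mathcal{E}}(\lambda))=t_\lambda$. The gauge action $\gamma$ of $\mathbb{T}^k$ on $C^*(\Lambda;\mathcal{E})$ is the strongly continuous action with $\gamma_z(s_{\mathcal{E}}(\lambda))=z^{d(\lambda)}s_{\mathcal{E}}(\lambda)$, where $z^n=\prod_i z_i^{n_i}$; the core $C^*(\Lambda;\mathcal{E})^\gamma$ is its fixed-point algebra, which equals $\overline{\mathrm{span}}\{s_{\mathcal{E}}(\lambda)s_{\mathcal{E}}(\mu)^*:d(\lambda)=d(\mu)\}$.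 Satiated. $\mathcal{E}\subset\mathrm{FE}(\Lambda)$ is satiated if: (S1) $G\in\mathcal{E}$, $E\in\mathrm{FE}(\Lambda)$, $G\subset E$ imply $E\in\mathcal{E}$; (S2) if $G\in\mathcal{E}$ with $r(G)=v$ and $\mu\in v\Lambda\setminus G\Lambda$, then $\mathrm{Ext}(\mu;G)\in\mathcal{E}$; (S3) if $G\in\mathcal{E}$ and $0<n_\lambda\le d(\lambda)$ for each $\lambda\in G$, then $\{\lambda(0,n_\lambda):\lambda\in G\}\in\mathcal{E}$; (S4) if $G\in\mathcal{E}$, $G'\subset G$ and $G'_\lambda\in\mathcal{E}$ with $r(G'_\lambda)=s(\lambda)$ for each $\lambda\in G'$, then $(G\setminus G')\cup\bigcup_{\lambda\in G'}\lambda G'_\lambda\in\mathcal{E}$. *)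

theory Defs
  imports
    Complex_Main
    "HOL-Library.Countable_Set"
    "HOL-Library.Function_Algebras"
    "HOL-Library.Poly_Mapping"
    "HOL-Algebra.Ring"
begin

section \<open>Higher-rank graphs\<close>

text \<open>
  Degrees live in \<open>'k \<Rightarrow> nat\<close> for a finite (nonempty) index type \<open>'k\<close>, with the pointwise addition,
  order and supremum; in particular \<open>0 < n\<close> means \<open>0 \<le> n\<close> and \<open>n \<noteq> 0\<close>.
  Categories are arrows-only: objects are identified with their identity morphisms, so \<open>rng\<close>
  (codomain) and \<open>src\<close> (domain) take values in the set of morphisms.
\<close>

record ('l, 'k) kgraph =
  paths :: "'l set"
  rng :: "'l \<Rightarrow> 'l"
  src :: "'l \<Rightarrow> 'l"
  cmp :: "'l \<Rightarrow> 'l \<Rightarrow> 'l"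
  deg :: "'l \<Rightarrow> 'k \<Rightarrow> nat"

locale k_graph =
  fixes \<Lambda> :: "('l, 'k::finite) kgraph"
  assumes countable_paths: "countable (paths \<Lambda>)"
    and rng_closed: "\<kappa> \<in> paths \<Lambda> \<Longrightarrow> rng \<Lambda> \<kappa> \<in> paths \<Lambda>"
    and src_closed: "\<kappa> \<in> paths \<Lambda> \<Longrightarrow> src \<Lambda> \<kappa> \<in> paths \<Lambda>"
    and rng_rng: "\<kappa> \<in> paths \<Lambda> \<Longrightarrow> rng \<Lambda> (rng \<Lambda> \<kappa>) = rng \<Lambda> \<kappa>"
    and src_rng: "\<kappa> \<in> paths \<Lambda> \<Longrightarrow> src \<Lambda> (rng \<Lambda> \<kappa>) = rng \<Lambda> \<kappa>"
    and rng_src: "\<kappa> \<in> paths \<Lambda> \<Longrightarrow> rng \<Lambda> (src \<Lambda> \<kappa>) = src \<Lambda> \<kappa>"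
    and src_src: "\<kappa> \<in> paths \<Lambda> \<Longrightarrow> src \<Lambda> (src \<Lambda> \<kappa>) = src \<Lambda> \<kappa>"
    and cmp_closed: "\<lbrakk>\<kappa> \<in> paths \<Lambda>; \<mu> \<in> paths \<Lambda>; src \<Lambda> \<kappa> = rng \<Lambda> \<mu>\<rbrakk> \<Longrightarrow> cmp \<Lambda> \<kappa> \<mu> \<in> paths \<Lambda>"
    and rng_cmp: "\<lbrakk>\<kappa> \<in> paths \<Lambda>; \<mu> \<in> paths \<Lambda>; src \<Lambda> \<kappa> = rng \<Lambda> \<mu>\<rbrakk> \<Longrightarrow> rng \<Lambda> (cmp \<Lambda> \<kappa> \<mu>) = rng \<Lambda> \<kappa>"
    and src_cmp: "\<lbrakk>\<kappa> \<in> paths \<Lambda>; \<mu> \<in> paths \<Lambda>; src \<Lambda> \<kappa> = rng \<Lambda> \<mu>\<rbrakk> \<Longrightarrow> src \<Lambda> (cmp \<Lambda> \<kappa> \<mu>) = src \<Lambda> \<mu>"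
    and cmp_assoc: "\<lbrakk>\<kappa> \<in> paths \<Lambda>; \<mu> \<in> paths \<Lambda>; \<nu> \<in> paths \<Lambda>; src \<Lambda> \<kappa> = rng \<Lambda> \<mu>; src \<Lambda> \<mu> = rng \<Lambda> \<nu>\<rbrakk>
                      \<Longrightarrow> cmp \<Lambda> (cmp \<Lambda> \<kappa> \<mu>) \<nu> = cmp \<Lambda> \<kappa> (cmp \<Lambda> \<mu> \<nu>)"
    and cmp_rng: "\<kappa> \<in> paths \<Lambda> \<Longrightarrow> cmp \<Lambda> (rng \<Lambda> \<kappa>) \<kappa> = \<kappa>"
    and cmp_src: "\<kappa> \<in> paths \<Lambda> \<Longrightarrow> cmp \<Lambda> \<kappa> (src \<Lambda> \<kappa>) = \<kappa>"
    and deg_rng: "\<kappa> \<in> paths \<Lambda> \<Longrightarrow> deg \<Lambda> (rng \<Lambda> \<kappa>) = 0"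
    and deg_cmp: "\<lbrakk>\<kappa> \<in> paths \<Lambda>; \<mu> \<in> paths \<Lambda>; src \<Lambda> \<kappa> = rng \<Lambda> \<mu>\<rbrakk> \<Longrightarrow> deg \<Lambda> (cmp \<Lambda> \<kappa> \<mu>) = deg \<Lambda> \<kappa> + deg \<Lambda> \<mu>"
    and factorisation: "\<lbrakk>\<kappa> \<in> paths \<Lambda>; deg \<Lambda> \<kappa> = m + n\<rbrakk> \<Longrightarrow>
          \<exists>!p. fst p \<in> paths \<Lambda> \<and> snd p \<in> paths \<Lambda> \<and> src \<Lambda> (fst p) = rng \<Lambda> (snd p) \<and>
               deg \<Lambda> (fst p) = m \<and> deg \<Lambda> (snd p) = n \<and> \<kappa> = cmp \<Lambda> (fst p) (snd p)"

definition vertices :: "('l, 'k) kgraph \<Rightarrow> 'l set" where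
  "vertices \<Lambda> = {\<kappa> \<in> paths \<Lambda>. deg \<Lambda> \<kappa> = 0}"

text \<open>The identification of objects with paths of degree zero.\<close>

lemma (in k_graph) vertices_eq_identities: "vertices \<Lambda> = rng \<Lambda> ` paths \<Lambda>"
proof
  show "rng \<Lambda> ` paths \<Lambda> \<subseteq> vertices \<Lambda>"
    by (auto simp: vertices_def rng_closed deg_rng)
  show "vertices \<Lambda> \<subseteq> rng \<Lambda> ` paths \<Lambda>"
  proof
    fix v assume "v \<in> vertices \<Lambda>"
    then have v: "v \<in> paths \<Lambda>" "deg \<Lambda> v = 0 + 0"
      by (auto simp: vertices_def)
    have s: "deg \<Lambda> (src \<Lambda> v) = 0"
      using deg_rng[OF src_closed[OF v(1)]] by (simp add: rng_src v)
    have "(rng \<Lambda> v, v) = (v, src \<Lambda> v)"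
      using factorisation[OF v] v s
      by (elim ex1E) (metis fst_conv snd_conv rng_closed src_closed src_rng rng_src deg_rng cmp_rng cmp_src add.right_neutral)
    then show "v \<in> rng \<Lambda> ` paths \<Lambda>"
      using v by force
  qed
qed

definition paths_to :: "('l, 'k) kgraph \<Rightarrow> 'l \<Rightarrow> 'l set" where
  "paths_to \<Lambda> v = {\<kappa> \<in> paths \<Lambda>. rng \<Lambda> \<kappa> = v}"

definition left_translate :: "('l, 'k) kgraph \<Rightarrow> 'l \<Rightarrow> 'l set \<Rightarrow> 'l set" where
  "left_translate \<Lambda> \<kappa> E = {cmp \<Lambda> \<kappa> \<mu> | \<mu>. \<mu> \<in> E \<and> rng \<Lambda> \<mu> = src \<Lambda> \<kappa>}"

definition extensions_of :: "('l, 'k) kgraph \<Rightarrow> 'l set \<Rightarrow> 'l set" where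
  "extensions_of \<Lambda> E = {cmp \<Lambda> \<kappa> \<mu> | \<kappa> \<mu>. \<kappa> \<in> E \<and> \<mu> \<in> paths_to \<Lambda> (src \<Lambda> \<kappa>)}"

definition segment :: "('l, 'k) kgraph \<Rightarrow> 'l \<Rightarrow> ('k \<Rightarrow> nat) \<Rightarrow> ('k \<Rightarrow> nat) \<Rightarrow> 'l" where
  "segment \<Lambda> \<kappa> l m = (THE \<beta>. \<exists>\<alpha> \<gamma>. \<alpha> \<in> paths \<Lambda> \<and> \<beta> \<in> paths \<Lambda> \<and> \<gamma> \<in> paths \<Lambda> \<and>
     src \<Lambda> \<alpha> = rng \<Lambda> \<beta> \<and> src \<Lambda> \<beta> = rng \<Lambda> \<gamma> \<and>
     deg \<Lambda> \<alpha> = l \<and> deg \<Lambda> \<beta> = m - l \<and> deg \<Lambda> \<gamma> = deg \<Lambda> \<kappa> - m \<and>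
     \<kappa> = cmp \<Lambda> \<alpha> (cmp \<Lambda> \<beta> \<gamma>))"

definition MCE :: "('l, 'k) kgraph \<Rightarrow> 'l \<Rightarrow> 'l \<Rightarrow> 'l set" where
  "MCE \<Lambda> \<mu> \<nu> = {\<kappa> \<in> paths \<Lambda>. deg \<Lambda> \<kappa> = sup (deg \<Lambda> \<mu>) (deg \<Lambda> \<nu>) \<and>
     segment \<Lambda> \<kappa> 0 (deg \<Lambda> \<mu>) = \<mu> \<and> segment \<Lambda> \<kappa> 0 (deg \<Lambda> \<nu>) = \<nu>}"

definition min_ext :: "('l, 'k) kgraph \<Rightarrow> 'l \<Rightarrow> 'l \<Rightarrow> ('l \<times> 'l) set" where
  "min_ext \<Lambda> \<mu> \<nu> = {(\<alpha>, \<beta>). \<alpha> \<in> paths \<Lambda> \<and> \<beta> \<in> paths \<Lambda> \<and>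
     src \<Lambda> \<mu> = rng \<Lambda> \<alpha> \<and> src \<Lambda> \<nu> = rng \<Lambda> \<beta> \<and>
     cmp \<Lambda> \<mu> \<alpha> = cmp \<Lambda> \<nu> \<beta> \<and> cmp \<Lambda> \<mu> \<alpha> \<in> MCE \<Lambda> \<mu> \<nu>}"

locale finitely_aligned_k_graph = k_graph +
  assumes finite_MCE: "\<lbrakk>\<mu> \<in> paths \<Lambda>; \<nu> \<in> paths \<Lambda>\<rbrakk> \<Longrightarrow> finite (MCE \<Lambda> \<mu> \<nu>)"

definition Ext :: "('l, 'k) kgraph \<Rightarrow> 'l \<Rightarrow> 'l set \<Rightarrow> 'l set" where
  "Ext \<Lambda> \<mu> E = {\<alpha> \<in> paths_to \<Lambda> (src \<Lambda> \<mu>). \<exists>\<nu>\<in>E. \<exists>\<beta>. (\<alpha>, \<beta>) \<in> min_ext \<Lambda> \<mu> \<nu>}"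

definition exhaustive :: "('l, 'k) kgraph \<Rightarrow> 'l \<Rightarrow> 'l set \<Rightarrow> bool" where
  "exhaustive \<Lambda> v E \<longleftrightarrow> E \<subseteq> paths_to \<Lambda> v \<and> (\<forall>\<kappa>\<in>paths_to \<Lambda> v. Ext \<Lambda> \<kappa> E \<noteq> {})"

definition FE :: "('l, 'k) kgraph \<Rightarrow> 'l set set" where
  "FE \<Lambda> = (\<Union>v\<in>vertices \<Lambda>. {E. E \<subseteq> paths_to \<Lambda> v - {v} \<and> finite E \<and> exhaustive \<Lambda> v E})"

definition rng_set :: "('l, 'k) kgraph \<Rightarrow> 'l set \<Rightarrow> 'l" where
  "rng_set \<Lambda> E = (THE v. v \<in> vertices \<Lambda> \<and> E \<subseteq> paths_to \<Lambda> v)"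

definition satiated :: "('l, 'k) kgraph \<Rightarrow> 'l set set \<Rightarrow> bool" where
  "satiated \<Lambda> \<E> \<longleftrightarrow> \<E> \<subseteq> FE \<Lambda> \<and>
     (\<forall>G\<in>\<E>. \<forall>E\<in>FE \<Lambda>. G \<subseteq> E \<longrightarrow> E \<in> \<E>) \<and>
     (\<forall>G\<in>\<E>. \<forall>\<mu>\<in>paths_to \<Lambda> (rng_set \<Lambda> G) - extensions_of \<Lambda> G. Ext \<Lambda> \<mu> G \<in> \<E>) \<and>
     (\<forall>G\<in>\<E>. \<forall>n. (\<forall>\<kappa>\<in>G. 0 < n \<kappa> \<and> n \<kappa> \<le> deg \<Lambda> \<kappa>) \<longrightarrow> (\<lambda>\<kappa>. segment \<Lambda> \<kappa> 0 (n \<kappa>)) ` G \<in> \<E>) \<and>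
     (\<forall>G\<in>\<E>. \<forall>G'\<subseteq>G. \<forall>H. (\<forall>\<kappa>\<in>G'. H \<kappa> \<in> \<E> \<and> rng_set \<Lambda> (H \<kappa>) = src \<Lambda> \<kappa>) \<longrightarrow>
        (G - G') \<union> (\<Union>\<kappa>\<in>G'. left_translate \<Lambda> \<kappa> (H \<kappa>)) \<in> \<E>)"


section \<open>C*-algebras\<close>

text \<open>
  C*-algebras are not assumed unital; the field \<open>one\<close> inherited from \<^type>\<open>ring\<close> is never used.
\<close>

record 'a cstar = "'a ring" +
  smul :: "complex \<Rightarrow> 'a \<Rightarrow> 'a"
  adj :: "'a \<Rightarrow> 'a"
  nrm :: "'a \<Rightarrow> real"

locale pre_cstar_algebra = abelian_group A for A :: "'a cstar" (structure) +
  assumes m_closed [simp]: "\<lbrakk>x \<in> carrier A; y \<in> carrier A\<rbrakk> \<Longrightarrow> x \<otimes> y \<in> carrier A"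
    and m_assoc: "\<lbrakk>x \<in> carrier A; y \<in> carrier A; z \<in> carrier A\<rbrakk> \<Longrightarrow> (x \<otimes> y) \<otimes> z = x \<otimes> (y \<otimes> z)"
    and l_distr: "\<lbrakk>x \<in> carrier A; y \<in> carrier A; z \<in> carrier A\<rbrakk> \<Longrightarrow> (x \<oplus> y) \<otimes> z = x \<otimes> z \<oplus> y \<otimes> z"
    and r_distr: "\<lbrakk>x \<in> carrier A; y \<in> carrier A; z \<in> carrier A\<rbrakk> \<Longrightarrow> z \<otimes> (x \<oplus> y) = z \<otimes> x \<oplus> z \<otimes> y"
    and smul_closed [simp]: "x \<in> carrier A \<Longrightarrow> smul A c x \<in> carrier A"
    and smul_add_right: "\<lbrakk>x \<in> carrier A; y \<in> carrier A\<rbrakk> \<Longrightarrow> smul A c (x \<oplus> y) = smul A c x \<oplus> smul A c y"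
    and smul_add_left: "x \<in> carrier A \<Longrightarrow> smul A (c + d) x = smul A c x \<oplus> smul A d x"
    and smul_smul: "x \<in> carrier A \<Longrightarrow> smul A c (smul A d x) = smul A (c * d) x"
    and smul_one [simp]: "x \<in> carrier A \<Longrightarrow> smul A 1 x = x"
    and smul_mult_left: "\<lbrakk>x \<in> carrier A; y \<in> carrier A\<rbrakk> \<Longrightarrow> smul A c x \<otimes> y = smul A c (x \<otimes> y)"
    and smul_mult_right: "\<lbrakk>x \<in> carrier A; y \<in> carrier A\<rbrakk> \<Longrightarrow> x \<otimes> smul A c y = smul A c (x \<otimes> y)"
    and adj_closed [simp]: "x \<in> carrier A \<Longrightarrow> adj A x \<in> carrier A"
    and adj_adj [simp]: "x \<in> carrier A \<Longrightarrow> adj A (adj A x) = x"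
    and adj_add: "\<lbrakk>x \<in> carrier A; y \<in> carrier A\<rbrakk> \<Longrightarrow> adj A (x \<oplus> y) = adj A x \<oplus> adj A y"
    and adj_smul: "x \<in> carrier A \<Longrightarrow> adj A (smul A c x) = smul A (cnj c) (adj A x)"
    and adj_mult: "\<lbrakk>x \<in> carrier A; y \<in> carrier A\<rbrakk> \<Longrightarrow> adj A (x \<otimes> y) = adj A y \<otimes> adj A x"
    and nrm_eq_0: "x \<in> carrier A \<Longrightarrow> nrm A x = 0 \<longleftrightarrow> x = \<zero>"
    and nrm_add: "\<lbrakk>x \<in> carrier A; y \<in> carrier A\<rbrakk> \<Longrightarrow> nrm A (x \<oplus> y) \<le> nrm A x + nrm A y"
    and nrm_smul: "x \<in> carrier A \<Longrightarrow> nrm A (smul A c x) = cmod c * nrm A x"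
    and nrm_mult: "\<lbrakk>x \<in> carrier A; y \<in> carrier A\<rbrakk> \<Longrightarrow> nrm A (x \<otimes> y) \<le> nrm A x * nrm A y"
    and nrm_adj_mult: "x \<in> carrier A \<Longrightarrow> nrm A (adj A x \<otimes> x) = (nrm A x)\<^sup>2"

locale cstar_algebra = pre_cstar_algebra +
  assumes complete: "\<lbrakk>\<And>n. X n \<in> carrier A; \<And>e. e > 0 \<Longrightarrow> \<exists>N. \<forall>m\<ge>N. \<forall>n\<ge>N. nrm A (X m \<ominus> X n) < e\<rbrakk>
    \<Longrightarrow> \<exists>x\<in>carrier A. (\<lambda>n. nrm A (X n \<ominus> x)) \<longlonglongrightarrow> 0"

definition star_hom :: "'a cstar \<Rightarrow> 'b cstar \<Rightarrow> ('a \<Rightarrow> 'b) \<Rightarrow> bool" where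
  "star_hom A B \<pi> \<longleftrightarrow> \<pi> \<in> carrier A \<rightarrow> carrier B \<and>
     (\<forall>x\<in>carrier A. \<forall>y\<in>carrier A. \<pi> (x \<oplus>\<^bsub>A\<^esub> y) = \<pi> x \<oplus>\<^bsub>B\<^esub> \<pi> y) \<and>
     (\<forall>x\<in>carrier A. \<forall>y\<in>carrier A. \<pi> (x \<otimes>\<^bsub>A\<^esub> y) = \<pi> x \<otimes>\<^bsub>B\<^esub> \<pi> y) \<and>
     (\<forall>c. \<forall>x\<in>carrier A. \<pi> (smul A c x) = smul B c (\<pi> x)) \<and>
     (\<forall>x\<in>carrier A. \<pi> (adj A x) = adj B (\<pi> x))"

text \<open>Products are only taken over nonempty lists (there need not be a unit).\<close>

fun mult_list :: "'a cstar \<Rightarrow> 'a list \<Rightarrow> 'a" where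
  "mult_list A [] = \<zero>\<^bsub>A\<^esub>"
| "mult_list A [x] = x"
| "mult_list A (x # y # zs) = x \<otimes>\<^bsub>A\<^esub> mult_list A (y # zs)"

text \<open>
  The product over a finite nonempty set, in the order of some enumeration. It is used only for
  commuting factors, where the order is irrelevant.
\<close>

definition mult_set :: "'a cstar \<Rightarrow> ('i \<Rightarrow> 'a) \<Rightarrow> 'i set \<Rightarrow> 'a" where
  "mult_set A f E = mult_list A (map f (SOME xs. distinct xs \<and> set xs = E))"


section \<open>Relative Cuntz--Krieger families\<close>

definition gap_projection :: "('l, 'k) kgraph \<Rightarrow> 'b cstar \<Rightarrow> ('l \<Rightarrow> 'b) \<Rightarrow> 'l set \<Rightarrow> 'b" where
  "gap_projection \<Lambda> B t E = mult_set B (\<lambda>\<kappa>. t (rng_set \<Lambda> E) \<ominus>\<^bsub>B\<^esub> t \<kappa> \<otimes>\<^bsub>B\<^esub> adj B (t \<kappa>)) E"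

definition relative_CK_family ::
    "('l, 'k) kgraph \<Rightarrow> 'l set set \<Rightarrow> 'b cstar \<Rightarrow> ('l \<Rightarrow> 'b) \<Rightarrow> bool" where
  "relative_CK_family \<Lambda> \<E> B t \<longleftrightarrow>
     (\<forall>\<kappa>\<in>paths \<Lambda>. t \<kappa> \<in> carrier B \<and> t \<kappa> \<otimes>\<^bsub>B\<^esub> adj B (t \<kappa>) \<otimes>\<^bsub>B\<^esub> t \<kappa> = t \<kappa>) \<and>
     (\<forall>v\<in>vertices \<Lambda>. adj B (t v) = t v \<and> t v \<otimes>\<^bsub>B\<^esub> t v = t v) \<and>
     (\<forall>v\<in>vertices \<Lambda>. \<forall>w\<in>vertices \<Lambda>. v \<noteq> w \<longrightarrow> t v \<otimes>\<^bsub>B\<^esub> t w = \<zero>\<^bsub>B\<^esub>) \<and>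
     (\<forall>\<kappa>\<in>paths \<Lambda>. \<forall>\<mu>\<in>paths \<Lambda>. src \<Lambda> \<kappa> = rng \<Lambda> \<mu> \<longrightarrow> t \<kappa> \<otimes>\<^bsub>B\<^esub> t \<mu> = t (cmp \<Lambda> \<kappa> \<mu>)) \<and>
     (\<forall>\<kappa>\<in>paths \<Lambda>. \<forall>\<mu>\<in>paths \<Lambda>. adj B (t \<kappa>) \<otimes>\<^bsub>B\<^esub> t \<mu> =
        finsum B (\<lambda>p. t (fst p) \<otimes>\<^bsub>B\<^esub> adj B (t (snd p))) (min_ext \<Lambda> \<kappa> \<mu>)) \<and>
     (\<forall>E\<in>\<E>. gap_projection \<Lambda> B t E = \<zero>\<^bsub>B\<^esub>)"


section \<open>Completions of the free *-algebra\<close>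

text \<open>
  The free *-algebra on \<open>G\<close> consists of the finitely supported complex functions on nonempty words
  in letters \<open>(g, False)\<close> (the generator \<open>g\<close>) and \<open>(g, True)\<close> (its adjoint), with convolution.
\<close>

instantiation list :: (type) monoid_add
begin
definition zero_list :: "'a list" where "zero_list = []"
definition plus_list :: "'a list \<Rightarrow> 'a list \<Rightarrow> 'a list" where "plus_list = (@)"
instance by standard (simp_all add: zero_list_def plus_list_def)
end

type_synonym 'g free = "('g \<times> bool) list \<Rightarrow>\<^sub>0 complex"

definition free_star_algebra :: "'g set \<Rightarrow> 'g free set" where
  "free_star_algebra G = {x. \<forall>w\<in>Poly_Mapping.keys x. w \<noteq> [] \<and> fst ` set w \<subseteq> G}"

definition free_smul :: "complex \<Rightarrow> 'g free \<Rightarrow> 'g free" where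
  "free_smul c x = Poly_Mapping.map ((*) c) x"

definition word_adj :: "('g \<times> bool) list \<Rightarrow> ('g \<times> bool) list" where
  "word_adj w = rev (map (\<lambda>(g, b). (g, \<not> b)) w)"

definition free_adj :: "'g free \<Rightarrow> 'g free" where
  "free_adj x = (\<Sum>w\<in>Poly_Mapping.keys x. Poly_Mapping.single (word_adj w) (cnj (Poly_Mapping.lookup x w)))"

locale cstar_seminorm =
  fixes G :: "'g set" and q :: "'g free \<Rightarrow> real"
  assumes q_add: "\<lbrakk>x \<in> free_star_algebra G; y \<in> free_star_algebra G\<rbrakk> \<Longrightarrow> q (x + y) \<le> q x + q y"
    and q_smul: "x \<in> free_star_algebra G \<Longrightarrow> q (free_smul c x) = cmod c * q x"
    and q_mult: "\<lbrakk>x \<in> free_star_algebra G; y \<in> free_star_algebra G\<rbrakk> \<Longrightarrow> q (x * y) \<le> q x * q y"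
    and q_adj_mult: "x \<in> free_star_algebra G \<Longrightarrow> q (free_adj x * x) = (q x)\<^sup>2"

text \<open>
  The Hausdorff completion of the free *-algebra with respect to a C*-seminorm: classes of
  Cauchy sequences modulo sequences whose seminorms tend to zero.
\<close>

definition cauchy_seq :: "'g set \<Rightarrow> ('g free \<Rightarrow> real) \<Rightarrow> (nat \<Rightarrow> 'g free) \<Rightarrow> bool" where
  "cauchy_seq G q X \<longleftrightarrow> (\<forall>n. X n \<in> free_star_algebra G) \<and>
     (\<forall>e>0. \<exists>N. \<forall>m\<ge>N. \<forall>n\<ge>N. q (X m - X n) < e)"

definition seq_class :: "'g set \<Rightarrow> ('g free \<Rightarrow> real) \<Rightarrow> (nat \<Rightarrow> 'g free) \<Rightarrow> (nat \<Rightarrow> 'g free) set" where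
  "seq_class G q X = {Y. cauchy_seq G q Y \<and> (\<lambda>n. q (X n - Y n)) \<longlonglongrightarrow> 0}"

definition seq_rep :: "(nat \<Rightarrow> 'g free) set \<Rightarrow> nat \<Rightarrow> 'g free" where
  "seq_rep a = (SOME X. X \<in> a)"

definition completion :: "'g set \<Rightarrow> ('g free \<Rightarrow> real) \<Rightarrow> (nat \<Rightarrow> 'g free) set cstar" where
  "completion G q = \<lparr>carrier = seq_class G q ` {X. cauchy_seq G q X},
     mult = (\<lambda>a b. seq_class G q (\<lambda>n. seq_rep a n * seq_rep b n)),
     one = undefined,
     zero = seq_class G q (\<lambda>_. 0),
     add = (\<lambda>a b. seq_class G q (\<lambda>n. seq_rep a n + seq_rep b n)),
     smul = (\<lambda>c a. seq_class G q (\<lambda>n. free_smul c (seq_rep a n))),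
     adj = (\<lambda>a. seq_class G q (\<lambda>n. free_adj (seq_rep a n))),
     nrm = (\<lambda>a. lim (\<lambda>n. q (seq_rep a n)))\<rparr>"

definition gen :: "'g set \<Rightarrow> ('g free \<Rightarrow> real) \<Rightarrow> 'g \<Rightarrow> (nat \<Rightarrow> 'g free) set" where
  "gen G q g = seq_class G q (\<lambda>_. Poly_Mapping.single [(g, False)] 1)"


section \<open>The universal C*-algebra\<close>

text \<open>
  The universal algebra is the completion for the largest C*-seminorm in whose completion the
  generators form a relative Cuntz--Krieger family. That it is the C*-algebra universal for
  relative Cuntz--Krieger families in arbitrary C*-algebras is proved at the end of this theory.
\<close>

definition CK_seminorms :: "('l, 'k) kgraph \<Rightarrow> 'l set set \<Rightarrow> ('l free \<Rightarrow> real) set" where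
  "CK_seminorms \<Lambda> \<E> = {q. cstar_seminorm (paths \<Lambda>) q \<and>
     relative_CK_family \<Lambda> \<E> (completion (paths \<Lambda>) q) (gen (paths \<Lambda>) q)}"

definition CK_norm :: "('l, 'k) kgraph \<Rightarrow> 'l set set \<Rightarrow> 'l free \<Rightarrow> real" where
  "CK_norm \<Lambda> \<E> x = (SUP q\<in>CK_seminorms \<Lambda> \<E>. q x)"

definition CK_algebra :: "('l, 'k) kgraph \<Rightarrow> 'l set set \<Rightarrow> (nat \<Rightarrow> 'l free) set cstar" where
  "CK_algebra \<Lambda> \<E> = completion (paths \<Lambda>) (CK_norm \<Lambda> \<E>)"

definition CK_gen :: "('l, 'k) kgraph \<Rightarrow> 'l set set \<Rightarrow> 'l \<Rightarrow> (nat \<Rightarrow> 'l free) set" where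
  "CK_gen \<Lambda> \<E> = gen (paths \<Lambda>) (CK_norm \<Lambda> \<E>)"

definition CK_hom :: "('l, 'k) kgraph \<Rightarrow> 'l set set \<Rightarrow> 'b cstar \<Rightarrow> ('l \<Rightarrow> 'b)
    \<Rightarrow> (nat \<Rightarrow> 'l free) set \<Rightarrow> 'b" where
  "CK_hom \<Lambda> \<E> B t = (THE \<pi>. \<pi> \<in> extensional (carrier (CK_algebra \<Lambda> \<E>)) \<and>
     star_hom (CK_algebra \<Lambda> \<E>) B \<pi> \<and> (\<forall>\<kappa>\<in>paths \<Lambda>. \<pi> (CK_gen \<Lambda> \<E> \<kappa>) = t \<kappa>))"

definition torus :: "('k::finite \<Rightarrow> complex) set" where
  "torus = {z. \<forall>i. cmod (z i) = 1}"

definition gauge :: "('l, 'k::finite) kgraph \<Rightarrow> 'l set set \<Rightarrow> ('k \<Rightarrow> complex)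
    \<Rightarrow> (nat \<Rightarrow> 'l free) set \<Rightarrow> (nat \<Rightarrow> 'l free) set" where
  "gauge \<Lambda> \<E> z = CK_hom \<Lambda> \<E> (CK_algebra \<Lambda> \<E>)
     (\<lambda>\<kappa>. smul (CK_algebra \<Lambda> \<E>) (\<Prod>i\<in>UNIV. z i ^ deg \<Lambda> \<kappa> i) (CK_gen \<Lambda> \<E> \<kappa>))"

definition CK_core :: "('l, 'k::finite) kgraph \<Rightarrow> 'l set set \<Rightarrow> (nat \<Rightarrow> 'l free) set set" where
  "CK_core \<Lambda> \<E> = {a \<in> carrier (CK_algebra \<Lambda> \<E>). \<forall>z\<in>torus. gauge \<Lambda> \<E> z a = a}"


section \<open>Calculation rules for the free *-algebra\<close>

abbreviation letter_word :: "'g \<Rightarrow> 'g free" where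
  "letter_word g \<equiv> Poly_Mapping.single [(g, False)] 1"

lemma word_adj_append: "word_adj (u @ v) = word_adj v @ word_adj u"
  by (simp add: word_adj_def)

lemma word_adj_word_adj [simp]: "word_adj (word_adj w) = w"
  by (induction w) (auto simp: word_adj_def rev_map)

lemma word_adj_eq_Nil [simp]: "word_adj w = [] \<longleftrightarrow> w = []"
  by (simp add: word_adj_def)

lemma fst_set_word_adj [simp]: "fst ` set (word_adj w) = fst ` set w"
  by (force simp: word_adj_def)

lemma lookup_free_smul [simp]: "Poly_Mapping.lookup (free_smul c x) w = c * Poly_Mapping.lookup x w"
  by (simp add: free_smul_def Poly_Mapping.map.rep_eq when_def)

lemma lookup_sum_single:
  assumes "finite S" "inj_on f S" "w \<in> S"
  shows "Poly_Mapping.lookup (\<Sum>u\<in>S. Poly_Mapping.single (f u) (c u)) (f w) = c w"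
proof -
  have "(\<Sum>u\<in>S. (c u when f u = f w)) = (\<Sum>u\<in>S. (c u when u = w))"
    using assms by (intro sum.cong) (auto simp: when_def dest: inj_onD)
  also have "\<dots> = c w"
    using assms by (simp add: when_def)
  finally show ?thesis
    by (simp add: lookup_sum lookup_single)
qed

lemma lookup_free_adj [simp]:
  "Poly_Mapping.lookup (free_adj x) w = cnj (Poly_Mapping.lookup x (word_adj w))"
proof (cases "word_adj w \<in> Poly_Mapping.keys x")
  case True
  have "inj_on word_adj (Poly_Mapping.keys x)"
    by (metis inj_onI word_adj_word_adj)
  from lookup_sum_single[OF _ this True] show ?thesis
    by (simp add: free_adj_def)
next
  case False
  then have "(\<Sum>u\<in>Poly_Mapping.keys x. (cnj (Poly_Mapping.lookup x u) when word_adj u = w)) = 0"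
    by (intro sum.neutral) (auto simp: when_def)
  with False show ?thesis
    by (simp add: free_adj_def lookup_sum lookup_single in_keys_iff)
qed

lemma free_smul_single [simp]:
  "free_smul c (Poly_Mapping.single w d) = Poly_Mapping.single w (c * d)"
  by (rule poly_mapping_eqI) (simp add: lookup_single when_def)

lemma free_adj_single [simp]:
  "free_adj (Poly_Mapping.single w d) = Poly_Mapping.single (word_adj w) (cnj d)"
  by (cases "d = 0") (auto simp: free_adj_def)

lemma free_smul_eq_single_mult: "free_smul c x = Poly_Mapping.single [] c * x"
  by (simp add: free_smul_def mult_map_scale_conv_mult zero_list_def)

lemma free_smul_eq_mult_single: "free_smul c x = x * Poly_Mapping.single [] c"
proof -
  have "x * Poly_Mapping.single [] c = Poly_Mapping.single [] c * x"
  proof (induction x rule: update_induct)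
    case const then show ?case by simp
  next
    case (update f a b)
    have "Poly_Mapping.update a b f = f + Poly_Mapping.single a b"
      using update by (intro poly_mapping_eqI)
        (auto simp: lookup_update lookup_add lookup_single when_def in_keys_iff)
    then show ?case
      using update by (simp add: distrib_left distrib_right mult_single zero_list_def plus_list_def mult.commute)
  qed
  then show ?thesis by (simp add: free_smul_eq_single_mult)
qed

lemma free_smul_add: "free_smul c (x + y) = free_smul c x + free_smul c y"
  by (simp add: free_smul_eq_single_mult distrib_left)

lemma free_smul_diff: "free_smul c (x - y) = free_smul c x - free_smul c y"
  by (simp add: free_smul_eq_single_mult right_diff_distrib)

lemma free_smul_add_left: "free_smul (c + d) x = free_smul c x + free_smul d x"
  by (simp add: free_smul_eq_single_mult distrib_right single_add)

lemma free_smul_free_smul: "free_smul c (free_smul d x) = free_smul (c * d) x"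
  by (rule poly_mapping_eqI) simp

lemma free_smul_one [simp]: "free_smul 1 x = x"
  by (rule poly_mapping_eqI) simp

lemma free_smul_minus_one: "free_smul (-1) x = - x"
  by (rule poly_mapping_eqI) simp

lemma free_smul_zero [simp]: "free_smul 0 x = 0" "free_smul c 0 = 0"
  by (rule poly_mapping_eqI, simp)+

lemma free_smul_mult_left: "free_smul c x * y = free_smul c (x * y)"
  by (simp add: free_smul_eq_single_mult mult.assoc)

lemma free_smul_mult_right: "x * free_smul c y = free_smul c (x * y)"
  by (simp add: free_smul_eq_mult_single mult.assoc)

lemma free_adj_add: "free_adj (x + y) = free_adj x + free_adj y"
  by (rule poly_mapping_eqI) (simp add: lookup_add)

lemma free_adj_zero [simp]: "free_adj 0 = 0"
  by (simp add: free_adj_def)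

lemma free_adj_diff: "free_adj (x - y) = free_adj x - free_adj y"
  by (rule poly_mapping_eqI) (simp add: lookup_minus)

lemma free_adj_free_adj [simp]: "free_adj (free_adj x) = x"
  by (rule poly_mapping_eqI) simp

lemma free_adj_smul: "free_adj (free_smul c x) = free_smul (cnj c) (free_adj x)"
  by (rule poly_mapping_eqI) simp

lemma poly_mapping_induct_add [case_names zero single add]:
  assumes "P 0" "\<And>w c. P (Poly_Mapping.single w c)" "\<And>x y. P x \<Longrightarrow> P y \<Longrightarrow> P (x + y)"
  shows "P x"
proof (induction x rule: update_induct)
  case const then show ?case by (simp add: assms)
next
  case (update f a b)
  have "Poly_Mapping.update a b f = f + Poly_Mapping.single a b"
    using update by (intro poly_mapping_eqI)
      (auto simp: lookup_update lookup_add lookup_single when_def in_keys_iff)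
  then show ?case using update assms by simp
qed

lemma free_adj_mult: "free_adj (x * y) = free_adj y * free_adj x"
proof (induction x rule: poly_mapping_induct_add)
  case (single u c)
  show ?case
    by (induction y rule: poly_mapping_induct_add)
      (simp_all add: mult_single free_adj_add distrib_left distrib_right plus_list_def word_adj_append mult.commute)
qed (simp_all add: free_adj_add distrib_left distrib_right)

lemma free_zero [simp]: "0 \<in> free_star_algebra G"
  by (simp add: free_star_algebra_def)

lemma free_add [simp]:
  "\<lbrakk>x \<in> free_star_algebra G; y \<in> free_star_algebra G\<rbrakk> \<Longrightarrow> x + y \<in> free_star_algebra G"
  unfolding free_star_algebra_def using keys_add[of x y] by blast

lemma free_smul_closed [simp]: "x \<in> free_star_algebra G \<Longrightarrow> free_smul c x \<in> free_star_algebra G"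
  by (auto simp: free_star_algebra_def in_keys_iff)

lemma free_minus [simp]: "x \<in> free_star_algebra G \<Longrightarrow> - x \<in> free_star_algebra G"
  using free_smul_closed[of x G "-1"] by (simp add: free_smul_minus_one)

lemma free_diff [simp]:
  "\<lbrakk>x \<in> free_star_algebra G; y \<in> free_star_algebra G\<rbrakk> \<Longrightarrow> x - y \<in> free_star_algebra G"
  using free_add[of x G "- y"] by simp

lemma free_mult [simp]:
  assumes "x \<in> free_star_algebra G" "y \<in> free_star_algebra G"
  shows "x * y \<in> free_star_algebra G"
  unfolding free_star_algebra_def
proof (intro CollectI ballI)
  fix w assume "w \<in> Poly_Mapping.keys (x * y)"
  with keys_mult[of x y] obtain u v where
    uv: "u \<in> Poly_Mapping.keys x" "v \<in> Poly_Mapping.keys y" "w = u @ v"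
    by (auto simp: plus_list_def)
  then have "u \<noteq> [] \<and> fst ` set u \<subseteq> G" "v \<noteq> [] \<and> fst ` set v \<subseteq> G"
    using assms unfolding free_star_algebra_def by blast+
  then show "w \<noteq> [] \<and> fst ` set w \<subseteq> G"
    using uv by auto
qed

lemma free_adj_closed [simp]:
  assumes "x \<in> free_star_algebra G"
  shows "free_adj x \<in> free_star_algebra G"
  unfolding free_star_algebra_def
proof (intro CollectI ballI)
  fix w assume "w \<in> Poly_Mapping.keys (free_adj x)"
  then have "word_adj w \<in> Poly_Mapping.keys x"
    by (simp add: in_keys_iff)
  with assms have "word_adj w \<noteq> [] \<and> fst ` set (word_adj w) \<subseteq> G"
    unfolding free_star_algebra_def by blast
  then show "w \<noteq> [] \<and> fst ` set w \<subseteq> G"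
    by simp
qed

lemma free_single [simp]:
  "Poly_Mapping.single w c \<in> free_star_algebra G \<longleftrightarrow> c = 0 \<or> (w \<noteq> [] \<and> fst ` set w \<subseteq> G)"
  by (auto simp: free_star_algebra_def)

lemma free_induct [consumes 1, case_names zero single add]:
  assumes x: "x \<in> free_star_algebra G" and "P 0"
    and single: "\<And>w c. \<lbrakk>w \<noteq> []; fst ` set w \<subseteq> G\<rbrakk> \<Longrightarrow> P (Poly_Mapping.single w c)"
    and add: "\<And>x y. \<lbrakk>x \<in> free_star_algebra G; y \<in> free_star_algebra G; P x; P y\<rbrakk> \<Longrightarrow> P (x + y)"
  shows "P x"
  using x
proof (induction x rule: update_induct)
  case const then show ?case by (simp add: assms)
next
  case (update f a b)
  have eq: "Poly_Mapping.update a b f = f + Poly_Mapping.single a b"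
    using update by (intro poly_mapping_eqI)
      (auto simp: lookup_update lookup_add lookup_single when_def in_keys_iff)
  have k: "Poly_Mapping.keys (Poly_Mapping.update a b f) = insert a (Poly_Mapping.keys f)"
    using update by (simp add: keys_update)
  have "\<forall>w\<in>insert a (Poly_Mapping.keys f). w \<noteq> [] \<and> fst ` set w \<subseteq> G"
    using update.prems unfolding free_star_algebra_def k mem_Collect_eq .
  then have f: "f \<in> free_star_algebra G" and a: "a \<noteq> []" "fst ` set a \<subseteq> G"
    unfolding free_star_algebra_def mem_Collect_eq by blast+
  show ?case unfolding eq
  proof (rule add)
    show "P (Poly_Mapping.single a b)" using a by (rule single)
    show "P f" using f by (rule update.IH)
    show "Poly_Mapping.single a b \<in> free_star_algebra G" using a by simp
  qed (rule f)
qed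


lemma tendsto_zero_dominated:
  assumes "(\<lambda>n. f n) \<longlonglongrightarrow> (0::real)" "\<And>n. 0 \<le> g n" "\<And>n. g n \<le> K * f n"
  shows "g \<longlonglongrightarrow> 0"
proof (rule tendsto_sandwich[where f = "\<lambda>_. 0", OF always_eventually always_eventually])
  show "(\<lambda>n. K * f n) \<longlonglongrightarrow> 0" using tendsto_mult_right_zero[OF assms(1)] by simp
  show "\<forall>n. g n \<le> K * f n" using assms by blast
  show "\<forall>n. 0 \<le> g n" using assms by blast
qed simp

section \<open>Elementary facts on C*-algebras\<close>

context pre_cstar_algebra
begin

lemma add_left_cancel_zero: "\<lbrakk>x \<in> carrier A; x \<oplus> x = x\<rbrakk> \<Longrightarrow> x = \<zero>"
  by (metis add.l_cancel_one')

lemma mult_zero_left [simp]: "x \<in> carrier A \<Longrightarrow> \<zero> \<otimes> x = \<zero>"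
  by (metis add_left_cancel_zero l_distr l_zero m_closed zero_closed)

lemma mult_zero_right [simp]: "x \<in> carrier A \<Longrightarrow> x \<otimes> \<zero> = \<zero>"
  by (metis add_left_cancel_zero r_distr l_zero m_closed zero_closed)

lemma smul_zero_left [simp]: "x \<in> carrier A \<Longrightarrow> smul A 0 x = \<zero>"
  by (metis add_left_cancel_zero smul_add_left smul_closed add_0)

lemma smul_zero_right [simp]: "smul A c \<zero> = \<zero>"
  by (metis add_left_cancel_zero smul_add_right smul_closed l_zero zero_closed)

lemma adj_zero [simp]: "adj A \<zero> = \<zero>"
  by (metis add_left_cancel_zero adj_add adj_closed l_zero zero_closed)

lemma smul_minus_one: "x \<in> carrier A \<Longrightarrow> smul A (-1) x = \<ominus> x"
  using smul_add_left[of x "-1" 1] by (simp add: minus_equality)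

lemma mult_minus_left: "\<lbrakk>x \<in> carrier A; y \<in> carrier A\<rbrakk> \<Longrightarrow> (\<ominus> x) \<otimes> y = \<ominus> (x \<otimes> y)"
  by (simp add: smul_minus_one[symmetric] smul_mult_left)

lemma mult_minus_right: "\<lbrakk>x \<in> carrier A; y \<in> carrier A\<rbrakk> \<Longrightarrow> x \<otimes> (\<ominus> y) = \<ominus> (x \<otimes> y)"
  by (simp add: smul_minus_one[symmetric] smul_mult_right)

lemma mult_diff_left:
  "\<lbrakk>x \<in> carrier A; y \<in> carrier A; z \<in> carrier A\<rbrakk> \<Longrightarrow> (x \<ominus> y) \<otimes> z = x \<otimes> z \<ominus> y \<otimes> z"
  by (simp add: a_minus_def l_distr mult_minus_left)

lemma mult_diff_right:
  "\<lbrakk>x \<in> carrier A; y \<in> carrier A; z \<in> carrier A\<rbrakk> \<Longrightarrow> z \<otimes> (x \<ominus> y) = z \<otimes> x \<ominus> z \<otimes> y"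
  by (simp add: a_minus_def r_distr mult_minus_right)

lemma smul_minus: "x \<in> carrier A \<Longrightarrow> smul A c (\<ominus> x) = \<ominus> (smul A c x)"
  by (simp add: smul_minus_one[symmetric] smul_smul)

lemma smul_diff: "\<lbrakk>x \<in> carrier A; y \<in> carrier A\<rbrakk> \<Longrightarrow> smul A c (x \<ominus> y) = smul A c x \<ominus> smul A c y"
  by (simp add: a_minus_def smul_add_right smul_minus)

lemma adj_minus: "x \<in> carrier A \<Longrightarrow> adj A (\<ominus> x) = \<ominus> (adj A x)"
  by (simp add: smul_minus_one[symmetric] adj_smul)

lemma adj_diff: "\<lbrakk>x \<in> carrier A; y \<in> carrier A\<rbrakk> \<Longrightarrow> adj A (x \<ominus> y) = adj A x \<ominus> adj A y"
  by (simp add: a_minus_def adj_add adj_minus)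

lemma diff_self [simp]: "x \<in> carrier A \<Longrightarrow> x \<ominus> x = \<zero>"
  by (simp add: a_minus_def r_neg)

lemma diff_eq_zero_iff: "\<lbrakk>x \<in> carrier A; y \<in> carrier A\<rbrakk> \<Longrightarrow> x \<ominus> y = \<zero> \<longleftrightarrow> x = y"
  by (metis a_minus_def a_inv_closed minus_equality minus_minus diff_self)

lemma diff_add_cancel: "\<lbrakk>x \<in> carrier A; y \<in> carrier A\<rbrakk> \<Longrightarrow> (x \<ominus> y) \<oplus> y = x"
  by (simp add: a_minus_def a_assoc l_neg)

lemma diff_swap: "\<lbrakk>x \<in> carrier A; y \<in> carrier A\<rbrakk> \<Longrightarrow> \<ominus> (x \<ominus> y) = y \<ominus> x"
  by (simp add: a_minus_def minus_add a_comm)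

lemma diff_split:
  "\<lbrakk>x \<in> carrier A; y \<in> carrier A; z \<in> carrier A\<rbrakk> \<Longrightarrow> x \<ominus> z = (x \<ominus> y) \<oplus> (y \<ominus> z)"
  by (metis a_minus_def a_assoc a_inv_closed a_closed diff_add_cancel minus_closed)

lemma add_diff_add:
  "\<lbrakk>x \<in> carrier A; y \<in> carrier A; u \<in> carrier A; v \<in> carrier A\<rbrakk> \<Longrightarrow>
    (x \<oplus> y) \<ominus> (u \<oplus> v) = (x \<ominus> u) \<oplus> (y \<ominus> v)"
  by (simp add: a_minus_def minus_add a_ac)

lemma nrm_zero [simp]: "nrm A \<zero> = 0"
  by (simp add: nrm_eq_0)

lemma nrm_minus [simp]: "x \<in> carrier A \<Longrightarrow> nrm A (\<ominus> x) = nrm A x"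
  by (simp add: smul_minus_one[symmetric] nrm_smul)

lemma nrm_nonneg [simp]: "x \<in> carrier A \<Longrightarrow> 0 \<le> nrm A x"
  using nrm_add[of x "\<ominus> x"] by (simp add: r_neg)

lemma nrm_diff_commute: "\<lbrakk>x \<in> carrier A; y \<in> carrier A\<rbrakk> \<Longrightarrow> nrm A (x \<ominus> y) = nrm A (y \<ominus> x)"
  by (metis diff_swap minus_closed nrm_minus)

lemma nrm_diff_le: "\<lbrakk>x \<in> carrier A; y \<in> carrier A\<rbrakk> \<Longrightarrow> nrm A (x \<ominus> y) \<le> nrm A x + nrm A y"
  using nrm_add[of x "\<ominus> y"] by (simp add: a_minus_def)

lemma nrm_diff_triangle:
  "\<lbrakk>x \<in> carrier A; y \<in> carrier A; z \<in> carrier A\<rbrakk> \<Longrightarrow> nrm A (x \<ominus> z) \<le> nrm A (x \<ominus> y) + nrm A (y \<ominus> z)"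
  using nrm_add[of "x \<ominus> y" "y \<ominus> z"] by (simp add: diff_split[of x y z])

lemma nrm_abs_diff_le: "\<lbrakk>x \<in> carrier A; y \<in> carrier A\<rbrakk> \<Longrightarrow> \<bar>nrm A x - nrm A y\<bar> \<le> nrm A (x \<ominus> y)"
  using nrm_add[of "x \<ominus> y" y] nrm_add[of "y \<ominus> x" x]
  by (simp add: diff_add_cancel nrm_diff_commute[of y x])

lemma nrm_adj [simp]:
  assumes x: "x \<in> carrier A"
  shows "nrm A (adj A x) = nrm A x"
proof -
  have *: "nrm A y \<le> nrm A (adj A y)" if y: "y \<in> carrier A" for y
  proof (cases "nrm A y = 0")
    case False
    with y have "nrm A y > 0" by (simp add: order_less_le)
    moreover have "nrm A y * nrm A y \<le> nrm A (adj A y) * nrm A y"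
      using nrm_mult[of "adj A y" y] nrm_adj_mult[OF y] y by (simp add: power2_eq_square)
    ultimately show ?thesis by simp
  qed (use y in simp)
  show ?thesis
    using *[OF x] *[of "adj A x"] x by simp
qed

lemma limit_unique:
  assumes "\<And>n. X n \<in> carrier A" "x \<in> carrier A" "y \<in> carrier A"
    and "(\<lambda>n. nrm A (X n \<ominus> x)) \<longlonglongrightarrow> 0" "(\<lambda>n. nrm A (X n \<ominus> y)) \<longlonglongrightarrow> 0"
  shows "x = y"
proof -
  have "(\<lambda>n. nrm A (X n \<ominus> x) + nrm A (X n \<ominus> y)) \<longlonglongrightarrow> 0 + 0"
    using assms by (intro tendsto_add)
  moreover have "nrm A (x \<ominus> y) \<le> nrm A (X n \<ominus> x) + nrm A (X n \<ominus> y)" for n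
    using nrm_diff_triangle[of x "X n" y] assms by (simp add: nrm_diff_commute[of x])
  ultimately have "nrm A (x \<ominus> y) \<le> 0"
    by (intro LIMSEQ_le_const) auto
  moreover have "0 \<le> nrm A (x \<ominus> y)"
    using assms by simp
  ultimately have "nrm A (x \<ominus> y) = 0"
    by (rule order_antisym)
  then show ?thesis
    using assms by (simp add: nrm_eq_0 diff_eq_zero_iff)
qed

lemma mult_list_Cons: "xs \<noteq> [] \<Longrightarrow> mult_list A (x # xs) = x \<otimes> mult_list A xs"
  by (cases xs) auto

lemma mult_list_closed [simp]: "set xs \<subseteq> carrier A \<Longrightarrow> mult_list A xs \<in> carrier A"
proof (induction xs)
  case (Cons x xs)
  then show ?case
    by (cases "xs = []") (simp_all add: mult_list_Cons)
qed simp

lemma mult_list_append: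
  "\<lbrakk>xs \<noteq> []; ys \<noteq> []; set xs \<subseteq> carrier A; set ys \<subseteq> carrier A\<rbrakk> \<Longrightarrow>
    mult_list A (xs @ ys) = mult_list A xs \<otimes> mult_list A ys"
proof (induction xs)
  case (Cons x xs)
  then show ?case
    by (cases "xs = []") (simp_all add: mult_list_Cons m_assoc)
qed simp

lemma adj_mult_list:
  "set xs \<subseteq> carrier A \<Longrightarrow> adj A (mult_list A xs) = mult_list A (rev (map (adj A) xs))"
proof (induction xs)
  case (Cons x xs)
  then show ?case
    by (cases "xs = []") (simp_all add: mult_list_Cons adj_mult, subst mult_list_append, auto)
qed simp

end


section \<open>The completion is a C*-algebra\<close>

context cstar_seminorm
begin

abbreviation "Fr \<equiv> free_star_algebra G"
abbreviation "cls \<equiv> seq_class G q"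
abbreviation "cau \<equiv> cauchy_seq G q"

lemma q_zero [simp]: "q 0 = 0"
  using q_smul[of 0 0] by simp

lemma q_minus [simp]: "x \<in> Fr \<Longrightarrow> q (- x) = q x"
  using q_smul[of x "-1"] by (simp add: free_smul_minus_one)

lemma q_nonneg [simp]: "x \<in> Fr \<Longrightarrow> 0 \<le> q x"
  using q_add[of x "- x"] by simp

lemma q_diff_commute: "\<lbrakk>x \<in> Fr; y \<in> Fr\<rbrakk> \<Longrightarrow> q (x - y) = q (y - x)"
  using q_minus[of "x - y"] by simp

lemma q_triangle: "\<lbrakk>x \<in> Fr; y \<in> Fr; z \<in> Fr\<rbrakk> \<Longrightarrow> q (x - z) \<le> q (x - y) + q (y - z)"
  using q_add[of "x - y" "y - z"] by simp

lemma q_abs_diff: "\<lbrakk>x \<in> Fr; y \<in> Fr\<rbrakk> \<Longrightarrow> \<bar>q x - q y\<bar> \<le> q (x - y)"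
  using q_add[of "x - y" y] q_add[of "y - x" x] by (simp add: q_diff_commute[of y x])

lemma q_adj [simp]:
  assumes x: "x \<in> Fr"
  shows "q (free_adj x) = q x"
proof -
  have *: "q y \<le> q (free_adj y)" if y: "y \<in> Fr" for y
  proof (cases "q y = 0")
    case False
    with y have "q y > 0" by (simp add: order_less_le)
    moreover have "q y * q y \<le> q (free_adj y) * q y"
      using q_mult[of "free_adj y" y] q_adj_mult[OF y] y by (simp add: power2_eq_square)
    ultimately show ?thesis by simp
  qed (use y in simp)
  show ?thesis
    using *[OF x] *[of "free_adj x"] x by simp
qed

lemma cauchy_seqD: "cau X \<Longrightarrow> X n \<in> Fr"
  by (simp add: cauchy_seq_def)

lemma cauchy_seq_q: "cau X \<Longrightarrow> \<exists>L. (\<lambda>n. q (X n)) \<longlonglongrightarrow> L"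
proof -
  assume X: "cau X"
  have "Cauchy (\<lambda>n. q (X n))"
    unfolding Cauchy_def
  proof (intro allI impI)
    fix e :: real assume "e > 0"
    with X obtain N where N: "\<forall>m\<ge>N. \<forall>n\<ge>N. q (X m - X n) < e"
      unfolding cauchy_seq_def by blast
    show "\<exists>M. \<forall>m\<ge>M. \<forall>n\<ge>M. dist (q (X m)) (q (X n)) < e"
      unfolding dist_real_def
      using N by (meson le_less_trans q_abs_diff cauchy_seqD[OF X])
  qed
  then show ?thesis
    by (simp add: Cauchy_convergent_iff convergent_def)
qed

lemma cauchy_seq_bounded:
  assumes "cau X"
  obtains K where "K > 0" "\<And>n. q (X n) \<le> K"
proof -
  from cauchy_seq_q[OF assms] obtain L where "(\<lambda>n. q (X n)) \<longlonglongrightarrow> L" by blast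
  then have "Bseq (\<lambda>n. q (X n))"
    by (intro convergent_imp_Bseq) (auto simp: convergent_def)
  then obtain K where "K > 0" "\<forall>n. norm (q (X n)) \<le> K"
    by (auto simp: Bseq_def)
  then show ?thesis
    by (intro that[of K]) (auto dest: spec abs_le_D1)
qed

lemma cauchy_const [simp]: "x \<in> Fr \<Longrightarrow> cau (\<lambda>_. x)"
  by (simp add: cauchy_seq_def)

lemma cauchy_dominated:
  assumes X: "cau X" and Y: "cau Y" and Z: "\<And>n. Z n \<in> Fr"
    and K: "K \<ge> 0" and le: "\<And>m n. q (Z m - Z n) \<le> K * q (X m - X n) + K * q (Y m - Y n)"
  shows "cau Z"
  unfolding cauchy_seq_def
proof (intro conjI allI impI)
  fix e :: real assume e: "e > 0"
  define d where "d = e / (2 * (K + 1))"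
  have d: "d > 0" "K * d < e / 2" using e K by (auto simp: d_def field_simps)
  obtain N M where N: "\<forall>m\<ge>N. \<forall>n\<ge>N. q (X m - X n) < d" and M: "\<forall>m\<ge>M. \<forall>n\<ge>M. q (Y m - Y n) < d"
    using X Y d(1) unfolding cauchy_seq_def by meson
  show "\<exists>N. \<forall>m\<ge>N. \<forall>n\<ge>N. q (Z m - Z n) < e"
  proof (intro exI[of _ "max N M"] allI impI)
    fix m n assume "max N M \<le> m" "max N M \<le> n"
    then have "q (X m - X n) \<le> d" "q (Y m - Y n) \<le> d" using N M by (auto intro: less_imp_le)
    then have "K * q (X m - X n) \<le> K * d" "K * q (Y m - Y n) \<le> K * d"
      using K by (auto intro: mult_left_mono)
    then show "q (Z m - Z n) < e" using le[of m n] d(2) by linarith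
  qed
qed (rule Z)

lemma q_mult_diff:
  assumes "x \<in> Fr" "y \<in> Fr" "u \<in> Fr" "v \<in> Fr"
  shows "q (x * y - u * v) \<le> q x * q (y - v) + q (x - u) * q v"
proof -
  have "x * y - u * v = x * (y - v) + (x - u) * v" by (simp add: algebra_simps)
  then show ?thesis
    using q_add[of "x * (y - v)" "(x - u) * v"] q_mult[of x "y - v"] q_mult[of "x - u" v] assms
    by simp
qed

lemma cauchy_add: "\<lbrakk>cau X; cau Y\<rbrakk> \<Longrightarrow> cau (\<lambda>n. X n + Y n)"
proof (rule cauchy_dominated[of X Y _ 1])
  fix m n assume "cau X" "cau Y"
  then show "q (X m + Y m - (X n + Y n)) \<le> 1 * q (X m - X n) + 1 * q (Y m - Y n)"
    using q_add[of "X m - X n" "Y m - Y n"] by (simp add: cauchy_seqD add_diff_add)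
qed (simp_all add: cauchy_seqD)

lemma cauchy_smul: "cau X \<Longrightarrow> cau (\<lambda>n. free_smul c (X n))"
proof (rule cauchy_dominated[of X X _ "cmod c"])
  fix m n assume "cau X"
  then show "q (free_smul c (X m) - free_smul c (X n)) \<le> cmod c * q (X m - X n) + cmod c * q (X m - X n)"
    by (simp add: free_smul_diff[symmetric] q_smul cauchy_seqD)
qed (simp_all add: cauchy_seqD)

lemma cauchy_adj: "cau X \<Longrightarrow> cau (\<lambda>n. free_adj (X n))"
proof (rule cauchy_dominated[of X X _ 1])
  fix m n assume "cau X"
  then show "q (free_adj (X m) - free_adj (X n)) \<le> 1 * q (X m - X n) + 1 * q (X m - X n)"
    by (simp add: free_adj_diff[symmetric] cauchy_seqD)
qed (simp_all add: cauchy_seqD)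

lemma cauchy_mult:
  assumes X: "cau X" and Y: "cau Y"
  shows "cau (\<lambda>n. X n * Y n)"
proof -
  obtain K L where K: "K > 0" "\<And>n. q (X n) \<le> K" and L: "L > 0" "\<And>n. q (Y n) \<le> L"
    using X Y by (metis cauchy_seq_bounded)
  show ?thesis
  proof (rule cauchy_dominated[OF X Y, of _ "max K L"])
    fix m n
    note mem = cauchy_seqD[OF X] cauchy_seqD[OF Y]
    have "q (X m) * q (Y m - Y n) \<le> max K L * q (Y m - Y n)"
      using K(2)[of m] mem by (intro mult_right_mono) auto
    moreover have "q (X m - X n) * q (Y n) \<le> q (X m - X n) * max K L"
      using L(2)[of n] mem by (intro mult_left_mono) auto
    ultimately show "q (X m * Y m - X n * Y n) \<le> max K L * q (X m - X n) + max K L * q (Y m - Y n)"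
      using q_mult_diff[of "X m" "Y m" "X n" "Y n"] mem by (simp add: mult.commute)
  qed (use X Y K(1) in \<open>simp_all add: cauchy_seqD\<close>)
qed

lemma cls_self: "cau X \<Longrightarrow> X \<in> cls X"
  by (simp add: seq_class_def)

lemma cls_eq_iff:
  assumes X: "cau X" and Y: "cau Y"
  shows "cls X = cls Y \<longleftrightarrow> (\<lambda>n. q (X n - Y n)) \<longlonglongrightarrow> 0"
proof
  assume "cls X = cls Y"
  then have "Y \<in> cls X" using cls_self[OF Y] by simp
  then show "(\<lambda>n. q (X n - Y n)) \<longlonglongrightarrow> 0" by (simp add: seq_class_def)
next
  assume lim: "(\<lambda>n. q (X n - Y n)) \<longlonglongrightarrow> 0"
  have *: "(\<lambda>n. q (U n - W n)) \<longlonglongrightarrow> 0"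
    if "cau U" "cau V" "cau W" "(\<lambda>n. q (U n - V n)) \<longlonglongrightarrow> 0" "(\<lambda>n. q (V n - W n)) \<longlonglongrightarrow> 0" for U V W
  proof (rule tendsto_sandwich[where f = "\<lambda>_. 0", OF always_eventually always_eventually])
    show "\<forall>n. q (U n - W n) \<le> q (U n - V n) + q (V n - W n)"
      using that by (auto intro: q_triangle cauchy_seqD)
    show "(\<lambda>n. q (U n - V n) + q (V n - W n)) \<longlonglongrightarrow> 0"
      using tendsto_add[OF that(4,5)] by simp
    show "\<forall>n. 0 \<le> q (U n - W n)"
      using that by (simp add: cauchy_seqD)
  qed simp
  have lim': "(\<lambda>n. q (Y n - X n)) \<longlonglongrightarrow> 0"
    using lim X Y by (simp add: q_diff_commute cauchy_seqD)
  show "cls X = cls Y"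
    using *[OF Y X _ lim'] *[OF X Y _ lim] X Y by (auto simp: seq_class_def)
qed

lemma rep_cls:
  assumes "cau X"
  shows "cau (seq_rep (cls X))" "(\<lambda>n. q (X n - seq_rep (cls X) n)) \<longlonglongrightarrow> 0"
    "cls (seq_rep (cls X)) = cls X"
proof -
  have "seq_rep (cls X) \<in> cls X"
    unfolding seq_rep_def by (rule someI[of "\<lambda>U. U \<in> cls X", OF cls_self[OF assms]])
  then show "cau (seq_rep (cls X))" "(\<lambda>n. q (X n - seq_rep (cls X) n)) \<longlonglongrightarrow> 0"
    by (auto simp: seq_class_def)
  then show "cls (seq_rep (cls X)) = cls X"
    using assms by (metis cls_eq_iff)
qed

abbreviation "C \<equiv> completion G q"

lemma carrier_C: "carrier C = cls ` {X. cau X}"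
  by (simp add: completion_def)

lemma cls_in_carrier [simp]: "cau X \<Longrightarrow> cls X \<in> carrier C"
  by (simp add: carrier_C)

lemma carrier_cases:
  assumes "a \<in> carrier C"
  obtains X where "cau X" "a = cls X"
  using assms by (auto simp: carrier_C)

lemma zero_C: "\<zero>\<^bsub>C\<^esub> = cls (\<lambda>_. 0)"
  by (simp add: completion_def)

lemma add_C:
  assumes "cau X" "cau Y"
  shows "cls X \<oplus>\<^bsub>C\<^esub> cls Y = cls (\<lambda>n. X n + Y n)"
proof -
  let ?U = "seq_rep (cls X)" and ?V = "seq_rep (cls Y)"
  note U = rep_cls[OF assms(1)] and V = rep_cls[OF assms(2)]
  note mem = cauchy_seqD[OF assms(1)] cauchy_seqD[OF assms(2)] cauchy_seqD[OF U(1)] cauchy_seqD[OF V(1)]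
  have "(\<lambda>n. q (X n + Y n - (?U n + ?V n))) \<longlonglongrightarrow> 0"
  proof (rule tendsto_zero_dominated[where K = 1])
    show "(\<lambda>n. q (X n - ?U n) + q (Y n - ?V n)) \<longlonglongrightarrow> 0"
      using tendsto_add[OF U(2) V(2)] by simp
    show "q (X n + Y n - (?U n + ?V n)) \<le> 1 * (q (X n - ?U n) + q (Y n - ?V n))" for n
      using q_add[of "X n - ?U n" "Y n - ?V n"] mem by (simp add: add_diff_add)
  qed (use mem in auto)
  then have "cls (\<lambda>n. X n + Y n) = cls (\<lambda>n. ?U n + ?V n)"
    using assms U V by (subst cls_eq_iff) (auto intro: cauchy_add)
  then show ?thesis by (simp add: completion_def)
qed

lemma smul_C:
  assumes "cau X"
  shows "smul C c (cls X) = cls (\<lambda>n. free_smul c (X n))"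
proof -
  let ?U = "seq_rep (cls X)"
  note U = rep_cls[OF assms(1)]
  note mem = cauchy_seqD[OF assms(1)] cauchy_seqD[OF U(1)]
  have "(\<lambda>n. q (free_smul c (X n) - free_smul c (?U n))) \<longlonglongrightarrow> 0"
    using mem tendsto_mult_right_zero[OF U(2), of "cmod c"]
    by (simp add: free_smul_diff[symmetric] q_smul)
  then have "cls (\<lambda>n. free_smul c (X n)) = cls (\<lambda>n. free_smul c (?U n))"
    using assms U by (subst cls_eq_iff) (auto intro: cauchy_smul)
  then show ?thesis by (simp add: completion_def)
qed

lemma adj_C:
  assumes "cau X"
  shows "adj C (cls X) = cls (\<lambda>n. free_adj (X n))"
proof -
  let ?U = "seq_rep (cls X)"
  note U = rep_cls[OF assms(1)]
  note mem = cauchy_seqD[OF assms(1)] cauchy_seqD[OF U(1)]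
  have "(\<lambda>n. q (free_adj (X n) - free_adj (?U n))) \<longlonglongrightarrow> 0"
    using mem U(2) by (simp add: free_adj_diff[symmetric])
  then have "cls (\<lambda>n. free_adj (X n)) = cls (\<lambda>n. free_adj (?U n))"
    using assms U by (subst cls_eq_iff) (auto intro: cauchy_adj)
  then show ?thesis by (simp add: completion_def)
qed

lemma mult_C:
  assumes "cau X" "cau Y"
  shows "cls X \<otimes>\<^bsub>C\<^esub> cls Y = cls (\<lambda>n. X n * Y n)"
proof -
  let ?U = "seq_rep (cls X)" and ?V = "seq_rep (cls Y)"
  note U = rep_cls[OF assms(1)] and V = rep_cls[OF assms(2)]
  note mem = cauchy_seqD[OF assms(1)] cauchy_seqD[OF assms(2)] cauchy_seqD[OF U(1)] cauchy_seqD[OF V(1)]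
  obtain L M where L: "(\<lambda>n. q (X n)) \<longlonglongrightarrow> L" and M: "(\<lambda>n. q (?V n)) \<longlonglongrightarrow> M"
    using cauchy_seq_q assms(1) V(1) by meson
  have "(\<lambda>n. q (X n * Y n - ?U n * ?V n)) \<longlonglongrightarrow> 0"
  proof (rule tendsto_zero_dominated[where K = 1])
    show "(\<lambda>n. q (X n) * q (Y n - ?V n) + q (X n - ?U n) * q (?V n)) \<longlonglongrightarrow> 0"
      using tendsto_add[OF tendsto_mult[OF L V(2)] tendsto_mult[OF U(2) M]] by simp
    show "q (X n * Y n - ?U n * ?V n) \<le> 1 * (q (X n) * q (Y n - ?V n) + q (X n - ?U n) * q (?V n))" for n
      using q_mult_diff mem by simp
  qed (use mem in auto)
  then have "cls (\<lambda>n. X n * Y n) = cls (\<lambda>n. ?U n * ?V n)"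
    using assms U V by (subst cls_eq_iff) (auto intro: cauchy_mult)
  then show ?thesis by (simp add: completion_def)
qed

lemma nrm_C:
  assumes "cau X"
  shows "(\<lambda>n. q (X n)) \<longlonglongrightarrow> nrm C (cls X)"
proof -
  let ?U = "seq_rep (cls X)"
  note U = rep_cls[OF assms(1)]
  note mem = cauchy_seqD[OF assms(1)] cauchy_seqD[OF U(1)]
  obtain L where L: "(\<lambda>n. q (?U n)) \<longlonglongrightarrow> L"
    using cauchy_seq_q U(1) by meson
  have "(\<lambda>n. \<bar>q (X n) - q (?U n)\<bar>) \<longlonglongrightarrow> 0"
    by (rule tendsto_zero_dominated[OF U(2), where K = 1]) (use mem q_abs_diff in auto)
  then have "(\<lambda>n. (q (X n) - q (?U n)) + q (?U n)) \<longlonglongrightarrow> 0 + L"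
    using L by (intro tendsto_add) (auto simp: tendsto_rabs_zero_iff)
  moreover have "nrm C (cls X) = L"
    using limI[OF L] by (simp add: completion_def)
  ultimately show ?thesis by simp
qed

lemma nrm_C_const: "x \<in> Fr \<Longrightarrow> nrm C (cls (\<lambda>_. x)) = q x"
  using nrm_C[OF cauchy_const] tendsto_const by (rule LIMSEQ_unique)

lemma nrm_C_eq_zero: "cau X \<Longrightarrow> nrm C (cls X) = 0 \<longleftrightarrow> cls X = \<zero>\<^bsub>C\<^esub>"
proof -
  assume X: "cau X"
  have "cls X = \<zero>\<^bsub>C\<^esub> \<longleftrightarrow> (\<lambda>n. q (X n)) \<longlonglongrightarrow> 0"
    using X by (simp add: zero_C cls_eq_iff)
  then show ?thesis
    using nrm_C[OF X] LIMSEQ_unique by metis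
qed

lemma abelian_group_C: "abelian_group C"
proof (rule abelian_groupI)
  fix x assume "x \<in> carrier C"
  then obtain X where X: "cau X" "x = cls X" by (rule carrier_cases)
  have "cls (\<lambda>n. free_smul (-1) (X n)) \<oplus>\<^bsub>C\<^esub> x = \<zero>\<^bsub>C\<^esub>"
    using X by (simp add: add_C cauchy_smul zero_C) (simp add: free_smul_minus_one)
  then show "\<exists>y\<in>carrier C. y \<oplus>\<^bsub>C\<^esub> x = \<zero>\<^bsub>C\<^esub>"
    using cls_in_carrier[OF cauchy_smul[OF X(1)]] by blast
qed (auto elim!: carrier_cases simp: zero_C add_C cauchy_add add.assoc add.commute add.left_commute)

lemma pre_cstar_C: "pre_cstar_algebra C"
proof (intro pre_cstar_algebra.intro abelian_group_C pre_cstar_algebra_axioms.intro)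
  fix x assume "x \<in> carrier C"
  then obtain X where X: "cau X" "x = cls X" by (rule carrier_cases)
  show "nrm C x = 0 \<longleftrightarrow> x = \<zero>\<^bsub>C\<^esub>"
    using X by (simp add: nrm_C_eq_zero)
  show "nrm C (smul C c x) = cmod c * nrm C x" for c
  proof (rule LIMSEQ_unique)
    show "(\<lambda>n. q (free_smul c (X n))) \<longlonglongrightarrow> nrm C (smul C c x)"
      using X nrm_C[OF cauchy_smul[OF X(1)]] by (simp add: smul_C)
    show "(\<lambda>n. q (free_smul c (X n))) \<longlonglongrightarrow> cmod c * nrm C x"
      using X tendsto_mult_left[OF nrm_C[OF X(1)], of "cmod c"] by (simp add: q_smul cauchy_seqD)
  qed
  show "nrm C (adj C x \<otimes>\<^bsub>C\<^esub> x) = (nrm C x)\<^sup>2"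
  proof (rule LIMSEQ_unique)
    show "(\<lambda>n. q (free_adj (X n) * X n)) \<longlonglongrightarrow> nrm C (adj C x \<otimes>\<^bsub>C\<^esub> x)"
      using X nrm_C[OF cauchy_mult[OF cauchy_adj[OF X(1)] X(1)]] by (simp add: adj_C mult_C cauchy_adj)
    show "(\<lambda>n. q (free_adj (X n) * X n)) \<longlonglongrightarrow> (nrm C x)\<^sup>2"
      using X tendsto_power[OF nrm_C[OF X(1)], of 2] by (simp add: q_adj_mult cauchy_seqD)
  qed
  fix y assume "y \<in> carrier C"
  then obtain Y where Y: "cau Y" "y = cls Y" by (rule carrier_cases)
  show "nrm C (x \<oplus>\<^bsub>C\<^esub> y) \<le> nrm C x + nrm C y"
  proof (rule LIMSEQ_le)
    show "(\<lambda>n. q (X n + Y n)) \<longlonglongrightarrow> nrm C (x \<oplus>\<^bsub>C\<^esub> y)"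
      using X Y nrm_C[OF cauchy_add[OF X(1) Y(1)]] by (simp add: add_C)
    show "(\<lambda>n. q (X n) + q (Y n)) \<longlonglongrightarrow> nrm C x + nrm C y"
      using X Y by (auto intro: tendsto_add nrm_C)
  qed (use X Y in \<open>auto intro: q_add cauchy_seqD\<close>)
  show "nrm C (x \<otimes>\<^bsub>C\<^esub> y) \<le> nrm C x * nrm C y"
  proof (rule LIMSEQ_le)
    show "(\<lambda>n. q (X n * Y n)) \<longlonglongrightarrow> nrm C (x \<otimes>\<^bsub>C\<^esub> y)"
      using X Y nrm_C[OF cauchy_mult[OF X(1) Y(1)]] by (simp add: mult_C)
    show "(\<lambda>n. q (X n) * q (Y n)) \<longlonglongrightarrow> nrm C x * nrm C y"
      using X Y by (auto intro: tendsto_mult nrm_C)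
  qed (use X Y in \<open>auto intro: q_mult cauchy_seqD\<close>)
qed (auto elim!: carrier_cases
      simp: add_C mult_C smul_C adj_C cauchy_add cauchy_mult cauchy_smul cauchy_adj
            distrib_left distrib_right mult.assoc free_smul_add free_smul_add_left free_smul_free_smul
            free_smul_mult_left free_smul_mult_right free_adj_add free_adj_smul free_adj_mult)

lemma diff_C:
  assumes X: "cau X" and Y: "cau Y"
  shows "cls X \<ominus>\<^bsub>C\<^esub> cls Y = cls (\<lambda>n. X n - Y n)" "cau (\<lambda>n. X n - Y n)"
proof -
  interpret pre_cstar_algebra C by (rule pre_cstar_C)
  have m: "cau (\<lambda>n. - Y n)"
    using cauchy_smul[OF Y, of "-1"] by (simp add: free_smul_minus_one)
  show "cls X \<ominus>\<^bsub>C\<^esub> cls Y = cls (\<lambda>n. X n - Y n)"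
    using X Y m by (simp add: a_minus_def smul_minus_one[symmetric] smul_C add_C free_smul_minus_one)
  show "cau (\<lambda>n. X n - Y n)"
    using cauchy_add[OF X m] by simp
qed

lemma cls_limit:
  assumes X: "cau X"
  shows "(\<lambda>n. nrm C (cls (\<lambda>_. X n) \<ominus>\<^bsub>C\<^esub> cls X)) \<longlonglongrightarrow> 0"
proof (rule LIMSEQ_I)
  fix e :: real assume e: "e > 0"
  interpret pre_cstar_algebra C by (rule pre_cstar_C)
  obtain N where N: "\<forall>m\<ge>N. \<forall>n\<ge>N. q (X m - X n) < e / 2"
    using X e unfolding cauchy_seq_def by (meson half_gt_zero)
  have "norm (nrm C (cls (\<lambda>_. X n) \<ominus>\<^bsub>C\<^esub> cls X) - 0) < e" if n: "n \<ge> N" for n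
  proof -
    have c: "cau (\<lambda>_. X n)" using X by (simp add: cauchy_seqD)
    have "nrm C (cls (\<lambda>_. X n) \<ominus>\<^bsub>C\<^esub> cls X) \<le> e / 2"
      using nrm_C[OF diff_C(2)[OF c X]] N n
      unfolding diff_C(1)[OF c X] by (intro LIMSEQ_le_const2) (auto intro!: exI[of _ N] less_imp_le)
    then show ?thesis using e X c by simp
  qed
  then show "\<exists>no. \<forall>n\<ge>no. norm (nrm C (cls (\<lambda>_. X n) \<ominus>\<^bsub>C\<^esub> cls X) - 0) < e" by blast
qed

theorem cstar_algebra_completion: "cstar_algebra C"
proof (intro cstar_algebra.intro pre_cstar_C cstar_algebra_axioms.intro)
  interpret pre_cstar_algebra C by (rule pre_cstar_C)
  fix a assume a: "\<And>n::nat. a n \<in> carrier C"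
    and cauchy: "\<And>e. e > 0 \<Longrightarrow> \<exists>N. \<forall>m\<ge>N. \<forall>n\<ge>N. nrm C (a m \<ominus>\<^bsub>C\<^esub> a n) < e"
  have "\<exists>y. y \<in> Fr \<and> nrm C (cls (\<lambda>_. y) \<ominus>\<^bsub>C\<^esub> a n) < 1 / Suc n" for n
  proof -
    obtain X where X: "cau X" "a n = cls X" using a by (meson carrier_cases)
    obtain k where "norm (nrm C (cls (\<lambda>_. X k) \<ominus>\<^bsub>C\<^esub> cls X) - 0) < 1 / Suc n"
      using LIMSEQ_D[OF cls_limit[OF X(1)], of "1 / Suc n"] by auto
    then show ?thesis using X by (intro exI[of _ "X k"]) (simp add: cauchy_seqD)
  qed
  then obtain Y where Y: "\<And>n. Y n \<in> Fr" "\<And>n. nrm C (cls (\<lambda>_. Y n) \<ominus>\<^bsub>C\<^esub> a n) < 1 / Suc n"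
    by metis
  have inv: "(\<lambda>n. 1 / real (Suc n)) \<longlonglongrightarrow> 0"
    using LIMSEQ_inverse_real_of_nat by (simp add: inverse_eq_divide)
  have "cau Y"
    unfolding cauchy_seq_def
  proof (intro conjI allI impI Y(1))
    fix e :: real assume e: "e > 0"
    obtain M where M: "\<And>m n. m \<ge> M \<Longrightarrow> n \<ge> M \<Longrightarrow> nrm C (a m \<ominus>\<^bsub>C\<^esub> a n) < e / 3"
      using cauchy[of "e / 3"] e by auto
    obtain K where K: "\<And>n. n \<ge> K \<Longrightarrow> 1 / real (Suc n) < e / 3"
      using LIMSEQ_D[OF inv, of "e / 3"] e by auto
    have "q (Y m - Y n) < e" if mn: "m \<ge> max M K" "n \<ge> max M K" for m n
    proof -
      let ?y = "\<lambda>n. cls (\<lambda>_. Y n)"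
      have y: "?y n \<in> carrier C" for n using Y by simp
      have "nrm C (?y m \<ominus>\<^bsub>C\<^esub> ?y n) \<le> nrm C (?y m \<ominus>\<^bsub>C\<^esub> a m) + nrm C (a m \<ominus>\<^bsub>C\<^esub> ?y n)"
        using y a by (intro nrm_diff_triangle)
      also have "nrm C (a m \<ominus>\<^bsub>C\<^esub> ?y n) \<le> nrm C (a m \<ominus>\<^bsub>C\<^esub> a n) + nrm C (a n \<ominus>\<^bsub>C\<^esub> ?y n)"
        using y a by (intro nrm_diff_triangle)
      also have "nrm C (a n \<ominus>\<^bsub>C\<^esub> ?y n) = nrm C (?y n \<ominus>\<^bsub>C\<^esub> a n)"
        using y a by (intro nrm_diff_commute)
      finally have "nrm C (?y m \<ominus>\<^bsub>C\<^esub> ?y n) < e / 3 + (e / 3 + e / 3)"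
        using M[of m n] K[of m] K[of n] Y(2)[of m] Y(2)[of n] mn by auto
      then show ?thesis
        using Y(1) by (simp add: diff_C nrm_C_const)
    qed
    then show "\<exists>N. \<forall>m\<ge>N. \<forall>n\<ge>N. q (Y m - Y n) < e" by blast
  qed
  have "(\<lambda>n. nrm C (a n \<ominus>\<^bsub>C\<^esub> cls Y)) \<longlonglongrightarrow> 0"
  proof (rule tendsto_zero_dominated[where K = 1])
    show "(\<lambda>n. 1 / real (Suc n) + nrm C (cls (\<lambda>_. Y n) \<ominus>\<^bsub>C\<^esub> cls Y)) \<longlonglongrightarrow> 0"
      using tendsto_add[OF inv cls_limit[OF \<open>cau Y\<close>]] by simp
    fix n
    show "nrm C (a n \<ominus>\<^bsub>C\<^esub> cls Y) \<le> 1 * (1 / real (Suc n) + nrm C (cls (\<lambda>_. Y n) \<ominus>\<^bsub>C\<^esub> cls Y))"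
      using nrm_diff_triangle[of "a n" "cls (\<lambda>_. Y n)" "cls Y"] a Y(1) Y(2)[of n] \<open>cau Y\<close>
        nrm_diff_commute[of "a n" "cls (\<lambda>_. Y n)"] by simp
    show "0 \<le> nrm C (a n \<ominus>\<^bsub>C\<^esub> cls Y)" using a \<open>cau Y\<close> by simp
  qed
  then show "\<exists>x\<in>carrier C. (\<lambda>n. nrm C (a n \<ominus>\<^bsub>C\<^esub> x)) \<longlonglongrightarrow> 0"
    using \<open>cau Y\<close> by (intro bexI[of _ "cls Y"]) auto
qed

end


section \<open>*-homomorphisms are contractive\<close>

context pre_cstar_algebra
begin

lemma smul_two: "x \<in> carrier A \<Longrightarrow> smul A 2 x = x \<oplus> x"
  using smul_add_left[of x 1 1] by simp

lemma nrm_le_commuting_squares: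
  assumes a: "a \<in> carrier A" and c: "c \<in> carrier A" and ac: "adj A a \<otimes> c = adj A c \<otimes> a"
  shows "(nrm A a)\<^sup>2 \<le> nrm A (adj A a \<otimes> a \<oplus> adj A c \<otimes> c)"
proof -
  let ?w = "adj A a \<otimes> c" and ?N = "adj A a \<otimes> a \<oplus> adj A c \<otimes> c"
  have w: "?w \<in> carrier A" using a c by simp
  have *: "(nrm A (a \<oplus> smul A z c))\<^sup>2 = nrm A ?N" if z: "cnj z = - z" "z * z = -1" for z
  proof -
    have "adj A (a \<oplus> smul A z c) \<otimes> (a \<oplus> smul A z c)
        = (adj A a \<otimes> a \<oplus> smul A z ?w) \<oplus> (smul A (- z) ?w \<oplus> smul A (- z * z) (adj A c \<otimes> c))"
      using a c z by (simp add: adj_add adj_smul l_distr r_distr smul_mult_left smul_mult_right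
          smul_smul smul_add_right ac[symmetric] a_ac)
    also have "\<dots> = (adj A a \<otimes> a \<oplus> (smul A z ?w \<oplus> smul A (- z) ?w)) \<oplus> adj A c \<otimes> c"
      using a c w z by (simp add: a_assoc)
    also have "smul A z ?w \<oplus> smul A (- z) ?w = \<zero>"
      using smul_add_left[OF w, of z "- z"] w by simp
    finally have "adj A (a \<oplus> smul A z c) \<otimes> (a \<oplus> smul A z c) = ?N"
      using a c by simp
    then show ?thesis
      using nrm_adj_mult[of "a \<oplus> smul A z c"] a c by simp
  qed
  define u where "u = a \<oplus> smul A \<i> c"
  define v where "v = a \<oplus> smul A (- \<i>) c"
  have uv: "u \<in> carrier A" "v \<in> carrier A" using a c by (simp_all add: u_def v_def)
  have n: "nrm A u = sqrt (nrm A ?N)" "nrm A v = sqrt (nrm A ?N)"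
    using *[of "\<i>"] *[of "- \<i>"] uv unfolding u_def v_def
    by (metis complex_cnj_i i_squared nrm_nonneg real_sqrt_unique,
        metis add.inverse_inverse complex_cnj_i complex_cnj_minus i_squared minus_mult_minus nrm_nonneg real_sqrt_unique)
  have "u \<oplus> v = (a \<oplus> a) \<oplus> (smul A \<i> c \<oplus> smul A (- \<i>) c)"
    using a c by (simp add: u_def v_def a_ac)
  also have "smul A \<i> c \<oplus> smul A (- \<i>) c = \<zero>"
    using smul_add_left[OF c, of "\<i>" "- \<i>"] c by simp
  finally have "u \<oplus> v = smul A 2 a" using a by (simp add: smul_two)
  then have "2 * nrm A a \<le> 2 * sqrt (nrm A ?N)"
    using nrm_add[OF uv] n nrm_smul[OF a, of 2] by simp
  then have "nrm A a \<le> sqrt (nrm A ?N)" by simp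
  then have "(nrm A a)\<^sup>2 \<le> (sqrt (nrm A ?N))\<^sup>2"
    using a by (intro power_mono) auto
  then show ?thesis using a c by simp
qed

lemma nrm_le_one_of_circle:
  assumes k: "k \<in> carrier A" "adj A k = k" and p: "p \<in> carrier A" "adj A p = p"
    and kp: "k \<otimes> p = p \<otimes> k" and eq: "p \<oplus> p = k \<otimes> k \<oplus> p \<otimes> p"
  shows "nrm A k \<le> 1"
proof -
  have bound: "nrm A (k \<otimes> b) \<le> nrm A b" if b: "b \<in> carrier A" for b
  proof -
    define B where "B = adj A b"
    have B: "B \<in> carrier A" using b by (simp add: B_def)
    define a where "a = k \<otimes> b"
    define c where "c = b \<ominus> p \<otimes> b"
    have ac: "a \<in> carrier A" "c \<in> carrier A" using b k p by (simp_all add: a_def c_def)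
    have adja: "adj A a = B \<otimes> k" and adjc: "adj A c = B \<ominus> B \<otimes> p"
      using b k p by (simp_all add: a_def c_def B_def adj_mult adj_diff)
    have pk: "p \<otimes> (k \<otimes> b) = k \<otimes> (p \<otimes> b)"
      using b k p kp by (simp add: m_assoc[symmetric])
    have comm: "adj A a \<otimes> c = adj A c \<otimes> a"
      unfolding adja adjc using b k p B
      by (simp add: a_def c_def mult_diff_left mult_diff_right m_assoc pk)
    have 1: "adj A a \<otimes> a = B \<otimes> (k \<otimes> k) \<otimes> b"
      unfolding adja using b k B by (simp add: a_def m_assoc)
    have 2: "adj A c \<otimes> c = (B \<otimes> b \<ominus> B \<otimes> p \<otimes> b) \<ominus> (B \<otimes> p \<otimes> b \<ominus> B \<otimes> (p \<otimes> p) \<otimes> b)"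
      unfolding adjc using b p B by (simp add: c_def mult_diff_left mult_diff_right m_assoc)
    have 3: "B \<otimes> (k \<otimes> k) \<otimes> b \<oplus> B \<otimes> (p \<otimes> p) \<otimes> b = B \<otimes> p \<otimes> b \<oplus> B \<otimes> p \<otimes> b"
    proof -
      have "B \<otimes> (k \<otimes> k) \<otimes> b \<oplus> B \<otimes> (p \<otimes> p) \<otimes> b = B \<otimes> (k \<otimes> k \<oplus> p \<otimes> p) \<otimes> b"
        using B b k p by (simp add: l_distr r_distr)
      also have "\<dots> = B \<otimes> (p \<oplus> p) \<otimes> b" by (simp add: eq)
      finally show ?thesis using B b k p by (simp add: l_distr r_distr)
    qed
    have rearr: "x \<oplus> ((s \<ominus> y) \<ominus> (y \<ominus> z)) = s"
      if "x \<oplus> z = y \<oplus> y" "x \<in> carrier A" "y \<in> carrier A" "z \<in> carrier A" "s \<in> carrier A" for x y z s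
    proof -
      have "x \<oplus> ((s \<ominus> y) \<ominus> (y \<ominus> z)) = (x \<oplus> z) \<oplus> (\<ominus> y \<oplus> \<ominus> y) \<oplus> s"
        using that(2-) by (simp add: a_minus_def minus_add a_ac)
      also have "\<dots> = s"
        unfolding that(1) using that(2-) by (simp add: minus_add[symmetric] r_neg)
      finally show ?thesis .
    qed
    have "adj A a \<otimes> a \<oplus> adj A c \<otimes> c = B \<otimes> b"
      unfolding 1 2 using B b k p by (intro rearr 3) auto
    then have "(nrm A a)\<^sup>2 \<le> nrm A (B \<otimes> b)"
      using nrm_le_commuting_squares[OF ac comm] by simp
    also have "\<dots> = (nrm A b)\<^sup>2"
      using nrm_adj_mult[OF b] by (simp add: B_def)
    finally show ?thesis
      using b by (simp add: a_def power2_le_iff_abs_le abs_le_square_iff)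
  qed
  have "nrm A k * nrm A k = nrm A (k \<otimes> k)"
    using nrm_adj_mult[OF k(1)] k(2) by (simp add: power2_eq_square)
  also have "\<dots> \<le> 1 * nrm A k" using bound[OF k(1)] by simp
  finally show ?thesis
    using nrm_nonneg[OF k(1)] by (metis mult_le_cancel_right order_less_le zero_le_one order_trans not_le_imp_less)
qed

end

context cstar_algebra
begin

lemma exists_circle_partner:
  assumes h: "h \<in> carrier A" "adj A h = h" and less: "nrm A h < 1"
  shows "\<exists>y\<in>carrier A. adj A y = y \<and> h \<otimes> y = y \<otimes> h \<and> y \<oplus> y = h \<otimes> h \<oplus> y \<otimes> y"
proof -
  define r where "r = nrm A h"
  have r: "0 \<le> r" "r < 1" using h less by (simp_all add: r_def)
  define Y where "Y = rec_nat \<zero> (\<lambda>_ y. smul A (1/2) (h \<otimes> h \<oplus> y \<otimes> y))"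
  have Y0: "Y 0 = \<zero>" and YS: "Y (Suc n) = smul A (1/2) (h \<otimes> h \<oplus> Y n \<otimes> Y n)" for n
    by (simp_all add: Y_def)
  have Yc [simp]: "Y n \<in> carrier A" for n
    by (induction n) (simp_all add: Y0 YS h)
  have Ya: "adj A (Y n) = Y n" for n
    by (induction n) (simp_all add: Y0 YS h adj_smul adj_add adj_mult)
  have Yh: "h \<otimes> Y n = Y n \<otimes> h" for n
  proof (induction n)
    case (Suc n)
    have "h \<otimes> (Y n \<otimes> Y n) = (Y n \<otimes> Y n) \<otimes> h"
      using Suc h by (metis Yc m_assoc)
    then show ?case
      using h by (simp add: YS smul_mult_left smul_mult_right l_distr r_distr m_assoc)
  qed (simp add: Y0 h)
  have Yr: "nrm A (Y n) \<le> r" for n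
  proof (induction n)
    case (Suc n)
    have "nrm A (h \<otimes> h \<oplus> Y n \<otimes> Y n) \<le> nrm A (h \<otimes> h) + nrm A (Y n \<otimes> Y n)"
      using h by (intro nrm_add) auto
    also have "\<dots> \<le> nrm A h * nrm A h + nrm A (Y n) * nrm A (Y n)"
      using h by (intro add_mono nrm_mult) auto
    also have "\<dots> \<le> r * r + r * r"
      using Suc r h unfolding r_def by (intro add_mono mult_mono) auto
    also have "\<dots> \<le> r * 1 + r * 1"
      using r by (intro add_mono mult_left_mono) auto
    finally show ?case using h by (simp add: YS nrm_smul)
  qed (simp add: Y0 r)
  have Ycontr: "nrm A (Y (Suc m) \<ominus> Y (Suc n)) \<le> r * nrm A (Y m \<ominus> Y n)" for m n
  proof -
    have "Y (Suc m) \<ominus> Y (Suc n) = smul A (1/2) ((h \<otimes> h \<oplus> Y m \<otimes> Y m) \<ominus> (h \<otimes> h \<oplus> Y n \<otimes> Y n))"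
      using h by (simp add: YS smul_diff)
    also have "(h \<otimes> h \<oplus> Y m \<otimes> Y m) \<ominus> (h \<otimes> h \<oplus> Y n \<otimes> Y n) = Y m \<otimes> Y m \<ominus> Y n \<otimes> Y n"
      using h by (simp add: add_diff_add)
    also have "\<dots> = Y m \<otimes> (Y m \<ominus> Y n) \<oplus> (Y m \<ominus> Y n) \<otimes> Y n"
      by (simp add: mult_diff_left mult_diff_right diff_split[of "Y m \<otimes> Y m" "Y m \<otimes> Y n" "Y n \<otimes> Y n"])
    finally have "nrm A (Y (Suc m) \<ominus> Y (Suc n)) =
        1/2 * nrm A (Y m \<otimes> (Y m \<ominus> Y n) \<oplus> (Y m \<ominus> Y n) \<otimes> Y n)"
      by (simp add: nrm_smul)
    also have "\<dots> \<le> 1/2 * (nrm A (Y m) * nrm A (Y m \<ominus> Y n) + nrm A (Y m \<ominus> Y n) * nrm A (Y n))"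
      using nrm_add[of "Y m \<otimes> (Y m \<ominus> Y n)" "(Y m \<ominus> Y n) \<otimes> Y n"]
        nrm_mult[of "Y m" "Y m \<ominus> Y n"] nrm_mult[of "Y m \<ominus> Y n" "Y n"] by simp
    also have "\<dots> \<le> 1/2 * (r * nrm A (Y m \<ominus> Y n) + nrm A (Y m \<ominus> Y n) * r)"
      using Yr by (intro mult_left_mono add_mono mult_right_mono) auto
    finally show ?thesis by simp
  qed
  have Ypow: "nrm A (Y (n + k) \<ominus> Y n) \<le> r ^ n" for n k
  proof (induction n)
    case 0
    have "nrm A (Y k \<ominus> \<zero>) \<le> nrm A (Y k)" using nrm_diff_le[of "Y k" \<zero>] by simp
    then show ?case using Yr[of k] r by (simp add: Y0)
  next
    case (Suc n)
    have "nrm A (Y (Suc (n + k)) \<ominus> Y (Suc n)) \<le> r * r ^ n"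
      using Ycontr[of "n + k" n] mult_left_mono[OF Suc r(1)] by linarith
    then show ?case by simp
  qed
  have lim: "(\<lambda>n. r ^ n) \<longlonglongrightarrow> 0" using r by (intro LIMSEQ_power_zero) auto
  have "\<exists>N. \<forall>m\<ge>N. \<forall>n\<ge>N. nrm A (Y m \<ominus> Y n) < e" if e: "e > 0" for e
  proof -
    obtain N where N: "r ^ N < e / 2" using LIMSEQ_D[OF lim, of "e / 2"] e r by auto
    have *: "nrm A (Y m \<ominus> Y N) < e / 2" if "m \<ge> N" for m
      using Ypow[of N "m - N"] that N by simp
    have "nrm A (Y m \<ominus> Y n) < e" if "m \<ge> N" "n \<ge> N" for m n
      using nrm_diff_triangle[of "Y m" "Y N" "Y n"] *[OF that(1)] *[OF that(2)]
      by (simp add: nrm_diff_commute[of "Y N"])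
    then show ?thesis by blast
  qed
  then obtain y where y: "y \<in> carrier A" "(\<lambda>n. nrm A (Y n \<ominus> y)) \<longlonglongrightarrow> 0"
    using complete[of Y] Yc by blast
  have "(\<lambda>n. nrm A (Y n \<ominus> adj A y)) = (\<lambda>n. nrm A (Y n \<ominus> y))"
  proof
    fix n
    have "Y n \<ominus> adj A y = adj A (Y n \<ominus> y)" using y by (simp add: adj_diff Ya)
    then show "nrm A (Y n \<ominus> adj A y) = nrm A (Y n \<ominus> y)" using y by simp
  qed
  then have ya: "adj A y = y"
    using y by (intro limit_unique[of Y]) auto
  have "(\<lambda>n. nrm A (h \<otimes> Y n \<ominus> h \<otimes> y)) \<longlonglongrightarrow> 0"
  proof (rule tendsto_zero_dominated[OF y(2), where K = "nrm A h"])
    show "nrm A (h \<otimes> Y n \<ominus> h \<otimes> y) \<le> nrm A h * nrm A (Y n \<ominus> y)" for n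
      using h y by (simp add: mult_diff_right[symmetric] nrm_mult)
  qed (use h y in auto)
  moreover have "(\<lambda>n. nrm A (h \<otimes> Y n \<ominus> y \<otimes> h)) \<longlonglongrightarrow> 0"
  proof (rule tendsto_zero_dominated[OF y(2), where K = "nrm A h"])
    show "nrm A (h \<otimes> Y n \<ominus> y \<otimes> h) \<le> nrm A h * nrm A (Y n \<ominus> y)" for n
      using h y nrm_mult[of "Y n \<ominus> y" h] by (simp add: Yh mult_diff_left mult.commute)
  qed (use h y in auto)
  ultimately have yh: "h \<otimes> y = y \<otimes> h"
    using h y by (intro limit_unique[of "\<lambda>n. h \<otimes> Y n"]) auto
  have ny: "nrm A y \<le> r"
  proof -
    have "nrm A y \<le> r + nrm A (Y n \<ominus> y)" for n
      using nrm_abs_diff_le[OF Yc y(1), of n] Yr[of n] by linarith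
    moreover have "(\<lambda>n. r + nrm A (Y n \<ominus> y)) \<longlonglongrightarrow> r + 0"
      using y by (intro tendsto_add) auto
    ultimately show ?thesis by (intro LIMSEQ_le_const[where X = "\<lambda>n. r + nrm A (Y n \<ominus> y)"]) auto
  qed
  define y' where "y' = smul A (1/2) (h \<otimes> h \<oplus> y \<otimes> y)"
  have y': "y' \<in> carrier A" using h y by (simp add: y'_def)
  have "(\<lambda>n. nrm A (Y (Suc n) \<ominus> y')) \<longlonglongrightarrow> 0"
  proof (rule tendsto_zero_dominated[OF y(2), where K = r])
    fix n
    have "Y (Suc n) \<ominus> y' = smul A (1/2) ((h \<otimes> h \<oplus> Y n \<otimes> Y n) \<ominus> (h \<otimes> h \<oplus> y \<otimes> y))"
      using h y by (simp add: YS y'_def smul_diff)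
    also have "(h \<otimes> h \<oplus> Y n \<otimes> Y n) \<ominus> (h \<otimes> h \<oplus> y \<otimes> y) = Y n \<otimes> Y n \<ominus> y \<otimes> y"
      using h y by (simp add: add_diff_add)
    also have "\<dots> = Y n \<otimes> (Y n \<ominus> y) \<oplus> (Y n \<ominus> y) \<otimes> y"
      using y by (simp add: mult_diff_left mult_diff_right diff_split[of "Y n \<otimes> Y n" "Y n \<otimes> y" "y \<otimes> y"])
    finally have "nrm A (Y (Suc n) \<ominus> y') =
        1/2 * nrm A (Y n \<otimes> (Y n \<ominus> y) \<oplus> (Y n \<ominus> y) \<otimes> y)"
      using y by (simp add: nrm_smul)
    also have "\<dots> \<le> 1/2 * (nrm A (Y n) * nrm A (Y n \<ominus> y) + nrm A (Y n \<ominus> y) * nrm A y)"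
      using nrm_add[of "Y n \<otimes> (Y n \<ominus> y)" "(Y n \<ominus> y) \<otimes> y"] y
        nrm_mult[of "Y n" "Y n \<ominus> y"] nrm_mult[of "Y n \<ominus> y" y] by simp
    also have "\<dots> \<le> 1/2 * (r * nrm A (Y n \<ominus> y) + nrm A (Y n \<ominus> y) * r)"
      using Yr ny y by (intro mult_left_mono add_mono mult_right_mono) auto
    finally show "nrm A (Y (Suc n) \<ominus> y') \<le> r * nrm A (Y n \<ominus> y)" by simp
  qed (use y y' in auto)
  moreover have "(\<lambda>n. nrm A (Y (Suc n) \<ominus> y)) \<longlonglongrightarrow> 0"
    using y(2) by (rule LIMSEQ_Suc)
  ultimately have "y = y'"
    using y y' by (intro limit_unique[of "\<lambda>n. Y (Suc n)"]) auto
  then have "smul A 2 y = smul A 2 y'" by simp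
  also have "\<dots> = h \<otimes> h \<oplus> y \<otimes> y"
    using h y by (simp add: y'_def smul_smul)
  finally have "smul A 2 y = h \<otimes> h \<oplus> y \<otimes> y" .
  then show ?thesis
    using y ya yh by (auto simp: smul_two)
qed

end

locale star_homomorphism = A: pre_cstar_algebra A + B: pre_cstar_algebra B
  for A :: "'a cstar" and B :: "'b cstar" and \<pi> +
  assumes star_hom: "star_hom A B \<pi>"
begin

lemma hom_closed [simp]: "x \<in> carrier A \<Longrightarrow> \<pi> x \<in> carrier B"
  using star_hom by (auto simp: star_hom_def)

lemma hom_add: "\<lbrakk>x \<in> carrier A; y \<in> carrier A\<rbrakk> \<Longrightarrow> \<pi> (x \<oplus>\<^bsub>A\<^esub> y) = \<pi> x \<oplus>\<^bsub>B\<^esub> \<pi> y"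
  using star_hom by (auto simp: star_hom_def)

lemma hom_mult: "\<lbrakk>x \<in> carrier A; y \<in> carrier A\<rbrakk> \<Longrightarrow> \<pi> (x \<otimes>\<^bsub>A\<^esub> y) = \<pi> x \<otimes>\<^bsub>B\<^esub> \<pi> y"
  using star_hom by (auto simp: star_hom_def)

lemma hom_smul: "x \<in> carrier A \<Longrightarrow> \<pi> (smul A c x) = smul B c (\<pi> x)"
  using star_hom by (auto simp: star_hom_def)

lemma hom_adj: "x \<in> carrier A \<Longrightarrow> \<pi> (adj A x) = adj B (\<pi> x)"
  using star_hom by (auto simp: star_hom_def)

lemma hom_zero [simp]: "\<pi> \<zero>\<^bsub>A\<^esub> = \<zero>\<^bsub>B\<^esub>"
  by (metis A.smul_zero_left A.zero_closed B.smul_zero_left hom_closed hom_smul)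

lemma hom_diff: "\<lbrakk>x \<in> carrier A; y \<in> carrier A\<rbrakk> \<Longrightarrow> \<pi> (x \<ominus>\<^bsub>A\<^esub> y) = \<pi> x \<ominus>\<^bsub>B\<^esub> \<pi> y"
  by (simp add: a_minus_def A.smul_minus_one[symmetric] B.smul_minus_one[symmetric] hom_add hom_smul)

lemma hom_mult_list: "set xs \<subseteq> carrier A \<Longrightarrow> \<pi> (mult_list A xs) = mult_list B (map \<pi> xs)"
proof (induction xs)
  case (Cons x xs)
  then show ?case
    by (cases "xs = []") (simp_all add: A.mult_list_Cons B.mult_list_Cons hom_mult)
qed simp

lemma hom_finsum:
  "f \<in> I \<rightarrow> carrier A \<Longrightarrow> \<pi> (finsum A f I) = finsum B (\<lambda>i. \<pi> (f i)) I"
proof (induction I rule: infinite_finite_induct)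
  case (insert i I)
  then have "(\<lambda>i. \<pi> (f i)) \<in> I \<rightarrow> carrier B" by (auto intro!: hom_closed)
  with insert show ?case
    by (simp add: A.finsum_insert B.finsum_insert hom_add A.finsum_closed)
qed (simp_all add: A.finsum_infinite B.finsum_infinite A.finsum_empty B.finsum_empty)

end

theorem star_hom_contractive:
  assumes A: "cstar_algebra A" and B: "pre_cstar_algebra B" and \<pi>: "star_hom A B \<pi>"
    and x: "x \<in> carrier A"
  shows "nrm B (\<pi> x) \<le> nrm A x"
proof -
  interpret A: cstar_algebra A by (rule A)
  interpret B: pre_cstar_algebra B by (rule B)
  interpret star_homomorphism A B \<pi>
    by (intro star_homomorphism.intro star_homomorphism_axioms.intro A.pre_cstar_algebra_axioms B \<pi>)
  have unit: "nrm B (\<pi> h) \<le> 1" if h: "h \<in> carrier A" "adj A h = h" "nrm A h < 1" for h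
  proof -
    obtain y where y: "y \<in> carrier A" "adj A y = y" "h \<otimes>\<^bsub>A\<^esub> y = y \<otimes>\<^bsub>A\<^esub> h"
      "y \<oplus>\<^bsub>A\<^esub> y = h \<otimes>\<^bsub>A\<^esub> h \<oplus>\<^bsub>A\<^esub> y \<otimes>\<^bsub>A\<^esub> y"
      using A.exists_circle_partner[OF h] by blast
    show ?thesis
    proof (rule B.nrm_le_one_of_circle[of "\<pi> h" "\<pi> y"])
      show "adj B (\<pi> h) = \<pi> h" "adj B (\<pi> y) = \<pi> y"
        using h y by (simp_all add: hom_adj[symmetric])
      show "\<pi> h \<otimes>\<^bsub>B\<^esub> \<pi> y = \<pi> y \<otimes>\<^bsub>B\<^esub> \<pi> h"
        using h y by (simp add: hom_mult[symmetric])
      show "\<pi> y \<oplus>\<^bsub>B\<^esub> \<pi> y = \<pi> h \<otimes>\<^bsub>B\<^esub> \<pi> h \<oplus>\<^bsub>B\<^esub> \<pi> y \<otimes>\<^bsub>B\<^esub> \<pi> y"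
        using h y by (simp add: hom_mult[symmetric] hom_add[symmetric])
    qed (use h y in auto)
  qed
  have selfadj: "nrm B (\<pi> h) \<le> nrm A h" if h: "h \<in> carrier A" "adj A h = h" for h
  proof (rule field_le_epsilon)
    fix e :: real assume e: "e > 0"
    define c where "c = nrm A h + e"
    have c: "c > 0" "nrm A h < c" using e h by (simp_all add: c_def add_nonneg_pos)
    have n: "cmod (complex_of_real (1 / c)) = 1 / c" using c by (simp add: norm_divide)
    have "nrm B (\<pi> (smul A (complex_of_real (1 / c)) h)) \<le> 1"
    proof (rule unit)
      show "nrm A (smul A (complex_of_real (1 / c)) h) < 1"
        using h c by (simp add: A.nrm_smul n del: of_real_divide) 
    qed (use h in \<open>simp_all add: A.adj_smul\<close>)
    then have "1 / c * nrm B (\<pi> h) \<le> 1"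
      using h c by (simp add: hom_smul B.nrm_smul n del: of_real_divide)
    then show "nrm B (\<pi> h) \<le> nrm A h + e"
      using c by (simp add: c_def divide_le_eq)
  qed
  have "(nrm B (\<pi> x))\<^sup>2 = nrm B (\<pi> (adj A x \<otimes>\<^bsub>A\<^esub> x))"
    using x B.nrm_adj_mult[of "\<pi> x"] by (simp add: hom_mult hom_adj)
  also have "\<dots> \<le> nrm A (adj A x \<otimes>\<^bsub>A\<^esub> x)"
    using x by (intro selfadj) (simp_all add: A.adj_mult)
  also have "\<dots> = (nrm A x)\<^sup>2" by (rule A.nrm_adj_mult[OF x])
  finally show ?thesis
    using x by (metis A.nrm_nonneg power2_le_imp_le)
qed


section \<open>Evaluation of the free *-algebra\<close>

definition letter_value :: "'b cstar \<Rightarrow> ('g \<Rightarrow> 'b) \<Rightarrow> 'g \<times> bool \<Rightarrow> 'b" where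
  "letter_value B t p = (if snd p then adj B (t (fst p)) else t (fst p))"

definition word_value :: "'b cstar \<Rightarrow> ('g \<Rightarrow> 'b) \<Rightarrow> ('g \<times> bool) list \<Rightarrow> 'b" where
  "word_value B t w = mult_list B (map (letter_value B t) w)"

definition free_eval :: "'b cstar \<Rightarrow> ('g \<Rightarrow> 'b) \<Rightarrow> 'g free \<Rightarrow> 'b" where
  "free_eval B t x = finsum B (\<lambda>w. smul B (Poly_Mapping.lookup x w) (word_value B t w)) (Poly_Mapping.keys x)"

locale free_evaluation = pre_cstar_algebra B for B :: "'b cstar" (structure) +
  fixes G :: "'g set" and t :: "'g \<Rightarrow> 'b"
  assumes t_closed: "g \<in> G \<Longrightarrow> t g \<in> carrier B"
begin

abbreviation "Fr \<equiv> free_star_algebra G"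
abbreviation "ev \<equiv> free_eval B t"

lemma letter_closed: "fst ` set w \<subseteq> G \<Longrightarrow> set (map (letter_value B t) w) \<subseteq> carrier B"
  by (auto simp: letter_value_def intro!: adj_closed t_closed)

lemma word_closed [simp]: "fst ` set w \<subseteq> G \<Longrightarrow> word_value B t w \<in> carrier B"
  unfolding word_value_def by (rule mult_list_closed, rule letter_closed)

lemma word_append:
  assumes "u \<noteq> []" "v \<noteq> []" "fst ` set u \<subseteq> G" "fst ` set v \<subseteq> G"
  shows "word_value B t (u @ v) = word_value B t u \<otimes> word_value B t v"
  unfolding word_value_def map_append
  by (rule mult_list_append) (use assms letter_closed in auto)

lemma word_value_adj:
  assumes "fst ` set w \<subseteq> G"
  shows "word_value B t (word_adj w) = adj B (word_value B t w)"
proof -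
  have "map (letter_value B t) (map (\<lambda>(g, b). (g, \<not> b)) w) = map (adj B) (map (letter_value B t) w)"
    using assms by (auto simp: letter_value_def image_subset_iff t_closed)
  then show ?thesis
    using adj_mult_list[OF letter_closed[OF assms]]
    by (simp add: word_value_def word_adj_def rev_map[symmetric] del: map_map)
qed

lemma free_keys: "\<lbrakk>x \<in> Fr; w \<in> Poly_Mapping.keys x\<rbrakk> \<Longrightarrow> w \<noteq> [] \<and> fst ` set w \<subseteq> G"
  by (auto simp: free_star_algebra_def)

lemma eval_superset:
  assumes "x \<in> Fr" "finite S" "Poly_Mapping.keys x \<subseteq> S" "\<And>w. w \<in> S \<Longrightarrow> fst ` set w \<subseteq> G"
  shows "ev x = finsum B (\<lambda>w. smul B (Poly_Mapping.lookup x w) (word_value B t w)) S"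
  unfolding free_eval_def
  by (rule add.finprod_mono_neutral_cong_left) (use assms in \<open>auto simp: in_keys_iff intro!: smul_closed word_closed\<close>)

lemma eval_closed [simp]: "x \<in> Fr \<Longrightarrow> ev x \<in> carrier B"
  unfolding free_eval_def by (rule finsum_closed) (use free_keys in \<open>auto intro!: smul_closed word_closed\<close>)

lemma eval_zero [simp]: "ev 0 = \<zero>"
  by (simp add: free_eval_def finsum_empty)

lemma eval_single:
  assumes "fst ` set w \<subseteq> G"
  shows "ev (Poly_Mapping.single w c) = smul B c (word_value B t w)"
  using assms by (cases "c = 0") (simp_all add: free_eval_def finsum_empty finsum_insert)

lemma eval_add:
  assumes x: "x \<in> Fr" and y: "y \<in> Fr"
  shows "ev (x + y) = ev x \<oplus> ev y"
proof -
  let ?S = "Poly_Mapping.keys x \<union> Poly_Mapping.keys y"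
  have S: "finite ?S" "\<And>w. w \<in> ?S \<Longrightarrow> fst ` set w \<subseteq> G"
    using free_keys[OF x] free_keys[OF y] by auto
  have "ev (x + y) = finsum B (\<lambda>w. smul B (Poly_Mapping.lookup (x + y) w) (word_value B t w)) ?S"
    using x y S keys_add[of x y] by (intro eval_superset) auto
  also have "\<dots> = finsum B (\<lambda>w. smul B (Poly_Mapping.lookup x w) (word_value B t w) \<oplus>
                     smul B (Poly_Mapping.lookup y w) (word_value B t w)) ?S"
    by (rule finsum_cong') (use S in \<open>auto simp: lookup_add smul_add_left word_closed\<close>)
  also have "\<dots> = finsum B (\<lambda>w. smul B (Poly_Mapping.lookup x w) (word_value B t w)) ?S \<oplus>
                 finsum B (\<lambda>w. smul B (Poly_Mapping.lookup y w) (word_value B t w)) ?S"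
    by (rule finsum_addf) (use S in \<open>auto intro!: smul_closed word_closed\<close>)
  also have "\<dots> = ev x \<oplus> ev y"
    using x y S by (subst (1 2) eval_superset[of _ ?S]) auto
  finally show ?thesis .
qed

lemma eval_smul: "x \<in> Fr \<Longrightarrow> ev (free_smul c x) = smul B c (ev x)"
  by (induction x rule: free_induct)
    (simp_all add: eval_single smul_smul free_smul_add eval_add smul_add_right)

lemma eval_adj: "x \<in> Fr \<Longrightarrow> ev (free_adj x) = adj B (ev x)"
  by (induction x rule: free_induct)
    (simp_all add: eval_single word_value_adj adj_smul free_adj_add eval_add adj_add)

lemma eval_mult:
  assumes x: "x \<in> Fr" and y: "y \<in> Fr"
  shows "ev (x * y) = ev x \<otimes> ev y"
  using x
proof (induction x rule: free_induct)
  case (single u c)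
  show ?case
    using y
  proof (induction y rule: free_induct)
    case (single v d)
    have uv: "fst ` set (u @ v) \<subseteq> G"
      using single \<open>fst ` set u \<subseteq> G\<close> by auto
    show ?case
      using single \<open>u \<noteq> []\<close> \<open>fst ` set u \<subseteq> G\<close>
      by (simp add: mult_single plus_list_def eval_single[OF uv] eval_single word_append
          smul_mult_left smul_mult_right smul_smul mult.commute)
  next
    case (add x y)
    then show ?case
      using \<open>u \<noteq> []\<close> \<open>fst ` set u \<subseteq> G\<close> by (simp add: distrib_left eval_add r_distr)
  qed (use \<open>u \<noteq> []\<close> \<open>fst ` set u \<subseteq> G\<close> in simp)
qed (use y in \<open>simp_all add: distrib_right eval_add l_distr\<close>)

lemma eval_letter: "g \<in> G \<Longrightarrow> ev (letter_word g) = t g"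
  by (simp add: eval_single word_value_def letter_value_def t_closed)

lemma eval_diff: "\<lbrakk>x \<in> Fr; y \<in> Fr\<rbrakk> \<Longrightarrow> ev (x - y) = ev x \<ominus> ev y"
  using eval_add[of x "free_smul (-1) y"]
  by (simp add: eval_smul smul_minus_one a_minus_def) (simp add: free_smul_minus_one)

lemma eval_seminorm: "cstar_seminorm G (\<lambda>x. nrm B (ev x))"
  by unfold_locales
    (simp_all add: eval_add eval_smul eval_mult eval_adj nrm_add nrm_smul nrm_mult nrm_adj_mult)

end

lemma free_letter [simp]: "g \<in> G \<Longrightarrow> letter_word g \<in> free_star_algebra G"
  by simp

context cstar_seminorm
begin

abbreviation "emb x \<equiv> cls (\<lambda>_. x)"

lemma gen_closed: "g \<in> G \<Longrightarrow> gen G q g \<in> carrier C"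
  by (simp add: gen_def)

lemma extend_hom:
  fixes B :: "'b cstar"
  assumes B: "cstar_algebra B"
    and t: "\<And>g. g \<in> G \<Longrightarrow> t g \<in> carrier B"
    and le: "\<And>x. x \<in> Fr \<Longrightarrow> nrm B (free_eval B t x) \<le> q x"
  shows "\<exists>J. star_hom C B J \<and> (\<forall>x\<in>Fr. J (emb x) = free_eval B t x) \<and> (\<forall>g\<in>G. J (gen G q g) = t g) \<and>
    (\<forall>X. cau X \<longrightarrow> (\<lambda>n. nrm B (free_eval B t (X n))) \<longlonglongrightarrow> nrm B (J (cls X)))"
proof -
  interpret B: cstar_algebra B by (rule B)
  interpret B: free_evaluation B G t by unfold_locales (rule t)
  have ex: "\<exists>b\<in>carrier B. (\<lambda>n. nrm B (B.ev (X n) \<ominus>\<^bsub>B\<^esub> b)) \<longlonglongrightarrow> 0" if X: "cau X" for X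
  proof (rule B.complete)
    fix e :: real assume "e > 0"
    then obtain N where N: "\<forall>m\<ge>N. \<forall>n\<ge>N. q (X m - X n) < e"
      using X unfolding cauchy_seq_def by blast
    have "nrm B (B.ev (X m) \<ominus>\<^bsub>B\<^esub> B.ev (X n)) \<le> q (X m - X n)" for m n
      using le[of "X m - X n"] X by (simp add: B.eval_diff cauchy_seqD)
    then show "\<exists>N. \<forall>m\<ge>N. \<forall>n\<ge>N. nrm B (B.ev (X m) \<ominus>\<^bsub>B\<^esub> B.ev (X n)) < e"
      using N by (meson le_less_trans)
  qed (use X in \<open>simp add: cauchy_seqD\<close>)
  define J where "J a = (SOME b. b \<in> carrier B \<and>
      (\<lambda>n. nrm B (B.ev (seq_rep a n) \<ominus>\<^bsub>B\<^esub> b)) \<longlonglongrightarrow> 0)" for a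
  have Jrep: "J (cls X) \<in> carrier B" "(\<lambda>n. nrm B (B.ev (seq_rep (cls X) n) \<ominus>\<^bsub>B\<^esub> J (cls X))) \<longlonglongrightarrow> 0"
    if X: "cau X" for X
  proof -
    have "\<exists>b. b \<in> carrier B \<and> (\<lambda>n. nrm B (B.ev (seq_rep (cls X) n) \<ominus>\<^bsub>B\<^esub> b)) \<longlonglongrightarrow> 0"
      using ex[OF rep_cls(1)[OF X]] by blast
    from someI_ex[OF this] show "J (cls X) \<in> carrier B"
      "(\<lambda>n. nrm B (B.ev (seq_rep (cls X) n) \<ominus>\<^bsub>B\<^esub> J (cls X))) \<longlonglongrightarrow> 0"
      unfolding J_def by blast+
  qed
  have Jlim: "(\<lambda>n. nrm B (B.ev (X n) \<ominus>\<^bsub>B\<^esub> J (cls X))) \<longlonglongrightarrow> 0" if X: "cau X" for X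
  proof (rule tendsto_zero_dominated[where K = 1])
    let ?U = "seq_rep (cls X)"
    note U = rep_cls[OF X]
    show "(\<lambda>n. q (X n - ?U n) + nrm B (B.ev (?U n) \<ominus>\<^bsub>B\<^esub> J (cls X))) \<longlonglongrightarrow> 0"
      using tendsto_add[OF U(2) Jrep(2)[OF X]] by simp
    fix n
    have "nrm B (B.ev (X n) \<ominus>\<^bsub>B\<^esub> B.ev (?U n)) \<le> q (X n - ?U n)"
      using le[of "X n - ?U n"] X U(1) by (simp add: B.eval_diff cauchy_seqD)
    then show "nrm B (B.ev (X n) \<ominus>\<^bsub>B\<^esub> J (cls X)) \<le>
        1 * (q (X n - ?U n) + nrm B (B.ev (?U n) \<ominus>\<^bsub>B\<^esub> J (cls X)))"
      using B.nrm_diff_triangle[of "B.ev (X n)" "B.ev (?U n)" "J (cls X)"] X U(1) Jrep(1)[OF X]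
      by (simp add: cauchy_seqD)
    show "0 \<le> nrm B (B.ev (X n) \<ominus>\<^bsub>B\<^esub> J (cls X))"
      using X Jrep(1)[OF X] by (simp add: cauchy_seqD)
  qed
  have Junique: "J (cls X) = b"
    if "cau X" "b \<in> carrier B" "(\<lambda>n. nrm B (B.ev (X n) \<ominus>\<^bsub>B\<^esub> b)) \<longlonglongrightarrow> 0" for X b
    using that Jlim[OF that(1)] Jrep(1)[OF that(1)]
    by (intro B.limit_unique[of "\<lambda>n. B.ev (X n)"]) (auto simp: cauchy_seqD)
  have Jnrm: "(\<lambda>n. nrm B (B.ev (X n))) \<longlonglongrightarrow> nrm B (J (cls X))" if X: "cau X" for X
  proof -
    have "(\<lambda>n. \<bar>nrm B (B.ev (X n)) - nrm B (J (cls X))\<bar>) \<longlonglongrightarrow> 0"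
      by (rule tendsto_zero_dominated[OF Jlim[OF X], where K = 1])
        (use X Jrep(1)[OF X] B.nrm_abs_diff_le in \<open>simp_all add: cauchy_seqD\<close>)
    then show ?thesis
      by (simp add: tendsto_rabs_zero_iff LIM_zero_iff)
  qed
  have Jemb: "J (emb x) = B.ev x" if "x \<in> Fr" for x
    using that by (intro Junique) auto
  have hom: "star_hom C B J"
    unfolding star_hom_def
  proof (intro conjI ballI allI)
    show "J \<in> carrier C \<rightarrow> carrier B"
      using Jrep(1) by (auto elim: carrier_cases)
    fix a assume "a \<in> carrier C"
    then obtain X where X: "cau X" "a = cls X" by (rule carrier_cases)
    note JX = Jrep(1)[OF X(1)]
    have mX: "X n \<in> Fr" for n using X by (simp add: cauchy_seqD)
    show "J (smul C c a) = smul B c (J a)" for c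
    proof -
      have "J (cls (\<lambda>n. free_smul c (X n))) = smul B c (J (cls X))"
      proof (rule Junique[OF cauchy_smul[OF X(1)]])
        show "(\<lambda>n. nrm B (B.ev (free_smul c (X n)) \<ominus>\<^bsub>B\<^esub> smul B c (J (cls X)))) \<longlonglongrightarrow> 0"
          using tendsto_mult_right_zero[OF Jlim[OF X(1)], of "cmod c"] mX JX
          by (simp add: B.eval_smul B.smul_diff[symmetric] B.nrm_smul)
      qed (use JX in simp)
      then show ?thesis using X by (simp add: smul_C)
    qed
    show "J (adj C a) = adj B (J a)"
    proof -
      have "J (cls (\<lambda>n. free_adj (X n))) = adj B (J (cls X))"
      proof (rule Junique[OF cauchy_adj[OF X(1)]])
        show "(\<lambda>n. nrm B (B.ev (free_adj (X n)) \<ominus>\<^bsub>B\<^esub> adj B (J (cls X)))) \<longlonglongrightarrow> 0"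
          using Jlim[OF X(1)] mX JX by (simp add: B.eval_adj B.adj_diff[symmetric])
      qed (use JX in simp)
      then show ?thesis using X by (simp add: adj_C)
    qed
    fix b assume "b \<in> carrier C"
    then obtain Y where Y: "cau Y" "b = cls Y" by (rule carrier_cases)
    note JY = Jrep(1)[OF Y(1)]
    have mY: "Y n \<in> Fr" for n using Y by (simp add: cauchy_seqD)
    show "J (a \<oplus>\<^bsub>C\<^esub> b) = J a \<oplus>\<^bsub>B\<^esub> J b"
    proof -
      have "J (cls (\<lambda>n. X n + Y n)) = J (cls X) \<oplus>\<^bsub>B\<^esub> J (cls Y)"
      proof (rule Junique[OF cauchy_add[OF X(1) Y(1)]])
        show "(\<lambda>n. nrm B (B.ev (X n + Y n) \<ominus>\<^bsub>B\<^esub> (J (cls X) \<oplus>\<^bsub>B\<^esub> J (cls Y)))) \<longlonglongrightarrow> 0"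
        proof (rule tendsto_zero_dominated[where K = 1])
          show "(\<lambda>n. nrm B (B.ev (X n) \<ominus>\<^bsub>B\<^esub> J (cls X)) + nrm B (B.ev (Y n) \<ominus>\<^bsub>B\<^esub> J (cls Y))) \<longlonglongrightarrow> 0"
            using tendsto_add[OF Jlim[OF X(1)] Jlim[OF Y(1)]] by simp
        qed (use mX mY JX JY in \<open>simp_all add: B.eval_add B.add_diff_add B.nrm_add\<close>)
      qed (use JX JY in simp)
      then show ?thesis using X Y by (simp add: add_C)
    qed
    show "J (a \<otimes>\<^bsub>C\<^esub> b) = J a \<otimes>\<^bsub>B\<^esub> J b"
    proof -
      have "J (cls (\<lambda>n. X n * Y n)) = J (cls X) \<otimes>\<^bsub>B\<^esub> J (cls Y)"
      proof (rule Junique[OF cauchy_mult[OF X(1) Y(1)]])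
        show "(\<lambda>n. nrm B (B.ev (X n * Y n) \<ominus>\<^bsub>B\<^esub> (J (cls X) \<otimes>\<^bsub>B\<^esub> J (cls Y)))) \<longlonglongrightarrow> 0"
        proof (rule tendsto_zero_dominated[where K = 1])
          show "(\<lambda>n. nrm B (B.ev (X n)) * nrm B (B.ev (Y n) \<ominus>\<^bsub>B\<^esub> J (cls Y)) +
                   nrm B (B.ev (X n) \<ominus>\<^bsub>B\<^esub> J (cls X)) * nrm B (J (cls Y))) \<longlonglongrightarrow> 0"
            using tendsto_add[OF tendsto_mult[OF Jnrm[OF X(1)] Jlim[OF Y(1)]]
                tendsto_mult[OF Jlim[OF X(1)] tendsto_const]] by simp
          fix n
          have "B.ev (X n * Y n) \<ominus>\<^bsub>B\<^esub> (J (cls X) \<otimes>\<^bsub>B\<^esub> J (cls Y)) =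
              B.ev (X n) \<otimes>\<^bsub>B\<^esub> (B.ev (Y n) \<ominus>\<^bsub>B\<^esub> J (cls Y)) \<oplus>\<^bsub>B\<^esub>
              (B.ev (X n) \<ominus>\<^bsub>B\<^esub> J (cls X)) \<otimes>\<^bsub>B\<^esub> J (cls Y)"
            using mX mY JX JY
            by (simp add: B.eval_mult B.mult_diff_left B.mult_diff_right
                B.diff_split[of "B.ev (X n) \<otimes>\<^bsub>B\<^esub> B.ev (Y n)" "B.ev (X n) \<otimes>\<^bsub>B\<^esub> J (cls Y)" "J (cls X) \<otimes>\<^bsub>B\<^esub> J (cls Y)"])
          also have "nrm B \<dots> \<le> nrm B (B.ev (X n) \<otimes>\<^bsub>B\<^esub> (B.ev (Y n) \<ominus>\<^bsub>B\<^esub> J (cls Y))) +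
              nrm B ((B.ev (X n) \<ominus>\<^bsub>B\<^esub> J (cls X)) \<otimes>\<^bsub>B\<^esub> J (cls Y))"
            using mX mY JX JY by (intro B.nrm_add) auto
          also have "\<dots> \<le> nrm B (B.ev (X n)) * nrm B (B.ev (Y n) \<ominus>\<^bsub>B\<^esub> J (cls Y)) +
              nrm B (B.ev (X n) \<ominus>\<^bsub>B\<^esub> J (cls X)) * nrm B (J (cls Y))"
            using mX mY JX JY by (intro add_mono B.nrm_mult) auto
          finally show "nrm B (B.ev (X n * Y n) \<ominus>\<^bsub>B\<^esub> (J (cls X) \<otimes>\<^bsub>B\<^esub> J (cls Y))) \<le> 1 *
              (nrm B (B.ev (X n)) * nrm B (B.ev (Y n) \<ominus>\<^bsub>B\<^esub> J (cls Y)) +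
              nrm B (B.ev (X n) \<ominus>\<^bsub>B\<^esub> J (cls X)) * nrm B (J (cls Y)))"
            by simp
        qed (use mX mY JX JY in simp)
      qed (use JX JY in simp)
      then show ?thesis using X Y by (simp add: mult_C)
    qed
  qed
  show ?thesis
  proof (intro exI[of _ J] conjI ballI allI impI hom Jemb Jnrm)
    show "J (gen G q g) = t g" if "g \<in> G" for g
      using Jemb[of "letter_word g"] that by (simp add: gen_def B.eval_letter)
  qed
qed

lemma emb_hom:
  assumes "x \<in> Fr" "y \<in> Fr"
  shows "emb (x + y) = emb x \<oplus>\<^bsub>C\<^esub> emb y" "emb (x * y) = emb x \<otimes>\<^bsub>C\<^esub> emb y"
    "emb (free_smul c x) = smul C c (emb x)" "emb (free_adj x) = adj C (emb x)"
  using assms by (simp_all add: add_C mult_C smul_C adj_C)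

lemma emb_eq_eval:
  assumes "x \<in> Fr"
  shows "emb x = free_eval C (gen G q) x"
proof -
  interpret pre_cstar_algebra C by (rule pre_cstar_C)
  interpret E: free_evaluation C G "gen G q" by unfold_locales (rule gen_closed)
  have word: "emb (Poly_Mapping.single w 1) = word_value C (gen G q) w"
    if "w \<noteq> []" "fst ` set w \<subseteq> G" for w
    using that
  proof (induction w rule: list_nonempty_induct)
    case (single p)
    obtain g b where p: "p = (g, b)" by force
    have "emb (Poly_Mapping.single [(g, True)] 1) = adj C (gen G q g)"
      using single p emb_hom(4)[of "letter_word g" "letter_word g"] by (simp add: gen_def word_adj_def)
    then show ?case using p by (simp add: word_value_def letter_value_def gen_def)
  next
    case (cons p w)
    have "Poly_Mapping.single (p # w) (1::complex) = Poly_Mapping.single [p] 1 * Poly_Mapping.single w 1"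
      by (simp add: mult_single plus_list_def)
    moreover have "emb (Poly_Mapping.single [p] 1) = word_value C (gen G q) [p]"
    proof -
      obtain g b where p: "p = (g, b)" by force
      have "emb (Poly_Mapping.single [(g, True)] 1) = adj C (gen G q g)"
        using cons p emb_hom(4)[of "letter_word g" "letter_word g"] by (simp add: gen_def word_adj_def)
      then show ?thesis using p by (simp add: word_value_def letter_value_def gen_def)
    qed
    moreover have "word_value C (gen G q) (p # w) = word_value C (gen G q) [p] \<otimes>\<^bsub>C\<^esub> word_value C (gen G q) w"
      using E.word_append[of "[p]" w] cons by simp
    ultimately show ?case
      using cons by (simp add: emb_hom)
  qed
  show ?thesis
    using assms
  proof (induction x rule: free_induct)
    case (single w c)
    have "Poly_Mapping.single w c = free_smul c (Poly_Mapping.single w 1)" by simp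
    then show ?case
      using single word[of w] emb_hom(3)[of "Poly_Mapping.single w 1" "Poly_Mapping.single w 1" c]
      by (simp add: E.eval_single)
  qed (simp_all add: zero_C emb_hom E.eval_add)
qed

lemma dense:
  assumes "a \<in> carrier C" "e > 0"
  obtains x where "x \<in> Fr" "nrm C (emb x \<ominus>\<^bsub>C\<^esub> a) < e"
proof -
  interpret pre_cstar_algebra C by (rule pre_cstar_C)
  obtain X where X: "cau X" "a = cls X" using assms(1) by (rule carrier_cases)
  obtain n where "norm (nrm C (emb (X n) \<ominus>\<^bsub>C\<^esub> a) - 0) < e"
    using LIMSEQ_D[OF cls_limit[OF X(1)] assms(2)] X by blast
  then show ?thesis using X by (intro that[of "X n"]) (auto simp: cauchy_seqD)
qed

lemma hom_eval:
  assumes B: "pre_cstar_algebra B" and \<pi>: "star_hom C B \<pi>" and x: "x \<in> Fr"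
  shows "\<pi> (emb x) = free_eval B (\<lambda>g. \<pi> (gen G q g)) x"
proof -
  interpret C: pre_cstar_algebra C by (rule pre_cstar_C)
  interpret B: pre_cstar_algebra B by (rule B)
  interpret star_homomorphism C B \<pi>
    by (intro star_homomorphism.intro star_homomorphism_axioms.intro pre_cstar_C B \<pi>)
  interpret C: free_evaluation C G "gen G q" by unfold_locales (rule gen_closed)
  interpret B: free_evaluation B G "\<lambda>g. \<pi> (gen G q g)"
    by unfold_locales (simp add: gen_closed)
  have letter: "\<pi> (letter_value C (gen G q) p) = letter_value B (\<lambda>g. \<pi> (gen G q g)) p" if "fst p \<in> G" for p
    using that by (simp add: letter_value_def hom_adj gen_closed)
  have word: "\<pi> (word_value C (gen G q) w) = word_value B (\<lambda>g. \<pi> (gen G q g)) w" if "fst ` set w \<subseteq> G" for w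
  proof -
    have "map \<pi> (map (letter_value C (gen G q)) w) = map (letter_value B (\<lambda>g. \<pi> (gen G q g))) w"
      using that by (auto simp: image_subset_iff letter)
    then show ?thesis
      unfolding word_value_def using hom_mult_list[OF C.letter_closed[OF that]] by (simp del: map_map)
  qed
  have "\<pi> (C.ev x) = B.ev x"
    using x by (induction x rule: free_induct)
      (simp_all add: C.eval_single B.eval_single hom_smul word C.eval_add B.eval_add hom_add)
  then show ?thesis using x by (simp add: emb_eq_eval)
qed

lemma hom_unique:
  assumes B: "pre_cstar_algebra B" and \<pi>: "star_hom C B \<pi>" and \<rho>: "star_hom C B \<rho>"
    and eq: "\<And>g. g \<in> G \<Longrightarrow> \<pi> (gen G q g) = \<rho> (gen G q g)" and a: "a \<in> carrier C"
  shows "\<pi> a = \<rho> a"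
proof -
  interpret C: pre_cstar_algebra C by (rule pre_cstar_C)
  interpret B: pre_cstar_algebra B by (rule B)
  interpret \<pi>: star_homomorphism C B \<pi>
    by (intro star_homomorphism.intro star_homomorphism_axioms.intro pre_cstar_C B \<pi>)
  interpret \<rho>: star_homomorphism C B \<rho>
    by (intro star_homomorphism.intro star_homomorphism_axioms.intro pre_cstar_C B \<rho>)
  interpret e1: free_evaluation B G "\<lambda>g. \<pi> (gen G q g)" by unfold_locales (simp add: gen_closed)
  interpret e2: free_evaluation B G "\<lambda>g. \<rho> (gen G q g)" by unfold_locales (simp add: gen_closed)
  have emb: "\<pi> (emb x) = \<rho> (emb x)" if x: "x \<in> Fr" for x
  proof -
    have word: "word_value B (\<lambda>g. \<pi> (gen G q g)) w = word_value B (\<lambda>g. \<rho> (gen G q g)) w"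
      if "fst ` set w \<subseteq> G" for w
      unfolding word_value_def
      by (rule arg_cong[where f = "mult_list B"]) (use that in \<open>auto simp: letter_value_def eq image_subset_iff\<close>)
    have "e1.ev x = e2.ev x"
      using x by (induction x rule: free_induct)
        (simp_all add: e1.eval_single e2.eval_single word e1.eval_add e2.eval_add)
    then show ?thesis using x B \<pi> \<rho> by (simp add: hom_eval)
  qed
  obtain X where X: "cau X" "a = cls X" using a by (rule carrier_cases)
  have lim: "(\<lambda>n. nrm B (\<sigma> (emb (X n)) \<ominus>\<^bsub>B\<^esub> \<sigma> a)) \<longlonglongrightarrow> 0" if "star_hom C B \<sigma>" for \<sigma>
  proof -
    interpret \<sigma>: star_homomorphism C B \<sigma>
      by (intro star_homomorphism.intro star_homomorphism_axioms.intro pre_cstar_C B that)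
    show ?thesis
    proof (rule tendsto_zero_dominated[OF cls_limit[OF X(1)], where K = 1])
      show "nrm B (\<sigma> (emb (X n)) \<ominus>\<^bsub>B\<^esub> \<sigma> a) \<le> 1 * nrm C (emb (X n) \<ominus>\<^bsub>C\<^esub> cls X)" for n
        using star_hom_contractive[OF cstar_algebra_completion B that, of "emb (X n) \<ominus>\<^bsub>C\<^esub> cls X"] X
        by (simp add: \<sigma>.hom_diff cauchy_seqD)
    qed (use X a in \<open>simp_all add: cauchy_seqD\<close>)
  qed
  show ?thesis
    using lim[OF \<pi>] lim[OF \<rho>] X a emb
    by (intro B.limit_unique[of "\<lambda>n. \<pi> (emb (X n))"]) (simp_all add: cauchy_seqD)
qed

end


section \<open>The universal property\<close>

context k_graph
begin

lemma rng_set: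
  assumes "E \<in> FE \<Lambda>"
  shows "rng_set \<Lambda> E \<in> vertices \<Lambda>" "E \<subseteq> paths_to \<Lambda> (rng_set \<Lambda> E)" "finite E" "E \<noteq> {}"
proof -
  obtain v where v: "v \<in> vertices \<Lambda>" "E \<subseteq> paths_to \<Lambda> v" "finite E" "exhaustive \<Lambda> v E"
    using assms by (auto simp: FE_def)
  have "v \<in> paths_to \<Lambda> v"
    using v(1) by (auto simp: vertices_eq_identities paths_to_def rng_closed rng_rng)
  then have "Ext \<Lambda> v E \<noteq> {}" using v(4) by (auto simp: exhaustive_def)
  then show ne: "E \<noteq> {}" by (auto simp: Ext_def)
  have "rng_set \<Lambda> E = v"
    unfolding rng_set_def using v ne by (intro the_equality) (auto simp: paths_to_def)
  then show "rng_set \<Lambda> E \<in> vertices \<Lambda>" "E \<subseteq> paths_to \<Lambda> (rng_set \<Lambda> E)" "finite E"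
    using v by simp_all
qed

lemma FE_paths: "E \<in> FE \<Lambda> \<Longrightarrow> E \<subseteq> paths \<Lambda>" "E \<in> FE \<Lambda> \<Longrightarrow> rng_set \<Lambda> E \<in> paths \<Lambda>"
  using rng_set by (auto simp: paths_to_def vertices_def)

lemma enumeration:
  assumes "E \<in> FE \<Lambda>"
  shows "set (SOME xs. distinct xs \<and> set xs = E) = E"
proof -
  have "\<exists>xs. distinct xs \<and> set xs = E"
    using finite_distinct_list[OF rng_set(3)[OF assms]] by blast
  from someI_ex[OF this] show ?thesis by simp
qed

lemma gap_closed:
  assumes "pre_cstar_algebra A" and g: "\<And>\<kappa>. \<kappa> \<in> paths \<Lambda> \<Longrightarrow> g \<kappa> \<in> carrier A" and E: "E \<in> FE \<Lambda>"
  shows "gap_projection \<Lambda> A g E \<in> carrier A"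
proof -
  interpret pre_cstar_algebra A by fact
  show ?thesis
    unfolding gap_projection_def mult_set_def
    by (rule mult_list_closed) (use FE_paths[OF E] enumeration[OF E] in \<open>auto intro!: minus_closed m_closed adj_closed g\<close>)
qed

lemma gap_hom:
  assumes A: "pre_cstar_algebra A" and B: "pre_cstar_algebra B" and J: "star_hom A B J"
    and g: "\<And>\<kappa>. \<kappa> \<in> paths \<Lambda> \<Longrightarrow> g \<kappa> \<in> carrier A" and E: "E \<in> FE \<Lambda>"
    and h: "\<And>\<kappa>. \<kappa> \<in> paths \<Lambda> \<Longrightarrow> J (g \<kappa>) = h \<kappa>"
  shows "J (gap_projection \<Lambda> A g E) = gap_projection \<Lambda> B h E"
proof -
  interpret star_homomorphism A B J
    by (intro star_homomorphism.intro star_homomorphism_axioms.intro A B J)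
  let ?xs = "SOME xs. distinct xs \<and> set xs = E"
  let ?f = "\<lambda>\<kappa>. g (rng_set \<Lambda> E) \<ominus>\<^bsub>A\<^esub> g \<kappa> \<otimes>\<^bsub>A\<^esub> adj A (g \<kappa>)"
  let ?f' = "\<lambda>\<kappa>. h (rng_set \<Lambda> E) \<ominus>\<^bsub>B\<^esub> h \<kappa> \<otimes>\<^bsub>B\<^esub> adj B (h \<kappa>)"
  have f: "?f \<kappa> \<in> carrier A \<and> J (?f \<kappa>) = ?f' \<kappa>" if "\<kappa> \<in> E" for \<kappa>
  proof -
    have "g \<kappa> \<in> carrier A" "g (rng_set \<Lambda> E) \<in> carrier A" "J (g \<kappa>) = h \<kappa>" "J (g (rng_set \<Lambda> E)) = h (rng_set \<Lambda> E)"
      using that FE_paths[OF E] g h by auto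
    then show ?thesis by (simp add: hom_diff hom_mult hom_adj)
  qed
  have "set (map ?f ?xs) \<subseteq> carrier A" using f enumeration[OF E] by auto
  moreover have "map J (map ?f ?xs) = map ?f' ?xs" using f enumeration[OF E] by simp
  ultimately show ?thesis
    unfolding gap_projection_def mult_set_def using hom_mult_list[of "map ?f ?xs"] by argo
qed

lemma CK_family_pullback:
  assumes A: "pre_cstar_algebra A" and \<E>: "\<E> \<subseteq> FE \<Lambda>"
    and g: "\<And>\<kappa>. \<kappa> \<in> paths \<Lambda> \<Longrightarrow> g \<kappa> \<in> carrier A"
    and B: "\<And>i. i \<in> I \<Longrightarrow> pre_cstar_algebra (B i)"
    and J: "\<And>i. i \<in> I \<Longrightarrow> star_hom A (B i) (J i)"
    and h: "\<And>i \<kappa>. \<lbrakk>i \<in> I; \<kappa> \<in> paths \<Lambda>\<rbrakk> \<Longrightarrow> J i (g \<kappa>) = h i \<kappa>"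
    and CK: "\<And>i. i \<in> I \<Longrightarrow> relative_CK_family \<Lambda> \<E> (B i) (h i)"
    and inj: "\<And>a. \<lbrakk>a \<in> carrier A; \<And>i. i \<in> I \<Longrightarrow> J i a = \<zero>\<^bsub>B i\<^esub>\<rbrakk> \<Longrightarrow> a = \<zero>\<^bsub>A\<^esub>"
  shows "relative_CK_family \<Lambda> \<E> A g"
proof -
  interpret A: pre_cstar_algebra A by (rule A)
  have hom: "star_homomorphism A (B i) (J i)" if "i \<in> I" for i
    using that by (intro star_homomorphism.intro star_homomorphism_axioms.intro A B J)
  have eqI: "a = b" if "a \<in> carrier A" "b \<in> carrier A" "\<And>i. i \<in> I \<Longrightarrow> J i a = J i b" for a b
  proof -
    have "a \<ominus>\<^bsub>A\<^esub> b = \<zero>\<^bsub>A\<^esub>"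
    proof (rule inj)
      fix i assume i: "i \<in> I"
      interpret star_homomorphism A "B i" "J i" by (rule hom[OF i])
      show "J i (a \<ominus>\<^bsub>A\<^esub> b) = \<zero>\<^bsub>B i\<^esub>"
        using that i by (simp add: hom_diff B.diff_eq_zero_iff)
    qed (use that in simp)
    then show ?thesis using that by (simp add: A.diff_eq_zero_iff)
  qed
  have v: "w \<in> paths \<Lambda>" if "w \<in> vertices \<Lambda>" for w using that by (simp add: vertices_def)
  have mult: "J i (a \<otimes>\<^bsub>A\<^esub> b) = J i a \<otimes>\<^bsub>B i\<^esub> J i b" if "i \<in> I" "a \<in> carrier A" "b \<in> carrier A" for i a b
    using star_homomorphism.hom_mult[OF hom] that by blast
  have adj: "J i (adj A a) = adj (B i) (J i a)" if "i \<in> I" "a \<in> carrier A" for i a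
    using star_homomorphism.hom_adj[OF hom] that by blast
  have zero: "J i \<zero>\<^bsub>A\<^esub> = \<zero>\<^bsub>B i\<^esub>" if "i \<in> I" for i
    using star_homomorphism.hom_zero[OF hom] that by blast
  show ?thesis
    unfolding relative_CK_family_def
  proof (intro conjI ballI impI)
    fix \<kappa> assume k: "\<kappa> \<in> paths \<Lambda>"
    show "g \<kappa> \<in> carrier A" by (rule g[OF k])
    show "g \<kappa> \<otimes>\<^bsub>A\<^esub> adj A (g \<kappa>) \<otimes>\<^bsub>A\<^esub> g \<kappa> = g \<kappa>"
      using k g CK h by (intro eqI) (auto simp: mult adj relative_CK_family_def)
    fix \<mu> assume m: "\<mu> \<in> paths \<Lambda>"
    show "g \<kappa> \<otimes>\<^bsub>A\<^esub> g \<mu> = g (cmp \<Lambda> \<kappa> \<mu>)" if "src \<Lambda> \<kappa> = rng \<Lambda> \<mu>"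
      using k m that g CK h by (intro eqI) (auto simp: mult relative_CK_family_def cmp_closed)
    have pi: "(\<lambda>p. g (fst p) \<otimes>\<^bsub>A\<^esub> adj A (g (snd p))) \<in> min_ext \<Lambda> \<kappa> \<mu> \<rightarrow> carrier A"
      using g by (auto simp: min_ext_def)
    show "adj A (g \<kappa>) \<otimes>\<^bsub>A\<^esub> g \<mu> = (\<Oplus>\<^bsub>A\<^esub>p\<in>min_ext \<Lambda> \<kappa> \<mu>. g (fst p) \<otimes>\<^bsub>A\<^esub> adj A (g (snd p)))"
    proof (rule eqI)
      fix i assume i: "i \<in> I"
      interpret star_homomorphism A "B i" "J i" by (rule hom[OF i])
      have hc: "h i \<nu> \<in> carrier (B i)" if "\<nu> \<in> paths \<Lambda>" for \<nu>
        using that h[OF i, symmetric] g by simp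
      have "J i (\<Oplus>\<^bsub>A\<^esub>p\<in>min_ext \<Lambda> \<kappa> \<mu>. g (fst p) \<otimes>\<^bsub>A\<^esub> adj A (g (snd p))) =
          (\<Oplus>\<^bsub>B i\<^esub>p\<in>min_ext \<Lambda> \<kappa> \<mu>. J i (g (fst p) \<otimes>\<^bsub>A\<^esub> adj A (g (snd p))))"
        by (rule hom_finsum[OF pi])
      also have "\<dots> = (\<Oplus>\<^bsub>B i\<^esub>p\<in>min_ext \<Lambda> \<kappa> \<mu>. h i (fst p) \<otimes>\<^bsub>B i\<^esub> adj (B i) (h i (snd p)))"
        by (rule B.finsum_cong') (use g h i hc in \<open>auto simp: min_ext_def hom_mult hom_adj intro!: B.m_closed B.adj_closed\<close>)
      also have "\<dots> = adj (B i) (h i \<kappa>) \<otimes>\<^bsub>B i\<^esub> h i \<mu>"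
        using CK[OF i] k m by (simp add: relative_CK_family_def)
      finally show "J i (adj A (g \<kappa>) \<otimes>\<^bsub>A\<^esub> g \<mu>) =
          J i (\<Oplus>\<^bsub>A\<^esub>p\<in>min_ext \<Lambda> \<kappa> \<mu>. g (fst p) \<otimes>\<^bsub>A\<^esub> adj A (g (snd p)))"
        using k m i g h by (simp add: hom_mult hom_adj)
    qed (use k m g A.finsum_closed[OF pi] in simp_all)
  next
    fix w assume w: "w \<in> vertices \<Lambda>"
    show "adj A (g w) = g w"
      using w v g CK h by (intro eqI) (auto simp: adj relative_CK_family_def)
    show "g w \<otimes>\<^bsub>A\<^esub> g w = g w"
      using w v g CK h by (intro eqI) (auto simp: mult relative_CK_family_def)
    fix u assume u: "u \<in> vertices \<Lambda>" and "w \<noteq> u"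
    then show "g w \<otimes>\<^bsub>A\<^esub> g u = \<zero>\<^bsub>A\<^esub>"
      using w v g CK h by (intro eqI) (auto simp: mult zero relative_CK_family_def)
  next
    fix E assume E: "E \<in> \<E>"
    then have "J i (gap_projection \<Lambda> A g E) = gap_projection \<Lambda> (B i) (h i) E" if "i \<in> I" for i
      using \<E> that by (intro gap_hom A B J g h) auto
    then show "gap_projection \<Lambda> A g E = \<zero>\<^bsub>A\<^esub>"
      using E \<E> CK by (intro eqI gap_closed A g) (auto simp: zero relative_CK_family_def)
  qed
qed

lemma CK_seminorm_of_family:
  assumes \<E>: "\<E> \<subseteq> FE \<Lambda>" and B: "cstar_algebra B" and t: "relative_CK_family \<Lambda> \<E> B t"
  shows "(\<lambda>x. nrm B (free_eval B t x)) \<in> CK_seminorms \<Lambda> \<E>"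
proof -
  interpret B: cstar_algebra B by (rule B)
  have tc: "t \<kappa> \<in> carrier B" if "\<kappa> \<in> paths \<Lambda>" for \<kappa>
    using t that by (simp add: relative_CK_family_def)
  interpret B: free_evaluation B "paths \<Lambda>" t by unfold_locales (rule tc)
  interpret q: cstar_seminorm "paths \<Lambda>" "\<lambda>x. nrm B (B.ev x)" by (rule B.eval_seminorm)
  obtain J where J: "star_hom q.C B J" "\<And>x. x \<in> q.Fr \<Longrightarrow> J (q.emb x) = B.ev x"
    "\<And>\<kappa>. \<kappa> \<in> paths \<Lambda> \<Longrightarrow> J (gen (paths \<Lambda>) (\<lambda>x. nrm B (B.ev x)) \<kappa>) = t \<kappa>"
    "\<And>X. q.cau X \<Longrightarrow> (\<lambda>n. nrm B (B.ev (X n))) \<longlonglongrightarrow> nrm B (J (q.cls X))"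
    using q.extend_hom[OF B tc order_refl] by blast
  have "relative_CK_family \<Lambda> \<E> q.C (gen (paths \<Lambda>) (\<lambda>x. nrm B (B.ev x)))"
  proof (rule CK_family_pullback[where I = "{()}" and B = "\<lambda>_. B" and J = "\<lambda>_. J" and h = "\<lambda>_. t"])
    fix a assume a: "a \<in> carrier q.C" "\<And>i. i \<in> {()} \<Longrightarrow> J a = \<zero>\<^bsub>B\<^esub>"
    obtain X where X: "q.cau X" "a = q.cls X" using a(1) by (rule q.carrier_cases)
    have "nrm q.C a = nrm B (J a)"
      using LIMSEQ_unique[OF q.nrm_C[OF X(1)] J(4)[OF X(1)]] X(2) by simp
    then show "a = \<zero>\<^bsub>q.C\<^esub>"
      using a X by (simp add: q.nrm_C_eq_zero)
  qed (simp_all add: q.pre_cstar_C B.pre_cstar_algebra_axioms \<E> J(1,3) t q.gen_closed)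
  then show ?thesis
    unfolding CK_seminorms_def using B.eval_seminorm by simp
qed

lemma CK_seminorms_nonempty:
  assumes "\<E> \<subseteq> FE \<Lambda>"
  shows "(\<lambda>_. 0) \<in> CK_seminorms \<Lambda> \<E>"
proof -
  define z :: "'l free \<Rightarrow> real" where "z = (\<lambda>_. 0)"
  interpret q: cstar_seminorm "paths \<Lambda>" z by unfold_locales (auto simp: z_def)
  have "relative_CK_family \<Lambda> \<E> q.C (gen (paths \<Lambda>) z)"
  proof (rule CK_family_pullback[where I = "{} :: unit set" and B = "\<lambda>_. q.C" and J = undefined and h = undefined])
    fix a assume "a \<in> carrier q.C"
    then obtain X where X: "q.cau X" "a = q.cls X" by (rule q.carrier_cases)
    then show "a = \<zero>\<^bsub>q.C\<^esub>"
      by (simp add: q.zero_C q.cls_eq_iff) (simp add: z_def)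
  qed (simp_all add: q.pre_cstar_C assms q.gen_closed)
  then have "z \<in> CK_seminorms \<Lambda> \<E>"
    unfolding CK_seminorms_def using q.cstar_seminorm_axioms by simp
  then show ?thesis by (simp add: z_def)
qed

lemma CK_seminorms_bounded:
  assumes "x \<in> free_star_algebra (paths \<Lambda>)"
  shows "\<exists>M. \<forall>q\<in>CK_seminorms \<Lambda> \<E>. q x \<le> M"
  using assms
proof (induction x rule: free_induct)
  case zero
  have "q 0 = 0" if "q \<in> CK_seminorms \<Lambda> \<E>" for q
    using that cstar_seminorm.q_zero by (auto simp: CK_seminorms_def)
  then show ?case by (metis order_refl)
next
  case (single w c)
  have "q (Poly_Mapping.single w c) \<le> cmod c" if "q \<in> CK_seminorms \<Lambda> \<E>" for q
  proof -
    interpret q: cstar_seminorm "paths \<Lambda>" q using that by (simp add: CK_seminorms_def)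
    interpret C: pre_cstar_algebra q.C by (rule q.pre_cstar_C)
    have letter: "q (letter_word g) \<le> 1" if g: "g \<in> paths \<Lambda>" for g
    proof -
      let ?t = "gen (paths \<Lambda>) q g"
      have t: "?t \<in> carrier q.C" "?t \<otimes>\<^bsub>q.C\<^esub> adj q.C ?t \<otimes>\<^bsub>q.C\<^esub> ?t = ?t"
        using \<open>q \<in> CK_seminorms \<Lambda> \<E>\<close> g by (auto simp: CK_seminorms_def relative_CK_family_def)
      let ?p = "adj q.C ?t \<otimes>\<^bsub>q.C\<^esub> ?t"
      have p: "?p \<in> carrier q.C" "adj q.C ?p = ?p" using t by (simp_all add: C.adj_mult)
      have "?p \<otimes>\<^bsub>q.C\<^esub> ?p = adj q.C ?t \<otimes>\<^bsub>q.C\<^esub> (?t \<otimes>\<^bsub>q.C\<^esub> adj q.C ?t \<otimes>\<^bsub>q.C\<^esub> ?t)"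
        using t(1) by (simp add: C.m_assoc)
      then have idem: "adj q.C ?p \<otimes>\<^bsub>q.C\<^esub> ?p = ?p" using p t(2) by simp
      have "nrm q.C ?p = (nrm q.C ?p)\<^sup>2"
        using C.nrm_adj_mult[OF p(1)] unfolding idem .
      then have "nrm q.C ?p \<le> 1"
        using C.nrm_nonneg[OF p(1)] by (auto simp: power2_eq_square)
      then have "(nrm q.C ?t)\<^sup>2 \<le> 1"
        using C.nrm_adj_mult[OF t(1)] by simp
      then have "nrm q.C ?t \<le> 1"
        using C.nrm_nonneg[OF t(1)] by (simp add: power_le_one_iff abs_square_le_1)
      then show ?thesis
        using g by (simp add: gen_def q.nrm_C_const)
    qed
    have letter': "q (Poly_Mapping.single [p] 1) \<le> 1" if "fst p \<in> paths \<Lambda>" for p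
    proof (cases "snd p")
      case True
      then have "p = (fst p, True)" by (simp add: prod_eq_iff)
      then have eq: "Poly_Mapping.single [p] (1::complex) = free_adj (letter_word (fst p))"
        by (simp add: word_adj_def)
      show ?thesis unfolding eq using letter[OF that] that by (subst q.q_adj) simp_all
    next
      case False
      then have "p = (fst p, False)" by (simp add: prod_eq_iff)
      then show ?thesis using letter[OF that] by metis
    qed
    have "q (Poly_Mapping.single w 1) \<le> 1"
      using single
    proof (induction w rule: list_nonempty_induct)
      case (single p)
      then show ?case by (simp add: letter')
    next
      case (cons p w)
      have eq: "Poly_Mapping.single (p # w) (1::complex) = Poly_Mapping.single [p] 1 * Poly_Mapping.single w 1"
        by (simp add: mult_single plus_list_def)
      have "q (Poly_Mapping.single (p # w) 1) \<le> q (Poly_Mapping.single [p] 1) * q (Poly_Mapping.single w 1)"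
        unfolding eq using cons by (intro q.q_mult) auto
      also have "\<dots> \<le> 1 * 1"
        using cons letter'[of p] by (intro mult_mono) (auto intro!: q.q_nonneg)
      finally show ?case by simp
    qed
    then have "cmod c * q (Poly_Mapping.single w 1) \<le> cmod c * 1"
      by (intro mult_left_mono) auto
    then show ?thesis
      using q.q_smul[of "Poly_Mapping.single w 1" c] single by simp
  qed
  then show ?case by blast
next
  case (add x y)
  then obtain M N where "\<forall>q\<in>CK_seminorms \<Lambda> \<E>. q x \<le> M" "\<forall>q\<in>CK_seminorms \<Lambda> \<E>. q y \<le> N" by blast
  moreover have "q (x + y) \<le> q x + q y" if "q \<in> CK_seminorms \<Lambda> \<E>" for q
    using that add cstar_seminorm.q_add by (auto simp: CK_seminorms_def)
  ultimately show ?case by (intro exI[of _ "M + N"]) (meson add_mono order_trans)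
qed

lemma CK_norm_upper:
  assumes "q \<in> CK_seminorms \<Lambda> \<E>" "x \<in> free_star_algebra (paths \<Lambda>)"
  shows "q x \<le> CK_norm \<Lambda> \<E> x"
  unfolding CK_norm_def
  using assms CK_seminorms_bounded[OF assms(2), of \<E>] by (intro cSUP_upper) (auto simp: bdd_above_def)

context
  fixes \<E> :: "'l set set"
  assumes \<E>: "\<E> \<subseteq> FE \<Lambda>"
begin

lemma CK_norm_least:
  assumes "\<And>q. q \<in> CK_seminorms \<Lambda> \<E> \<Longrightarrow> q x \<le> M"
  shows "CK_norm \<Lambda> \<E> x \<le> M"
  unfolding CK_norm_def
  using CK_seminorms_nonempty[OF \<E>] assms by (intro cSUP_least) auto

lemma CK_norm_nonneg: "x \<in> free_star_algebra (paths \<Lambda>) \<Longrightarrow> 0 \<le> CK_norm \<Lambda> \<E> x"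
  using CK_norm_upper[OF CK_seminorms_nonempty[OF \<E>]] by simp

lemma CK_norm_seminorm: "cstar_seminorm (paths \<Lambda>) (CK_norm \<Lambda> \<E>)"
proof
  let ?F = "free_star_algebra (paths \<Lambda>)"
  note up = CK_norm_upper[of _ \<E>]
  have sn: "cstar_seminorm (paths \<Lambda>) q" if "q \<in> CK_seminorms \<Lambda> \<E>" for q
    using that by (simp add: CK_seminorms_def)
  fix x assume x: "x \<in> ?F"
  have smul_le: "CK_norm \<Lambda> \<E> (free_smul c y) \<le> cmod c * CK_norm \<Lambda> \<E> y" if "y \<in> ?F" for c y
  proof (rule CK_norm_least)
    fix q assume q: "q \<in> CK_seminorms \<Lambda> \<E>"
    show "q (free_smul c y) \<le> cmod c * CK_norm \<Lambda> \<E> y"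
      unfolding cstar_seminorm.q_smul[OF sn[OF q] that] by (intro mult_left_mono up q that) simp
  qed
  show "CK_norm \<Lambda> \<E> (free_smul c x) = cmod c * CK_norm \<Lambda> \<E> x" for c
  proof (cases "c = 0")
    case True
    then show ?thesis using smul_le[OF x, of 0] CK_norm_nonneg[of 0] by simp
  next
    case False
    have "CK_norm \<Lambda> \<E> x = CK_norm \<Lambda> \<E> (free_smul (inverse c) (free_smul c x))"
      using False by (simp add: free_smul_free_smul)
    also have "\<dots> \<le> cmod (inverse c) * CK_norm \<Lambda> \<E> (free_smul c x)"
      using x by (intro smul_le) simp
    finally have "cmod c * CK_norm \<Lambda> \<E> x \<le> cmod c * (cmod (inverse c) * CK_norm \<Lambda> \<E> (free_smul c x))"
      by (intro mult_left_mono) auto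
    also have "\<dots> = CK_norm \<Lambda> \<E> (free_smul c x)"
      using False by (simp add: norm_inverse)
    finally show ?thesis
      using smul_le[OF x, of c] by (rule antisym[rotated])
  qed
  show "CK_norm \<Lambda> \<E> (free_adj x * x) = (CK_norm \<Lambda> \<E> x)\<^sup>2"
  proof (rule antisym)
    show "CK_norm \<Lambda> \<E> (free_adj x * x) \<le> (CK_norm \<Lambda> \<E> x)\<^sup>2"
    proof (rule CK_norm_least)
      fix q assume q: "q \<in> CK_seminorms \<Lambda> \<E>"
      interpret q: cstar_seminorm "paths \<Lambda>" q by (rule sn[OF q])
      show "q (free_adj x * x) \<le> (CK_norm \<Lambda> \<E> x)\<^sup>2"
        using x up[OF q x] by (simp add: q.q_adj_mult power_mono)
    qed
    have "CK_norm \<Lambda> \<E> x \<le> sqrt (CK_norm \<Lambda> \<E> (free_adj x * x))"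
    proof (rule CK_norm_least)
      fix q assume q: "q \<in> CK_seminorms \<Lambda> \<E>"
      interpret q: cstar_seminorm "paths \<Lambda>" q by (rule sn[OF q])
      have "(q x)\<^sup>2 \<le> CK_norm \<Lambda> \<E> (free_adj x * x)"
        using x up[OF q, of "free_adj x * x"] by (simp add: q.q_adj_mult)
      then show "q x \<le> sqrt (CK_norm \<Lambda> \<E> (free_adj x * x))"
        by (rule real_le_rsqrt)
    qed
    then have "(CK_norm \<Lambda> \<E> x)\<^sup>2 \<le> (sqrt (CK_norm \<Lambda> \<E> (free_adj x * x)))\<^sup>2"
      using CK_norm_nonneg[OF x] by (intro power_mono) auto
    then show "(CK_norm \<Lambda> \<E> x)\<^sup>2 \<le> CK_norm \<Lambda> \<E> (free_adj x * x)"
      using x CK_norm_nonneg[of "free_adj x * x"] by simp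
  qed
  fix y assume y: "y \<in> ?F"
  show "CK_norm \<Lambda> \<E> (x + y) \<le> CK_norm \<Lambda> \<E> x + CK_norm \<Lambda> \<E> y"
  proof (rule CK_norm_least)
    fix q assume q: "q \<in> CK_seminorms \<Lambda> \<E>"
    show "q (x + y) \<le> CK_norm \<Lambda> \<E> x + CK_norm \<Lambda> \<E> y"
      using cstar_seminorm.q_add[OF sn[OF q] x y] up[OF q x] up[OF q y] by linarith
  qed
  show "CK_norm \<Lambda> \<E> (x * y) \<le> CK_norm \<Lambda> \<E> x * CK_norm \<Lambda> \<E> y"
  proof (rule CK_norm_least)
    fix q assume q: "q \<in> CK_seminorms \<Lambda> \<E>"
    interpret q: cstar_seminorm "paths \<Lambda>" q by (rule sn[OF q])
    have "q x * q y \<le> CK_norm \<Lambda> \<E> x * CK_norm \<Lambda> \<E> y"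
      using up[OF q x] up[OF q y] x y CK_norm_nonneg[OF x] by (intro mult_mono) auto
    then show "q (x * y) \<le> CK_norm \<Lambda> \<E> x * CK_norm \<Lambda> \<E> y"
      using q.q_mult[OF x y] by linarith
  qed
qed

theorem cstar_algebra_CK_algebra: "cstar_algebra (CK_algebra \<Lambda> \<E>)"
  unfolding CK_algebra_def by (rule cstar_seminorm.cstar_algebra_completion[OF CK_norm_seminorm])

theorem CK_gen_family: "relative_CK_family \<Lambda> \<E> (CK_algebra \<Lambda> \<E>) (CK_gen \<Lambda> \<E>)"
proof -
  interpret u: cstar_seminorm "paths \<Lambda>" "CK_norm \<Lambda> \<E>" by (rule CK_norm_seminorm)
  interpret U: pre_cstar_algebra u.C by (rule u.pre_cstar_C)
  have "\<exists>J. star_hom u.C (completion (paths \<Lambda>) q) J \<and>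
      (\<forall>\<kappa>\<in>paths \<Lambda>. J (gen (paths \<Lambda>) (CK_norm \<Lambda> \<E>) \<kappa>) = gen (paths \<Lambda>) q \<kappa>) \<and>
      (\<forall>x\<in>u.Fr. nrm (completion (paths \<Lambda>) q) (J (u.emb x)) = q x)"
    if q: "q \<in> CK_seminorms \<Lambda> \<E>" for q
  proof -
    interpret q: cstar_seminorm "paths \<Lambda>" q using q by (simp add: CK_seminorms_def)
    have n: "nrm q.C (free_eval q.C (gen (paths \<Lambda>) q) x) = q x" if "x \<in> u.Fr" for x
      using that by (simp add: q.emb_eq_eval[symmetric] q.nrm_C_const)
    have le: "nrm q.C (free_eval q.C (gen (paths \<Lambda>) q) x) \<le> CK_norm \<Lambda> \<E> x" if "x \<in> u.Fr" for x
      using n[OF that] CK_norm_upper[OF q that] by simp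
    obtain J where "star_hom u.C q.C J" "\<And>x. x \<in> u.Fr \<Longrightarrow> J (u.emb x) = free_eval q.C (gen (paths \<Lambda>) q) x"
      "\<And>\<kappa>. \<kappa> \<in> paths \<Lambda> \<Longrightarrow> J (gen (paths \<Lambda>) (CK_norm \<Lambda> \<E>) \<kappa>) = gen (paths \<Lambda>) q \<kappa>"
      using u.extend_hom[OF q.cstar_algebra_completion q.gen_closed le] by blast
    then show ?thesis using n by (intro exI[of _ J]) simp
  qed
  then obtain J where J: "\<And>q. q \<in> CK_seminorms \<Lambda> \<E> \<Longrightarrow> star_hom u.C (completion (paths \<Lambda>) q) (J q)"
    "\<And>q \<kappa>. \<lbrakk>q \<in> CK_seminorms \<Lambda> \<E>; \<kappa> \<in> paths \<Lambda>\<rbrakk> \<Longrightarrow> J q (gen (paths \<Lambda>) (CK_norm \<Lambda> \<E>) \<kappa>) = gen (paths \<Lambda>) q \<kappa>"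
    "\<And>q x. \<lbrakk>q \<in> CK_seminorms \<Lambda> \<E>; x \<in> u.Fr\<rbrakk> \<Longrightarrow> nrm (completion (paths \<Lambda>) q) (J q (u.emb x)) = q x"
    by metis
  have pre: "pre_cstar_algebra (completion (paths \<Lambda>) q)" if "q \<in> CK_seminorms \<Lambda> \<E>" for q
    using that cstar_seminorm.pre_cstar_C by (auto simp: CK_seminorms_def)
  have "relative_CK_family \<Lambda> \<E> u.C (gen (paths \<Lambda>) (CK_norm \<Lambda> \<E>))"
  proof (rule CK_family_pullback[where I = "CK_seminorms \<Lambda> \<E>" and B = "completion (paths \<Lambda>)" and J = J and h = "gen (paths \<Lambda>)"])
    fix a assume a: "a \<in> carrier u.C" "\<And>q. q \<in> CK_seminorms \<Lambda> \<E> \<Longrightarrow> J q a = \<zero>\<^bsub>completion (paths \<Lambda>) q\<^esub>"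
    show "a = \<zero>\<^bsub>u.C\<^esub>"
    proof (rule ccontr)
      assume "a \<noteq> \<zero>\<^bsub>u.C\<^esub>"
      then have pos: "nrm u.C a > 0"
        using a(1) by (simp add: order_less_le U.nrm_eq_0)
      then obtain x where x: "x \<in> u.Fr" "nrm u.C (u.emb x \<ominus>\<^bsub>u.C\<^esub> a) < nrm u.C a / 3"
        using u.dense[OF a(1), of "nrm u.C a / 3"] by auto
      have ex: "u.emb x \<in> carrier u.C" using x by simp
      have "nrm u.C a / 3 < CK_norm \<Lambda> \<E> x"
        using U.nrm_abs_diff_le[OF ex a(1)] x pos u.nrm_C_const[OF x(1)] by linarith
      then obtain q where q: "q \<in> CK_seminorms \<Lambda> \<E>" "nrm u.C a / 3 < q x"
        using CK_norm_least[of x "nrm u.C a / 3"] by force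
      interpret star_homomorphism u.C "completion (paths \<Lambda>) q" "J q"
        using pre[OF q(1)] u.pre_cstar_C J(1)[OF q(1)]
        by (intro star_homomorphism.intro star_homomorphism_axioms.intro)
      have "J q (u.emb x \<ominus>\<^bsub>u.C\<^esub> a) = J q (u.emb x) \<ominus>\<^bsub>completion (paths \<Lambda>) q\<^esub> \<zero>\<^bsub>completion (paths \<Lambda>) q\<^esub>"
        using ex a q(1) by (simp add: hom_diff)
      also have "\<dots> = J q (u.emb x)"
        using ex by (simp add: a_minus_def)
      finally have "J q (u.emb x \<ominus>\<^bsub>u.C\<^esub> a) = J q (u.emb x)" .
      then have "q x \<le> nrm u.C (u.emb x \<ominus>\<^bsub>u.C\<^esub> a)"
        using star_hom_contractive[OF u.cstar_algebra_completion pre[OF q(1)] J(1)[OF q(1)],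
            of "u.emb x \<ominus>\<^bsub>u.C\<^esub> a"] J(3)[OF q(1) x(1)] ex a by simp
      then show False using q x by linarith
    qed
  qed (use u.pre_cstar_C pre \<E> J u.gen_closed in \<open>auto simp: CK_seminorms_def\<close>)
  then show ?thesis by (simp add: CK_algebra_def CK_gen_def)
qed

text \<open>Every element is a limit of *-polynomials in the generators.\<close>

theorem CK_algebra_generated:
  assumes "a \<in> carrier (CK_algebra \<Lambda> \<E>)" "e > 0"
  shows "\<exists>x\<in>free_star_algebra (paths \<Lambda>).
    nrm (CK_algebra \<Lambda> \<E>) (free_eval (CK_algebra \<Lambda> \<E>) (CK_gen \<Lambda> \<E>) x \<ominus>\<^bsub>CK_algebra \<Lambda> \<E>\<^esub> a) < e"
proof -
  interpret u: cstar_seminorm "paths \<Lambda>" "CK_norm \<Lambda> \<E>" by (rule CK_norm_seminorm)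
  show ?thesis
    using u.dense[of a e] assms u.emb_eq_eval unfolding CK_algebra_def CK_gen_def by metis
qed

theorem CK_algebra_universal:
  assumes B: "cstar_algebra B" and t: "relative_CK_family \<Lambda> \<E> B t"
  shows "\<exists>!\<pi>. \<pi> \<in> extensional (carrier (CK_algebra \<Lambda> \<E>)) \<and> star_hom (CK_algebra \<Lambda> \<E>) B \<pi> \<and>
    (\<forall>\<kappa>\<in>paths \<Lambda>. \<pi> (CK_gen \<Lambda> \<E> \<kappa>) = t \<kappa>)"
proof -
  interpret u: cstar_seminorm "paths \<Lambda>" "CK_norm \<Lambda> \<E>" by (rule CK_norm_seminorm)
  interpret U: pre_cstar_algebra u.C by (rule u.pre_cstar_C)
  interpret B: cstar_algebra B by (rule B)
  have tc: "t \<kappa> \<in> carrier B" if "\<kappa> \<in> paths \<Lambda>" for \<kappa>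
    using t that by (simp add: relative_CK_family_def)
  obtain J where J: "star_hom u.C B J"
    "\<And>\<kappa>. \<kappa> \<in> paths \<Lambda> \<Longrightarrow> J (gen (paths \<Lambda>) (CK_norm \<Lambda> \<E>) \<kappa>) = t \<kappa>"
    using u.extend_hom[OF B tc CK_norm_upper[OF CK_seminorm_of_family[OF \<E> B t]]] by blast
  have U_def: "CK_algebra \<Lambda> \<E> = u.C" "CK_gen \<Lambda> \<E> = gen (paths \<Lambda>) (CK_norm \<Lambda> \<E>)"
    by (simp_all add: CK_algebra_def CK_gen_def)
  show ?thesis
    unfolding U_def
  proof (rule ex1I)
    show "restrict J (carrier u.C) \<in> extensional (carrier u.C) \<and> star_hom u.C B (restrict J (carrier u.C)) \<and>
        (\<forall>\<kappa>\<in>paths \<Lambda>. restrict J (carrier u.C) (gen (paths \<Lambda>) (CK_norm \<Lambda> \<E>) \<kappa>) = t \<kappa>)"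
      using J u.gen_closed by (auto simp: star_hom_def)
  next
    fix \<pi> assume \<pi>: "\<pi> \<in> extensional (carrier u.C) \<and> star_hom u.C B \<pi> \<and>
        (\<forall>\<kappa>\<in>paths \<Lambda>. \<pi> (gen (paths \<Lambda>) (CK_norm \<Lambda> \<E>) \<kappa>) = t \<kappa>)"
    note \<pi>' = \<pi>[THEN conjunct2, THEN conjunct1] \<pi>[THEN conjunct2, THEN conjunct2, rule_format]
    have eq: "\<pi> a = J a" if "a \<in> carrier u.C" for a
    proof (rule u.hom_unique[OF B.pre_cstar_algebra_axioms \<pi>'(1) J(1) _ that])
      show "\<pi> (gen (paths \<Lambda>) (CK_norm \<Lambda> \<E>) \<kappa>) = J (gen (paths \<Lambda>) (CK_norm \<Lambda> \<E>) \<kappa>)"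
        if "\<kappa> \<in> paths \<Lambda>" for \<kappa>
        using that by (simp only: \<pi>'(2) J(2))
    qed
    show "\<pi> = restrict J (carrier u.C)"
      by (rule extensionalityI[OF \<pi>[THEN conjunct1] restrict_extensional]) (simp add: eq)
  qed
qed

theorem CK_hom:
  assumes "cstar_algebra B" "relative_CK_family \<Lambda> \<E> B t"
  shows "star_hom (CK_algebra \<Lambda> \<E>) B (CK_hom \<Lambda> \<E> B t)"
    "\<kappa> \<in> paths \<Lambda> \<Longrightarrow> CK_hom \<Lambda> \<E> B t (CK_gen \<Lambda> \<E> \<kappa>) = t \<kappa>"
proof -
  have *: "CK_hom \<Lambda> \<E> B t \<in> extensional (carrier (CK_algebra \<Lambda> \<E>)) \<and>
    star_hom (CK_algebra \<Lambda> \<E>) B (CK_hom \<Lambda> \<E> B t) \<and>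
    (\<forall>\<kappa>\<in>paths \<Lambda>. CK_hom \<Lambda> \<E> B t (CK_gen \<Lambda> \<E> \<kappa>) = t \<kappa>)"
    unfolding CK_hom_def by (rule theI'[OF CK_algebra_universal[OF assms]])
  show "star_hom (CK_algebra \<Lambda> \<E>) B (CK_hom \<Lambda> \<E> B t)"
    by (rule *[THEN conjunct2, THEN conjunct1])
  show "CK_hom \<Lambda> \<E> B t (CK_gen \<Lambda> \<E> \<kappa>) = t \<kappa>" if "\<kappa> \<in> paths \<Lambda>"
    by (rule *[THEN conjunct2, THEN conjunct2, rule_format, OF that])
qed

text \<open>The rotated generators form a relative Cuntz--Krieger family, so \<open>gauge\<close> is well defined.\<close>

theorem rotated_family:
  assumes B: "cstar_algebra B" and t: "relative_CK_family \<Lambda> \<E> B t" and z: "z \<in> torus"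
  shows "relative_CK_family \<Lambda> \<E> B (\<lambda>\<kappa>. smul B (\<Prod>i\<in>UNIV. z i ^ deg \<Lambda> \<kappa> i) (t \<kappa>))"
proof -
  interpret B: cstar_algebra B by (rule B)
  define c where "c \<kappa> = (\<Prod>i\<in>UNIV. z i ^ deg \<Lambda> \<kappa> i)" for \<kappa>
  define t' where "t' \<kappa> = smul B (c \<kappa>) (t \<kappa>)" for \<kappa>
  have zz: "cmod (z i) = 1" for i using z by (simp add: torus_def)
  have cc: "c \<kappa> * cnj (c \<kappa>) = 1" for \<kappa>
  proof -
    have "cmod (c \<kappa>) = 1" by (simp add: c_def prod_norm[symmetric] norm_power zz)
    then show ?thesis using complex_norm_square[of "c \<kappa>"] by simp
  qed
  have c_cmp: "c (cmp \<Lambda> \<kappa> \<mu>) = c \<kappa> * c \<mu>"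
    if "\<kappa> \<in> paths \<Lambda>" "\<mu> \<in> paths \<Lambda>" "src \<Lambda> \<kappa> = rng \<Lambda> \<mu>" for \<kappa> \<mu>
    using that by (simp add: c_def deg_cmp power_add prod.distrib)
  have c_vertex: "c v = 1" if "v \<in> vertices \<Lambda>" for v
    using that by (simp add: c_def vertices_def)
  have tc: "t \<kappa> \<in> carrier B" if "\<kappa> \<in> paths \<Lambda>" for \<kappa>
    using t that by (simp add: relative_CK_family_def)
  have t'_vertex: "t' v = t v" "t v \<in> carrier B" if "v \<in> vertices \<Lambda>" for v
    using that tc by (simp_all add: t'_def c_vertex vertices_def)
  have t'_proj: "t' \<kappa> \<otimes>\<^bsub>B\<^esub> adj B (t' \<kappa>) = t \<kappa> \<otimes>\<^bsub>B\<^esub> adj B (t \<kappa>)" if "\<kappa> \<in> paths \<Lambda>" for \<kappa>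
    using tc[OF that] by (simp add: t'_def B.adj_smul B.smul_mult_left B.smul_mult_right B.smul_smul cc mult.commute[of "cnj _"])
  have "relative_CK_family \<Lambda> \<E> B t'"
    unfolding relative_CK_family_def
  proof (intro conjI ballI impI)
    fix \<kappa> assume k: "\<kappa> \<in> paths \<Lambda>"
    show "t' \<kappa> \<in> carrier B" using tc[OF k] by (simp add: t'_def)
    show "t' \<kappa> \<otimes>\<^bsub>B\<^esub> adj B (t' \<kappa>) \<otimes>\<^bsub>B\<^esub> t' \<kappa> = t' \<kappa>"
      unfolding t'_proj[OF k] using tc[OF k] t k
      by (simp add: t'_def B.smul_mult_right relative_CK_family_def)
    fix \<mu> assume m: "\<mu> \<in> paths \<Lambda>"
    show "t' \<kappa> \<otimes>\<^bsub>B\<^esub> t' \<mu> = t' (cmp \<Lambda> \<kappa> \<mu>)" if "src \<Lambda> \<kappa> = rng \<Lambda> \<mu>"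
    proof -
      have "t \<kappa> \<otimes>\<^bsub>B\<^esub> t \<mu> = t (cmp \<Lambda> \<kappa> \<mu>)" using t k m that by (simp add: relative_CK_family_def)
      then show ?thesis
        using tc[OF k] tc[OF m] tc[OF cmp_closed[OF k m that]] that k m
        by (simp add: t'_def B.smul_mult_left B.smul_mult_right B.smul_smul c_cmp mult.commute)
    qed
    let ?d = "cnj (c \<kappa>) * c \<mu>"
    let ?f = "\<lambda>p. t (fst p) \<otimes>\<^bsub>B\<^esub> adj B (t (snd p))"
    have f: "?f \<in> min_ext \<Lambda> \<kappa> \<mu> \<rightarrow> carrier B" using tc by (auto simp: min_ext_def)
    have term_eq: "t' (fst p) \<otimes>\<^bsub>B\<^esub> adj B (t' (snd p)) = smul B ?d (?f p)" if "p \<in> min_ext \<Lambda> \<kappa> \<mu>" for p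
    proof -
      obtain \<alpha> \<beta> where p: "p = (\<alpha>, \<beta>)" by force
      have m': "\<alpha> \<in> paths \<Lambda>" "\<beta> \<in> paths \<Lambda>" "src \<Lambda> \<kappa> = rng \<Lambda> \<alpha>" "src \<Lambda> \<mu> = rng \<Lambda> \<beta>"
        "cmp \<Lambda> \<kappa> \<alpha> = cmp \<Lambda> \<mu> \<beta>"
        using that p by (auto simp: min_ext_def)
      have e: "c \<kappa> * c \<alpha> = c \<mu> * c \<beta>"
        using m' k m by (metis c_cmp)
      have "c \<alpha> * cnj (c \<beta>) = (c \<kappa> * cnj (c \<kappa>)) * (c \<alpha> * cnj (c \<beta>))" by (simp add: cc)
      also have "\<dots> = cnj (c \<kappa>) * (c \<kappa> * c \<alpha>) * cnj (c \<beta>)" by (simp add: ac_simps)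
      also have "\<dots> = cnj (c \<kappa>) * c \<mu> * (c \<beta> * cnj (c \<beta>))" unfolding e by (simp add: ac_simps)
      finally have "c \<alpha> * cnj (c \<beta>) = ?d" by (simp add: cc)
      then show ?thesis
        using tc m' p by (simp add: t'_def B.adj_smul B.smul_mult_left B.smul_mult_right B.smul_smul mult.commute)
    qed
    have smul_sum: "finsum B (\<lambda>p. smul B ?d (?f p)) S = smul B ?d (finsum B ?f S)"
      if "?f \<in> S \<rightarrow> carrier B" for S
      using that
    proof (induction S rule: infinite_finite_induct)
      case (insert p S)
      then have "(\<lambda>p. smul B ?d (?f p)) \<in> S \<rightarrow> carrier B" by (auto intro!: B.smul_closed)
      with insert show ?case
        by (simp add: B.finsum_insert B.smul_add_right B.finsum_closed)
    qed (simp_all add: B.finsum_infinite B.finsum_empty)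
    have "finsum B (\<lambda>p. t' (fst p) \<otimes>\<^bsub>B\<^esub> adj B (t' (snd p))) (min_ext \<Lambda> \<kappa> \<mu>) =
        finsum B (\<lambda>p. smul B ?d (?f p)) (min_ext \<Lambda> \<kappa> \<mu>)"
      by (rule B.finsum_cong') (use f term_eq in \<open>auto intro!: B.smul_closed\<close>)
    also have "\<dots> = smul B ?d (adj B (t \<kappa>) \<otimes>\<^bsub>B\<^esub> t \<mu>)"
      using t k m smul_sum[OF f] by (simp add: relative_CK_family_def)
    also have "\<dots> = adj B (t' \<kappa>) \<otimes>\<^bsub>B\<^esub> t' \<mu>"
      using tc[OF k] tc[OF m]
      by (simp add: t'_def B.adj_smul B.smul_mult_left B.smul_mult_right B.smul_smul mult.commute)
    finally show "adj B (t' \<kappa>) \<otimes>\<^bsub>B\<^esub> t' \<mu> =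
        finsum B (\<lambda>p. t' (fst p) \<otimes>\<^bsub>B\<^esub> adj B (t' (snd p))) (min_ext \<Lambda> \<kappa> \<mu>)" by simp
  next
    fix E assume E: "E \<in> \<E>"
    have "gap_projection \<Lambda> B t' E = gap_projection \<Lambda> B t E"
      unfolding gap_projection_def mult_set_def
    proof (intro arg_cong[where f = "mult_list B"] map_cong refl)
      have E': "E \<in> FE \<Lambda>" using E \<E> by blast
      fix \<kappa> assume "\<kappa> \<in> set (SOME xs. distinct xs \<and> set xs = E)"
      then have "\<kappa> \<in> paths \<Lambda>" using enumeration[OF E'] FE_paths(1)[OF E'] by blast
      then show "t' (rng_set \<Lambda> E) \<ominus>\<^bsub>B\<^esub> t' \<kappa> \<otimes>\<^bsub>B\<^esub> adj B (t' \<kappa>) =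
          t (rng_set \<Lambda> E) \<ominus>\<^bsub>B\<^esub> t \<kappa> \<otimes>\<^bsub>B\<^esub> adj B (t \<kappa>)"
        by (simp only: t'_proj t'_vertex(1)[OF rng_set(1)[OF E']])
    qed
    then show "gap_projection \<Lambda> B t' E = \<zero>\<^bsub>B\<^esub>"
      using t E by (simp add: relative_CK_family_def)
  qed (use t in \<open>simp_all add: t'_vertex relative_CK_family_def\<close>)
  then show ?thesis by (simp add: t'_def[abs_def] c_def)
qed

theorem gauge_automorphism:
  assumes "z \<in> torus"
  shows "star_hom (CK_algebra \<Lambda> \<E>) (CK_algebra \<Lambda> \<E>) (gauge \<Lambda> \<E> z)"
    "\<kappa> \<in> paths \<Lambda> \<Longrightarrow> gauge \<Lambda> \<E> z (CK_gen \<Lambda> \<E> \<kappa>) =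
      smul (CK_algebra \<Lambda> \<E>) (\<Prod>i\<in>UNIV. z i ^ deg \<Lambda> \<kappa> i) (CK_gen \<Lambda> \<E> \<kappa>)"
  unfolding gauge_def
  by (rule CK_hom[OF cstar_algebra_CK_algebra rotated_family[OF cstar_algebra_CK_algebra CK_gen_family assms]], assumption?)+

end

end

end

theory Submission
  imports Defs "HOL-Analysis.L2_Norm"
begin

text \<open>
  The two conditions enter through two quite different arguments.

  \<^emph>\<open>The conditions imply injectivity.\<close> The core is a limit of finite-dimensional pieces. A finite set
  \<open>P\<close> of paths lies in a finite set that is closed under the minimal extensions occurring in products of
  monomials \<open>t \<sigma> (t \<rho>)\<^sup>*\<close> with \<open>deg \<sigma> = deg \<rho>\<close> (\<open>finite_path_closure\<close>). Over a closed set these monomials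
  span a *-algebra with matrix units \<open>unit \<kappa> \<tau> = t \<kappa> (defect \<kappa>) (t \<tau>)\<^sup>*\<close>, where \<open>defect \<kappa>\<close> is the product of
  the differences \<open>t (src \<kappa>) - t \<nu> (t \<nu>)\<^sup>*\<close> over the nontrivial \<open>\<nu>\<close> with \<open>\<kappa> \<cdot> \<nu>\<close> in the set. If the
  homomorphism \<open>\<pi>\<close> kills no nonzero defect, then matrix coefficients can be recovered from \<open>\<pi> x\<close>, which
  gives \<open>\<parallel>x\<parallel> \<le> K \<parallel>\<pi> x\<parallel>\<close> on the span; applied to powers of \<open>x\<^sup>* x\<close>, the C*-identity
  improves this to \<open>\<parallel>x\<parallel> \<le> \<parallel>\<pi> x\<parallel>\<close> (\<open>isometric_of_bounded_below\<close>, \<open>core_span_isometric\<close>). A defect is a vertex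
  projection if there are no such \<open>\<nu>\<close>; it is a gap projection if the \<open>\<nu>\<close> form an exhaustive set; and otherwise it
  dominates some \<open>t \<xi> (t \<xi>)\<^sup>*\<close>. Conditions (1) and (2) keep exactly these elements alive, except for
  the gap projections of members of \<open>\<E>\<close>, which vanish already in the universal algebra. It remains to see that
  polynomials in the balanced monomials are dense in the core; unbalanced monomials are removed one
  after the other by averaging \<open>x\<close> with a rotated copy of itself (\<open>remove_unbalanced\<close>).

  \<^emph>\<open>Injectivity implies the conditions.\<close> The vertex projections and the gap projections lie in the core,
  so it has to be shown that the universal ones are nonzero, the latter for \<open>F\<close> outside \<open>\<E>\<close>. For this one
  represents the graph on the vectors indexed by its \<open>\<E>\<close>-relative boundary paths, encoded as filters
  of finite paths: \<open>\<kappa>\<close> acts by prefixing. The gap projection of \<open>F\<close> is then nonzero if and only if some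
  boundary path at the vertex avoids \<open>F\<close>. Such a path is constructed step by step
  (\<open>filter_avoiding\<close>). Closure of \<open>\<E>\<close> under substitution, truncation and supersets means that the
  construction cannot get stuck, and closure under \<open>Ext\<close> that a requirement at an earlier vertex can be
  met later. The vectors have finite support, so that the operators form only a pre-C*-algebra; the
  family is carried over to the completion of the free *-algebra for the operator norm
  (\<open>family_in_completion\<close>).
\<close>

section \<open>Prefixes and common extensions\<close>

context k_graph
begin

abbreviation comp (infixl "\<cdot>" 70) where "\<kappa> \<cdot> \<mu> \<equiv> cmp \<Lambda> \<kappa> \<mu>"

definition prefix :: "'l \<Rightarrow> 'l \<Rightarrow> bool" (infix "\<preceq>" 50) where
  "\<mu> \<preceq> \<gamma> \<longleftrightarrow> \<mu> \<in> paths \<Lambda> \<and> (\<exists>\<alpha>\<in>paths \<Lambda>. src \<Lambda> \<mu> = rng \<Lambda> \<alpha> \<and> \<gamma> = \<mu> \<cdot> \<alpha>)"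

lemma prefixE:
  assumes "\<mu> \<preceq> \<gamma>"
  obtains \<alpha> where "\<mu> \<in> paths \<Lambda>" "\<alpha> \<in> paths \<Lambda>" "src \<Lambda> \<mu> = rng \<Lambda> \<alpha>" "\<gamma> = \<mu> \<cdot> \<alpha>"
  using assms by (auto simp: prefix_def)

lemma prefix_cmp: "\<lbrakk>\<mu> \<in> paths \<Lambda>; \<alpha> \<in> paths \<Lambda>; src \<Lambda> \<mu> = rng \<Lambda> \<alpha>\<rbrakk> \<Longrightarrow> \<mu> \<preceq> \<mu> \<cdot> \<alpha>"
  by (auto simp: prefix_def)

lemma prefix_paths: "\<mu> \<preceq> \<gamma> \<Longrightarrow> \<mu> \<in> paths \<Lambda>" "\<mu> \<preceq> \<gamma> \<Longrightarrow> \<gamma> \<in> paths \<Lambda>"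
  by (auto simp: prefix_def cmp_closed)

lemma prefix_rng: "\<mu> \<preceq> \<gamma> \<Longrightarrow> rng \<Lambda> \<mu> = rng \<Lambda> \<gamma>"
  by (auto simp: prefix_def rng_cmp)

lemma prefix_deg: "\<mu> \<preceq> \<gamma> \<Longrightarrow> deg \<Lambda> \<mu> \<le> deg \<Lambda> \<gamma>"
  by (auto simp: prefix_def deg_cmp le_fun_def)

lemma prefix_refl: "\<mu> \<in> paths \<Lambda> \<Longrightarrow> \<mu> \<preceq> \<mu>"
  unfolding prefix_def by (metis cmp_src rng_src src_closed)

lemma prefix_trans: "\<lbrakk>\<mu> \<preceq> \<nu>; \<nu> \<preceq> \<gamma>\<rbrakk> \<Longrightarrow> \<mu> \<preceq> \<gamma>"
  unfolding prefix_def by (metis cmp_assoc cmp_closed rng_cmp src_cmp)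

lemma rng_prefix: "\<mu> \<in> paths \<Lambda> \<Longrightarrow> rng \<Lambda> \<mu> \<preceq> \<mu>"
  unfolding prefix_def by (metis cmp_rng rng_closed src_rng)

lemma cmp_cancel:
  assumes "\<mu> \<in> paths \<Lambda>" "\<nu> \<in> paths \<Lambda>" "\<alpha> \<in> paths \<Lambda>" "\<beta> \<in> paths \<Lambda>"
    "src \<Lambda> \<mu> = rng \<Lambda> \<alpha>" "src \<Lambda> \<nu> = rng \<Lambda> \<beta>" "\<mu> \<cdot> \<alpha> = \<nu> \<cdot> \<beta>" "deg \<Lambda> \<mu> = deg \<Lambda> \<nu>"
  shows "\<mu> = \<nu>" "\<alpha> = \<beta>"
proof -
  let ?P = "\<lambda>p. fst p \<in> paths \<Lambda> \<and> snd p \<in> paths \<Lambda> \<and> src \<Lambda> (fst p) = rng \<Lambda> (snd p) \<and>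
    deg \<Lambda> (fst p) = deg \<Lambda> \<mu> \<and> deg \<Lambda> (snd p) = deg \<Lambda> \<alpha> \<and> \<mu> \<cdot> \<alpha> = fst p \<cdot> snd p"
  have "deg \<Lambda> \<mu> + deg \<Lambda> \<alpha> = deg \<Lambda> \<nu> + deg \<Lambda> \<beta>"
    using assms by (metis deg_cmp)
  then have d: "deg \<Lambda> \<alpha> = deg \<Lambda> \<beta>" using assms by simp
  with assms have P: "?P (\<mu>, \<alpha>)" "?P (\<nu>, \<beta>)" by simp_all
  have "\<exists>!p. ?P p"
    by (rule factorisation) (use assms d in \<open>simp_all add: cmp_closed deg_cmp\<close>)
  from the1_equality[OF this P(1)] the1_equality[OF this P(2)]
  have "(\<mu>, \<alpha>) = (\<nu>, \<beta>)" by simp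
  then show "\<mu> = \<nu>" "\<alpha> = \<beta>" by simp_all
qed

lemma factor:
  assumes "\<gamma> \<in> paths \<Lambda>" "n \<le> deg \<Lambda> \<gamma>"
  obtains \<mu> where "\<mu> \<preceq> \<gamma>" "deg \<Lambda> \<mu> = n"
proof -
  have "deg \<Lambda> \<gamma> = n + (deg \<Lambda> \<gamma> - n)"
    using assms(2) by (auto simp: le_fun_def fun_eq_iff)
  from factorisation[OF assms(1) this] show ?thesis
    by (elim ex1E) (metis prefix_def that)
qed

lemma prefix_unique: "\<lbrakk>\<mu> \<preceq> \<gamma>; \<nu> \<preceq> \<gamma>; deg \<Lambda> \<mu> = deg \<Lambda> \<nu>\<rbrakk> \<Longrightarrow> \<mu> = \<nu>"
  unfolding prefix_def by (metis cmp_cancel(1))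

text \<open>
  Unique factorisation: the prefix of \<open>\<nu>\<close> of degree \<open>deg \<mu>\<close> is also the prefix of \<open>\<gamma>\<close> of that degree.
\<close>

lemma prefix_of_prefix:
  assumes "\<mu> \<preceq> \<gamma>" "\<nu> \<preceq> \<gamma>" "deg \<Lambda> \<mu> \<le> deg \<Lambda> \<nu>"
  shows "\<mu> \<preceq> \<nu>"
  by (metis assms factor prefix_paths(1) prefix_trans prefix_unique)

lemma prefix_cmp_mono:
  assumes "\<kappa> \<in> paths \<Lambda>" "src \<Lambda> \<kappa> = rng \<Lambda> \<alpha>" "\<alpha> \<preceq> \<beta>"
  shows "\<kappa> \<cdot> \<alpha> \<preceq> \<kappa> \<cdot> \<beta>"
proof -
  obtain \<delta> where "\<alpha> \<in> paths \<Lambda>" "\<delta> \<in> paths \<Lambda>" "src \<Lambda> \<alpha> = rng \<Lambda> \<delta>" "\<beta> = \<alpha> \<cdot> \<delta>"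
    using assms(3) by (rule prefixE)
  then show ?thesis
    using assms by (auto simp: prefix_def cmp_closed src_cmp cmp_assoc)
qed

lemma prefix_cmp_cancel:
  assumes "\<kappa> \<in> paths \<Lambda>" "\<alpha> \<in> paths \<Lambda>" "\<beta> \<in> paths \<Lambda>"
    "src \<Lambda> \<kappa> = rng \<Lambda> \<alpha>" "src \<Lambda> \<kappa> = rng \<Lambda> \<beta>" "\<kappa> \<cdot> \<alpha> \<preceq> \<kappa> \<cdot> \<beta>"
  shows "\<alpha> \<preceq> \<beta>"
proof -
  obtain \<delta> where \<delta>: "\<delta> \<in> paths \<Lambda>" "src \<Lambda> (\<kappa> \<cdot> \<alpha>) = rng \<Lambda> \<delta>" "\<kappa> \<cdot> \<beta> = \<kappa> \<cdot> \<alpha> \<cdot> \<delta>"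
    using assms(6) by (rule prefixE)
  then have "\<kappa> \<cdot> \<beta> = \<kappa> \<cdot> (\<alpha> \<cdot> \<delta>)" "src \<Lambda> \<alpha> = rng \<Lambda> \<delta>"
    using assms by (simp_all add: src_cmp cmp_assoc)
  then have "\<beta> = \<alpha> \<cdot> \<delta>"
    using assms \<delta>(1) cmp_cancel(2)[of \<kappa> \<kappa> \<beta> "\<alpha> \<cdot> \<delta>"] by (simp add: cmp_closed rng_cmp)
  then show ?thesis
    using assms \<delta> by (auto simp: prefix_def src_cmp)
qed

lemma verticesD:
  assumes "v \<in> vertices \<Lambda>"
  shows "v \<in> paths \<Lambda>" "rng \<Lambda> v = v" "src \<Lambda> v = v" "deg \<Lambda> v = 0"
  using assms unfolding vertices_eq_identities by (auto simp: rng_closed rng_rng src_rng deg_rng)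

lemma rng_vertex: "\<kappa> \<in> paths \<Lambda> \<Longrightarrow> rng \<Lambda> \<kappa> \<in> vertices \<Lambda>"
  by (simp add: vertices_eq_identities)

lemma src_vertex: "\<kappa> \<in> paths \<Lambda> \<Longrightarrow> src \<Lambda> \<kappa> \<in> vertices \<Lambda>"
  by (metis rng_src rng_vertex src_closed)

lemma deg_zero: "\<lbrakk>\<kappa> \<in> paths \<Lambda>; deg \<Lambda> \<kappa> = 0\<rbrakk> \<Longrightarrow> src \<Lambda> \<kappa> = \<kappa> \<and> rng \<Lambda> \<kappa> = \<kappa>"
  using verticesD(2,3)[of \<kappa>] by (simp add: vertices_def)

lemma prefix_antisym: "\<lbrakk>\<mu> \<preceq> \<nu>; deg \<Lambda> \<nu> \<le> deg \<Lambda> \<mu>\<rbrakk> \<Longrightarrow> \<mu> = \<nu>"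
  by (metis order_antisym prefix_deg prefix_paths(2) prefix_refl prefix_unique)

lemma prefix_vertex: "\<lbrakk>\<mu> \<preceq> v; v \<in> vertices \<Lambda>\<rbrakk> \<Longrightarrow> \<mu> = v"
  by (metis prefix_antisym verticesD(4) le_fun_def zero_fun_apply zero_le)

lemma segment_prefix:
  assumes "\<kappa> \<in> paths \<Lambda>" "m \<le> deg \<Lambda> \<kappa>"
  shows "segment \<Lambda> \<kappa> 0 m \<preceq> \<kappa>" "deg \<Lambda> (segment \<Lambda> \<kappa> 0 m) = m"
proof -
  obtain \<mu> where \<mu>: "\<mu> \<preceq> \<kappa>" "deg \<Lambda> \<mu> = m" using factor[OF assms] .
  then obtain \<gamma> where \<gamma>: "\<mu> \<in> paths \<Lambda>" "\<gamma> \<in> paths \<Lambda>" "src \<Lambda> \<mu> = rng \<Lambda> \<gamma>" "\<kappa> = \<mu> \<cdot> \<gamma>"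
    by (elim prefixE)
  have dg: "deg \<Lambda> \<gamma> = deg \<Lambda> \<kappa> - m" using \<gamma> \<mu> by (simp add: deg_cmp)
  have "segment \<Lambda> \<kappa> 0 m = \<mu>"
    unfolding segment_def
  proof (rule the_equality)
    show "\<exists>\<alpha> \<gamma>. \<alpha> \<in> paths \<Lambda> \<and> \<mu> \<in> paths \<Lambda> \<and> \<gamma> \<in> paths \<Lambda> \<and> src \<Lambda> \<alpha> = rng \<Lambda> \<mu> \<and> src \<Lambda> \<mu> = rng \<Lambda> \<gamma> \<and>
       deg \<Lambda> \<alpha> = 0 \<and> deg \<Lambda> \<mu> = m - 0 \<and> deg \<Lambda> \<gamma> = deg \<Lambda> \<kappa> - m \<and> \<kappa> = \<alpha> \<cdot> (\<mu> \<cdot> \<gamma>)"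
    proof -
      have "rng \<Lambda> \<mu> \<cdot> \<kappa> = \<kappa>" using \<gamma> by (metis cmp_closed cmp_rng rng_cmp)
      then show ?thesis
        using \<gamma> \<mu> dg by (intro exI[of _ "rng \<Lambda> \<mu>"] exI[of _ \<gamma>])
          (simp add: rng_closed src_rng deg_rng fun_eq_iff)
    qed
  next
    fix \<beta> assume "\<exists>\<alpha> \<gamma>. \<alpha> \<in> paths \<Lambda> \<and> \<beta> \<in> paths \<Lambda> \<and> \<gamma> \<in> paths \<Lambda> \<and> src \<Lambda> \<alpha> = rng \<Lambda> \<beta> \<and> src \<Lambda> \<beta> = rng \<Lambda> \<gamma> \<and>
       deg \<Lambda> \<alpha> = 0 \<and> deg \<Lambda> \<beta> = m - 0 \<and> deg \<Lambda> \<gamma> = deg \<Lambda> \<kappa> - m \<and> \<kappa> = \<alpha> \<cdot> (\<beta> \<cdot> \<gamma>)"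
    then obtain \<alpha> \<gamma>' where b: "\<alpha> \<in> paths \<Lambda>" "\<beta> \<in> paths \<Lambda>" "\<gamma>' \<in> paths \<Lambda>" "src \<Lambda> \<alpha> = rng \<Lambda> \<beta>" "src \<Lambda> \<beta> = rng \<Lambda> \<gamma>'"
       "deg \<Lambda> \<alpha> = 0" "deg \<Lambda> \<beta> = m" "\<kappa> = \<alpha> \<cdot> (\<beta> \<cdot> \<gamma>')"
      by (auto simp: fun_eq_iff)
    then have "\<kappa> = \<beta> \<cdot> \<gamma>'" using deg_zero[of \<alpha>] by (metis cmp_closed cmp_rng rng_cmp)
    then have "\<beta> \<preceq> \<kappa>" using b by (auto simp: prefix_def)
    then show "\<beta> = \<mu>" using \<mu> b prefix_unique by auto
  qed
  then show "segment \<Lambda> \<kappa> 0 m \<preceq> \<kappa>" "deg \<Lambda> (segment \<Lambda> \<kappa> 0 m) = m" using \<mu> by simp_all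
qed

lemma MCE_iff:
  "\<kappa> \<in> MCE \<Lambda> \<mu> \<nu> \<longleftrightarrow> deg \<Lambda> \<kappa> = sup (deg \<Lambda> \<mu>) (deg \<Lambda> \<nu>) \<and> \<mu> \<preceq> \<kappa> \<and> \<nu> \<preceq> \<kappa>"
proof -
  have *: "segment \<Lambda> \<kappa> 0 (deg \<Lambda> \<mu>) = \<mu> \<longleftrightarrow> \<mu> \<preceq> \<kappa>" if "\<kappa> \<in> paths \<Lambda>" "deg \<Lambda> \<mu> \<le> deg \<Lambda> \<kappa>" for \<mu>
    using segment_prefix[OF that] prefix_unique by metis
  show ?thesis
    by (auto simp: MCE_def * prefix_paths)
qed

lemma min_extD:
  assumes "p \<in> min_ext \<Lambda> \<mu> \<nu>"
  shows "fst p \<in> paths \<Lambda>" "snd p \<in> paths \<Lambda>" "src \<Lambda> \<mu> = rng \<Lambda> (fst p)" "src \<Lambda> \<nu> = rng \<Lambda> (snd p)"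
    "\<mu> \<cdot> fst p = \<nu> \<cdot> snd p" "\<mu> \<cdot> fst p \<in> MCE \<Lambda> \<mu> \<nu>"
  using assms by (auto simp: min_ext_def)

lemma min_ext_src: "\<lbrakk>p \<in> min_ext \<Lambda> \<mu> \<nu>; \<mu> \<in> paths \<Lambda>; \<nu> \<in> paths \<Lambda>\<rbrakk> \<Longrightarrow> src \<Lambda> (fst p) = src \<Lambda> (snd p)"
  using min_extD(1-5)[of p \<mu> \<nu>] src_cmp[of \<mu> "fst p"] src_cmp[of \<nu> "snd p"] by simp

lemma min_ext_swap: "(\<beta>, \<alpha>) \<in> min_ext \<Lambda> \<nu> \<mu> \<longleftrightarrow> (\<alpha>, \<beta>) \<in> min_ext \<Lambda> \<mu> \<nu>"
  by (auto simp: min_ext_def MCE_iff sup_commute)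

lemma rng_set_eq:
  assumes "v \<in> vertices \<Lambda>" "F \<subseteq> paths_to \<Lambda> v" "F \<noteq> {}" shows "rng_set \<Lambda> F = v"
  unfolding rng_set_def by (rule the_equality) (use assms in \<open>auto simp: paths_to_def\<close>)

text \<open>
  The prefix of \<open>\<gamma>\<close> of degree \<open>sup (deg \<mu>) (deg \<nu>)\<close> extends both \<open>\<mu>\<close> and \<open>\<nu>\<close>, because prefixes of one
  path are determined by their degrees. So paths with a common extension have a minimal one.
\<close>

lemma common_prefix_MCE:
  assumes "\<mu> \<preceq> \<gamma>" "\<nu> \<preceq> \<gamma>"
  obtains p where "p \<in> min_ext \<Lambda> \<mu> \<nu>" "\<mu> \<cdot> fst p \<preceq> \<gamma>"
proof -
  obtain \<xi> where \<xi>: "\<xi> \<preceq> \<gamma>" "deg \<Lambda> \<xi> = sup (deg \<Lambda> \<mu>) (deg \<Lambda> \<nu>)"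
    using factor[of \<gamma> "sup (deg \<Lambda> \<mu>) (deg \<Lambda> \<nu>)"] assms prefix_paths prefix_deg by (metis le_sup_iff)
  then have *: "\<mu> \<preceq> \<xi>" "\<nu> \<preceq> \<xi>"
    by - (rule prefix_of_prefix[OF assms(1) \<xi>(1)], simp add: \<xi>(2), rule prefix_of_prefix[OF assms(2) \<xi>(1)], simp add: \<xi>(2))
  then obtain \<alpha> \<beta> where "\<alpha> \<in> paths \<Lambda>" "\<beta> \<in> paths \<Lambda>" "src \<Lambda> \<mu> = rng \<Lambda> \<alpha>" "src \<Lambda> \<nu> = rng \<Lambda> \<beta>"
    "\<xi> = \<mu> \<cdot> \<alpha>" "\<xi> = \<nu> \<cdot> \<beta>"
    unfolding prefix_def by blast
  then have "(\<alpha>, \<beta>) \<in> min_ext \<Lambda> \<mu> \<nu>" "\<mu> \<cdot> \<alpha> \<preceq> \<gamma>" using \<xi> * by (auto simp: min_ext_def MCE_iff)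
  then show ?thesis using that[of "(\<alpha>, \<beta>)"] by simp
qed

lemma min_ext_eqI:
  assumes "p \<in> min_ext \<Lambda> \<mu> \<nu>" "p' \<in> min_ext \<Lambda> \<mu> \<nu>" "\<mu> \<in> paths \<Lambda>" "\<nu> \<in> paths \<Lambda>" "\<mu> \<cdot> fst p = \<mu> \<cdot> fst p'"
  shows "p = p'"
  by (rule prod_eqI; metis assms cmp_cancel(2) min_extD(1-5))

lemma min_ext_of_prefix:
  assumes "\<sigma> \<in> paths \<Lambda>" "\<beta> \<in> paths \<Lambda>" "src \<Lambda> \<sigma> = rng \<Lambda> \<beta>"
  shows "min_ext \<Lambda> \<sigma> (\<sigma> \<cdot> \<beta>) = {(\<beta>, src \<Lambda> \<beta>)}"
proof -
  have c: "\<sigma> \<cdot> \<beta> \<in> paths \<Lambda>" using assms by (simp add: cmp_closed)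
  have m: "(\<beta>, src \<Lambda> \<beta>) \<in> min_ext \<Lambda> \<sigma> (\<sigma> \<cdot> \<beta>)"
    using assms c cmp_src[OF c] unfolding min_ext_def MCE_iff
    by (auto simp: src_closed src_cmp rng_src prefix_cmp prefix_refl deg_cmp sup_fun_def sup_nat_def fun_eq_iff)
  have "p = (\<beta>, src \<Lambda> \<beta>)" if p: "p \<in> min_ext \<Lambda> \<sigma> (\<sigma> \<cdot> \<beta>)" for p
  proof (rule min_ext_eqI[OF p m assms(1) c])
    have "\<sigma> \<cdot> \<beta> \<preceq> \<sigma> \<cdot> fst p" "deg \<Lambda> (\<sigma> \<cdot> fst p) = deg \<Lambda> (\<sigma> \<cdot> \<beta>)"
      using min_extD(6)[OF p] assms unfolding MCE_iff by (auto simp: deg_cmp sup_fun_def sup_nat_def fun_eq_iff)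
    then show "\<sigma> \<cdot> fst p = \<sigma> \<cdot> fst (\<beta>, src \<Lambda> \<beta>)" using prefix_antisym[of "\<sigma> \<cdot> \<beta>" "\<sigma> \<cdot> fst p"] by simp
  qed
  then show ?thesis using m by blast
qed

end

context finitely_aligned_k_graph
begin

lemma finite_min_ext:
  assumes "\<mu> \<in> paths \<Lambda>" "\<nu> \<in> paths \<Lambda>"
  shows "finite (min_ext \<Lambda> \<mu> \<nu>)"
proof (rule inj_on_finite)
  show "inj_on (\<lambda>p. \<mu> \<cdot> fst p) (min_ext \<Lambda> \<mu> \<nu>)"
    using assms min_ext_eqI by (auto intro!: inj_onI)
  show "(\<lambda>p. \<mu> \<cdot> fst p) ` min_ext \<Lambda> \<mu> \<nu> \<subseteq> MCE \<Lambda> \<mu> \<nu>" using min_extD(6) by auto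
qed (rule finite_MCE[OF assms])

end

section \<open>Finite sets of paths closed under minimal extensions\<close>

context k_graph
begin

text \<open>
  The monomials \<open>t \<kappa> (t \<mu>)\<^sup>*\<close> of twins are the ones that the gauge action fixes and whose two factors
  meet at a common source. A product of two of them is a sum over minimal extensions, and
  \<open>closed_paths\<close> says that this sum stays within the monomials of twins in the same set.
\<close>

definition twins :: "'l set \<Rightarrow> ('l \<times> 'l) set" where
  "twins P = {(\<kappa>, \<mu>). \<kappa> \<in> P \<and> \<mu> \<in> P \<and> deg \<Lambda> \<kappa> = deg \<Lambda> \<mu> \<and> src \<Lambda> \<kappa> = src \<Lambda> \<mu>}"

definition closed_paths :: "'l set \<Rightarrow> bool" where
  "closed_paths P \<longleftrightarrow> P \<subseteq> paths \<Lambda> \<and>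
     (\<forall>\<kappa> \<mu> \<sigma>. \<forall>p\<in>min_ext \<Lambda> \<mu> \<sigma>. (\<kappa>, \<mu>) \<in> twins P \<longrightarrow> \<sigma> \<in> P \<longrightarrow> \<kappa> \<cdot> fst p \<in> P)"

inductive_set path_closure :: "'l set \<Rightarrow> 'l set" for F where
  base: "\<kappa> \<in> F \<Longrightarrow> \<kappa> \<in> path_closure F"
| step: "\<lbrakk>\<kappa> \<in> path_closure F; \<mu> \<in> path_closure F; \<sigma> \<in> path_closure F; deg \<Lambda> \<kappa> = deg \<Lambda> \<mu>;
    src \<Lambda> \<kappa> = src \<Lambda> \<mu>; p \<in> min_ext \<Lambda> \<mu> \<sigma>\<rbrakk> \<Longrightarrow> \<kappa> \<cdot> fst p \<in> path_closure F"

lemma path_closure_paths: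
  assumes "F \<subseteq> paths \<Lambda>" "\<kappa> \<in> path_closure F" shows "\<kappa> \<in> paths \<Lambda>"
  using assms(2)
proof induction
  case (step \<kappa> \<mu> \<sigma> p) then show ?case using min_extD[OF step(6)] by (intro cmp_closed) auto
qed (use assms(1) in auto)

lemma path_closure_closed: "F \<subseteq> paths \<Lambda> \<Longrightarrow> closed_paths (path_closure F)"
  unfolding closed_paths_def twins_def by (auto intro: path_closure.step path_closure_paths)

lemma path_closure_deg:
  assumes "F \<subseteq> paths \<Lambda>" "\<And>\<kappa>. \<kappa> \<in> F \<Longrightarrow> deg \<Lambda> \<kappa> \<le> N" "\<kappa> \<in> path_closure F" shows "deg \<Lambda> \<kappa> \<le> N"
  using assms(3)
proof induction
  case (step \<kappa> \<mu> \<sigma> p)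
  have "deg \<Lambda> (\<kappa> \<cdot> fst p) = deg \<Lambda> (\<mu> \<cdot> fst p)"
    using step path_closure_paths[OF assms(1)] min_extD(1,3)[OF step(6)] by (simp add: deg_cmp)
  also have "\<dots> = sup (deg \<Lambda> \<mu>) (deg \<Lambda> \<sigma>)" using min_extD(6)[OF step(6)] by (simp add: MCE_iff)
  finally have "deg \<Lambda> (\<kappa> \<cdot> fst p) = sup (deg \<Lambda> \<mu>) (deg \<Lambda> \<sigma>)" .
  then show ?case using le_supI[OF step.IH(2,3)] by metis
qed (use assms(2) in auto)

end

context finitely_aligned_k_graph
begin

definition size_of :: "'a \<Rightarrow> nat" where "size_of \<kappa> = (\<Sum>i\<in>UNIV. deg \<Lambda> \<kappa> i)"

lemma size_less:
  assumes "deg \<Lambda> \<kappa> \<le> deg \<Lambda> \<mu>" "deg \<Lambda> \<kappa> \<noteq> deg \<Lambda> \<mu>" shows "size_of \<kappa> < size_of \<mu>"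
proof -
  obtain i where i: "deg \<Lambda> \<kappa> i \<noteq> deg \<Lambda> \<mu> i" using assms(2) by auto
  then have "deg \<Lambda> \<kappa> i < deg \<Lambda> \<mu> i" using assms(1) by (simp add: le_fun_def order_less_le)
  then show ?thesis
    unfolding size_of_def using assms(1) by (intro sum_strict_mono_ex1) (auto simp: le_fun_def)
qed

text \<open>
  Induction on the total degree \<open>j\<close>, with \<open>L j\<close> the members of smaller total degree. The members of
  total degree \<open>j\<close> arise by replacing heads, \<open>\<mu> \<cdot> \<alpha>\<close> becoming \<open>\<kappa> \<cdot> \<alpha>\<close>, and this may be repeated. It
  stays within finitely many paths since every member outside \<open>F\<close> has a head in \<open>L j\<close> and a tail in
  \<open>S j\<close>, the set of tails of the paths in \<open>M j\<close>, which are generators or minimal common extensions of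
  members of \<open>L j\<close>. The case to check is \<open>\<sigma> = \<mu> \<cdot> \<alpha> = \<mu>' \<cdot> \<alpha>'\<close> with \<open>\<mu>' \<in> L j\<close>, \<open>\<alpha>' \<in> S j\<close>: the least
  prefix of \<open>\<sigma>\<close> above \<open>\<mu>\<close> and \<open>\<mu>'\<close> is either \<open>\<sigma>\<close>, a member of \<open>M j\<close>, or short enough to be
  absorbed into the new head.
\<close>

lemma finite_path_closure:
  assumes F: "finite F" "F \<subseteq> paths \<Lambda>"
  shows "finite (path_closure F)"
proof -
  define L where "L j = {\<kappa> \<in> path_closure F. size_of \<kappa> < j}" for j
  define M where "M j = F \<union> (\<Union>\<mu>\<in>L j. \<Union>\<sigma>\<in>L j. MCE \<Lambda> \<mu> \<sigma>)" for j
  define S where "S j = (\<Union>\<xi>\<in>M j. \<Union>\<mu>\<in>{\<mu>. \<mu> \<preceq> \<xi>}. {\<alpha> \<in> paths \<Lambda>. src \<Lambda> \<mu> = rng \<Lambda> \<alpha> \<and> \<mu> \<cdot> \<alpha> = \<xi>})" for j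
  note cp = path_closure_paths[OF F(2)]
  have fS: "finite (S j)" if "finite (L j)" for j
  proof -
    have Mf: "finite (M j)" unfolding M_def using that F by (auto simp: L_def intro!: finite_MCE cp)
    have pf: "finite {\<mu>. \<mu> \<preceq> \<xi>}" for \<xi>
    proof (rule inj_on_finite)
      show "inj_on (deg \<Lambda>) {\<mu>. \<mu> \<preceq> \<xi>}" using prefix_unique by (auto intro!: inj_onI)
      show "deg \<Lambda> ` {\<mu>. \<mu> \<preceq> \<xi>} \<subseteq> {n. n \<le> deg \<Lambda> \<xi>}" using prefix_deg by auto
      have "{n. n \<le> deg \<Lambda> \<xi>} \<subseteq> PiE UNIV (\<lambda>i. {..deg \<Lambda> \<xi> i})" by (auto simp: le_fun_def)
      then show "finite {n. n \<le> deg \<Lambda> \<xi>}" by (rule finite_subset) (auto intro: finite_PiE)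
    qed
    have "finite {\<alpha> \<in> paths \<Lambda>. src \<Lambda> \<mu> = rng \<Lambda> \<alpha> \<and> \<mu> \<cdot> \<alpha> = \<xi>}" if \<mu>: "\<mu> \<preceq> \<xi>" for \<mu> \<xi>
    proof -
      obtain \<alpha> where a: "\<mu> \<in> paths \<Lambda>" "\<alpha> \<in> paths \<Lambda>" "src \<Lambda> \<mu> = rng \<Lambda> \<alpha>" "\<xi> = \<mu> \<cdot> \<alpha>" using \<mu> by (rule prefixE)
      have "{\<alpha> \<in> paths \<Lambda>. src \<Lambda> \<mu> = rng \<Lambda> \<alpha> \<and> \<mu> \<cdot> \<alpha> = \<xi>} \<subseteq> {\<alpha>}"
        using a cmp_cancel(2)[of \<mu> \<mu>] by auto
      then show ?thesis by (rule finite_subset) simp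
    qed
    then show ?thesis unfolding S_def using Mf pf by auto
  qed
  have key: "\<kappa> \<in> F \<or> (\<exists>\<mu>\<in>L j. \<exists>\<alpha>\<in>S j. src \<Lambda> \<mu> = rng \<Lambda> \<alpha> \<and> \<kappa> = \<mu> \<cdot> \<alpha>)"
    if "\<kappa> \<in> path_closure F" "size_of \<kappa> = j" for \<kappa> j
    using that
  proof induction
    case (step \<kappa> \<mu> \<sigma> p)
    obtain \<alpha> \<beta> where p: "p = (\<alpha>, \<beta>)" by force
    note m = min_extD[OF step(6), unfolded p, simplified]
    note c = cp[OF step(1)] cp[OF step(2)] cp[OF step(3)]
    have d\<alpha>: "deg \<Lambda> (\<kappa> \<cdot> \<alpha>) = deg \<Lambda> (\<mu> \<cdot> \<alpha>)" using c m(1,3) step(4,5) by (simp add: deg_cmp)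
    have d: "deg \<Lambda> (\<mu> \<cdot> \<alpha>) = sup (deg \<Lambda> \<mu>) (deg \<Lambda> \<sigma>)" and \<mu>\<alpha>: "\<mu> \<preceq> \<mu> \<cdot> \<alpha>" "\<sigma> \<preceq> \<mu> \<cdot> \<alpha>"
      using m(6) by (auto simp: MCE_iff)
    show ?case
    proof (cases "deg \<Lambda> \<mu> = deg \<Lambda> (\<mu> \<cdot> \<alpha>)")
      case True
      then have "deg \<Lambda> \<alpha> = 0" using deg_cmp[OF c(2) m(1,3)] by simp
      then have "\<kappa> \<cdot> \<alpha> = \<kappa>" using deg_zero[OF m(1)] m c step cmp_src by metis
      then show ?thesis using step p by simp
    next
      case False
      then have sz: "size_of \<mu> < j" "size_of \<kappa> < j"
        using size_less[of \<mu> "\<mu> \<cdot> \<alpha>"] size_less[of \<kappa> "\<kappa> \<cdot> \<alpha>"] d d\<alpha> step p by (auto simp: size_of_def)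
      then have kL: "\<kappa> \<in> L j" "\<mu> \<in> L j" using step by (auto simp: L_def)
      have tail_S: "\<alpha> \<in> S j" if "\<mu> \<cdot> \<alpha> \<in> M j"
        unfolding S_def using that m c \<mu>\<alpha> by blast
      have kS: ?thesis if "\<alpha> \<in> S j" using kL that m step p by (intro disjI2 bexI[of _ \<kappa>] bexI[of _ \<alpha>]) auto
      show ?thesis
      proof (cases "deg \<Lambda> \<sigma> = deg \<Lambda> (\<mu> \<cdot> \<alpha>)")
        case False
        then have "size_of \<sigma> < j"
          using size_less[of \<sigma> "\<mu> \<cdot> \<alpha>"] d d\<alpha> step p by (auto simp: size_of_def)
        then have "\<sigma> \<in> L j" using step by (auto simp: L_def)
        then show ?thesis using kL m(6) by (intro kS tail_S) (auto simp: M_def)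
      next
        case True
        then have \<sigma>eq: "\<sigma> = \<mu> \<cdot> \<alpha>" using prefix_antisym[OF \<mu>\<alpha>(2)] by simp
        have "size_of \<sigma> = j" using True d\<alpha> step p by (simp add: size_of_def)
        then consider "\<sigma> \<in> F" | \<mu>' \<alpha>' where "\<mu>' \<in> L j" "\<alpha>' \<in> S j" "src \<Lambda> \<mu>' = rng \<Lambda> \<alpha>'" "\<sigma> = \<mu>' \<cdot> \<alpha>'"
          using step.IH(3) by blast
        then show ?thesis
        proof cases
          case 1 then show ?thesis using \<sigma>eq by (intro kS tail_S) (simp add: M_def)
        next
          case (2 \<mu>' \<alpha>')
          have S_paths: "\<alpha>' \<in> paths \<Lambda>" using 2 by (auto simp: S_def)
          have m': "\<mu>' \<in> paths \<Lambda>" "\<mu>' \<in> path_closure F" using 2 by (auto simp: L_def intro: cp)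
          have pre: "\<mu>' \<preceq> \<sigma>" using 2 m' S_paths by (simp add: prefix_cmp)
          obtain p' where p': "p' \<in> min_ext \<Lambda> \<mu> \<mu>'" "\<mu> \<cdot> fst p' \<preceq> \<sigma>"
            using common_prefix_MCE[of \<mu> \<sigma> \<mu>'] pre \<mu>\<alpha> \<sigma>eq by metis
          note q = min_extD[OF p'(1)]
          show ?thesis
          proof (cases "deg \<Lambda> (\<mu> \<cdot> fst p') = deg \<Lambda> \<sigma>")
            case True
            then have "\<mu> \<cdot> fst p' = \<mu> \<cdot> \<alpha>" using prefix_antisym[OF p'(2)] \<sigma>eq by simp
            then have "\<mu> \<cdot> \<alpha> \<in> MCE \<Lambda> \<mu> \<mu>'" using q(6) by simp
            then show ?thesis using kL 2 by (intro kS tail_S) (auto simp: M_def)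
          next
            case False
            define \<nu> where "\<nu> = \<kappa> \<cdot> fst p'"
            have \<nu>: "\<nu> \<in> path_closure F" unfolding \<nu>_def
              by (rule path_closure.step[OF step(1,2) m'(2) step(4,5) p'(1)])
            obtain \<delta> where \<delta>: "\<delta> \<in> paths \<Lambda>" "src \<Lambda> (\<mu> \<cdot> fst p') = rng \<Lambda> \<delta>" "\<sigma> = \<mu> \<cdot> fst p' \<cdot> \<delta>"
              using p'(2) by (rule prefixE)
            have sd: "src \<Lambda> (fst p') = rng \<Lambda> \<delta>" using \<delta>(2) src_cmp[OF c(2) q(1,3)] by simp
            have "\<mu> \<cdot> \<alpha> = \<mu> \<cdot> (fst p' \<cdot> \<delta>)" using \<delta>(3) \<sigma>eq cmp_assoc[OF c(2) q(1) \<delta>(1) q(3) sd] by simp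
            then have a: "\<alpha> = fst p' \<cdot> \<delta>"
              using c m(1-3) q(1,3) \<delta>(1) sd cmp_cancel(2)[of \<mu> \<mu> \<alpha> "fst p' \<cdot> \<delta>"] by (simp add: cmp_closed rng_cmp)
            have e: "\<kappa> \<cdot> \<alpha> = \<nu> \<cdot> \<delta>" "src \<Lambda> \<nu> = rng \<Lambda> \<delta>" unfolding a \<nu>_def
              using c q(1,3) \<delta>(1) sd step(4,5) by (simp_all add: cmp_assoc src_cmp)
            have "deg \<Lambda> \<nu> = deg \<Lambda> (\<mu> \<cdot> fst p')" unfolding \<nu>_def using c q(1,3) step(4,5) by (simp add: deg_cmp)
            then have "size_of \<nu> < j"
              using size_less[of \<nu> \<sigma>] False prefix_deg[OF p'(2)] \<open>size_of \<sigma> = j\<close> by simp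
            then have "\<nu> \<in> L j" using \<nu> by (simp add: L_def)
            \<comment> \<open>The tail \<open>\<delta>\<close> of \<open>\<sigma> = \<mu>' \<cdot> \<alpha>'\<close> is also a tail of \<open>\<alpha>'\<close>, hence of the path in \<open>M j\<close> behind \<open>\<alpha>'\<close>.\<close>
            have "\<delta> \<in> S j"
            proof -
              obtain \<xi> \<eta> where \<xi>: "\<xi> \<in> M j" "\<eta> \<preceq> \<xi>" "src \<Lambda> \<eta> = rng \<Lambda> \<alpha>'" "\<eta> \<cdot> \<alpha>' = \<xi>"
                using 2 by (auto simp: S_def)
              have "\<mu>' \<cdot> snd p' \<cdot> \<delta> = \<mu>' \<cdot> \<alpha>'" using \<delta> 2 q(5) by simp
              then have "\<mu>' \<cdot> (snd p' \<cdot> \<delta>) = \<mu>' \<cdot> \<alpha>'" and sd': "src \<Lambda> (snd p') = rng \<Lambda> \<delta>"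
                using q \<delta> m' sd min_ext_src[OF p'(1)] c by (simp_all add: cmp_assoc)
              then have "\<alpha>' = snd p' \<cdot> \<delta>"
                using q \<delta> m' 2 S_paths cmp_cancel(2)[of \<mu>' \<mu>' \<alpha>' "snd p' \<cdot> \<delta>"] by (simp add: cmp_closed rng_cmp)
              moreover have "\<eta> \<in> paths \<Lambda>" "src \<Lambda> \<eta> = rng \<Lambda> (snd p')"
                using \<xi> prefix_paths calculation q \<delta> sd' by (auto simp: rng_cmp)
              ultimately have "\<eta> \<cdot> snd p' \<cdot> \<delta> = \<xi>" "\<eta> \<cdot> snd p' \<in> paths \<Lambda>" "src \<Lambda> (\<eta> \<cdot> snd p') = rng \<Lambda> \<delta>"
                using \<xi> q \<delta> sd' by (simp_all add: cmp_assoc cmp_closed src_cmp)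
              moreover from this have "\<eta> \<cdot> snd p' \<preceq> \<xi>" using \<delta> by (auto simp: prefix_def)
              ultimately show ?thesis unfolding S_def using \<xi>(1) \<delta>(1) by blast
            qed
            then show ?thesis using \<open>\<nu> \<in> L j\<close> e p by auto
          qed
        qed
      qed
    qed
  qed simp
  have fL: "finite (L j)" for j
  proof (induction j)
    case 0 show ?case by (simp add: L_def)
  next
    case (Suc j)
    have "L (Suc j) \<subseteq> L j \<union> F \<union> (\<lambda>(\<mu>, \<alpha>). \<mu> \<cdot> \<alpha>) ` (L j \<times> S j)"
    proof
      fix \<kappa> assume k: "\<kappa> \<in> L (Suc j)"
      show "\<kappa> \<in> L j \<union> F \<union> (\<lambda>(\<mu>, \<alpha>). \<mu> \<cdot> \<alpha>) ` (L j \<times> S j)"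
      proof (cases "size_of \<kappa> = j")
        case True
        then show ?thesis using k key[of \<kappa> j] by (auto simp: L_def)
      qed (use k in \<open>auto simp: L_def\<close>)
    qed
    then show ?case using Suc fS[OF Suc] F by (auto intro: finite_subset)
  qed
  define N where "N i = (\<Sum>\<kappa>\<in>F. deg \<Lambda> \<kappa> i)" for i
  have "deg \<Lambda> \<kappa> \<le> N" if "\<kappa> \<in> F" for \<kappa>
    unfolding le_fun_def N_def using that F(1) by (auto intro!: member_le_sum)
  then have "deg \<Lambda> \<kappa> \<le> N" if "\<kappa> \<in> path_closure F" for \<kappa> using path_closure_deg[OF F(2)] that by blast
  then have "size_of \<kappa> < Suc (\<Sum>i\<in>UNIV. N i)" if "\<kappa> \<in> path_closure F" for \<kappa>
    using that unfolding size_of_def by (auto simp: le_fun_def less_Suc_eq_le intro!: sum_mono)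
  then have "path_closure F \<subseteq> L (Suc (\<Sum>i\<in>UNIV. N i))" by (auto simp: L_def)
  then show ?thesis using fL finite_subset by blast
qed

end

section \<open>Spans and finite sums in C*-algebras\<close>

context pre_cstar_algebra
begin

lemma finsum_mult_left:
  "\<lbrakk>a \<in> carrier A; f \<in> I \<rightarrow> carrier A\<rbrakk> \<Longrightarrow> a \<otimes> finsum A f I = finsum A (\<lambda>i. a \<otimes> f i) I"
proof (induction I rule: infinite_finite_induct)
  case (insert i I)
  then have "(\<lambda>i. a \<otimes> f i) \<in> I \<rightarrow> carrier A" by (auto simp: Pi_iff)
  with insert show ?case by (simp add: finsum_insert r_distr finsum_closed)
qed (simp_all add: finsum_infinite finsum_empty)

lemma finsum_mult_right:
  "\<lbrakk>a \<in> carrier A; f \<in> I \<rightarrow> carrier A\<rbrakk> \<Longrightarrow> finsum A f I \<otimes> a = finsum A (\<lambda>i. f i \<otimes> a) I"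
proof (induction I rule: infinite_finite_induct)
  case (insert i I)
  then have "(\<lambda>i. f i \<otimes> a) \<in> I \<rightarrow> carrier A" by (auto simp: Pi_iff)
  with insert show ?case by (simp add: finsum_insert l_distr finsum_closed)
qed (simp_all add: finsum_infinite finsum_empty)

lemma finsum_adj:
  "f \<in> I \<rightarrow> carrier A \<Longrightarrow> adj A (finsum A f I) = finsum A (\<lambda>i. adj A (f i)) I"
proof (induction I rule: infinite_finite_induct)
  case (insert i I)
  then have "(\<lambda>i. adj A (f i)) \<in> I \<rightarrow> carrier A" by (auto simp: Pi_iff)
  with insert show ?case by (simp add: finsum_insert adj_add finsum_closed)
qed (simp_all add: finsum_infinite finsum_empty)

lemma nrm_finsum_le:
  "\<lbrakk>finite I; f \<in> I \<rightarrow> carrier A\<rbrakk> \<Longrightarrow> nrm A (finsum A f I) \<le> (\<Sum>i\<in>I. nrm A (f i))"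
proof (induction I rule: finite_induct)
  case (insert i I)
  then have "f \<in> I \<rightarrow> carrier A" "f i \<in> carrier A" by auto
  with insert nrm_add[of "f i" "finsum A f I"] show ?case by (simp add: finsum_insert finsum_closed)
qed (simp add: finsum_empty)

lemma finsum_all_zero: "(\<And>i. i \<in> I \<Longrightarrow> f i = \<zero>) \<Longrightarrow> finsum A f I = \<zero>"
  by (rule add.finprod_one_eqI)

lemma adj_mult_zero: "\<lbrakk>y \<in> carrier A; adj A y \<otimes> y = \<zero>\<rbrakk> \<Longrightarrow> y = \<zero>"
  using nrm_adj_mult[of y] by (simp add: nrm_eq_0)

inductive_set lin_span :: "'a set \<Rightarrow> 'a set" for S where
  zero: "\<zero> \<in> lin_span S"
| step: "\<lbrakk>x \<in> S; y \<in> lin_span S\<rbrakk> \<Longrightarrow> smul A c x \<oplus> y \<in> lin_span S"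

lemma lin_span_closed: "\<lbrakk>x \<in> lin_span S; S \<subseteq> carrier A\<rbrakk> \<Longrightarrow> x \<in> carrier A"
  by (induction rule: lin_span.induct) auto

lemma lin_span_base: "\<lbrakk>x \<in> S; S \<subseteq> carrier A\<rbrakk> \<Longrightarrow> x \<in> lin_span S"
  using lin_span.step[of x S \<zero> 1] lin_span.zero by (simp add: subset_iff)

lemma lin_span_add:
  assumes "x \<in> lin_span S" "y \<in> lin_span S" "S \<subseteq> carrier A" shows "x \<oplus> y \<in> lin_span S"
  using assms(1)
proof induction
  case zero then show ?case using assms lin_span_closed by simp
next
  case (step u z c)
  then have "smul A c u \<oplus> z \<oplus> y = smul A c u \<oplus> (z \<oplus> y)"
    using assms by (intro a_assoc) (auto intro: lin_span_closed)
  then show ?case using lin_span.step[OF step(1) step.IH, of c] by simp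
qed

lemma lin_span_smul:
  assumes "x \<in> lin_span S" "S \<subseteq> carrier A" shows "smul A c x \<in> lin_span S"
  using assms(1)
proof induction
  case (step u z d)
  then have "u \<in> carrier A" "z \<in> carrier A" using assms(2) lin_span_closed by auto
  then show ?case using lin_span.step[OF step(1) step.IH, of "c * d"] by (simp add: smul_add_right smul_smul)
qed (simp add: lin_span.zero)

lemma lin_span_finsum:
  assumes "\<And>i. i \<in> I \<Longrightarrow> f i \<in> lin_span S" "S \<subseteq> carrier A" shows "finsum A f I \<in> lin_span S"
  using assms(1)
proof (induction I rule: infinite_finite_induct)
  case (insert i I)
  then have "f \<in> I \<rightarrow> carrier A" "f i \<in> carrier A" using assms(2) lin_span_closed by auto
  with insert show ?case using assms(2) by (simp add: finsum_insert lin_span_add)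
qed (simp_all add: finsum_infinite finsum_empty lin_span.zero)

lemma lin_span_mono: "\<lbrakk>x \<in> lin_span S; S \<subseteq> T\<rbrakk> \<Longrightarrow> x \<in> lin_span T"
  by (induction rule: lin_span.induct) (auto intro: lin_span.intros)

lemma lin_span_finite:
  "x \<in> lin_span S \<Longrightarrow> \<exists>T. finite T \<and> T \<subseteq> S \<and> x \<in> lin_span T"
proof (induction rule: lin_span.induct)
  case zero show ?case by (intro exI[of _ "{}"]) (simp add: lin_span.zero)
next
  case (step x y c)
  then obtain T where "finite T" "T \<subseteq> S" "y \<in> lin_span T" by blast
  then show ?case using step(1)
    by (intro exI[of _ "insert x T"]) (auto intro: lin_span.step lin_span_mono)
qed

lemma lin_span_insert:
  assumes S: "S \<subseteq> carrier A" and m: "m \<in> carrier A" and x: "x \<in> lin_span (insert m S)"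
  shows "\<exists>c. \<exists>y\<in>lin_span S. x = smul A c m \<oplus> y"
  using x
proof induction
  case zero show ?case using m lin_span.zero[of S] by (intro exI[of _ 0]) force
next
  case (step u z d)
  then obtain c y where z: "z = smul A c m \<oplus> y" "y \<in> lin_span S" by blast
  have yc: "y \<in> carrier A" using z(2) S by (rule lin_span_closed)
  show ?case
  proof (cases "u = m")
    case True
    then have "smul A d u \<oplus> z = smul A (d + c) m \<oplus> y" using z m yc by (simp add: smul_add_left a_assoc)
    then show ?thesis using z by blast
  next
    case False
    then have u: "u \<in> S" using step(1) by simp
    then have "smul A d u \<oplus> z = smul A c m \<oplus> (smul A d u \<oplus> y)" using z m yc S by (simp add: a_lcomm subset_iff)
    then show ?thesis using lin_span.step[OF u z(2)] by blast
  qed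
qed

lemma lin_span_mult:
  assumes S: "S \<subseteq> carrier A" and mult: "\<And>x y. \<lbrakk>x \<in> S; y \<in> S\<rbrakk> \<Longrightarrow> x \<otimes> y \<in> lin_span S"
    and x: "x \<in> lin_span S" and y: "y \<in> lin_span S"
  shows "x \<otimes> y \<in> lin_span S"
  using x
proof induction
  case zero show ?case using y S lin_span_closed by (simp add: lin_span.zero)
next
  case (step u z c)
  note cl = lin_span_closed[OF _ S] and u = step(1)
  have "u \<otimes> y \<in> lin_span S"
    using y
  proof induction
    case zero show ?case using u S by (simp add: lin_span.zero subset_iff)
  next
    case (step w v d)
    then have "u \<in> carrier A" "w \<in> carrier A" "v \<in> carrier A" using u S cl by auto
    then have "u \<otimes> (smul A d w \<oplus> v) = smul A d (u \<otimes> w) \<oplus> u \<otimes> v"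
      by (simp add: r_distr smul_mult_right)
    then show ?case using step mult u S by (simp add: lin_span_add lin_span_smul)
  qed
  moreover have "(smul A c u \<oplus> z) \<otimes> y = smul A c (u \<otimes> y) \<oplus> z \<otimes> y"
    using step S y cl by (subst l_distr) (auto simp: smul_mult_left)
  ultimately show ?case using step S by (simp add: lin_span_add lin_span_smul)
qed

lemma lin_span_adj:
  assumes S: "S \<subseteq> carrier A" and adj: "\<And>x. x \<in> S \<Longrightarrow> adj A x \<in> S" and x: "x \<in> lin_span S"
  shows "adj A x \<in> lin_span S"
  using x
proof induction
  case (step u z c)
  then have "adj A (smul A c u \<oplus> z) = smul A (cnj c) (adj A u) \<oplus> adj A z"
    using S lin_span_closed[OF _ S] by (subst adj_add) (auto simp: adj_smul)
  then show ?case using lin_span.step[OF adj[OF step(1)] step.IH] by simp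
qed (simp add: lin_span.zero)

end

lemma le_of_power_bound:
  fixes a b K :: real
  assumes "0 \<le> a" "0 \<le> b" and le: "\<And>n. a ^ (2 ^ n) \<le> K * b ^ (2 ^ n)"
  shows "a \<le> b"
proof (rule ccontr)
  assume "\<not> a \<le> b"
  show False
  proof (cases "b = 0")
    case True then show ?thesis using le[of 0] \<open>\<not> a \<le> b\<close> by simp
  next
    case False
    then have b: "b > 0" "a / b > 1" using assms \<open>\<not> a \<le> b\<close> by auto
    obtain n where n: "K < (a / b) ^ n" using real_arch_pow[OF b(2)] by blast
    also have "\<dots> \<le> (a / b) ^ (2 ^ n)" using b by (intro power_increasing) auto
    finally have "K * b ^ (2 ^ n) < a ^ (2 ^ n)" using b by (simp add: power_divide field_simps)
    then show ?thesis using le[of n] by simp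
  qed
qed

text \<open>
  The C*-identity makes the norm of a self-adjoint element the growth rate of the norms of its
  powers, and a growth rate is insensitive to a constant factor.
\<close>

lemma (in star_homomorphism) isometric_of_bounded_below:
  assumes M: "M \<subseteq> carrier A" and mult: "\<And>x y. \<lbrakk>x \<in> M; y \<in> M\<rbrakk> \<Longrightarrow> x \<otimes>\<^bsub>A\<^esub> y \<in> M"
    and adj: "\<And>x. x \<in> M \<Longrightarrow> adj A x \<in> M"
    and bound: "\<And>x. x \<in> M \<Longrightarrow> nrm A x \<le> K * nrm B (\<pi> x)" and x: "x \<in> M"
  shows "nrm A x \<le> nrm B (\<pi> x)"
proof -
  define h where "h n = rec_nat (adj A x \<otimes>\<^bsub>A\<^esub> x) (\<lambda>_ y. y \<otimes>\<^bsub>A\<^esub> y) n" for n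
  have h0: "h 0 = adj A x \<otimes>\<^bsub>A\<^esub> x" and hS: "h (Suc n) = h n \<otimes>\<^bsub>A\<^esub> h n" for n by (simp_all add: h_def)
  have xc: "x \<in> carrier A" using x M by auto
  have hM: "h n \<in> M" for n by (induction n) (simp_all add: h0 hS mult adj x)
  then have hc: "h n \<in> carrier A" for n using M by auto
  have ha: "adj A (h n) = h n" for n
    by (induction n) (use xc hc in \<open>simp_all add: h0 hS A.adj_mult\<close>)
  have nA: "nrm A (h n) = ((nrm A x)\<^sup>2) ^ (2 ^ n)" for n
  proof (induction n)
    case (Suc n)
    have "nrm A (h (Suc n)) = (nrm A (h n))\<^sup>2" using A.nrm_adj_mult[OF hc] by (simp add: hS ha)
    then show ?case using Suc by (simp add: power_mult[symmetric] mult.commute)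
  qed (simp add: h0 A.nrm_adj_mult xc)
  have nB: "nrm B (\<pi> (h n)) = ((nrm B (\<pi> x))\<^sup>2) ^ (2 ^ n)" for n
  proof (induction n)
    case 0 show ?case using B.nrm_adj_mult[of "\<pi> x"] xc by (simp add: h0 hom_mult hom_adj)
  next
    case (Suc n)
    have "nrm B (\<pi> (h (Suc n))) = (nrm B (\<pi> (h n)))\<^sup>2"
      using B.nrm_adj_mult[of "\<pi> (h n)"] hc by (simp add: hS hom_mult hom_adj[symmetric] ha)
    then show ?case using Suc by (simp add: power_mult[symmetric] mult.commute)
  qed
  have "(nrm A x)\<^sup>2 \<le> (nrm B (\<pi> x))\<^sup>2"
    by (rule le_of_power_bound[where K = K]) (use bound[OF hM] in \<open>simp_all add: nA nB\<close>)
  then show ?thesis using xc by (simp add: power2_le_iff_abs_le)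
qed

section \<open>Calculus in a Toeplitz--Cuntz--Krieger family\<close>

text \<open>
  The product of the gaps along an enumeration. The empty product is \<open>t v\<close>, the unit of the corner
  in which all factors live.
\<close>

primrec gap_list :: "'b cstar \<Rightarrow> ('l \<Rightarrow> 'b) \<Rightarrow> 'l \<Rightarrow> 'l list \<Rightarrow> 'b" where
  "gap_list A t v [] = t v"
| "gap_list A t v (\<nu> # xs) = (t v \<ominus>\<^bsub>A\<^esub> t \<nu> \<otimes>\<^bsub>A\<^esub> adj A (t \<nu>)) \<otimes>\<^bsub>A\<^esub> gap_list A t v xs"

text \<open>
  For the empty collection no gap projection is required to vanish.
\<close>

locale toeplitz_family = finitely_aligned_k_graph \<Lambda> + pre_cstar_algebra A
  for \<Lambda> :: "('l, 'k::finite) kgraph" and A :: "'b cstar" (structure) +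
  fixes t :: "'l \<Rightarrow> 'b"
  assumes family: "relative_CK_family \<Lambda> {} A t"
begin

lemma t_closed [simp]: "\<kappa> \<in> paths \<Lambda> \<Longrightarrow> t \<kappa> \<in> carrier A"
  using family by (simp add: relative_CK_family_def)

lemma t_partial: "\<kappa> \<in> paths \<Lambda> \<Longrightarrow> t \<kappa> \<otimes> adj A (t \<kappa>) \<otimes> t \<kappa> = t \<kappa>"
  using family by (simp add: relative_CK_family_def)

lemma t_vertex: "v \<in> vertices \<Lambda> \<Longrightarrow> adj A (t v) = t v" "v \<in> vertices \<Lambda> \<Longrightarrow> t v \<otimes> t v = t v"
  using family by (simp_all add: relative_CK_family_def)

lemma t_orthogonal: "\<lbrakk>v \<in> vertices \<Lambda>; w \<in> vertices \<Lambda>; v \<noteq> w\<rbrakk> \<Longrightarrow> t v \<otimes> t w = \<zero>"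
  using family by (simp add: relative_CK_family_def)

lemma t_cmp: "\<lbrakk>\<kappa> \<in> paths \<Lambda>; \<mu> \<in> paths \<Lambda>; src \<Lambda> \<kappa> = rng \<Lambda> \<mu>\<rbrakk> \<Longrightarrow> t (\<kappa> \<cdot> \<mu>) = t \<kappa> \<otimes> t \<mu>"
  using family by (simp add: relative_CK_family_def)

lemma t_star: "\<lbrakk>\<kappa> \<in> paths \<Lambda>; \<mu> \<in> paths \<Lambda>\<rbrakk> \<Longrightarrow> adj A (t \<kappa>) \<otimes> t \<mu> =
    finsum A (\<lambda>q. t (fst q) \<otimes> adj A (t (snd q))) (min_ext \<Lambda> \<kappa> \<mu>)"
  using family by (simp add: relative_CK_family_def)

lemma t_rng: "\<kappa> \<in> paths \<Lambda> \<Longrightarrow> t (rng \<Lambda> \<kappa>) \<otimes> t \<kappa> = t \<kappa>"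
  using t_cmp[of "rng \<Lambda> \<kappa>" \<kappa>] by (simp add: rng_closed src_rng cmp_rng)

lemma t_src: "\<kappa> \<in> paths \<Lambda> \<Longrightarrow> t \<kappa> \<otimes> t (src \<Lambda> \<kappa>) = t \<kappa>"
  using t_cmp[of \<kappa> "src \<Lambda> \<kappa>"] by (simp add: src_closed rng_src cmp_src)

lemma t_src_adj: "\<kappa> \<in> paths \<Lambda> \<Longrightarrow> t (src \<Lambda> \<kappa>) \<otimes> adj A (t \<kappa>) = adj A (t \<kappa>)"
  using arg_cong[OF t_src, of \<kappa> "adj A"] by (simp add: adj_mult src_closed t_vertex src_vertex)

lemma t_isometry: "\<kappa> \<in> paths \<Lambda> \<Longrightarrow> adj A (t \<kappa>) \<otimes> t \<kappa> = t (src \<Lambda> \<kappa>)"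
proof -
  assume k: "\<kappa> \<in> paths \<Lambda>"
  have s: "src \<Lambda> \<kappa> \<in> vertices \<Lambda>" using k by (rule src_vertex)
  have "min_ext \<Lambda> \<kappa> \<kappa> = {(src \<Lambda> \<kappa>, src \<Lambda> \<kappa>)}"
    using min_ext_of_prefix[of \<kappa> "src \<Lambda> \<kappa>"] k by (simp add: src_closed rng_src src_src cmp_src)
  then show ?thesis using k s by (simp add: t_star finsum_insert finsum_empty src_closed t_vertex)
qed

lemma t_zero_iff: "\<kappa> \<in> paths \<Lambda> \<Longrightarrow> t \<kappa> = \<zero> \<longleftrightarrow> t (src \<Lambda> \<kappa>) = \<zero>"
  using t_isometry[of \<kappa>] t_src[of \<kappa>] by auto

abbreviation proj where "proj \<kappa> \<equiv> t \<kappa> \<otimes> adj A (t \<kappa>)"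

lemma product_formula:
  assumes "\<sigma> \<in> paths \<Lambda>" "\<rho> \<in> paths \<Lambda>" "\<kappa> \<in> paths \<Lambda>" "\<tau> \<in> paths \<Lambda>"
    "src \<Lambda> \<sigma> = src \<Lambda> \<rho>" "src \<Lambda> \<kappa> = src \<Lambda> \<tau>"
  shows "(t \<sigma> \<otimes> adj A (t \<rho>)) \<otimes> (t \<kappa> \<otimes> adj A (t \<tau>)) =
    finsum A (\<lambda>q. t (\<sigma> \<cdot> fst q) \<otimes> adj A (t (\<tau> \<cdot> snd q))) (min_ext \<Lambda> \<rho> \<kappa>)"
proof -
  let ?f = "\<lambda>q. t (fst q) \<otimes> adj A (t (snd q))"
  have f: "?f \<in> min_ext \<Lambda> \<rho> \<kappa> \<rightarrow> carrier A" by (intro funcsetI m_closed adj_closed t_closed min_extD)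
  then have f': "(\<lambda>q. t \<sigma> \<otimes> ?f q) \<in> min_ext \<Lambda> \<rho> \<kappa> \<rightarrow> carrier A"
    using assms by (simp add: Pi_iff del: split_paired_All)
  have "(t \<sigma> \<otimes> adj A (t \<rho>)) \<otimes> (t \<kappa> \<otimes> adj A (t \<tau>)) = (t \<sigma> \<otimes> (adj A (t \<rho>) \<otimes> t \<kappa>)) \<otimes> adj A (t \<tau>)"
    using assms by (simp add: m_assoc)
  also have "\<dots> = finsum A (\<lambda>q. (t \<sigma> \<otimes> ?f q) \<otimes> adj A (t \<tau>)) (min_ext \<Lambda> \<rho> \<kappa>)"
    using assms by (simp only: t_star finsum_mult_left[OF _ f] finsum_mult_right[OF _ f'] t_closed adj_closed)
  also have "\<dots> = finsum A (\<lambda>q. t (\<sigma> \<cdot> fst q) \<otimes> adj A (t (\<tau> \<cdot> snd q))) (min_ext \<Lambda> \<rho> \<kappa>)"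
  proof (rule finsum_cong')
    show "(\<lambda>q. t (\<sigma> \<cdot> fst q) \<otimes> adj A (t (\<tau> \<cdot> snd q))) \<in> min_ext \<Lambda> \<rho> \<kappa> \<rightarrow> carrier A"
      using assms by (auto simp: min_ext_def intro!: m_closed adj_closed t_closed cmp_closed)
    fix q assume "q \<in> min_ext \<Lambda> \<rho> \<kappa>"
    then show "(t \<sigma> \<otimes> ?f q) \<otimes> adj A (t \<tau>) = t (\<sigma> \<cdot> fst q) \<otimes> adj A (t (\<tau> \<cdot> snd q))"
      using assms min_extD(1-4)[of q \<rho> \<kappa>] by (simp add: t_cmp adj_mult m_assoc)
  qed simp
  finally show ?thesis .
qed

lemma proj_mult:
  assumes "\<mu> \<in> paths \<Lambda>" "\<nu> \<in> paths \<Lambda>"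
  shows "proj \<mu> \<otimes> proj \<nu> = finsum A (\<lambda>q. proj (\<mu> \<cdot> fst q)) (min_ext \<Lambda> \<mu> \<nu>)"
  unfolding product_formula[OF assms(1,1,2,2) refl refl]
  by (rule finsum_cong')
    (use assms min_extD(5) in \<open>auto simp: min_ext_def intro!: m_closed adj_closed t_closed cmp_closed\<close>)

text \<open>The product of two range projections is a sum of projections, hence self-adjoint.\<close>

lemma proj_commute:
  assumes "\<mu> \<in> paths \<Lambda>" "\<nu> \<in> paths \<Lambda>"
  shows "proj \<mu> \<otimes> proj \<nu> = proj \<nu> \<otimes> proj \<mu>"
proof -
  let ?f = "\<lambda>q. proj (\<mu> \<cdot> fst q)"
  have c: "\<mu> \<cdot> fst q \<in> paths \<Lambda>" if "q \<in> min_ext \<Lambda> \<mu> \<nu>" for q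
    using that assms min_extD(1,3)[OF that] by (simp add: cmp_closed)
  have f: "?f \<in> min_ext \<Lambda> \<mu> \<nu> \<rightarrow> carrier A" using c by auto
  have "adj A (finsum A ?f (min_ext \<Lambda> \<mu> \<nu>)) = finsum A ?f (min_ext \<Lambda> \<mu> \<nu>)"
    unfolding finsum_adj[OF f] by (rule finsum_cong') (use c f in \<open>auto simp: adj_mult\<close>)
  then have "adj A (proj \<mu> \<otimes> proj \<nu>) = proj \<mu> \<otimes> proj \<nu>" unfolding proj_mult[OF assms] .
  then show ?thesis using assms by (simp add: adj_mult)
qed

abbreviation gap where "gap \<equiv> gap_list A t"

context
  fixes v xs
  assumes v: "v \<in> vertices \<Lambda>" and xs: "set xs \<subseteq> paths_to \<Lambda> v"
begin

lemma gap_closed' [simp]: "gap v xs \<in> carrier A"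
  using v xs by (induction xs) (auto simp: vertices_def paths_to_def)

lemma gap_left: "t v \<otimes> gap v xs = gap v xs"
  using xs
proof (induction xs)
  case Nil show ?case using v by (simp add: t_vertex)
next
  case (Cons \<nu> xs)
  then have \<nu>: "\<nu> \<in> paths \<Lambda>" "t v \<otimes> t \<nu> = t \<nu>" using t_rng by (auto simp: paths_to_def)
  have tv: "t v \<in> carrier A" using v by (simp add: vertices_def)
  have gc: "gap v xs \<in> carrier A"
    using Cons.prems v by (induction xs) (auto simp: vertices_def paths_to_def)
  have "t v \<otimes> (t v \<ominus> proj \<nu>) = t v \<ominus> proj \<nu>"
    using \<nu> v tv by (simp add: mult_diff_right t_vertex m_assoc[symmetric])
  then show ?case using \<nu> tv gc m_assoc[of "t v" "t v \<ominus> proj \<nu>" "gap v xs"] by simp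
qed

end

lemma gap_commute:
  assumes v: "v \<in> vertices \<Lambda>" and xs: "set xs \<subseteq> paths_to \<Lambda> v" and m: "\<mu> \<in> paths_to \<Lambda> v"
  shows "proj \<mu> \<otimes> gap v xs = gap v xs \<otimes> proj \<mu>"
proof -
  have tv: "t v \<in> carrier A" using v by (simp add: vertices_def)
  have \<mu>: "\<mu> \<in> paths \<Lambda>" "t v \<otimes> t \<mu> = t \<mu>" using t_rng m by (auto simp: paths_to_def)
  have \<mu>': "adj A (t \<mu>) \<otimes> t v = adj A (t \<mu>)"
    using arg_cong[OF \<mu>(2), of "adj A"] \<mu>(1) tv v by (simp add: adj_mult t_vertex)
  show ?thesis
    using xs
  proof (induction xs)
    case Nil
    then show ?case using \<mu> \<mu>' tv by (simp add: m_assoc) (simp add: m_assoc[symmetric])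
  next
    case (Cons \<nu> xs)
    have \<nu>: "\<nu> \<in> paths \<Lambda>" and g: "gap v xs \<in> carrier A"
      using Cons v by (auto simp: paths_to_def intro!: gap_closed')
    have pv: "proj \<mu> \<otimes> t v = proj \<mu>" "t v \<otimes> proj \<mu> = proj \<mu>"
      using \<mu> \<mu>' tv by (simp add: m_assoc, simp add: m_assoc[symmetric])
    have "proj \<mu> \<otimes> (t v \<ominus> proj \<nu>) = (t v \<ominus> proj \<nu>) \<otimes> proj \<mu>"
      using \<mu> \<nu> tv pv proj_commute[of \<mu> \<nu>] by (simp add: mult_diff_left mult_diff_right)
    then have "proj \<mu> \<otimes> (t v \<ominus> proj \<nu>) \<otimes> gap v xs = (t v \<ominus> proj \<nu>) \<otimes> (gap v xs \<otimes> proj \<mu>)"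
      using Cons \<mu> \<nu> g tv by (simp add: m_assoc)
    then show ?case using \<mu> \<nu> g tv by (simp add: m_assoc)
  qed
qed

context
  fixes v xs
  assumes v: "v \<in> vertices \<Lambda>" and xs: "set xs \<subseteq> paths_to \<Lambda> v"
begin

lemma gap_adj: "adj A (gap v xs) = gap v xs"
  using xs
proof (induction xs)
  case Nil show ?case using v by (simp add: t_vertex)
next
  case (Cons \<nu> xs)
  have tv: "t v \<in> carrier A" using v by (simp add: vertices_def)
  have \<nu>: "\<nu> \<in> paths_to \<Lambda> v" "\<nu> \<in> paths \<Lambda>" and g: "gap v xs \<in> carrier A" "t v \<otimes> gap v xs = gap v xs"
    using Cons v by (auto simp: paths_to_def intro!: gap_closed' gap_left)
  have gv: "gap v xs \<otimes> t v = gap v xs"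
  proof -
    have "gap v xs \<otimes> t v = adj A (t v \<otimes> gap v xs)"
      using Cons tv g(1) v by (simp add: adj_mult t_vertex)
    then show ?thesis using g(2) Cons by simp
  qed
  have "proj \<nu> \<otimes> gap v xs = gap v xs \<otimes> proj \<nu>" using Cons \<nu> by (intro gap_commute v) auto
  then have "gap v xs \<otimes> (t v \<ominus> proj \<nu>) = (t v \<ominus> proj \<nu>) \<otimes> gap v xs"
    using \<nu> g gv tv by (simp add: mult_diff_left mult_diff_right)
  then show ?case using Cons \<nu> g tv v by (simp add: adj_mult adj_diff t_vertex)
qed

lemma gap_right: "gap v xs \<otimes> t v = gap v xs"
  using arg_cong[OF gap_left[OF v xs], of "adj A"] gap_adj v gap_closed'[OF v xs]
  by (simp add: adj_mult t_vertex vertices_def)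

text \<open>
  The factor belonging to \<open>\<alpha>\<close> annihilates \<open>t \<alpha>\<close>, and the range projections commute.
\<close>

lemma gap_kill: "\<alpha> \<in> set xs \<Longrightarrow> gap v xs \<otimes> t \<alpha> = \<zero>"
  using xs
proof (induction xs)
  case (Cons \<nu> xs)
  have tv: "t v \<in> carrier A" using v by (simp add: vertices_def)
  have \<nu>: "\<nu> \<in> paths_to \<Lambda> v" "\<nu> \<in> paths \<Lambda>" and g: "gap v xs \<in> carrier A"
    using Cons v by (auto simp: paths_to_def intro!: gap_closed')
  have \<alpha>: "\<alpha> \<in> paths \<Lambda>" using Cons by (auto simp: paths_to_def)
  show ?case
  proof (cases "\<alpha> \<in> set xs")
    case True
    then show ?thesis using Cons g \<nu> \<alpha> tv by (simp add: m_assoc)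
  next
    case False
    then have a: "\<alpha> = \<nu>" using Cons by simp
    have "gap v xs \<otimes> t \<nu> = gap v xs \<otimes> proj \<nu> \<otimes> t \<nu>" using \<nu> g t_partial by (simp add: m_assoc)
    also have "gap v xs \<otimes> proj \<nu> = proj \<nu> \<otimes> gap v xs"
      using Cons \<nu> by (intro gap_commute[symmetric] v) auto
    also have "\<dots> \<otimes> t \<nu> = proj \<nu> \<otimes> (gap v xs \<otimes> t \<nu>)"
      using \<nu> g by (intro m_assoc) auto
    finally have e: "gap v xs \<otimes> t \<nu> = proj \<nu> \<otimes> (gap v xs \<otimes> t \<nu>)" .
    have "t v \<otimes> t \<nu> = t \<nu>" using t_rng \<nu> by (auto simp: paths_to_def)
    then have "t v \<otimes> proj \<nu> = proj \<nu>" using \<nu> tv by (simp add: m_assoc[symmetric])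
    moreover have "proj \<nu> \<otimes> proj \<nu> = proj \<nu>" using \<nu> t_partial by (simp add: m_assoc[symmetric])
    ultimately have z: "(t v \<ominus> proj \<nu>) \<otimes> proj \<nu> = \<zero>" using \<nu> tv by (simp add: mult_diff_left)
    have "(t v \<ominus> proj \<nu>) \<otimes> (gap v xs \<otimes> t \<nu>) = (t v \<ominus> proj \<nu>) \<otimes> (proj \<nu> \<otimes> (gap v xs \<otimes> t \<nu>))"
      using e by simp
    also have "\<dots> = ((t v \<ominus> proj \<nu>) \<otimes> proj \<nu>) \<otimes> (gap v xs \<otimes> t \<nu>)"
      using tv \<nu> g by (intro m_assoc[symmetric]) auto
    also have "\<dots> = \<zero>" unfolding z using g \<nu> by simp
    finally show ?thesis using a g tv \<nu> by (simp add: m_assoc)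
  qed
qed simp

text \<open>
  Together with \<open>gap_kill_adj\<close> this describes the range of a gap product without reference to the
  order of its factors; idempotence and independence of the enumeration follow.
\<close>

lemma gap_fix:
  assumes "y \<in> carrier A" "t v \<otimes> y = y" "\<And>\<nu>. \<nu> \<in> set xs \<Longrightarrow> adj A (t \<nu>) \<otimes> y = \<zero>"
  shows "gap v xs \<otimes> y = y"
  using xs assms(3)
proof (induction xs)
  case (Cons \<nu> xs)
  have tv: "t v \<in> carrier A" using v by (simp add: vertices_def)
  have \<nu>: "\<nu> \<in> paths \<Lambda>" and g: "gap v xs \<in> carrier A"
    using Cons v by (auto simp: paths_to_def intro!: gap_closed')
  have "gap v (\<nu> # xs) \<otimes> y = (t v \<ominus> proj \<nu>) \<otimes> (gap v xs \<otimes> y)" using \<nu> g tv assms by (simp add: m_assoc)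
  also have "gap v xs \<otimes> y = y" using Cons by simp
  also have "(t v \<ominus> proj \<nu>) \<otimes> y = y \<ominus> t \<nu> \<otimes> (adj A (t \<nu>) \<otimes> y)"
    using \<nu> tv assms by (simp add: mult_diff_left m_assoc)
  also have "\<dots> = y" using Cons.prems(2)[of \<nu>] \<nu> assms by (simp add: a_minus_def)
  finally show ?case .
qed (use assms in simp)

lemma gap_kill_adj: "\<alpha> \<in> set xs \<Longrightarrow> adj A (t \<alpha>) \<otimes> gap v xs = \<zero>"
  using arg_cong[OF gap_kill, of \<alpha> "adj A"] xs gap_adj gap_closed'[OF v xs]
  by (auto simp: adj_mult paths_to_def)

lemma gap_idem: "gap v xs \<otimes> gap v xs = gap v xs"
  by (rule gap_fix) (use gap_kill_adj gap_left[OF v xs] gap_closed'[OF v xs] in auto)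

end

end

section \<open>Matrix units over a closed set of paths\<close>

context toeplitz_family
begin

definition monomials :: "('l \<times> 'l) set \<Rightarrow> 'b set" where
  "monomials R = {t \<sigma> \<otimes> adj A (t \<rho>) | \<sigma> \<rho>. (\<sigma>, \<rho>) \<in> R}"

lemma monomials_closed: "R \<subseteq> paths \<Lambda> \<times> paths \<Lambda> \<Longrightarrow> monomials R \<subseteq> carrier A"
  by (auto simp: monomials_def)

lemma lin_span_monomials_finite:
  assumes "x \<in> lin_span (monomials R)"
  obtains F where "finite F" "F \<subseteq> R" "x \<in> lin_span (monomials F)"
proof -
  let ?m = "\<lambda>(\<sigma>, \<rho>). t \<sigma> \<otimes> adj A (t \<rho>)"
  have m: "monomials R = ?m ` R" for R by (auto simp: monomials_def)
  obtain T where T: "finite T" "T \<subseteq> ?m ` R" "x \<in> lin_span T"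
    using lin_span_finite[OF assms] m by auto
  obtain F where F: "F \<subseteq> R" "finite F" "T = ?m ` F" using finite_subset_image[OF T(1,2)] by metis
  show ?thesis by (rule that[OF F(2,1)]) (use T(3) in \<open>simp add: F(3) m\<close>)
qed

lemma monomials_adj:
  assumes "R \<subseteq> paths \<Lambda> \<times> paths \<Lambda>" "sym R" "x \<in> monomials R"
  shows "adj A x \<in> monomials R"
proof -
  obtain \<sigma> \<rho> where x: "x = t \<sigma> \<otimes> adj A (t \<rho>)" "(\<sigma>, \<rho>) \<in> R" using assms(3) by (auto simp: monomials_def)
  then have "adj A x = t \<rho> \<otimes> adj A (t \<sigma>)" "(\<rho>, \<sigma>) \<in> R"
    using assms(1,2) by (auto simp: adj_mult dest: symD)
  then show ?thesis by (auto simp: monomials_def)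
qed

lemma monomials_mult:
  assumes R: "R \<subseteq> {(\<sigma>, \<rho>). \<sigma> \<in> paths \<Lambda> \<and> \<rho> \<in> paths \<Lambda> \<and> src \<Lambda> \<sigma> = src \<Lambda> \<rho>}"
    and ext: "\<And>\<sigma> \<rho> \<kappa> \<tau> q. \<lbrakk>(\<sigma>, \<rho>) \<in> R; (\<kappa>, \<tau>) \<in> R; q \<in> min_ext \<Lambda> \<rho> \<kappa>\<rbrakk> \<Longrightarrow> (\<sigma> \<cdot> fst q, \<tau> \<cdot> snd q) \<in> R"
    and "x \<in> monomials R" "y \<in> monomials R"
  shows "x \<otimes> y \<in> lin_span (monomials R)"
proof -
  obtain \<sigma> \<rho> \<kappa> \<tau> where x: "x = t \<sigma> \<otimes> adj A (t \<rho>)" "(\<sigma>, \<rho>) \<in> R" and y: "y = t \<kappa> \<otimes> adj A (t \<tau>)" "(\<kappa>, \<tau>) \<in> R"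
    using assms(3,4) by (auto simp: monomials_def)
  have c: "monomials R \<subseteq> carrier A" using R by (intro monomials_closed) auto
  have "x \<otimes> y = finsum A (\<lambda>q. t (\<sigma> \<cdot> fst q) \<otimes> adj A (t (\<tau> \<cdot> snd q))) (min_ext \<Lambda> \<rho> \<kappa>)"
    unfolding x y by (rule product_formula) (use x y R in auto)
  also have "\<dots> \<in> lin_span (monomials R)"
    by (rule lin_span_finsum[OF _ c], rule lin_span_base[OF _ c])
      (use ext[OF x(2) y(2)] in \<open>auto simp: monomials_def\<close>)
  finally show ?thesis .
qed

end

locale closed_family = toeplitz_family \<Lambda> A t
  for \<Lambda> :: "('l, 'k::finite) kgraph" and A :: "'b cstar" (structure) and t :: "'l \<Rightarrow> 'b" +
  fixes P :: "'l set"
  assumes finite_P: "finite P" and closed_P: "closed_paths P"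
begin

lemma P_paths: "\<kappa> \<in> P \<Longrightarrow> \<kappa> \<in> paths \<Lambda>"
  using closed_P by (auto simp: closed_paths_def)

lemma P_ext: "\<lbrakk>(\<kappa>, \<mu>) \<in> twins P; \<sigma> \<in> P; q \<in> min_ext \<Lambda> \<mu> \<sigma>\<rbrakk> \<Longrightarrow> \<kappa> \<cdot> fst q \<in> P"
  using closed_P unfolding closed_paths_def by blast

lemma twins_sym: "(\<kappa>, \<mu>) \<in> twins P \<Longrightarrow> (\<mu>, \<kappa>) \<in> twins P"
  by (auto simp: twins_def)

lemma twins_refl: "\<kappa> \<in> P \<Longrightarrow> (\<kappa>, \<kappa>) \<in> twins P"
  by (auto simp: twins_def)

lemma twinsD: "(\<kappa>, \<mu>) \<in> twins P \<Longrightarrow> \<kappa> \<in> P \<and> \<mu> \<in> P \<and> \<kappa> \<in> paths \<Lambda> \<and> \<mu> \<in> paths \<Lambda> \<and>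
    deg \<Lambda> \<kappa> = deg \<Lambda> \<mu> \<and> src \<Lambda> \<kappa> = src \<Lambda> \<mu>"
  by (auto simp: twins_def P_paths)

lemma twins_extend:
  assumes "(\<kappa>, \<mu>) \<in> twins P" "\<beta> \<in> paths \<Lambda>" "src \<Lambda> \<mu> = rng \<Lambda> \<beta>" "\<mu> \<cdot> \<beta> \<in> P"
  shows "(\<kappa> \<cdot> \<beta>, \<mu> \<cdot> \<beta>) \<in> twins P"
proof -
  have "\<kappa> \<cdot> \<beta> \<in> P"
    using P_ext[OF assms(1,4), of "(\<beta>, src \<Lambda> \<beta>)"] assms twinsD[OF assms(1)] by (simp add: min_ext_of_prefix)
  then show ?thesis
    using assms twinsD[OF assms(1)] by (simp add: twins_def deg_cmp src_cmp)
qed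

definition tails :: "'l \<Rightarrow> 'l set" where
  "tails \<kappa> = {\<nu> \<in> paths_to \<Lambda> (src \<Lambda> \<kappa>). \<kappa> \<cdot> \<nu> \<in> P \<and> \<nu> \<noteq> src \<Lambda> \<kappa>}"

text \<open>
  The part of \<open>t (src \<kappa>)\<close> not covered by the members of \<open>P\<close> that properly extend \<open>\<kappa>\<close>. It depends on
  \<open>\<kappa>\<close> only through \<open>tails \<kappa>\<close>, which twins share; this makes the elements \<open>unit\<close> multiply like
  matrix units.
\<close>

definition defect :: "'l \<Rightarrow> 'b" where
  "defect \<kappa> = gap (src \<Lambda> \<kappa>) (SOME xs. set xs = tails \<kappa>)"

definition unit :: "'l \<Rightarrow> 'l \<Rightarrow> 'b" where
  "unit \<kappa> \<mu> = t \<kappa> \<otimes> (defect \<kappa> \<otimes> adj A (t \<mu>))"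

lemma tails_list:
  assumes "\<kappa> \<in> P"
  shows "set (SOME xs. set xs = tails \<kappa>) = tails \<kappa>"
proof -
  have "inj_on (\<lambda>\<nu>. \<kappa> \<cdot> \<nu>) (tails \<kappa>)"
    using P_paths[OF assms] cmp_cancel(2)[of \<kappa> \<kappa>] by (auto simp: tails_def paths_to_def intro!: inj_onI)
  moreover have "(\<lambda>\<nu>. \<kappa> \<cdot> \<nu>) ` tails \<kappa> \<subseteq> P" by (auto simp: tails_def)
  ultimately have "finite (tails \<kappa>)" using finite_P by (metis inj_on_finite)
  then have "\<exists>xs. set xs = tails \<kappa>" by (rule finite_list)
  then show ?thesis by (rule someI_ex)
qed

lemma tails_twins: "(\<kappa>, \<mu>) \<in> twins P \<Longrightarrow> tails \<kappa> = tails \<mu>"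
proof -
  have "tails \<kappa> \<subseteq> tails \<mu>" if k: "(\<kappa>, \<mu>) \<in> twins P" for \<kappa> \<mu>
  proof
    fix \<nu> assume \<nu>: "\<nu> \<in> tails \<kappa>"
    then have "\<mu> \<cdot> \<nu> \<in> P"
      using twins_extend[OF twins_sym[OF k], of \<nu>] by (auto simp: tails_def paths_to_def dest: twinsD)
    then show "\<nu> \<in> tails \<mu>" using \<nu> twinsD[OF k] by (auto simp: tails_def)
  qed
  then show "(\<kappa>, \<mu>) \<in> twins P \<Longrightarrow> tails \<kappa> = tails \<mu>" using twins_sym by blast
qed

lemma defect_twins: "(\<kappa>, \<mu>) \<in> twins P \<Longrightarrow> defect \<kappa> = defect \<mu>"
  by (simp add: defect_def tails_twins twinsD)

context
  fixes \<kappa> assumes \<kappa>: "\<kappa> \<in> P"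
begin

lemma gap_conditions: "src \<Lambda> \<kappa> \<in> vertices \<Lambda>" "set (SOME xs. set xs = tails \<kappa>) \<subseteq> paths_to \<Lambda> (src \<Lambda> \<kappa>)"
  using \<kappa> by (simp add: src_vertex P_paths, simp add: tails_list) (auto simp: tails_def)

lemma defect_closed [simp]: "defect \<kappa> \<in> carrier A"
  unfolding defect_def by (rule gap_closed'[OF gap_conditions])

lemma defect_adj: "adj A (defect \<kappa>) = defect \<kappa>"
  unfolding defect_def by (rule gap_adj[OF gap_conditions])

lemma defect_idem: "defect \<kappa> \<otimes> defect \<kappa> = defect \<kappa>"
  unfolding defect_def by (rule gap_idem[OF gap_conditions])

lemma defect_src: "t (src \<Lambda> \<kappa>) \<otimes> defect \<kappa> = defect \<kappa>" "defect \<kappa> \<otimes> t (src \<Lambda> \<kappa>) = defect \<kappa>"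
  unfolding defect_def by (rule gap_left[OF gap_conditions], rule gap_right[OF gap_conditions])

lemma defect_kill: "\<alpha> \<in> tails \<kappa> \<Longrightarrow> defect \<kappa> \<otimes> t \<alpha> = \<zero>" "\<alpha> \<in> tails \<kappa> \<Longrightarrow> adj A (t \<alpha>) \<otimes> defect \<kappa> = \<zero>"
  unfolding defect_def
  by (rule gap_kill[OF gap_conditions], simp add: tails_list[OF \<kappa>],
      rule gap_kill_adj[OF gap_conditions], simp add: tails_list[OF \<kappa>])

lemma defect_fix:
  "\<lbrakk>y \<in> carrier A; t (src \<Lambda> \<kappa>) \<otimes> y = y; \<And>\<nu>. \<nu> \<in> tails \<kappa> \<Longrightarrow> adj A (t \<nu>) \<otimes> y = \<zero>\<rbrakk> \<Longrightarrow> defect \<kappa> \<otimes> y = y"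
  unfolding defect_def by (rule gap_fix[OF gap_conditions]) (simp_all add: tails_list[OF \<kappa>])

end

lemma unit_closed [simp]: "\<lbrakk>\<kappa> \<in> P; \<mu> \<in> P\<rbrakk> \<Longrightarrow> unit \<kappa> \<mu> \<in> carrier A"
  by (simp add: unit_def P_paths)

lemma unit_adj: "\<kappa> \<in> P \<Longrightarrow> adj A (unit \<kappa> \<kappa>) = unit \<kappa> \<kappa>"
  by (simp add: unit_def P_paths adj_mult defect_adj m_assoc)

lemma star_of_extension:
  assumes "\<sigma> \<in> paths \<Lambda>" "\<beta> \<in> paths \<Lambda>" "src \<Lambda> \<sigma> = rng \<Lambda> \<beta>"
  shows "adj A (t (\<sigma> \<cdot> \<beta>)) \<otimes> t \<sigma> = adj A (t \<beta>)"
proof -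
  have "adj A (t (\<sigma> \<cdot> \<beta>)) \<otimes> t \<sigma> = adj A (t \<beta>) \<otimes> (adj A (t \<sigma>) \<otimes> t \<sigma>)"
    using assms by (simp add: t_cmp adj_mult m_assoc)
  also have "\<dots> = adj A (t (rng \<Lambda> \<beta>) \<otimes> t \<beta>)"
    using assms by (simp add: t_isometry adj_mult rng_closed t_vertex rng_vertex)
  finally show ?thesis using assms by (simp add: t_rng)
qed

text \<open>
  As \<open>\<sigma>\<close> is not a prefix of \<open>\<kappa>\<close>, each minimal common extension of the two prolongs \<open>\<kappa>\<close> by a nontrivial tail, and these are killed by
  the defect.
\<close>

lemma defect_star_zero:
  assumes k: "\<kappa> \<in> P" "\<sigma> \<in> P" "\<not> \<sigma> \<preceq> \<kappa>"
  shows "defect \<kappa> \<otimes> (adj A (t \<kappa>) \<otimes> t \<sigma>) = \<zero>"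
proof -
  let ?f = "\<lambda>q. t (fst q) \<otimes> adj A (t (snd q))"
  have f: "?f \<in> min_ext \<Lambda> \<kappa> \<sigma> \<rightarrow> carrier A" by (auto simp: min_ext_def)
  have "defect \<kappa> \<otimes> ?f q = \<zero>" if q: "q \<in> min_ext \<Lambda> \<kappa> \<sigma>" for q
  proof -
    note m = min_extD[OF q]
    have "fst q \<noteq> src \<Lambda> \<kappa>"
    proof
      assume "fst q = src \<Lambda> \<kappa>"
      then have "\<kappa> \<cdot> fst q = \<kappa>" using k by (simp add: cmp_src P_paths)
      then show False using m(6) k by (simp add: MCE_iff)
    qed
    then have "fst q \<in> tails \<kappa>"
      using m P_ext[OF twins_refl[OF k(1)] k(2) q] by (simp add: tails_def paths_to_def)
    then have "defect \<kappa> \<otimes> t (fst q) = \<zero>" by (rule defect_kill[OF k(1)])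
    then show ?thesis using m(1,2) k by (simp add: m_assoc[symmetric])
  qed
  then show ?thesis
    using k by (simp only: t_star P_paths finsum_mult_left[OF defect_closed f] finsum_all_zero)
qed

text \<open>
  If \<open>\<kappa>\<close> properly extends \<open>\<tau>\<close>, the difference is a tail of \<open>\<tau>\<close> and meets the defect of \<open>\<tau>\<close>; if \<open>\<kappa>\<close> does
  not extend \<open>\<tau>\<close>, it is the defect of \<open>\<kappa>\<close> that annihilates the product.
\<close>

lemma defect_unit:
  assumes k: "\<kappa> \<in> P" "\<tau> \<in> P"
  shows "defect \<kappa> \<otimes> (adj A (t \<kappa>) \<otimes> unit \<tau> \<tau>) = (if \<kappa> = \<tau> then defect \<kappa> \<otimes> adj A (t \<kappa>) else \<zero>)"
proof -
  note p = P_paths[OF k(1)] P_paths[OF k(2)]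
  have "defect \<kappa> \<otimes> (adj A (t \<kappa>) \<otimes> unit \<tau> \<tau>) =
      (defect \<kappa> \<otimes> (adj A (t \<kappa>) \<otimes> t \<tau>)) \<otimes> (defect \<tau> \<otimes> adj A (t \<tau>))"
    using k p by (simp add: unit_def m_assoc)
  also have "\<dots> = (if \<kappa> = \<tau> then defect \<kappa> \<otimes> adj A (t \<kappa>) else \<zero>)"
  proof (cases "\<tau> \<preceq> \<kappa>")
    case False
    then have "\<kappa> \<noteq> \<tau>" using p prefix_refl by auto
    then show ?thesis using defect_star_zero[OF k False] k p by simp
  next
    case True
    then obtain \<beta> where b: "\<beta> \<in> paths \<Lambda>" "src \<Lambda> \<tau> = rng \<Lambda> \<beta>" "\<kappa> = \<tau> \<cdot> \<beta>" by (rule prefixE)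
    have s: "adj A (t \<kappa>) \<otimes> t \<tau> = adj A (t \<beta>)" using b p by (simp add: star_of_extension)
    show ?thesis
    proof (cases "\<beta> = src \<Lambda> \<tau>")
      case True
      then have "\<kappa> = \<tau>" using b(3) cmp_src[OF p(2)] by simp
      moreover have "adj A (t \<beta>) = t (src \<Lambda> \<kappa>)" using True calculation p by (simp add: t_vertex src_vertex)
      ultimately show ?thesis
        using s k p by (simp add: defect_src m_assoc[symmetric] defect_idem)
    next
      case False
      then have "\<beta> \<in> tails \<tau>" using b k by (simp add: tails_def paths_to_def)
      then have z: "adj A (t \<beta>) \<otimes> defect \<tau> = \<zero>" by (rule defect_kill[OF k(2)])
      have "\<kappa> \<noteq> \<tau>"
      proof
        assume "\<kappa> = \<tau>"
        then have "\<tau> \<cdot> \<beta> = \<tau> \<cdot> src \<Lambda> \<tau>" using b(3) cmp_src[OF p(2)] by simp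
        from cmp_cancel(2)[OF p(2) p(2) b(1) src_closed[OF p(2)] b(2) _ this refl]
        show False using False rng_src[OF p(2)] by simp
      qed
      moreover have "defect \<kappa> \<otimes> adj A (t \<beta>) \<otimes> (defect \<tau> \<otimes> adj A (t \<tau>)) =
          defect \<kappa> \<otimes> ((adj A (t \<beta>) \<otimes> defect \<tau>) \<otimes> adj A (t \<tau>))"
        using k p b by (simp add: m_assoc)
      ultimately show ?thesis unfolding s z using k p by simp
    qed
  qed
  finally show ?thesis .
qed

lemma unit_mult:
  assumes k: "\<kappa> \<in> P" "\<tau> \<in> P"
  shows "unit \<kappa> \<kappa> \<otimes> unit \<tau> \<tau> = (if \<kappa> = \<tau> then unit \<kappa> \<kappa> else \<zero>)"
proof -
  have "unit \<kappa> \<kappa> \<otimes> unit \<tau> \<tau> = t \<kappa> \<otimes> (defect \<kappa> \<otimes> (adj A (t \<kappa>) \<otimes> unit \<tau> \<tau>))"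
    using k by (simp add: unit_def[of \<kappa> \<kappa>] P_paths m_assoc)
  then show ?thesis using k by (simp add: defect_unit) (simp add: unit_def P_paths)
qed

text \<open>
  The left unit kills \<open>t \<sigma>\<close> unless \<open>\<kappa> = \<sigma> \<cdot> \<beta>\<close>. In that case \<open>(t \<rho>)\<^sup>*\<close> turns into \<open>(t (\<rho> \<cdot> \<beta>))\<^sup>*\<close>, and the
  right unit kills this unless \<open>\<rho> \<cdot> \<beta> = \<tau>\<close>.
\<close>

lemma unit_compress:
  assumes k: "\<kappa> \<in> P" "\<tau> \<in> P" and sr: "(\<sigma>, \<rho>) \<in> twins P"
  shows "\<exists>c. unit \<kappa> \<kappa> \<otimes> (t \<sigma> \<otimes> adj A (t \<rho>)) \<otimes> unit \<tau> \<tau> = smul A c (unit \<kappa> \<tau>)"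
proof -
  note p = P_paths[OF k(1)] P_paths[OF k(2)] and tw = twinsD[OF sr]
  have e: "unit \<kappa> \<kappa> \<otimes> (t \<sigma> \<otimes> adj A (t \<rho>)) \<otimes> unit \<tau> \<tau> =
      t \<kappa> \<otimes> ((defect \<kappa> \<otimes> (adj A (t \<kappa>) \<otimes> t \<sigma>)) \<otimes> (adj A (t \<rho>) \<otimes> unit \<tau> \<tau>))"
    using k p tw by (simp add: unit_def[of \<kappa> \<kappa>] m_assoc)
  show ?thesis
  proof (cases "\<sigma> \<preceq> \<kappa>")
    case False
    have "unit \<kappa> \<kappa> \<otimes> (t \<sigma> \<otimes> adj A (t \<rho>)) \<otimes> unit \<tau> \<tau> = \<zero>"
      unfolding e using defect_star_zero[OF k(1) _ False] k p tw by simp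
    then show ?thesis using k by (intro exI[of _ 0]) simp
  next
    case True
    then obtain \<beta> where b: "\<beta> \<in> paths \<Lambda>" "src \<Lambda> \<sigma> = rng \<Lambda> \<beta>" "\<kappa> = \<sigma> \<cdot> \<beta>" by (rule prefixE)
    define \<mu> where "\<mu> = \<rho> \<cdot> \<beta>"
    have mu: "(\<mu>, \<kappa>) \<in> twins P" unfolding \<mu>_def b(3)
      by (rule twins_extend[OF twins_sym[OF sr]]) (use b k in auto)
    note mP = twinsD[OF mu]
    have tm: "adj A (t \<beta>) \<otimes> adj A (t \<rho>) = adj A (t \<mu>)"
      unfolding \<mu>_def using b tw by (simp add: t_cmp adj_mult)
    have s: "adj A (t \<kappa>) \<otimes> t \<sigma> = adj A (t \<beta>)" using b tw by (simp add: star_of_extension)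
    have "unit \<kappa> \<kappa> \<otimes> (t \<sigma> \<otimes> adj A (t \<rho>)) \<otimes> unit \<tau> \<tau> =
        t \<kappa> \<otimes> (defect \<mu> \<otimes> ((adj A (t \<beta>) \<otimes> adj A (t \<rho>)) \<otimes> unit \<tau> \<tau>))"
      unfolding e s defect_twins[OF mu] using k p tw b by (simp add: m_assoc)
    also have "\<dots> = (if \<mu> = \<tau> then unit \<kappa> \<tau> else \<zero>)"
      unfolding tm using defect_unit[of \<mu> \<tau>] mP k p
      by (cases "\<mu> = \<tau>") (simp_all add: unit_def[of \<kappa> \<tau>] defect_twins[OF mu, symmetric])
    finally show ?thesis
      using k by (intro exI[of _ "if \<mu> = \<tau> then 1 else 0"]) simp
  qed
qed

text \<open>
  Downward induction on the total degree: once the adjoints of all longer members annihilate \<open>y\<close>,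
  the defect of \<open>\<kappa>\<close> acts as the identity on \<open>(t \<kappa>)\<^sup>* y\<close>.
\<close>

lemma star_zero_of_units:
  assumes y: "y \<in> carrier A" "\<And>\<mu>. \<mu> \<in> P \<Longrightarrow> unit \<mu> \<mu> \<otimes> y = \<zero>" and k: "\<kappa> \<in> P"
  shows "adj A (t \<kappa>) \<otimes> y = \<zero>"
  using k
proof (induction "Max (size_of ` P) - size_of \<kappa>" arbitrary: \<kappa> rule: less_induct)
  case less
  note p = P_paths[OF less.prems]
  let ?z = "adj A (t \<kappa>) \<otimes> y"
  have "defect \<kappa> \<otimes> ?z = ?z"
  proof (rule defect_fix[OF less.prems])
    show "t (src \<Lambda> \<kappa>) \<otimes> ?z = ?z" using p y by (simp add: m_assoc[symmetric] src_closed t_src_adj)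
    fix \<nu> assume \<nu>: "\<nu> \<in> tails \<kappa>"
    then have n: "\<nu> \<in> paths \<Lambda>" "src \<Lambda> \<kappa> = rng \<Lambda> \<nu>" "\<kappa> \<cdot> \<nu> \<in> P" "\<nu> \<noteq> src \<Lambda> \<kappa>"
      by (auto simp: tails_def paths_to_def)
    have "deg \<Lambda> \<nu> \<noteq> 0" using n deg_zero by force
    then have "size_of \<kappa> < size_of (\<kappa> \<cdot> \<nu>)"
      using n p by (intro size_less) (auto simp: deg_cmp le_fun_def)
    moreover have "size_of (\<kappa> \<cdot> \<nu>) \<le> Max (size_of ` P)" using n finite_P by simp
    ultimately have "adj A (t (\<kappa> \<cdot> \<nu>)) \<otimes> y = \<zero>" using n by (intro less.hyps) auto
    then show "adj A (t \<nu>) \<otimes> ?z = \<zero>" using n p y by (simp add: t_cmp adj_mult m_assoc)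
  qed (use p y in simp)
  then have z: "t \<kappa> \<otimes> ?z = \<zero>" using y(2)[OF less.prems] y(1) p less.prems by (simp add: unit_def m_assoc)
  have "adj A (t \<kappa>) \<otimes> (t \<kappa> \<otimes> ?z) = \<zero>" unfolding z using p by simp
  moreover have "adj A (t \<kappa>) \<otimes> (t \<kappa> \<otimes> ?z) = ?z"
    using p y by (simp add: m_assoc[symmetric] t_isometry src_closed t_src_adj)
  ultimately show ?case by simp
qed

text \<open>
  The difference \<open>y\<close> of the two sides is annihilated by all units, hence by all \<open>(t \<kappa>)\<^sup>*\<close>. As \<open>y\<close> is
  itself a combination of elements \<open>t \<kappa> a\<close>, this gives \<open>y\<^sup>* y = 0\<close>.
\<close>

lemma units_sum:
  assumes s: "\<sigma> \<in> P"
  shows "finsum A (\<lambda>\<kappa>. unit \<kappa> \<kappa> \<otimes> t \<sigma>) P = t \<sigma>"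
proof -
  let ?f = "\<lambda>\<kappa>. unit \<kappa> \<kappa> \<otimes> t \<sigma>"
  note p = P_paths[OF s]
  have f: "?f \<in> P \<rightarrow> carrier A" using p by auto
  define y where "y = t \<sigma> \<ominus> finsum A ?f P"
  have yc: "y \<in> carrier A" unfolding y_def using p f by (simp add: finsum_closed)
  have uy: "unit \<mu> \<mu> \<otimes> y = \<zero>" if m: "\<mu> \<in> P" for \<mu>
  proof -
    have "unit \<mu> \<mu> \<otimes> finsum A ?f P = finsum A (\<lambda>\<kappa>. unit \<mu> \<mu> \<otimes> ?f \<kappa>) P"
      using m by (intro finsum_mult_left f) simp
    also have "\<dots> = finsum A (\<lambda>\<kappa>. if \<mu> = \<kappa> then ?f \<kappa> else \<zero>) P"
    proof (rule finsum_cong')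
      fix \<kappa> assume "\<kappa> \<in> P"
      then have "unit \<mu> \<mu> \<otimes> ?f \<kappa> = unit \<mu> \<mu> \<otimes> unit \<kappa> \<kappa> \<otimes> t \<sigma>" using m p by (simp add: m_assoc)
      then show "unit \<mu> \<mu> \<otimes> ?f \<kappa> = (if \<mu> = \<kappa> then ?f \<kappa> else \<zero>)" using m p \<open>\<kappa> \<in> P\<close> by (simp add: unit_mult)
    qed (use f in auto)
    also have "\<dots> = ?f \<mu>" using m finite_P f by (rule finsum_singleton)
    finally show ?thesis using m p f by (simp add: y_def mult_diff_right finsum_closed)
  qed
  have z: "adj A y \<otimes> t \<sigma> = \<zero>" "\<And>\<mu>. \<mu> \<in> P \<Longrightarrow> adj A y \<otimes> ?f \<mu> = \<zero>"
  proof -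
    show "adj A y \<otimes> t \<sigma> = \<zero>"
      using arg_cong[OF star_zero_of_units[OF yc uy s], of "adj A"] yc p by (simp add: adj_mult)
    fix \<mu> assume m: "\<mu> \<in> P"
    have "adj A y \<otimes> unit \<mu> \<mu> = \<zero>"
      using arg_cong[OF uy[OF m], of "adj A"] yc m by (simp add: adj_mult unit_adj)
    then show "adj A y \<otimes> ?f \<mu> = \<zero>" using m p yc by (simp add: m_assoc[symmetric])
  qed
  have "adj A y \<otimes> finsum A ?f P = \<zero>"
    by (subst finsum_mult_left[OF adj_closed[OF yc] f], rule finsum_all_zero, rule z(2))
  moreover have "finsum A ?f P \<in> carrier A" using f by (rule finsum_closed)
  ultimately have "adj A y \<otimes> (t \<sigma> \<ominus> finsum A ?f P) = \<zero>"
    using z(1) yc p by (simp add: mult_diff_right)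
  then have "adj A y \<otimes> y = \<zero>" by (simp only: y_def[symmetric])
  then have "y = \<zero>" by (rule adj_mult_zero[OF yc])
  then show ?thesis using p f by (simp add: y_def diff_eq_zero_iff finsum_closed)
qed

abbreviation "core_span \<equiv> lin_span (monomials (twins P))"

lemma twins_paths: "twins P \<subseteq> paths \<Lambda> \<times> paths \<Lambda>"
  by (auto simp: twins_def P_paths)

lemmas core_span_closed = lin_span_closed[OF _ monomials_closed[OF twins_paths]]

lemma core_span_adj: "x \<in> core_span \<Longrightarrow> adj A x \<in> core_span"
  by (rule lin_span_adj[OF monomials_closed[OF twins_paths] monomials_adj[OF twins_paths]])
    (auto intro: symI twins_sym)

lemma core_span_mult: "\<lbrakk>x \<in> core_span; y \<in> core_span\<rbrakk> \<Longrightarrow> x \<otimes> y \<in> core_span"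
proof (rule lin_span_mult[OF monomials_closed[OF twins_paths]], rule monomials_mult)
  fix \<sigma> \<rho> \<kappa> \<tau> q assume a: "(\<sigma>, \<rho>) \<in> twins P" "(\<kappa>, \<tau>) \<in> twins P" "q \<in> min_ext \<Lambda> \<rho> \<kappa>"
  obtain \<alpha> \<beta> where q: "q = (\<alpha>, \<beta>)" by force
  have "\<sigma> \<cdot> \<alpha> \<in> P" using P_ext[OF a(1) _ a(3)] twinsD[OF a(2)] q by simp
  moreover have "\<tau> \<cdot> \<beta> \<in> P"
    using P_ext[OF twins_sym[OF a(2)], of \<rho> "(\<beta>, \<alpha>)"] twinsD[OF a(1)] a(3) q by (simp add: min_ext_swap)
  moreover have "deg \<Lambda> \<rho> + deg \<Lambda> \<alpha> = deg \<Lambda> \<kappa> + deg \<Lambda> \<beta>" "src \<Lambda> \<alpha> = src \<Lambda> \<beta>"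
    using min_extD(1-5)[OF a(3)] min_ext_src[OF a(3)] twinsD[OF a(1)] twinsD[OF a(2)] q
      deg_cmp[of \<rho> \<alpha>] deg_cmp[of \<kappa> \<beta>] by auto
  ultimately show "(\<sigma> \<cdot> fst q, \<tau> \<cdot> snd q) \<in> twins P"
    using min_extD(1-4)[OF a(3)] twinsD[OF a(1)] twinsD[OF a(2)] q
    by (simp add: twins_def deg_cmp src_cmp)
qed (auto dest: twinsD)

lemma units_sum_left:
  assumes "x \<in> core_span" shows "finsum A (\<lambda>\<kappa>. unit \<kappa> \<kappa> \<otimes> x) P = x"
  using assms
proof induction
  case zero show ?case by (rule finsum_all_zero) simp
next
  case (step x y c)
  have yc: "y \<in> carrier A" using step core_span_closed by simp
  obtain \<sigma> \<rho> where x: "x = t \<sigma> \<otimes> adj A (t \<rho>)" "(\<sigma>, \<rho>) \<in> twins P" using step by (auto simp: monomials_def)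
  note tw = twinsD[OF x(2)]
  have xc: "x \<in> carrier A" using tw x by simp
  let ?u = "smul A c (adj A (t \<rho>))"
  have e: "smul A c x = t \<sigma> \<otimes> ?u" using x tw by (simp add: smul_mult_right)
  have f: "(\<lambda>\<kappa>. unit \<kappa> \<kappa> \<otimes> t \<sigma>) \<in> P \<rightarrow> carrier A" "(\<lambda>\<kappa>. unit \<kappa> \<kappa> \<otimes> y) \<in> P \<rightarrow> carrier A"
    "(\<lambda>\<kappa>. unit \<kappa> \<kappa> \<otimes> smul A c x) \<in> P \<rightarrow> carrier A" using tw yc xc by auto
  have "finsum A (\<lambda>\<kappa>. unit \<kappa> \<kappa> \<otimes> (smul A c x \<oplus> y)) P =
      finsum A (\<lambda>\<kappa>. unit \<kappa> \<kappa> \<otimes> smul A c x \<oplus> unit \<kappa> \<kappa> \<otimes> y) P"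
    using xc yc by (intro finsum_cong') (auto simp: r_distr)
  also have "\<dots> = finsum A (\<lambda>\<kappa>. unit \<kappa> \<kappa> \<otimes> smul A c x) P \<oplus> finsum A (\<lambda>\<kappa>. unit \<kappa> \<kappa> \<otimes> y) P"
    using f by (intro finsum_addf)
  also have "finsum A (\<lambda>\<kappa>. unit \<kappa> \<kappa> \<otimes> smul A c x) P = finsum A (\<lambda>\<kappa>. unit \<kappa> \<kappa> \<otimes> t \<sigma> \<otimes> ?u) P"
    using tw by (intro finsum_cong') (auto simp: e m_assoc)
  also have "\<dots> = smul A c x"
  proof -
    have "?u \<in> carrier A" using tw by simp
    from finsum_mult_right[OF this f(1)] units_sum tw show ?thesis by (simp add: e)
  qed
  finally show ?case using step by simp
qed

lemma units_sum_right:
  assumes "x \<in> core_span" shows "finsum A (\<lambda>\<kappa>. x \<otimes> unit \<kappa> \<kappa>) P = x"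
proof -
  note ax = core_span_adj[OF assms]
  have xc: "x \<in> carrier A" using assms by (rule core_span_closed)
  have f: "(\<lambda>\<kappa>. unit \<kappa> \<kappa> \<otimes> adj A x) \<in> P \<rightarrow> carrier A" using xc by auto
  have "x = adj A (finsum A (\<lambda>\<kappa>. unit \<kappa> \<kappa> \<otimes> adj A x) P)" using units_sum_left[OF ax] xc by simp
  also have "\<dots> = finsum A (\<lambda>\<kappa>. x \<otimes> unit \<kappa> \<kappa>) P"
    unfolding finsum_adj[OF f] using xc by (intro finsum_cong') (auto simp: adj_mult unit_adj)
  finally show ?thesis by simp
qed

lemma core_span_compress:
  assumes "x \<in> core_span" "\<kappa> \<in> P" "\<tau> \<in> P"
  shows "\<exists>c. unit \<kappa> \<kappa> \<otimes> x \<otimes> unit \<tau> \<tau> = smul A c (unit \<kappa> \<tau>)"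
  using assms(1)
proof induction
  case zero then show ?case using assms by (intro exI[of _ 0]) simp
next
  case (step x y c)
  have yc: "y \<in> carrier A" and xc: "x \<in> carrier A"
    using step core_span_closed monomials_closed[OF twins_paths] by auto
  obtain \<sigma> \<rho> where x: "x = t \<sigma> \<otimes> adj A (t \<rho>)" "(\<sigma>, \<rho>) \<in> twins P" using step by (auto simp: monomials_def)
  obtain d where d: "unit \<kappa> \<kappa> \<otimes> x \<otimes> unit \<tau> \<tau> = smul A d (unit \<kappa> \<tau>)"
    using unit_compress[OF assms(2,3) x(2)] x by auto
  obtain d' where d': "unit \<kappa> \<kappa> \<otimes> y \<otimes> unit \<tau> \<tau> = smul A d' (unit \<kappa> \<tau>)" using step by blast
  have "unit \<kappa> \<kappa> \<otimes> (smul A c x \<oplus> y) \<otimes> unit \<tau> \<tau> =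
      smul A c (unit \<kappa> \<kappa> \<otimes> x \<otimes> unit \<tau> \<tau>) \<oplus> unit \<kappa> \<kappa> \<otimes> y \<otimes> unit \<tau> \<tau>"
    using xc yc assms by (simp add: l_distr r_distr smul_mult_left smul_mult_right)
  also have "\<dots> = smul A (c * d + d') (unit \<kappa> \<tau>)"
    unfolding d d' using assms by (simp add: smul_smul smul_add_left)
  finally show ?case by blast
qed

end

section \<open>Isometry on the span of the matrix units\<close>

context closed_family
begin

text \<open>
  Every \<open>x\<close> in the span is the sum of its corners, and the corner at \<open>(\<kappa>, \<tau>)\<close> is \<open>c\<close> times
  \<open>unit \<kappa> \<tau>\<close>. If \<open>\<pi>\<close> does not kill this unit, then \<open>\<bar>c\<bar>\<close> is at most a constant multiple of the norm of
  \<open>\<pi> x\<close>. Adding up, the norm of \<open>x\<close> is at most \<open>K\<close> times the norm of \<open>\<pi> x\<close> with \<open>K\<close> depending on \<open>P\<close>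
  only, and such a bound on a *-algebra improves itself to \<open>K = 1\<close>.
\<close>

lemma core_span_isometric:
  assumes \<pi>: "star_homomorphism A B \<pi>"
    and defect: "\<And>\<kappa>. \<lbrakk>\<kappa> \<in> P; \<pi> (defect \<kappa>) = \<zero>\<^bsub>B\<^esub>\<rbrakk> \<Longrightarrow> defect \<kappa> = \<zero>"
    and x: "x \<in> core_span"
  shows "nrm A x \<le> nrm B (\<pi> x)"
proof -
  interpret star_homomorphism A B \<pi> by (rule \<pi>)
  have unit0: "unit \<kappa> \<tau> = \<zero>" if k: "\<kappa> \<in> P" "\<tau> \<in> P" and z: "\<pi> (unit \<kappa> \<tau>) = \<zero>\<^bsub>B\<^esub>" for \<kappa> \<tau>
  proof (cases "src \<Lambda> \<kappa> = src \<Lambda> \<tau>")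
    case True
    note p = P_paths[OF k(1)] P_paths[OF k(2)]
    have "adj A (t \<kappa>) \<otimes> unit \<kappa> \<tau> \<otimes> t \<tau> = (adj A (t \<kappa>) \<otimes> t \<kappa>) \<otimes> (defect \<kappa> \<otimes> (adj A (t \<tau>) \<otimes> t \<tau>))"
      using k p by (simp add: unit_def m_assoc)
    also have "\<dots> = defect \<kappa>" using k p True defect_src[OF k(1)] by (simp add: t_isometry)
    finally have "\<pi> (defect \<kappa>) = \<pi> (adj A (t \<kappa>)) \<otimes>\<^bsub>B\<^esub> \<pi> (unit \<kappa> \<tau>) \<otimes>\<^bsub>B\<^esub> \<pi> (t \<tau>)"
      using k p by (metis hom_mult m_closed unit_closed adj_closed t_closed)
    then have "defect \<kappa> = \<zero>" using z p by (intro defect k) simp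
    then show ?thesis using p by (simp add: unit_def)
  next
    case False
    note p = P_paths[OF k(1)] P_paths[OF k(2)]
    have "defect \<kappa> \<otimes> adj A (t \<tau>) =
        (defect \<kappa> \<otimes> t (src \<Lambda> \<kappa>)) \<otimes> (t (src \<Lambda> \<tau>) \<otimes> adj A (t \<tau>))"
      using p k by (simp add: defect_src t_src_adj)
    also have "\<dots> = defect \<kappa> \<otimes> ((t (src \<Lambda> \<kappa>) \<otimes> t (src \<Lambda> \<tau>)) \<otimes> adj A (t \<tau>))"
      using p k by (simp only: m_assoc m_closed defect_closed t_closed adj_closed src_closed)
    also have "\<dots> = \<zero>" using p k False by (simp add: t_orthogonal src_vertex)
    finally show ?thesis using p by (simp add: unit_def)
  qed
  have entry: "\<exists>K. \<forall>x\<in>core_span. nrm A (unit \<kappa> \<kappa> \<otimes> x \<otimes> unit \<tau> \<tau>) \<le> K * nrm B (\<pi> x)"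
    if k: "\<kappa> \<in> P" "\<tau> \<in> P" for \<kappa> \<tau>
  proof (cases "\<pi> (unit \<kappa> \<tau>) = \<zero>\<^bsub>B\<^esub>")
    case True
    then have "unit \<kappa> \<kappa> \<otimes> x \<otimes> unit \<tau> \<tau> = \<zero>" if "x \<in> core_span" for x
      using core_span_compress[OF that k] unit0[OF k] by auto
    then show ?thesis by (intro exI[of _ 0]) simp
  next
    case False
    define b where "b = nrm B (\<pi> (unit \<kappa> \<tau>))"
    have b: "b > 0" using False k by (simp add: b_def order_less_le B.nrm_eq_0[symmetric])
    define L where "L = nrm B (\<pi> (unit \<kappa> \<kappa>)) * nrm B (\<pi> (unit \<tau> \<tau>))"
    show ?thesis
    proof (intro exI[of _ "L / b * nrm A (unit \<kappa> \<tau>)"] ballI)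
      fix x assume x: "x \<in> core_span"
      have xc: "x \<in> carrier A" using x by (rule core_span_closed)
      obtain c where c: "unit \<kappa> \<kappa> \<otimes> x \<otimes> unit \<tau> \<tau> = smul A c (unit \<kappa> \<tau>)"
        using core_span_compress[OF x k] by blast
      have "cmod c * b = nrm B (\<pi> (unit \<kappa> \<kappa> \<otimes> x \<otimes> unit \<tau> \<tau>))"
        unfolding c using k by (simp add: hom_smul B.nrm_smul b_def)
      also have "\<dots> = nrm B (\<pi> (unit \<kappa> \<kappa>) \<otimes>\<^bsub>B\<^esub> \<pi> x \<otimes>\<^bsub>B\<^esub> \<pi> (unit \<tau> \<tau>))"
        using k xc by (simp add: hom_mult)
      also have "\<dots> \<le> nrm B (\<pi> (unit \<kappa> \<kappa>) \<otimes>\<^bsub>B\<^esub> \<pi> x) * nrm B (\<pi> (unit \<tau> \<tau>))"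
        using k xc by (intro B.nrm_mult) auto
      also have "\<dots> \<le> (nrm B (\<pi> (unit \<kappa> \<kappa>)) * nrm B (\<pi> x)) * nrm B (\<pi> (unit \<tau> \<tau>))"
        using k xc by (intro mult_right_mono B.nrm_mult) auto
      finally have "cmod c \<le> L / b * nrm B (\<pi> x)"
        using b by (simp add: L_def field_simps)
      then have "cmod c * nrm A (unit \<kappa> \<tau>) \<le> (L / b * nrm B (\<pi> x)) * nrm A (unit \<kappa> \<tau>)"
        using k by (intro mult_right_mono) auto
      then show "nrm A (unit \<kappa> \<kappa> \<otimes> x \<otimes> unit \<tau> \<tau>) \<le> L / b * nrm A (unit \<kappa> \<tau>) * nrm B (\<pi> x)"
        unfolding c using k by (simp add: nrm_smul mult_ac)
    qed
  qed
  then obtain K where K: "\<And>\<kappa> \<tau> x. \<lbrakk>\<kappa> \<in> P; \<tau> \<in> P; x \<in> core_span\<rbrakk> \<Longrightarrow>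
      nrm A (unit \<kappa> \<kappa> \<otimes> x \<otimes> unit \<tau> \<tau>) \<le> K \<kappa> \<tau> * nrm B (\<pi> x)"
    by metis
  show ?thesis
  proof (rule isometric_of_bounded_below[where M = core_span and K = "\<Sum>\<kappa>\<in>P. \<Sum>\<tau>\<in>P. K \<kappa> \<tau>"])
    fix x assume x: "x \<in> core_span"
    have xc: "x \<in> carrier A" using x by (rule core_span_closed)
    have u: "(\<lambda>\<tau>. x \<otimes> unit \<tau> \<tau>) \<in> P \<rightarrow> carrier A" using xc by auto
    have row: "nrm A (unit \<kappa> \<kappa> \<otimes> x) \<le> (\<Sum>\<tau>\<in>P. K \<kappa> \<tau>) * nrm B (\<pi> x)" if k: "\<kappa> \<in> P" for \<kappa>
    proof -
      have "unit \<kappa> \<kappa> \<otimes> x = unit \<kappa> \<kappa> \<otimes> finsum A (\<lambda>\<tau>. x \<otimes> unit \<tau> \<tau>) P"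
        using units_sum_right[OF x] by simp
      also have "\<dots> = finsum A (\<lambda>\<tau>. unit \<kappa> \<kappa> \<otimes> (x \<otimes> unit \<tau> \<tau>)) P"
        using k by (intro finsum_mult_left u) simp
      finally have "nrm A (unit \<kappa> \<kappa> \<otimes> x) \<le> (\<Sum>\<tau>\<in>P. nrm A (unit \<kappa> \<kappa> \<otimes> (x \<otimes> unit \<tau> \<tau>)))"
        using nrm_finsum_le[OF finite_P, of "\<lambda>\<tau>. unit \<kappa> \<kappa> \<otimes> (x \<otimes> unit \<tau> \<tau>)"] k xc by auto
      also have "\<dots> \<le> (\<Sum>\<tau>\<in>P. K \<kappa> \<tau> * nrm B (\<pi> x))"
        using K k x xc by (intro sum_mono) (simp add: m_assoc[symmetric])
      finally show ?thesis by (simp add: sum_distrib_right)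
    qed
    have "nrm A x = nrm A (finsum A (\<lambda>\<kappa>. unit \<kappa> \<kappa> \<otimes> x) P)" using units_sum_left[OF x] by simp
    also have "\<dots> \<le> (\<Sum>\<kappa>\<in>P. nrm A (unit \<kappa> \<kappa> \<otimes> x))" using xc by (intro nrm_finsum_le finite_P) auto
    also have "\<dots> \<le> (\<Sum>\<kappa>\<in>P. (\<Sum>\<tau>\<in>P. K \<kappa> \<tau>) * nrm B (\<pi> x))" by (intro sum_mono row)
    finally show "nrm A x \<le> (\<Sum>\<kappa>\<in>P. \<Sum>\<tau>\<in>P. K \<kappa> \<tau>) * nrm B (\<pi> x)" by (simp add: sum_distrib_right)
  qed (use x core_span_closed core_span_mult core_span_adj in auto)
qed

end

section \<open>Gap projections\<close>

context toeplitz_family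
begin

text \<open>
  By \<open>gap_fix\<close> each of the two products acts as the identity on the other; compare adjoints.
\<close>

lemma gap_set_eq:
  assumes v: "v \<in> vertices \<Lambda>" and xs: "set xs \<subseteq> paths_to \<Lambda> v" and eq: "set xs = set ys"
  shows "gap v xs = gap v ys"
proof -
  have ys: "set ys \<subseteq> paths_to \<Lambda> v" using xs eq by simp
  have 1: "gap v xs \<otimes> gap v ys = gap v ys"
    by (rule gap_fix[OF v xs]) (use gap_kill_adj[OF v ys] gap_left[OF v ys] gap_closed'[OF v ys] eq in auto)
  have 2: "gap v ys \<otimes> gap v xs = gap v xs"
    by (rule gap_fix[OF v ys]) (use gap_kill_adj[OF v xs] gap_left[OF v xs] gap_closed'[OF v xs] eq in auto)
  have "gap v xs = adj A (gap v ys \<otimes> gap v xs)" using 2 gap_adj[OF v xs] by simp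
  also have "\<dots> = gap v xs \<otimes> gap v ys"
    using gap_adj[OF v xs] gap_adj[OF v ys] gap_closed'[OF v xs] gap_closed'[OF v ys] by (simp add: adj_mult)
  finally show ?thesis using 1 by simp
qed

lemma gap_eq_mult_list:
  assumes v: "v \<in> vertices \<Lambda>" and xs: "set xs \<subseteq> paths_to \<Lambda> v" "xs \<noteq> []"
  shows "mult_list A (map (\<lambda>\<kappa>. t v \<ominus> proj \<kappa>) xs) = gap v xs"
  using xs(2,1)
proof (induction xs rule: list_nonempty_induct)
  case (single \<nu>)
  then have \<nu>: "\<nu> \<in> paths \<Lambda>" "t v \<otimes> t \<nu> = t \<nu>" using t_rng by (auto simp: paths_to_def)
  have tv: "t v \<in> carrier A" using v by (simp add: vertices_def)
  have "adj A (t \<nu>) \<otimes> t v = adj A (t \<nu>)"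
    using arg_cong[OF \<nu>(2), of "adj A"] \<nu>(1) tv v by (simp add: adj_mult t_vertex)
  then show ?case using \<nu>(1) tv v by (simp add: mult_diff_left m_assoc t_vertex)
next
  case (cons \<nu> xs)
  then show ?case by (simp add: mult_list_Cons)
qed

lemma gap_projection_eq:
  assumes F: "F \<in> FE \<Lambda>" and xs: "set xs = F"
  shows "gap_projection \<Lambda> A t F = gap (rng_set \<Lambda> F) xs"
proof -
  let ?ys = "SOME xs. distinct xs \<and> set xs = F"
  note ys = enumeration[OF F] and r = rng_set[OF F]
  have "?ys \<noteq> []" using ys r(4) by (metis list.set(1))
  then have "gap_projection \<Lambda> A t F = gap (rng_set \<Lambda> F) ?ys"
    unfolding gap_projection_def mult_set_def using ys r by (intro gap_eq_mult_list) auto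
  also have "\<dots> = gap (rng_set \<Lambda> F) xs" using ys r xs by (intro gap_set_eq) auto
  finally show ?thesis .
qed

lemma gap_hom_list:
  assumes \<pi>: "star_homomorphism A B \<pi>" and v: "v \<in> vertices \<Lambda>" and xs: "set xs \<subseteq> paths_to \<Lambda> v"
    and h: "\<And>\<kappa>. \<kappa> \<in> paths \<Lambda> \<Longrightarrow> \<pi> (t \<kappa>) = h \<kappa>"
  shows "\<pi> (gap v xs) = gap_list B h v xs"
proof -
  interpret star_homomorphism A B \<pi> by (rule \<pi>)
  show ?thesis
    using xs
  proof (induction xs)
    case Nil show ?case using v h by (simp add: vertices_def)
  next
    case (Cons \<nu> xs)
    then have "\<nu> \<in> paths \<Lambda>" "v \<in> paths \<Lambda>" "gap v xs \<in> carrier A" "set xs \<subseteq> paths_to \<Lambda> v"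
      using v by (auto simp: paths_to_def vertices_def intro!: gap_closed')
    then show ?case using Cons.IH by (simp add: hom_mult hom_diff hom_adj h)
  qed
qed

text \<open>
  If some \<open>\<xi>\<close> has no common extension with the listed paths, the gap product fixes \<open>t \<xi> \<noteq> 0\<close>. So it
  can only vanish for exhaustive sets.
\<close>

lemma gap_nonzero:
  assumes nz: "\<And>v. v \<in> vertices \<Lambda> \<Longrightarrow> t v \<noteq> \<zero>"
    and v: "v \<in> vertices \<Lambda>" and xs: "set xs \<subseteq> paths_to \<Lambda> v - {v}" and z: "gap v xs = \<zero>"
  shows "set xs \<in> FE \<Lambda> \<and> rng_set \<Lambda> (set xs) = v"
proof -
  have xs': "set xs \<subseteq> paths_to \<Lambda> v" using xs by auto
  have "Ext \<Lambda> \<xi> (set xs) \<noteq> {}" if \<xi>: "\<xi> \<in> paths_to \<Lambda> v" for \<xi>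
  proof
    assume E: "Ext \<Lambda> \<xi> (set xs) = {}"
    have x: "\<xi> \<in> paths \<Lambda>" "t v \<otimes> t \<xi> = t \<xi>" using \<xi> t_rng by (auto simp: paths_to_def)
    have "gap v xs \<otimes> t \<xi> = t \<xi>"
    proof (rule gap_fix[OF v xs'])
      fix \<nu> assume \<nu>: "\<nu> \<in> set xs"
      have "min_ext \<Lambda> \<nu> \<xi> = {}"
      proof (rule ccontr)
        assume "min_ext \<Lambda> \<nu> \<xi> \<noteq> {}"
        then obtain \<beta> \<alpha> where "(\<beta>, \<alpha>) \<in> min_ext \<Lambda> \<nu> \<xi>" by auto
        then have "(\<alpha>, \<beta>) \<in> min_ext \<Lambda> \<xi> \<nu>" by (simp add: min_ext_swap)
        moreover from this have "\<alpha> \<in> paths_to \<Lambda> (src \<Lambda> \<xi>)" by (simp add: paths_to_def min_ext_def)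
        ultimately have "\<alpha> \<in> Ext \<Lambda> \<xi> (set xs)" using \<nu> unfolding Ext_def by blast
        then show False using E by simp
      qed
      then show "adj A (t \<nu>) \<otimes> t \<xi> = \<zero>"
        using t_star[of \<nu> \<xi>] x \<nu> xs' by (auto simp: paths_to_def finsum_empty)
    qed (use x in auto)
    then have "t \<xi> = \<zero>" using z x by simp
    then show False using nz[OF src_vertex[OF x(1)]] t_zero_iff[OF x(1)] by simp
  qed
  then have FE: "set xs \<in> FE \<Lambda>" using xs v by (auto simp: FE_def exhaustive_def)
  then show ?thesis using rng_set_eq[OF v xs'] rng_set(4)[OF FE] by simp
qed

section \<open>Polynomials in the generators\<close>

lemma eval_in_span:
  assumes "x \<in> free_star_algebra (paths \<Lambda>)"
  shows "free_eval A t x \<in> lin_span (monomials {(\<sigma>, \<rho>). \<sigma> \<in> paths \<Lambda> \<and> \<rho> \<in> paths \<Lambda> \<and> src \<Lambda> \<sigma> = src \<Lambda> \<rho>})"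
    (is "_ \<in> lin_span (monomials ?R)")
proof -
  interpret E: free_evaluation A "paths \<Lambda>" t by unfold_locales simp
  have R: "?R \<subseteq> paths \<Lambda> \<times> paths \<Lambda>" by auto
  note c = monomials_closed[OF R]
  have mult: "x \<otimes> y \<in> lin_span (monomials ?R)" if "x \<in> lin_span (monomials ?R)" "y \<in> lin_span (monomials ?R)" for x y
  proof (rule lin_span_mult[OF c _ that], rule monomials_mult)
    fix \<sigma> \<rho> \<kappa> \<tau> q assume a: "(\<sigma>, \<rho>) \<in> ?R" "(\<kappa>, \<tau>) \<in> ?R" "q \<in> min_ext \<Lambda> \<rho> \<kappa>"
    then show "(\<sigma> \<cdot> fst q, \<tau> \<cdot> snd q) \<in> ?R"
      using min_extD(1-4)[OF a(3)] min_ext_src[OF a(3)] by (auto simp: cmp_closed src_cmp)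
  qed auto
  have gen: "t g \<in> monomials ?R" if g: "g \<in> paths \<Lambda>" for g
  proof -
    have "t g = t g \<otimes> adj A (t (src \<Lambda> g))" using g by (simp add: t_vertex src_vertex t_src)
    moreover have "(g, src \<Lambda> g) \<in> ?R" using g by (simp add: src_closed src_src)
    ultimately show ?thesis unfolding monomials_def by blast
  qed
  have letter: "letter_value A t p \<in> lin_span (monomials ?R)" if "fst p \<in> paths \<Lambda>" for p
  proof -
    have "letter_value A t p \<in> monomials ?R"
      unfolding letter_value_def using gen[OF that] monomials_adj[OF R _ gen[OF that]] by (auto simp: sym_def)
    then show ?thesis by (rule lin_span_base[OF _ c])
  qed
  have word: "word_value A t w \<in> lin_span (monomials ?R)" if "w \<noteq> []" "fst ` set w \<subseteq> paths \<Lambda>" for w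
    using that
  proof (induction w rule: list_nonempty_induct)
    case (single p) then show ?case using letter by (simp add: word_value_def)
  next
    case (cons p w)
    then show ?case using mult letter by (simp add: word_value_def mult_list_Cons)
  qed
  show ?thesis
    using assms
  proof (induction x rule: free_induct)
    case zero show ?case by (simp add: lin_span.zero)
  next
    case (single w d)
    then show ?case using word by (simp add: E.eval_single lin_span_smul c)
  next
    case (add x y)
    then show ?case by (simp add: E.eval_add lin_span_add c)
  qed
qed

end

section \<open>Elements of the core are limits of balanced polynomials\<close>

lemma toeplitz_familyI:
  assumes "finitely_aligned_k_graph \<Lambda>" "pre_cstar_algebra A" "relative_CK_family \<Lambda> \<E> A t"
  shows "toeplitz_family \<Lambda> A t"
  using assms by (intro toeplitz_family.intro toeplitz_family_axioms.intro) (auto simp: relative_CK_family_def)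

context finitely_aligned_k_graph
begin

context
  fixes \<E> :: "'a set set"
  assumes \<E>: "\<E> \<subseteq> FE \<Lambda>"
begin

abbreviation "U \<equiv> CK_algebra \<Lambda> \<E>"
abbreviation "s \<equiv> CK_gen \<Lambda> \<E>"

lemma U_family: "toeplitz_family \<Lambda> U s"
  by (rule toeplitz_familyI[OF finitely_aligned_k_graph_axioms _ CK_gen_family[OF \<E>]])
    (rule cstar_algebra.axioms(1)[OF cstar_algebra_CK_algebra[OF \<E>]])

interpretation U: cstar_algebra U by (rule cstar_algebra_CK_algebra[OF \<E>])
interpretation U: toeplitz_family \<Lambda> U s by (rule U_family)

lemma gauge_hom: "z \<in> torus \<Longrightarrow> star_homomorphism U U (gauge \<Lambda> \<E> z)"
  by (intro star_homomorphism.intro star_homomorphism_axioms.intro U.pre_cstar_algebra_axioms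
      gauge_automorphism(1)[OF \<E>])

definition weight :: "('b \<Rightarrow> complex) \<Rightarrow> 'a \<Rightarrow> complex" where
  "weight z \<kappa> = (\<Prod>i\<in>UNIV. z i ^ deg \<Lambda> \<kappa> i)"

lemma gauge_monomial:
  assumes z: "z \<in> torus" and p: "\<sigma> \<in> paths \<Lambda>" "\<rho> \<in> paths \<Lambda>"
  shows "gauge \<Lambda> \<E> z (s \<sigma> \<otimes>\<^bsub>U\<^esub> adj U (s \<rho>)) =
    smul U (weight z \<sigma> * cnj (weight z \<rho>)) (s \<sigma> \<otimes>\<^bsub>U\<^esub> adj U (s \<rho>))"
proof -
  interpret star_homomorphism U U "gauge \<Lambda> \<E> z" by (rule gauge_hom[OF z])
  have g: "gauge \<Lambda> \<E> z (s \<kappa>) = smul U (weight z \<kappa>) (s \<kappa>)" if "\<kappa> \<in> paths \<Lambda>" for \<kappa>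
    unfolding weight_def by (rule gauge_automorphism(2)[OF \<E> z that])
  show ?thesis
    using p by (simp add: hom_mult hom_adj g U.adj_smul U.smul_mult_left U.smul_mult_right U.smul_smul mult.commute)
qed

lemma weight_balanced:
  assumes "z \<in> torus" "deg \<Lambda> \<sigma> = deg \<Lambda> \<rho>" shows "weight z \<sigma> * cnj (weight z \<rho>) = 1"
proof -
  have "cmod (weight z \<rho>) = 1" using assms(1) by (simp add: weight_def prod_norm[symmetric] norm_power torus_def)
  moreover have "weight z \<sigma> = weight z \<rho>" using assms(2) by (simp add: weight_def)
  ultimately show ?thesis using complex_norm_square[of "weight z \<rho>"] by simp
qed

lemma weight_unbalanced:
  assumes "deg \<Lambda> \<sigma> \<noteq> deg \<Lambda> \<rho>"
  shows "\<exists>z\<in>torus. weight z \<sigma> * cnj (weight z \<rho>) = -1"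
proof -
  obtain i where i: "deg \<Lambda> \<sigma> i \<noteq> deg \<Lambda> \<rho> i" using assms by auto
  define d where "d = real (deg \<Lambda> \<sigma> i) - real (deg \<Lambda> \<rho> i)"
  have d: "d \<noteq> 0" using i by (simp add: d_def)
  define z where "z = (\<lambda>j. if j = i then cis (pi / d) else 1)"
  have w: "weight z \<kappa> = cis (real (deg \<Lambda> \<kappa> i) * (pi / d))" for \<kappa>
  proof -
    have "weight z \<kappa> = (\<Prod>j\<in>UNIV. if j = i then cis (pi / d) ^ deg \<Lambda> \<kappa> i else 1)"
      unfolding weight_def z_def by (intro prod.cong) auto
    then show ?thesis by (simp add: DeMoivre)
  qed
  have "real (deg \<Lambda> \<sigma> i) * (pi / d) + - (real (deg \<Lambda> \<rho> i) * (pi / d)) = d * (pi / d)"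
    unfolding d_def left_diff_distrib by simp
  also have "\<dots> = pi" using d by simp
  finally have "weight z \<sigma> * cnj (weight z \<rho>) = -1" by (simp add: w cis_cnj cis_mult)
  moreover have "z \<in> torus" by (simp add: torus_def z_def)
  ultimately show ?thesis by blast
qed

lemma lin_span_gauge:
  assumes z: "z \<in> torus" and R: "R \<subseteq> paths \<Lambda> \<times> paths \<Lambda>" and y: "y \<in> U.lin_span (U.monomials R)"
  shows "gauge \<Lambda> \<E> z y \<in> U.lin_span (U.monomials R)"
  using y
proof induction
  interpret star_homomorphism U U "gauge \<Lambda> \<E> z" by (rule gauge_hom[OF z])
  case zero show ?case by (simp add: U.lin_span.zero)
next
  interpret star_homomorphism U U "gauge \<Lambda> \<E> z" by (rule gauge_hom[OF z])
  case (step x y c)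
  obtain \<sigma> \<rho> where x: "x = s \<sigma> \<otimes>\<^bsub>U\<^esub> adj U (s \<rho>)" "(\<sigma>, \<rho>) \<in> R" using step by (auto simp: U.monomials_def)
  have p: "\<sigma> \<in> paths \<Lambda>" "\<rho> \<in> paths \<Lambda>" using x(2) R by auto
  have "gauge \<Lambda> \<E> z (smul U c x \<oplus>\<^bsub>U\<^esub> y) =
      smul U (c * (weight z \<sigma> * cnj (weight z \<rho>))) x \<oplus>\<^bsub>U\<^esub> gauge \<Lambda> \<E> z y"
    using p U.lin_span_closed[OF step(2) U.monomials_closed[OF R]]
    by (simp add: x(1) hom_add hom_smul gauge_monomial[OF z p] U.smul_smul)
  then show ?case using U.lin_span.step[OF step(1) step.IH] by simp
qed

definition balanced :: "('a \<times> 'a) set" where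
  "balanced = {(\<sigma>, \<rho>). \<sigma> \<in> paths \<Lambda> \<and> \<rho> \<in> paths \<Lambda> \<and> deg \<Lambda> \<sigma> = deg \<Lambda> \<rho> \<and> src \<Lambda> \<sigma> = src \<Lambda> \<rho>}"

lemma balanced_closed: "U.monomials balanced \<subseteq> carrier U"
  by (rule U.monomials_closed) (auto simp: balanced_def)

lemma gauge_balanced:
  assumes "z \<in> torus" "b \<in> U.lin_span (U.monomials balanced)" shows "gauge \<Lambda> \<E> z b = b"
  using assms(2)
proof induction
  interpret star_homomorphism U U "gauge \<Lambda> \<E> z" by (rule gauge_hom[OF assms(1)])
  case zero show ?case by simp
next
  interpret star_homomorphism U U "gauge \<Lambda> \<E> z" by (rule gauge_hom[OF assms(1)])
  case (step x y c)
  obtain \<sigma> \<rho> where x: "x = s \<sigma> \<otimes>\<^bsub>U\<^esub> adj U (s \<rho>)" "(\<sigma>, \<rho>) \<in> balanced"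
    using step by (auto simp: U.monomials_def)
  then have b: "\<sigma> \<in> paths \<Lambda>" "\<rho> \<in> paths \<Lambda>" "deg \<Lambda> \<sigma> = deg \<Lambda> \<rho>" by (auto simp: balanced_def)
  have "gauge \<Lambda> \<E> z x = x"
    unfolding x gauge_monomial[OF assms(1) b(1,2)] using b assms(1) by (simp add: weight_balanced)
  moreover have "x \<in> carrier U" "y \<in> carrier U" using x b step U.lin_span_closed[OF _ balanced_closed] by auto
  ultimately show ?case using step by (simp add: hom_add hom_smul)
qed

text \<open>
  Rotating by a \<open>z\<close> that acts as \<open>-1\<close> on an unbalanced monomial and averaging removes this monomial;
  the distance to a fixed point of the gauge action does not increase.
\<close>

lemma remove_unbalanced:
  assumes a: "a \<in> CK_core \<Lambda> \<E>"
    and "finite R" "R \<subseteq> {(\<sigma>, \<rho>). \<sigma> \<in> paths \<Lambda> \<and> \<rho> \<in> paths \<Lambda> \<and> src \<Lambda> \<sigma> = src \<Lambda> \<rho>}"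
    and "b \<in> U.lin_span (U.monomials balanced)" "y \<in> U.lin_span (U.monomials R)"
    and "nrm U ((b \<oplus>\<^bsub>U\<^esub> y) \<ominus>\<^bsub>U\<^esub> a) < e"
  shows "\<exists>b'\<in>U.lin_span (U.monomials balanced). nrm U (b' \<ominus>\<^bsub>U\<^esub> a) < e"
  using assms(2-)
proof (induction R arbitrary: b y rule: finite_induct)
  case empty
  have "U.monomials {} = {}" by (simp add: U.monomials_def)
  then have "y = \<zero>\<^bsub>U\<^esub>" using empty.prems(3) by (auto elim: U.lin_span.cases)
  moreover have "b \<in> carrier U" using empty U.lin_span_closed[OF _ balanced_closed] by simp
  ultimately show ?case using empty by auto
next
  case (insert p R)
  let ?m = "s (fst p) \<otimes>\<^bsub>U\<^esub> adj U (s (snd p))"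
  have p: "fst p \<in> paths \<Lambda>" "snd p \<in> paths \<Lambda>" "src \<Lambda> (fst p) = src \<Lambda> (snd p)"
    and R: "R \<subseteq> {(\<sigma>, \<rho>). \<sigma> \<in> paths \<Lambda> \<and> \<rho> \<in> paths \<Lambda> \<and> src \<Lambda> \<sigma> = src \<Lambda> \<rho>}" "R \<subseteq> paths \<Lambda> \<times> paths \<Lambda>"
    using insert.prems(1) by auto
  have "U.monomials (insert p R) = insert ?m (U.monomials R)"
    by (cases p) (auto simp: U.monomials_def)
  then obtain c y' where y: "y = smul U c ?m \<oplus>\<^bsub>U\<^esub> y'" "y' \<in> U.lin_span (U.monomials R)"
    using U.lin_span_insert[OF U.monomials_closed[OF R(2)], of ?m y] insert.prems(3) p by auto
  have m: "?m \<in> carrier U" and y'c: "y' \<in> carrier U" and bc: "b \<in> carrier U" and ac: "a \<in> carrier U"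
    using p U.lin_span_closed[OF y(2) U.monomials_closed[OF R(2)]] insert.prems
      U.lin_span_closed[OF _ balanced_closed] a
    by (auto simp: CK_core_def)
  show ?case
  proof (cases "deg \<Lambda> (fst p) = deg \<Lambda> (snd p)")
    case True
    then have "p \<in> balanced" using p by (cases p) (auto simp: balanced_def)
    then have "?m \<in> U.monomials balanced" by (cases p) (auto simp: U.monomials_def)
    then have "smul U c ?m \<oplus>\<^bsub>U\<^esub> b \<in> U.lin_span (U.monomials balanced)" by (rule U.lin_span.step) (rule insert.prems)
    moreover have "b \<oplus>\<^bsub>U\<^esub> y = (smul U c ?m \<oplus>\<^bsub>U\<^esub> b) \<oplus>\<^bsub>U\<^esub> y'" using m y'c bc y by (simp add: U.a_ac)
    ultimately show ?thesis using insert.IH[OF R(1) _ y(2)] insert.prems(4) by metis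
  next
    case False
    then obtain z where z: "z \<in> torus" "weight z (fst p) * cnj (weight z (snd p)) = -1"
      using weight_unbalanced by blast
    interpret star_homomorphism U U "gauge \<Lambda> \<E> z" by (rule gauge_hom[OF z(1)])
    let ?g = "gauge \<Lambda> \<E> z"
    define w where "w = smul U (1/2) (y' \<oplus>\<^bsub>U\<^esub> ?g y')"
    define x where "x = b \<oplus>\<^bsub>U\<^esub> y"
    have xc: "x \<in> carrier U" unfolding x_def y using m y'c bc by simp
    have w: "w \<in> U.lin_span (U.monomials R)" unfolding w_def
      using U.monomials_closed[OF R(2)] y(2) lin_span_gauge[OF z(1) R(2) y(2)]
      by (intro U.lin_span_smul U.lin_span_add)
    have gb: "?g b = b" using z(1) insert.prems(2) by (rule gauge_balanced)
    have gm: "?g ?m = \<ominus>\<^bsub>U\<^esub> ?m" using gauge_monomial[OF z(1) p(1,2)] z(2) m by (simp add: U.smul_minus_one)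
    have gx: "?g x = b \<oplus>\<^bsub>U\<^esub> (\<ominus>\<^bsub>U\<^esub> smul U c ?m \<oplus>\<^bsub>U\<^esub> ?g y')"
      unfolding x_def y using m y'c bc by (simp add: hom_add hom_smul gb gm U.smul_minus)
    have "x \<oplus>\<^bsub>U\<^esub> ?g x = (b \<oplus>\<^bsub>U\<^esub> b) \<oplus>\<^bsub>U\<^esub> (smul U c ?m \<oplus>\<^bsub>U\<^esub> \<ominus>\<^bsub>U\<^esub> smul U c ?m) \<oplus>\<^bsub>U\<^esub> (y' \<oplus>\<^bsub>U\<^esub> ?g y')"
      unfolding gx unfolding x_def y using m y'c bc by (simp add: U.a_ac)
    also have "\<dots> = smul U 2 b \<oplus>\<^bsub>U\<^esub> (y' \<oplus>\<^bsub>U\<^esub> ?g y')"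
      using m y'c bc by (simp add: U.r_neg U.smul_two)
    finally have "smul U (1/2) (x \<oplus>\<^bsub>U\<^esub> ?g x) = b \<oplus>\<^bsub>U\<^esub> w"
      using bc y'c by (simp add: w_def U.smul_add_right U.smul_smul)
    moreover have "a = smul U (1/2) (a \<oplus>\<^bsub>U\<^esub> a)" using ac by (simp add: U.smul_two[symmetric] U.smul_smul)
    ultimately have "(b \<oplus>\<^bsub>U\<^esub> w) \<ominus>\<^bsub>U\<^esub> a = smul U (1/2) (x \<oplus>\<^bsub>U\<^esub> ?g x) \<ominus>\<^bsub>U\<^esub> smul U (1/2) (a \<oplus>\<^bsub>U\<^esub> a)" by metis
    also have "\<dots> = smul U (1/2) ((x \<ominus>\<^bsub>U\<^esub> a) \<oplus>\<^bsub>U\<^esub> (?g x \<ominus>\<^bsub>U\<^esub> a))"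
      using xc ac by (simp add: U.smul_diff[symmetric] U.add_diff_add)
    also have "?g x \<ominus>\<^bsub>U\<^esub> a = ?g (x \<ominus>\<^bsub>U\<^esub> a)" using a z(1) xc ac by (simp add: hom_diff CK_core_def)
    finally have "nrm U ((b \<oplus>\<^bsub>U\<^esub> w) \<ominus>\<^bsub>U\<^esub> a) = 1/2 * nrm U ((x \<ominus>\<^bsub>U\<^esub> a) \<oplus>\<^bsub>U\<^esub> ?g (x \<ominus>\<^bsub>U\<^esub> a))"
      using xc ac by (simp add: U.nrm_smul)
    also have "\<dots> \<le> 1/2 * (nrm U (x \<ominus>\<^bsub>U\<^esub> a) + nrm U (?g (x \<ominus>\<^bsub>U\<^esub> a)))"
      using xc ac by (intro mult_left_mono U.nrm_add) auto
    also have "\<dots> \<le> nrm U (x \<ominus>\<^bsub>U\<^esub> a)"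
      using star_hom_contractive[OF U.cstar_algebra_axioms U.pre_cstar_algebra_axioms
          gauge_automorphism(1)[OF \<E> z(1)], of "x \<ominus>\<^bsub>U\<^esub> a"] xc ac by simp
    finally have "nrm U ((b \<oplus>\<^bsub>U\<^esub> w) \<ominus>\<^bsub>U\<^esub> a) < e" using insert.prems(4) by (simp add: x_def)
    then show ?thesis using insert.IH[OF R(1) insert.prems(2) w] by blast
  qed
qed

lemma core_approx:
  assumes a: "a \<in> CK_core \<Lambda> \<E>" and e: "e > 0"
  shows "\<exists>b\<in>U.lin_span (U.monomials balanced). nrm U (b \<ominus>\<^bsub>U\<^esub> a) < e"
proof -
  let ?R = "{(\<sigma>, \<rho>). \<sigma> \<in> paths \<Lambda> \<and> \<rho> \<in> paths \<Lambda> \<and> src \<Lambda> \<sigma> = src \<Lambda> \<rho>}"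
  obtain x where x: "x \<in> free_star_algebra (paths \<Lambda>)" "nrm U (free_eval U s x \<ominus>\<^bsub>U\<^esub> a) < e"
    using CK_algebra_generated[OF \<E> _ e, of a] a by (auto simp: CK_core_def)
  have sp: "free_eval U s x \<in> U.lin_span (U.monomials ?R)" by (rule U.eval_in_span[OF x(1)])
  have xc: "free_eval U s x \<in> carrier U"
    by (rule U.lin_span_closed[OF sp], rule U.monomials_closed) auto
  obtain R where R: "finite R" "R \<subseteq> ?R" "free_eval U s x \<in> U.lin_span (U.monomials R)"
    using sp by (rule U.lin_span_monomials_finite)
  show ?thesis
    by (rule remove_unbalanced[OF a R(1,2) U.lin_span.zero R(3)]) (use x(2) xc in simp)
qed

text \<open>
  An element of the kernel is approximated by balanced polynomials \<open>b\<close>. The finitely many paths in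
  \<open>b\<close> lie in a finite closed set, so \<open>\<pi>\<close> preserves the norm of \<open>b\<close> by \<open>core_span_isometric\<close>.
\<close>

theorem injective_on_core:
  fixes B :: "'c cstar"
  assumes B: "cstar_algebra B" and t: "relative_CK_family \<Lambda> \<E> B t"
    and nz: "\<And>v. v \<in> vertices \<Lambda> \<Longrightarrow> t v \<noteq> \<zero>\<^bsub>B\<^esub>"
    and gap: "\<And>F. F \<in> FE \<Lambda> - \<E> \<Longrightarrow> gap_projection \<Lambda> B t F \<noteq> \<zero>\<^bsub>B\<^esub>"
  shows "inj_on (CK_hom \<Lambda> \<E> B t) (CK_core \<Lambda> \<E>)"
proof -
  let ?\<pi> = "CK_hom \<Lambda> \<E> B t"
  interpret B: cstar_algebra B by (rule B)
  interpret B: toeplitz_family \<Lambda> B t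
    by (rule toeplitz_familyI[OF finitely_aligned_k_graph_axioms B.pre_cstar_algebra_axioms t])
  have \<pi>: "star_homomorphism U B ?\<pi>"
    by (intro star_homomorphism.intro star_homomorphism_axioms.intro U.pre_cstar_algebra_axioms
        B.pre_cstar_algebra_axioms CK_hom(1)[OF \<E> B t])
  interpret star_homomorphism U B ?\<pi> by (rule \<pi>)
  have zero: "U.gap v xs = \<zero>\<^bsub>U\<^esub>"
    if v: "v \<in> vertices \<Lambda>" and xs: "set xs \<subseteq> paths_to \<Lambda> v - {v}" and z: "?\<pi> (U.gap v xs) = \<zero>\<^bsub>B\<^esub>" for v xs
  proof -
    have xs': "set xs \<subseteq> paths_to \<Lambda> v" using xs by auto
    have g: "B.gap v xs = \<zero>\<^bsub>B\<^esub>" using U.gap_hom_list[OF \<pi> v xs' CK_hom(2)[OF \<E> B t]] z by simp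
    have F: "set xs \<in> FE \<Lambda>" "rng_set \<Lambda> (set xs) = v" using B.gap_nonzero[OF nz v xs g] by auto
    then have "set xs \<in> \<E>" using gap[of "set xs"] B.gap_projection_eq[OF F(1) refl] g by auto
    then have "gap_projection \<Lambda> U s (set xs) = \<zero>\<^bsub>U\<^esub>"
      using CK_gen_family[OF \<E>] by (simp add: relative_CK_family_def)
    then show ?thesis using U.gap_projection_eq[OF F(1) refl] F(2) by simp
  qed
  have iso: "nrm U b \<le> nrm B (?\<pi> b)" if b: "b \<in> U.lin_span (U.monomials balanced)" for b
  proof -
    obtain R where R: "finite R" "R \<subseteq> balanced" "b \<in> U.lin_span (U.monomials R)"
      using b by (rule U.lin_span_monomials_finite)
    define F where "F = fst ` R \<union> snd ` R"
    have F: "finite F" "F \<subseteq> paths \<Lambda>" using R by (auto simp: F_def balanced_def)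
    interpret P: closed_family \<Lambda> U s "path_closure F"
      by unfold_locales (use finite_path_closure[OF F] path_closure_closed[OF F(2)] in auto)
    have "R \<subseteq> twins (path_closure F)"
      using R(2) by (force simp: twins_def balanced_def F_def intro: path_closure.base)
    then have "U.monomials R \<subseteq> U.monomials (twins (path_closure F))" unfolding U.monomials_def by blast
    then have b': "b \<in> P.core_span" using R(3) U.lin_span_mono by blast
    show ?thesis
    proof (rule P.core_span_isometric[OF \<pi> _ b'])
      fix \<kappa> assume k: "\<kappa> \<in> path_closure F" "?\<pi> (P.defect \<kappa>) = \<zero>\<^bsub>B\<^esub>"
      show "P.defect \<kappa> = \<zero>\<^bsub>U\<^esub>"
        using k(2) unfolding P.defect_def
      proof (rule zero[rotated 2])
        show "src \<Lambda> \<kappa> \<in> vertices \<Lambda>" using k(1) by (intro src_vertex P.P_paths)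
        show "set (SOME xs. set xs = P.tails \<kappa>) \<subseteq> paths_to \<Lambda> (src \<Lambda> \<kappa>) - {src \<Lambda> \<kappa>}"
          unfolding P.tails_list[OF k(1)] by (auto simp: P.tails_def)
      qed
    qed
  qed
  have kernel: "a = \<zero>\<^bsub>U\<^esub>" if a: "a \<in> CK_core \<Lambda> \<E>" "?\<pi> a = \<zero>\<^bsub>B\<^esub>" for a
  proof (rule ccontr)
    assume "a \<noteq> \<zero>\<^bsub>U\<^esub>"
    have ac: "a \<in> carrier U" using a by (simp add: CK_core_def)
    then have e: "nrm U a / 2 > 0" using \<open>a \<noteq> \<zero>\<^bsub>U\<^esub>\<close> by (simp add: order_less_le U.nrm_eq_0)
    obtain b where b: "b \<in> U.lin_span (U.monomials balanced)" "nrm U (b \<ominus>\<^bsub>U\<^esub> a) < nrm U a / 2"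
      using core_approx[OF a(1) e] by blast
    have bc: "b \<in> carrier U" using b U.lin_span_closed[OF _ balanced_closed] by simp
    have "nrm U b \<le> nrm B (?\<pi> b)" by (rule iso[OF b(1)])
    also have "?\<pi> b = ?\<pi> b \<ominus>\<^bsub>B\<^esub> ?\<pi> a" unfolding a(2) using bc by (simp add: a_minus_def)
    also have "\<dots> = ?\<pi> (b \<ominus>\<^bsub>U\<^esub> a)" using bc ac by (simp add: hom_diff)
    also have "nrm B \<dots> \<le> nrm U (b \<ominus>\<^bsub>U\<^esub> a)"
      using bc ac by (intro star_hom_contractive[OF U.cstar_algebra_axioms B.pre_cstar_algebra_axioms CK_hom(1)[OF \<E> B t]]) simp
    finally show False using U.nrm_abs_diff_le[OF bc ac] b(2) by linarith
  qed
  show ?thesis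
  proof (rule inj_onI)
    fix a b assume ab: "a \<in> CK_core \<Lambda> \<E>" "b \<in> CK_core \<Lambda> \<E>" "?\<pi> a = ?\<pi> b"
    then have c: "a \<in> carrier U" "b \<in> carrier U" by (auto simp: CK_core_def)
    have "a \<ominus>\<^bsub>U\<^esub> b = \<zero>\<^bsub>U\<^esub>"
    proof (rule kernel)
      have "gauge \<Lambda> \<E> z (a \<ominus>\<^bsub>U\<^esub> b) = a \<ominus>\<^bsub>U\<^esub> b" if "z \<in> torus" for z
        using ab c that star_homomorphism.hom_diff[OF gauge_hom[OF that] c] by (simp add: CK_core_def)
      then show "a \<ominus>\<^bsub>U\<^esub> b \<in> CK_core \<Lambda> \<E>" using c by (simp add: CK_core_def)
      show "?\<pi> (a \<ominus>\<^bsub>U\<^esub> b) = \<zero>\<^bsub>B\<^esub>" using ab c by (simp add: hom_diff)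
    qed
    then show "a = b" using c by (simp add: U.diff_eq_zero_iff)
  qed
qed

end

end

section \<open>Relative filters of paths\<close>

context k_graph
begin

text \<open>
  The initial segments of a finite or infinite path form a filter. The last condition says that at
  every vertex on the way, the path continues through each member of \<open>\<E>\<close> based there. The nonempty sets
  with these properties encode the \<open>\<E>\<close>-relative boundary paths.
\<close>

definition relative_filter :: "'l set set \<Rightarrow> 'l set \<Rightarrow> bool" where
  "relative_filter \<E> x \<longleftrightarrow> x \<subseteq> paths \<Lambda> \<and> (\<forall>\<mu>\<in>x. \<forall>\<kappa>. \<kappa> \<preceq> \<mu> \<longrightarrow> \<kappa> \<in> x) \<and>
     (\<forall>\<kappa>\<in>x. \<forall>\<mu>\<in>x. \<exists>\<gamma>\<in>x. \<kappa> \<preceq> \<gamma> \<and> \<mu> \<preceq> \<gamma>) \<and>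
     (\<forall>\<kappa>\<in>x. \<forall>G\<in>\<E>. rng_set \<Lambda> G = src \<Lambda> \<kappa> \<longrightarrow> (\<exists>\<nu>\<in>G. \<kappa> \<cdot> \<nu> \<in> x))"

lemma relative_filterD:
  assumes "relative_filter \<E> x"
  shows "\<mu> \<in> x \<Longrightarrow> \<mu> \<in> paths \<Lambda>" "\<lbrakk>\<mu> \<in> x; \<kappa> \<preceq> \<mu>\<rbrakk> \<Longrightarrow> \<kappa> \<in> x"
    "\<lbrakk>\<kappa> \<in> x; \<mu> \<in> x\<rbrakk> \<Longrightarrow> \<exists>\<gamma>\<in>x. \<kappa> \<preceq> \<gamma> \<and> \<mu> \<preceq> \<gamma>"
    "\<lbrakk>\<kappa> \<in> x; G \<in> \<E>; rng_set \<Lambda> G = src \<Lambda> \<kappa>\<rbrakk> \<Longrightarrow> \<exists>\<nu>\<in>G. \<kappa> \<cdot> \<nu> \<in> x"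
  using assms unfolding relative_filter_def by blast+

lemma filter_unique:
  assumes "relative_filter \<E> x" "\<kappa> \<in> x" "\<mu> \<in> x" "deg \<Lambda> \<kappa> = deg \<Lambda> \<mu>" shows "\<kappa> = \<mu>"
  using relative_filterD(3)[OF assms(1-3)] assms(4) prefix_unique by blast

lemma filter_vertex:
  assumes "relative_filter \<E> x" "v \<in> x" "v \<in> vertices \<Lambda>" "\<mu> \<in> x" shows "rng \<Lambda> \<mu> = v"
proof -
  obtain \<gamma> where "\<mu> \<preceq> \<gamma>" "v \<preceq> \<gamma>" using relative_filterD(3)[OF assms(1,4,2)] by blast
  then show ?thesis using prefix_rng verticesD(2)[OF assms(3)] by metis
qed

text \<open>
  If \<open>y\<close> is the filter of a path \<open>p\<close>, then \<open>shift \<kappa> y\<close> is the filter of \<open>\<kappa> p\<close>.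
\<close>

definition shift :: "'l \<Rightarrow> 'l set \<Rightarrow> 'l set" where
  "shift \<kappa> y = {\<rho>. \<exists>\<mu>\<in>y. rng \<Lambda> \<mu> = src \<Lambda> \<kappa> \<and> \<rho> \<preceq> \<kappa> \<cdot> \<mu>}"

definition unshift :: "'l \<Rightarrow> 'l set \<Rightarrow> 'l set" where
  "unshift \<kappa> x = {\<mu> \<in> paths \<Lambda>. src \<Lambda> \<kappa> = rng \<Lambda> \<mu> \<and> \<kappa> \<cdot> \<mu> \<in> x}"

lemma Ext_paths_to: "Ext \<Lambda> \<mu> G \<subseteq> paths_to \<Lambda> (src \<Lambda> \<mu>)"
  by (auto simp: Ext_def)

lemma extensions_iff:
  assumes "G \<subseteq> paths \<Lambda>" shows "\<kappa> \<in> extensions_of \<Lambda> G \<longleftrightarrow> (\<exists>\<nu>\<in>G. \<nu> \<preceq> \<kappa>)"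
proof
  assume "\<kappa> \<in> extensions_of \<Lambda> G"
  then obtain \<nu> \<mu> where "\<nu> \<in> G" "\<mu> \<in> paths \<Lambda>" "src \<Lambda> \<nu> = rng \<Lambda> \<mu>" "\<kappa> = \<nu> \<cdot> \<mu>"
    by (auto simp: extensions_of_def paths_to_def)
  then show "\<exists>\<nu>\<in>G. \<nu> \<preceq> \<kappa>" using assms by (auto intro: prefix_cmp)
next
  assume "\<exists>\<nu>\<in>G. \<nu> \<preceq> \<kappa>"
  then show "\<kappa> \<in> extensions_of \<Lambda> G" by (force simp: extensions_of_def paths_to_def prefix_def)
qed

lemma Ext_iff:
  assumes "\<mu> \<in> paths \<Lambda>"
  shows "\<alpha> \<in> Ext \<Lambda> \<mu> G \<longleftrightarrow> (\<exists>\<nu>\<in>G. \<exists>\<beta>. (\<alpha>, \<beta>) \<in> min_ext \<Lambda> \<mu> \<nu>)"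
  by (auto simp: Ext_def paths_to_def min_ext_def)

context
  fixes \<E>
  assumes sat: "satiated \<Lambda> \<E>"
begin

lemma satiated_FE: "G \<in> \<E> \<Longrightarrow> G \<in> FE \<Lambda>"
  using sat by (auto simp: satiated_def)

lemma satiated_superset: "\<lbrakk>G \<in> \<E>; E \<in> FE \<Lambda>; G \<subseteq> E\<rbrakk> \<Longrightarrow> E \<in> \<E>"
  using sat by (auto simp: satiated_def)

lemma satiated_Ext:
  assumes "G \<in> \<E>" "\<mu> \<in> paths \<Lambda>" "rng \<Lambda> \<mu> = rng_set \<Lambda> G" "\<mu> \<notin> extensions_of \<Lambda> G"
  shows "Ext \<Lambda> \<mu> G \<in> \<E>" "rng_set \<Lambda> (Ext \<Lambda> \<mu> G) = src \<Lambda> \<mu>"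
proof -
  show E: "Ext \<Lambda> \<mu> G \<in> \<E>" using sat assms by (auto simp: satiated_def paths_to_def)
  show "rng_set \<Lambda> (Ext \<Lambda> \<mu> G) = src \<Lambda> \<mu>"
    using rng_set(4)[OF satiated_FE[OF E]] assms(2) by (intro rng_set_eq src_vertex Ext_paths_to) auto
qed

lemma satiated_truncate:
  assumes "G \<in> \<E>" "\<And>\<kappa>. \<kappa> \<in> G \<Longrightarrow> 0 < n \<kappa> \<and> n \<kappa> \<le> deg \<Lambda> \<kappa>"
  shows "(\<lambda>\<kappa>. segment \<Lambda> \<kappa> 0 (n \<kappa>)) ` G \<in> \<E>"
proof -
  have "\<forall>G\<in>\<E>. \<forall>n. (\<forall>\<kappa>\<in>G. 0 < n \<kappa> \<and> n \<kappa> \<le> deg \<Lambda> \<kappa>) \<longrightarrow> (\<lambda>\<kappa>. segment \<Lambda> \<kappa> 0 (n \<kappa>)) ` G \<in> \<E>"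
    using sat unfolding satiated_def by (elim conjE)
  from this[rule_format, OF assms(1), of n] assms(2) show ?thesis by simp
qed

lemma satiated_substitute:
  assumes "G \<in> \<E>" "G' \<subseteq> G" "\<And>\<kappa>. \<kappa> \<in> G' \<Longrightarrow> H \<kappa> \<in> \<E> \<and> rng_set \<Lambda> (H \<kappa>) = src \<Lambda> \<kappa>"
  shows "(G - G') \<union> (\<Union>\<kappa>\<in>G'. left_translate \<Lambda> \<kappa> (H \<kappa>)) \<in> \<E>"
proof -
  have "\<forall>G\<in>\<E>. \<forall>G'\<subseteq>G. \<forall>H. (\<forall>\<kappa>\<in>G'. H \<kappa> \<in> \<E> \<and> rng_set \<Lambda> (H \<kappa>) = src \<Lambda> \<kappa>) \<longrightarrow>
      (G - G') \<union> (\<Union>\<kappa>\<in>G'. left_translate \<Lambda> \<kappa> (H \<kappa>)) \<in> \<E>"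
    using sat unfolding satiated_def by (elim conjE)
  from this[rule_format, OF assms(1,2), of H] assms(3) show ?thesis by simp
qed

text \<open>
  The condition at \<open>\<kappa> \<preceq> \<gamma>\<close> is met by extending \<open>\<gamma>\<close> along an element of some member of the
  collection: this is what closure under \<open>Ext\<close> provides.
\<close>

lemma relative_condition_at_prefix:
  assumes G: "G \<in> \<E>" "rng_set \<Lambda> G = src \<Lambda> \<kappa>" and \<kappa>: "\<kappa> \<preceq> \<gamma>"
  shows "(\<exists>\<nu>\<in>G. \<kappa> \<cdot> \<nu> \<preceq> \<gamma>) \<or>
    (\<exists>H\<in>\<E>. rng_set \<Lambda> H = src \<Lambda> \<gamma> \<and> (\<forall>\<alpha>\<in>H. \<exists>\<nu>\<in>G. \<kappa> \<cdot> \<nu> \<preceq> \<gamma> \<cdot> \<alpha>))"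
proof -
  obtain \<mu> where \<mu>: "\<kappa> \<in> paths \<Lambda>" "\<mu> \<in> paths \<Lambda>" "src \<Lambda> \<kappa> = rng \<Lambda> \<mu>" "\<gamma> = \<kappa> \<cdot> \<mu>" using \<kappa> by (rule prefixE)
  have Gp: "G \<subseteq> paths_to \<Lambda> (src \<Lambda> \<kappa>)" "G \<subseteq> paths \<Lambda>"
    using rng_set(2)[OF satiated_FE[OF G(1)]] G(2) by (auto simp: paths_to_def)
  show ?thesis
  proof (cases "\<mu> \<in> extensions_of \<Lambda> G")
    case True
    then obtain \<nu> where \<nu>: "\<nu> \<in> G" "\<nu> \<preceq> \<mu>" using extensions_iff[OF Gp(2)] by blast
    have "src \<Lambda> \<kappa> = rng \<Lambda> \<nu>" using Gp(1) \<nu>(1) by (auto simp: paths_to_def)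
    then have "\<kappa> \<cdot> \<nu> \<preceq> \<gamma>" unfolding \<mu>(4) using \<mu>(1) \<nu>(2) by (intro prefix_cmp_mono)
    then show ?thesis using \<nu> by blast
  next
    case False
    note S = satiated_Ext[OF G(1) \<mu>(2) _ False]
    have "\<exists>\<nu>\<in>G. \<kappa> \<cdot> \<nu> \<preceq> \<gamma> \<cdot> \<alpha>" if \<alpha>: "\<alpha> \<in> Ext \<Lambda> \<mu> G" for \<alpha>
    proof -
      obtain \<nu> \<beta> where n: "\<nu> \<in> G" "(\<alpha>, \<beta>) \<in> min_ext \<Lambda> \<mu> \<nu>" using \<alpha> Ext_iff[OF \<mu>(2)] by blast
      note m = min_extD[OF n(2), simplified]
      have \<nu>: "\<nu> \<in> paths \<Lambda>" "rng \<Lambda> \<nu> = src \<Lambda> \<kappa>" using Gp n by (auto simp: paths_to_def)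
      have "\<kappa> \<cdot> \<nu> \<preceq> \<kappa> \<cdot> (\<nu> \<cdot> \<beta>)" using \<nu> m \<mu> by (intro prefix_cmp_mono prefix_cmp) auto
      also have "\<kappa> \<cdot> (\<nu> \<cdot> \<beta>) = \<gamma> \<cdot> \<alpha>" using \<mu> m(1,3,5) by (simp add: cmp_assoc)
      finally show ?thesis using n by blast
    qed
    then show ?thesis using S G(2) \<mu> by (intro disjI2 bexI[of _ "Ext \<Lambda> \<mu> G"]) (auto simp: src_cmp)
  qed
qed

text \<open>
  The filter is generated by an increasing chain of paths. There are countably many requirements,
  one for each path and each member of \<open>\<E>\<close>, and one step of the chain settles one of them while it
  keeps the invariant \<open>I\<close>.
\<close>

lemma relative_filter_exists:
  assumes I0: "\<kappa>0 \<in> paths \<Lambda>" "I \<kappa>0"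
    and step: "\<And>\<kappa> G. \<lbrakk>\<kappa> \<in> paths \<Lambda>; I \<kappa>; G \<in> \<E>; rng_set \<Lambda> G = src \<Lambda> \<kappa>\<rbrakk> \<Longrightarrow> \<exists>\<alpha>\<in>G. I (\<kappa> \<cdot> \<alpha>)"
  shows "\<exists>x. relative_filter \<E> x \<and> \<kappa>0 \<in> x \<and> (\<forall>\<mu>\<in>x. \<exists>\<kappa>. I \<kappa> \<and> \<mu> \<preceq> \<kappa>)"
proof -
  have "countable \<E>"
  proof (rule countable_subset)
    show "\<E> \<subseteq> {G. finite G \<and> G \<subseteq> paths \<Lambda>}" using satiated_FE rng_set(3) FE_paths(1) by blast
  qed (rule countable_Collect_finite_subset[OF countable_paths])
  then have "countable (paths \<Lambda> \<times> \<E>)" using countable_paths by simp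
  then obtain f :: "'l \<times> 'l set \<Rightarrow> nat" where f: "inj_on f (paths \<Lambda> \<times> \<E>)" by (auto simp: countable_def)
  define task where "task n = inv_into (paths \<Lambda> \<times> \<E>) f (fst (prod_decode n))" for n
  \<comment> \<open>Every requirement is scheduled infinitely often, so also after its path has become a prefix.\<close>
  have task: "\<exists>n\<ge>m. task n = p" if "p \<in> paths \<Lambda> \<times> \<E>" for p m
    using that f by (intro exI[of _ "prod_encode (f p, m)"]) (simp add: task_def le_prod_encode_2)
  define Q where "Q n \<kappa> \<kappa>' \<longleftrightarrow> \<kappa> \<preceq> \<kappa>' \<and>
    (\<forall>\<mu> G. task n = (\<mu>, G) \<and> G \<in> \<E> \<and> \<mu> \<preceq> \<kappa> \<and> rng_set \<Lambda> G = src \<Lambda> \<mu> \<longrightarrow> (\<exists>\<nu>\<in>G. \<mu> \<cdot> \<nu> \<preceq> \<kappa>'))" for n \<kappa> \<kappa>'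
  have ext: "\<exists>\<kappa>'. (\<kappa>' \<in> paths \<Lambda> \<and> I \<kappa>') \<and> Q n \<kappa> \<kappa>'" if k: "\<kappa> \<in> paths \<Lambda> \<and> I \<kappa>" for n \<kappa>
  proof -
    obtain \<mu> G where T: "task n = (\<mu>, G)" by force
    show ?thesis
    proof (cases "G \<in> \<E> \<and> \<mu> \<preceq> \<kappa> \<and> rng_set \<Lambda> G = src \<Lambda> \<mu> \<and> \<not> (\<exists>\<nu>\<in>G. \<mu> \<cdot> \<nu> \<preceq> \<kappa>)")
      case False
      then show ?thesis using k T prefix_refl by (intro exI[of _ \<kappa>]) (auto simp: Q_def)
    next
      case True
      then obtain H where H: "H \<in> \<E>" "rng_set \<Lambda> H = src \<Lambda> \<kappa>" "\<forall>\<alpha>\<in>H. \<exists>\<nu>\<in>G. \<mu> \<cdot> \<nu> \<preceq> \<kappa> \<cdot> \<alpha>"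
        using relative_condition_at_prefix[of G \<mu> \<kappa>] by blast
      then obtain \<alpha> where \<alpha>: "\<alpha> \<in> H" "I (\<kappa> \<cdot> \<alpha>)" using step k by blast
      have "\<alpha> \<in> paths \<Lambda>" "rng \<Lambda> \<alpha> = src \<Lambda> \<kappa>"
        using rng_set(2)[OF satiated_FE[OF H(1)]] H(2) \<alpha>(1) by (auto simp: paths_to_def)
      then show ?thesis
        using k T \<alpha> H by (intro exI[of _ "\<kappa> \<cdot> \<alpha>"]) (auto simp: Q_def cmp_closed prefix_cmp)
    qed
  qed
  have "\<exists>g. \<forall>n. (g n \<in> paths \<Lambda> \<and> I (g n) \<and> (n = 0 \<longrightarrow> g n = \<kappa>0)) \<and> Q n (g n) (g (Suc n))"
  proof (rule dependent_nat_choice)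
    show "\<exists>\<kappa>. \<kappa> \<in> paths \<Lambda> \<and> I \<kappa> \<and> (0 = (0::nat) \<longrightarrow> \<kappa> = \<kappa>0)" using I0 by blast
    fix \<kappa> n assume "\<kappa> \<in> paths \<Lambda> \<and> I \<kappa> \<and> (n = (0::nat) \<longrightarrow> \<kappa> = \<kappa>0)"
    then show "\<exists>\<kappa>'. (\<kappa>' \<in> paths \<Lambda> \<and> I \<kappa>' \<and> (Suc n = 0 \<longrightarrow> \<kappa>' = \<kappa>0)) \<and> Q n \<kappa> \<kappa>'" using ext by simp
  qed
  then obtain g where g: "\<And>n. g n \<in> paths \<Lambda>" "\<And>n. I (g n)" "g 0 = \<kappa>0" "\<And>n. Q n (g n) (g (Suc n))" by blast
  have mono: "g m \<preceq> g n" if "m \<le> n" for m n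
    using that
  proof (induction n rule: dec_induct)
    case base show ?case using g(1) by (rule prefix_refl)
  next
    case (step n) then show ?case using g(4)[of n] prefix_trans by (auto simp: Q_def)
  qed
  define x where "x = {\<mu>. \<exists>n. \<mu> \<preceq> g n}"
  have "relative_filter \<E> x"
    unfolding relative_filter_def
  proof (intro conjI ballI allI impI)
    show "x \<subseteq> paths \<Lambda>" using prefix_paths by (auto simp: x_def)
    show "\<kappa> \<in> x" if "\<mu> \<in> x" "\<kappa> \<preceq> \<mu>" for \<mu> \<kappa> using that prefix_trans by (auto simp: x_def)
    show "\<exists>\<gamma>\<in>x. \<kappa> \<preceq> \<gamma> \<and> \<mu> \<preceq> \<gamma>" if km: "\<kappa> \<in> x" "\<mu> \<in> x" for \<kappa> \<mu>
    proof -
      obtain m n where mn: "\<kappa> \<preceq> g m" "\<mu> \<preceq> g n" using km by (auto simp: x_def)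
      have "\<kappa> \<preceq> g (max m n)" "\<mu> \<preceq> g (max m n)"
        using prefix_trans[OF mn(1) mono] prefix_trans[OF mn(2) mono] by auto
      moreover have "g (max m n) \<in> x" using prefix_refl[OF g(1)] by (auto simp: x_def)
      ultimately show ?thesis by blast
    qed
    show "\<exists>\<nu>\<in>G. \<kappa> \<cdot> \<nu> \<in> x" if k: "\<kappa> \<in> x" "G \<in> \<E>" "rng_set \<Lambda> G = src \<Lambda> \<kappa>" for \<kappa> G
    proof -
      obtain m where m: "\<kappa> \<preceq> g m" using k by (auto simp: x_def)
      obtain n where n: "n \<ge> m" "task n = (\<kappa>, G)" using task[of "(\<kappa>, G)" m] k prefix_paths[OF m] by auto
      have "\<kappa> \<preceq> g n" using prefix_trans[OF m mono[OF n(1)]] .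
      then obtain \<nu> where "\<nu> \<in> G" "\<kappa> \<cdot> \<nu> \<preceq> g (Suc n)" using g(4)[of n] n(2) k unfolding Q_def by blast
      then show ?thesis by (auto simp: x_def)
    qed
  qed
  moreover have "\<kappa>0 \<in> x" using g(3) prefix_refl[OF I0(1)] by (auto simp: x_def intro: exI[of _ 0])
  moreover have "\<forall>\<mu>\<in>x. \<exists>\<kappa>. I \<kappa> \<and> \<mu> \<preceq> \<kappa>" using g(2) by (auto simp: x_def)
  ultimately show ?thesis by blast
qed

lemma filter_at_vertex:
  assumes "v \<in> vertices \<Lambda>" shows "\<exists>x. relative_filter \<E> x \<and> v \<in> x"
proof -
  have "\<exists>x. relative_filter \<E> x \<and> v \<in> x \<and> (\<forall>\<mu>\<in>x. \<exists>\<kappa>. True \<and> \<mu> \<preceq> \<kappa>)"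
  proof (rule relative_filter_exists)
    show "\<exists>\<alpha>\<in>G. True" if "G \<in> \<E>" for G using rng_set(4)[OF satiated_FE[OF that]] by blast
  qed (use verticesD(1)[OF assms] in auto)
  then show ?thesis by blast
qed

section \<open>Translation of relative filters\<close>

context
  fixes \<kappa> y
  assumes \<kappa>: "\<kappa> \<in> paths \<Lambda>" and y: "relative_filter \<E> y" "src \<Lambda> \<kappa> \<in> y"
begin

lemma shift_iff: "\<rho> \<in> shift \<kappa> y \<longleftrightarrow> (\<exists>\<mu>\<in>y. \<rho> \<preceq> \<kappa> \<cdot> \<mu>)"
  using filter_vertex[OF y src_vertex[OF \<kappa>]] by (auto simp: shift_def)

lemma shift_comp: "\<mu> \<in> y \<Longrightarrow> \<mu> \<in> paths \<Lambda> \<and> rng \<Lambda> \<mu> = src \<Lambda> \<kappa> \<and> \<kappa> \<cdot> \<mu> \<in> paths \<Lambda> \<and> \<kappa> \<cdot> \<mu> \<in> shift \<kappa> y"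
  using filter_vertex[OF y src_vertex[OF \<kappa>]] relative_filterD(1)[OF y(1)] \<kappa>
  by (auto simp: shift_iff cmp_closed intro!: bexI[of _ \<mu>] prefix_refl)

lemma shift_base: "\<kappa> \<in> shift \<kappa> y"
  using shift_comp[OF y(2)] cmp_src[OF \<kappa>] by simp

lemma shift_filter: "relative_filter \<E> (shift \<kappa> y)"
  unfolding relative_filter_def
proof (intro conjI ballI allI impI)
  show "shift \<kappa> y \<subseteq> paths \<Lambda>" using prefix_paths(1) by (auto simp: shift_iff)
  show "\<rho> \<in> shift \<kappa> y" if "\<mu> \<in> shift \<kappa> y" "\<rho> \<preceq> \<mu>" for \<mu> \<rho>
    using that prefix_trans by (auto simp: shift_iff)
  show "\<exists>\<gamma>\<in>shift \<kappa> y. \<rho> \<preceq> \<gamma> \<and> \<mu> \<preceq> \<gamma>" if "\<rho> \<in> shift \<kappa> y" "\<mu> \<in> shift \<kappa> y" for \<rho> \<mu>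
  proof -
    obtain \<eta> \<theta> where e: "\<eta> \<in> y" "\<theta> \<in> y" "\<rho> \<preceq> \<kappa> \<cdot> \<eta>" "\<mu> \<preceq> \<kappa> \<cdot> \<theta>" using \<open>\<rho> \<in> _\<close> \<open>\<mu> \<in> _\<close> by (auto simp: shift_iff)
    obtain \<gamma> where g: "\<gamma> \<in> y" "\<eta> \<preceq> \<gamma>" "\<theta> \<preceq> \<gamma>" using relative_filterD(3)[OF y(1) e(1,2)] by blast
    have "\<kappa> \<cdot> \<eta> \<preceq> \<kappa> \<cdot> \<gamma>" "\<kappa> \<cdot> \<theta> \<preceq> \<kappa> \<cdot> \<gamma>"
      using g \<kappa> shift_comp[OF e(1)] shift_comp[OF e(2)] by (auto intro!: prefix_cmp_mono)
    then show ?thesis using e g(1) prefix_trans shift_comp by blast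
  qed
  show "\<exists>\<nu>\<in>G. \<rho> \<cdot> \<nu> \<in> shift \<kappa> y"
    if G: "\<rho> \<in> shift \<kappa> y" "G \<in> \<E>" "rng_set \<Lambda> G = src \<Lambda> \<rho>" for \<rho> G
  proof -
    obtain \<mu> where m: "\<mu> \<in> y" "\<rho> \<preceq> \<kappa> \<cdot> \<mu>" using G(1) by (auto simp: shift_iff)
    consider "\<exists>\<nu>\<in>G. \<rho> \<cdot> \<nu> \<preceq> \<kappa> \<cdot> \<mu>" |
      H where "H \<in> \<E>" "rng_set \<Lambda> H = src \<Lambda> (\<kappa> \<cdot> \<mu>)" "\<forall>\<alpha>\<in>H. \<exists>\<nu>\<in>G. \<rho> \<cdot> \<nu> \<preceq> \<kappa> \<cdot> \<mu> \<cdot> \<alpha>"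
      using relative_condition_at_prefix[OF G(2,3) m(2)] by blast
    then show ?thesis
    proof cases
      case 1 then show ?thesis using m(1) by (auto simp: shift_iff)
    next
      case 2
      have s: "src \<Lambda> (\<kappa> \<cdot> \<mu>) = src \<Lambda> \<mu>" using shift_comp[OF m(1)] \<kappa> by (simp add: src_cmp)
      then obtain \<alpha> where a: "\<alpha> \<in> H" "\<mu> \<cdot> \<alpha> \<in> y" using relative_filterD(4)[OF y(1) m(1) 2(1)] 2(2) by auto
      have "\<alpha> \<in> paths \<Lambda>" "rng \<Lambda> \<alpha> = src \<Lambda> \<mu>"
        using rng_set(2)[OF satiated_FE[OF 2(1)]] 2(2) s a(1) by (auto simp: paths_to_def)
      then have as: "\<kappa> \<cdot> \<mu> \<cdot> \<alpha> = \<kappa> \<cdot> (\<mu> \<cdot> \<alpha>)" using shift_comp[OF m(1)] \<kappa> by (simp add: cmp_assoc)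
      obtain \<nu> where "\<nu> \<in> G" "\<rho> \<cdot> \<nu> \<preceq> \<kappa> \<cdot> (\<mu> \<cdot> \<alpha>)" using 2(3) a(1) unfolding as[symmetric] by blast
      then show ?thesis using a(2) unfolding shift_iff by blast
    qed
  qed
qed

lemma unshift_shift: "unshift \<kappa> (shift \<kappa> y) = y"
proof
  show "y \<subseteq> unshift \<kappa> (shift \<kappa> y)" using shift_comp by (auto simp: unshift_def)
  show "unshift \<kappa> (shift \<kappa> y) \<subseteq> y"
  proof
    fix \<mu> assume "\<mu> \<in> unshift \<kappa> (shift \<kappa> y)"
    then obtain \<eta> where e: "\<mu> \<in> paths \<Lambda>" "src \<Lambda> \<kappa> = rng \<Lambda> \<mu>" "\<eta> \<in> y" "\<kappa> \<cdot> \<mu> \<preceq> \<kappa> \<cdot> \<eta>"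
      by (auto simp: unshift_def shift_iff)
    have "\<mu> \<preceq> \<eta>" using prefix_cmp_cancel[OF \<kappa> e(1) _ e(2) _ e(4)] shift_comp[OF e(3)] by auto
    then show "\<mu> \<in> y" using relative_filterD(2)[OF y(1) e(3)] by simp
  qed
qed

end

context
  fixes \<kappa> x
  assumes x: "relative_filter \<E> x" "\<kappa> \<in> x"
begin

lemma unshift_path: "\<kappa> \<in> paths \<Lambda>"
  using x relative_filterD(1) by blast

lemma unshift_base: "src \<Lambda> \<kappa> \<in> unshift \<kappa> x"
  using x unshift_path by (simp add: unshift_def src_closed rng_src cmp_src)

lemma unshift_filter: "relative_filter \<E> (unshift \<kappa> x)"
  unfolding relative_filter_def
proof (intro conjI ballI allI impI)
  show "unshift \<kappa> x \<subseteq> paths \<Lambda>" by (auto simp: unshift_def)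
  show "\<rho> \<in> unshift \<kappa> x" if m: "\<mu> \<in> unshift \<kappa> x" "\<rho> \<preceq> \<mu>" for \<mu> \<rho>
  proof -
    have "rng \<Lambda> \<rho> = src \<Lambda> \<kappa>" using m prefix_rng by (auto simp: unshift_def)
    then have "\<kappa> \<cdot> \<rho> \<preceq> \<kappa> \<cdot> \<mu>" using m unshift_path by (intro prefix_cmp_mono) auto
    then show ?thesis using m relative_filterD(2)[OF x(1)] \<open>rng \<Lambda> \<rho> = _\<close> prefix_paths(1)[OF m(2)]
      by (auto simp: unshift_def)
  qed
  show "\<exists>\<gamma>\<in>unshift \<kappa> x. \<rho> \<preceq> \<gamma> \<and> \<mu> \<preceq> \<gamma>" if m: "\<rho> \<in> unshift \<kappa> x" "\<mu> \<in> unshift \<kappa> x" for \<rho> \<mu>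
  proof -
    have m': "\<rho> \<in> paths \<Lambda>" "src \<Lambda> \<kappa> = rng \<Lambda> \<rho>" "\<kappa> \<cdot> \<rho> \<in> x" "\<mu> \<in> paths \<Lambda>" "src \<Lambda> \<kappa> = rng \<Lambda> \<mu>" "\<kappa> \<cdot> \<mu> \<in> x"
      using m by (auto simp: unshift_def)
    obtain \<gamma> where g: "\<gamma> \<in> x" "\<kappa> \<cdot> \<rho> \<preceq> \<gamma>" "\<kappa> \<cdot> \<mu> \<preceq> \<gamma>" using relative_filterD(3)[OF x(1) m'(3,6)] by blast
    have "\<kappa> \<preceq> \<gamma>" using prefix_trans[OF prefix_cmp[OF unshift_path m'(1,2)] g(2)] .
    then obtain \<eta> where e: "\<eta> \<in> paths \<Lambda>" "src \<Lambda> \<kappa> = rng \<Lambda> \<eta>" "\<gamma> = \<kappa> \<cdot> \<eta>" by (rule prefixE)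
    have "\<rho> \<preceq> \<eta>" "\<mu> \<preceq> \<eta>" using g m' e unshift_path prefix_cmp_cancel by auto
    then show ?thesis using e g(1) by (auto simp: unshift_def)
  qed
  show "\<exists>\<nu>\<in>G. \<rho> \<cdot> \<nu> \<in> unshift \<kappa> x"
    if G: "\<rho> \<in> unshift \<kappa> x" "G \<in> \<E>" "rng_set \<Lambda> G = src \<Lambda> \<rho>" for \<rho> G
  proof -
    have r: "\<rho> \<in> paths \<Lambda>" "src \<Lambda> \<kappa> = rng \<Lambda> \<rho>" "\<kappa> \<cdot> \<rho> \<in> x" using G by (auto simp: unshift_def)
    then obtain \<nu> where n: "\<nu> \<in> G" "\<kappa> \<cdot> \<rho> \<cdot> \<nu> \<in> x"
      using relative_filterD(4)[OF x(1) r(3) G(2)] G(3) unshift_path by (auto simp: src_cmp)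
    have "\<nu> \<in> paths \<Lambda>" "rng \<Lambda> \<nu> = src \<Lambda> \<rho>"
      using rng_set(2)[OF satiated_FE[OF G(2)]] G(3) n(1) by (auto simp: paths_to_def)
    then have "\<rho> \<cdot> \<nu> \<in> unshift \<kappa> x"
      using r n unshift_path by (simp add: unshift_def cmp_closed rng_cmp cmp_assoc)
    then show ?thesis using n by blast
  qed
qed

lemma shift_unshift: "shift \<kappa> (unshift \<kappa> x) = x"
proof
  note s = shift_iff[OF unshift_path unshift_filter unshift_base]
  show "shift \<kappa> (unshift \<kappa> x) \<subseteq> x" using relative_filterD(2)[OF x(1)] unfolding subset_iff s by (auto simp: unshift_def)
  show "x \<subseteq> shift \<kappa> (unshift \<kappa> x)"
  proof
    fix \<rho> assume r: "\<rho> \<in> x"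
    obtain \<gamma> where g: "\<gamma> \<in> x" "\<rho> \<preceq> \<gamma>" "\<kappa> \<preceq> \<gamma>" using relative_filterD(3)[OF x(1) r x(2)] by blast
    obtain \<eta> where e: "\<eta> \<in> paths \<Lambda>" "src \<Lambda> \<kappa> = rng \<Lambda> \<eta>" "\<gamma> = \<kappa> \<cdot> \<eta>" using g(3) by (rule prefixE)
    then show "\<rho> \<in> shift \<kappa> (unshift \<kappa> x)" using g unfolding s by (auto simp: unshift_def)
  qed
qed

end

text \<open>
  In \<open>shift \<kappa> y\<close> the path \<open>\<mu>\<close> has a common extension with \<open>\<kappa>\<close>, hence a minimal one.
\<close>

lemma shift_mem_iff:
  assumes \<kappa>: "\<kappa> \<in> paths \<Lambda>" and y: "relative_filter \<E> y" "src \<Lambda> \<kappa> \<in> y" and \<mu>: "\<mu> \<in> paths \<Lambda>"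
  shows "\<mu> \<in> shift \<kappa> y \<longleftrightarrow> (\<exists>p\<in>min_ext \<Lambda> \<kappa> \<mu>. fst p \<in> y)"
proof
  assume "\<mu> \<in> shift \<kappa> y"
  then obtain \<eta> where e: "\<eta> \<in> y" "\<mu> \<preceq> \<kappa> \<cdot> \<eta>" by (auto simp: shift_iff[OF \<kappa> y])
  note c = shift_comp[OF \<kappa> y e(1)]
  obtain p where p: "p \<in> min_ext \<Lambda> \<kappa> \<mu>" "\<kappa> \<cdot> fst p \<preceq> \<kappa> \<cdot> \<eta>"
    using common_prefix_MCE[OF _ e(2), of \<kappa>] prefix_cmp[of \<kappa> \<eta>] c \<kappa> by metis
  have "fst p \<preceq> \<eta>" using prefix_cmp_cancel[OF \<kappa> _ _ _ _ p(2)] min_extD(1,3)[OF p(1)] c by auto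
  then show "\<exists>p\<in>min_ext \<Lambda> \<kappa> \<mu>. fst p \<in> y" using p(1) relative_filterD(2)[OF y(1) e(1)] by blast
next
  assume "\<exists>p\<in>min_ext \<Lambda> \<kappa> \<mu>. fst p \<in> y"
  then obtain p where p: "p \<in> min_ext \<Lambda> \<kappa> \<mu>" "fst p \<in> y" by blast
  have "\<mu> \<preceq> \<kappa> \<cdot> fst p" using min_extD(6)[OF p(1)] by (simp add: MCE_iff)
  then show "\<mu> \<in> shift \<kappa> y" using p(2) by (auto simp: shift_iff[OF \<kappa> y])
qed

lemma shift_shift:
  assumes "\<kappa> \<in> paths \<Lambda>" "\<mu> \<in> paths \<Lambda>" "src \<Lambda> \<kappa> = rng \<Lambda> \<mu>" "relative_filter \<E> y" "src \<Lambda> \<mu> \<in> y"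
  shows "shift \<kappa> (shift \<mu> y) = shift (\<kappa> \<cdot> \<mu>) y"
proof -
  note m = shift_filter[OF assms(2,4,5)] shift_base[OF assms(2,4,5)]
  have r: "src \<Lambda> \<kappa> \<in> shift \<mu> y" using relative_filterD(2)[OF m rng_prefix[OF assms(2)]] assms(3) by simp
  have c: "\<kappa> \<cdot> \<mu> \<in> paths \<Lambda>" "src \<Lambda> (\<kappa> \<cdot> \<mu>) \<in> y" using assms by (simp_all add: cmp_closed src_cmp)
  note i = shift_iff[OF assms(1) m(1) r] shift_iff[OF c(1) assms(4) c(2)] shift_iff[OF assms(2,4,5)]
  have as: "\<kappa> \<cdot> \<mu> \<cdot> \<eta> = \<kappa> \<cdot> (\<mu> \<cdot> \<eta>)" if "\<eta> \<in> y" for \<eta>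
    using shift_comp[OF assms(2,4,5) that] assms by (simp add: cmp_assoc)
  show ?thesis
  proof
    show "shift (\<kappa> \<cdot> \<mu>) y \<subseteq> shift \<kappa> (shift \<mu> y)"
      using as shift_comp[OF assms(2,4,5)] unfolding i(1,2) subset_iff by metis
    show "shift \<kappa> (shift \<mu> y) \<subseteq> shift (\<kappa> \<cdot> \<mu>) y"
    proof
      fix \<rho> assume "\<rho> \<in> shift \<kappa> (shift \<mu> y)"
      then obtain \<theta> where "\<theta> \<in> shift \<mu> y" "\<rho> \<preceq> \<kappa> \<cdot> \<theta>" unfolding i(1) by blast
      moreover from this obtain \<eta> where "\<theta> \<preceq> \<mu> \<cdot> \<eta>" "\<eta> \<in> y" unfolding i(3) by blast
      ultimately have h: "\<rho> \<preceq> \<kappa> \<cdot> \<theta>" "\<theta> \<preceq> \<mu> \<cdot> \<eta>" "\<eta> \<in> y" "\<theta> \<in> shift \<mu> y" by simp_all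
      have "\<kappa> \<cdot> \<theta> \<preceq> \<kappa> \<cdot> (\<mu> \<cdot> \<eta>)"
        using h(2) assms(1) shift_comp[OF assms(1) m(1) r h(4)] by (intro prefix_cmp_mono) auto
      from prefix_trans[OF h(1) this] show "\<rho> \<in> shift (\<kappa> \<cdot> \<mu>) y"
        using h(3) unfolding as[OF h(3), symmetric] i(2) by blast
    qed
  qed
qed

end

end

section \<open>A relative filter avoiding an exhaustive set outside the collection\<close>

context finitely_aligned_k_graph
begin

lemma Ext_exhaustive:
  assumes F: "F \<in> FE \<Lambda>" and \<kappa>: "\<kappa> \<in> paths \<Lambda>" "rng \<Lambda> \<kappa> = rng_set \<Lambda> F" "\<kappa> \<notin> extensions_of \<Lambda> F"
  shows "Ext \<Lambda> \<kappa> F \<in> FE \<Lambda>" "rng_set \<Lambda> (Ext \<Lambda> \<kappa> F) = src \<Lambda> \<kappa>"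
    "\<lbrakk>\<alpha> \<in> paths \<Lambda>; rng \<Lambda> \<alpha> = src \<Lambda> \<kappa>; \<kappa> \<cdot> \<alpha> \<in> extensions_of \<Lambda> F\<rbrakk> \<Longrightarrow> \<exists>h\<in>Ext \<Lambda> \<kappa> F. h \<preceq> \<alpha>"
proof -
  note r = rng_set[OF F] and Fp = FE_paths(1)[OF F]
  have fin: "finite (Ext \<Lambda> \<kappa> F)"
  proof (rule finite_subset)
    show "Ext \<Lambda> \<kappa> F \<subseteq> (\<Union>\<nu>\<in>F. fst ` min_ext \<Lambda> \<kappa> \<nu>)" by (force simp: Ext_def)
  qed (use r(3) Fp \<kappa>(1) in \<open>auto intro!: finite_min_ext\<close>)
  have nv: "src \<Lambda> \<kappa> \<notin> Ext \<Lambda> \<kappa> F"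
  proof
    assume "src \<Lambda> \<kappa> \<in> Ext \<Lambda> \<kappa> F"
    then obtain \<nu> \<beta> where n: "\<nu> \<in> F" "(src \<Lambda> \<kappa>, \<beta>) \<in> min_ext \<Lambda> \<kappa> \<nu>" by (auto simp: Ext_def)
    have "\<nu> \<preceq> \<kappa>" using min_extD(6)[OF n(2)] \<kappa> by (simp add: MCE_iff cmp_src)
    then show False using \<kappa> n extensions_iff[OF Fp] by blast
  qed
  have common: "\<exists>h\<in>Ext \<Lambda> \<kappa> F. h \<preceq> \<alpha>"
    if a: "\<alpha> \<in> paths \<Lambda>" "rng \<Lambda> \<alpha> = src \<Lambda> \<kappa>" "\<nu> \<in> F" "\<nu> \<preceq> \<kappa> \<cdot> \<alpha>" for \<alpha> \<nu>
  proof -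
    obtain p where p: "p \<in> min_ext \<Lambda> \<kappa> \<nu>" "\<kappa> \<cdot> fst p \<preceq> \<kappa> \<cdot> \<alpha>"
      using common_prefix_MCE[OF _ a(4), of \<kappa>] prefix_cmp[of \<kappa> \<alpha>] a \<kappa> by metis
    have "fst p \<preceq> \<alpha>" using prefix_cmp_cancel[OF \<kappa>(1) _ a(1) _ _ p(2)] min_extD(1,3)[OF p(1)] a by auto
    moreover have "(fst p, snd p) \<in> min_ext \<Lambda> \<kappa> \<nu>" using p(1) by simp
    then have "fst p \<in> Ext \<Lambda> \<kappa> F"
      using a(3) unfolding Ext_iff[OF \<kappa>(1)] by blast
    ultimately show ?thesis by blast
  qed
  then show "\<lbrakk>\<alpha> \<in> paths \<Lambda>; rng \<Lambda> \<alpha> = src \<Lambda> \<kappa>; \<kappa> \<cdot> \<alpha> \<in> extensions_of \<Lambda> F\<rbrakk> \<Longrightarrow> \<exists>h\<in>Ext \<Lambda> \<kappa> F. h \<preceq> \<alpha>"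
    unfolding extensions_iff[OF Fp] by blast
  have ex: "Ext \<Lambda> \<xi> (Ext \<Lambda> \<kappa> F) \<noteq> {}" if x: "\<xi> \<in> paths_to \<Lambda> (src \<Lambda> \<kappa>)" for \<xi>
  proof -
    have x': "\<xi> \<in> paths \<Lambda>" "rng \<Lambda> \<xi> = src \<Lambda> \<kappa>" using x by (auto simp: paths_to_def)
    have k: "\<kappa> \<cdot> \<xi> \<in> paths_to \<Lambda> (rng_set \<Lambda> F)" using x' \<kappa> by (simp add: paths_to_def cmp_closed rng_cmp)
    obtain v where v: "F \<subseteq> paths_to \<Lambda> v" "exhaustive \<Lambda> v F" "v \<in> vertices \<Lambda>" using F by (auto simp: FE_def)
    have "v = rng_set \<Lambda> F" using rng_set_eq[OF v(3,1) r(4)] by simp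
    then have "Ext \<Lambda> (\<kappa> \<cdot> \<xi>) F \<noteq> {}" using v(2) k by (auto simp: exhaustive_def)
    then obtain \<nu> \<alpha> \<beta> where n: "\<nu> \<in> F" "(\<alpha>, \<beta>) \<in> min_ext \<Lambda> (\<kappa> \<cdot> \<xi>) \<nu>" by (auto simp: Ext_def)
    note m = min_extD[OF n(2), simplified]
    have sx: "src \<Lambda> \<xi> = rng \<Lambda> \<alpha>" using m(3) x' \<kappa> by (simp add: src_cmp)
    have "\<nu> \<preceq> \<kappa> \<cdot> (\<xi> \<cdot> \<alpha>)" using m(6) x' \<kappa> m(1) sx by (simp add: MCE_iff cmp_assoc)
    then obtain h where h: "h \<in> Ext \<Lambda> \<kappa> F" "h \<preceq> \<xi> \<cdot> \<alpha>"
      using common[of "\<xi> \<cdot> \<alpha>"] x' m(1) sx n(1) by (auto simp: cmp_closed rng_cmp)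
    obtain p where p: "p \<in> min_ext \<Lambda> \<xi> h" using common_prefix_MCE[OF prefix_cmp[OF x'(1) m(1) sx] h(2)] by blast
    then have "(fst p, snd p) \<in> min_ext \<Lambda> \<xi> h" by simp
    then have "fst p \<in> Ext \<Lambda> \<xi> (Ext \<Lambda> \<kappa> F)"
      using h(1) unfolding Ext_iff[OF x'(1)] by blast
    then show ?thesis by blast
  qed
  have sub: "Ext \<Lambda> \<kappa> F \<subseteq> paths_to \<Lambda> (src \<Lambda> \<kappa>)" by (auto simp: Ext_def)
  show E: "Ext \<Lambda> \<kappa> F \<in> FE \<Lambda>"
    unfolding FE_def using sub nv fin ex src_vertex[OF \<kappa>(1)] by (auto simp: exhaustive_def)
  show "rng_set \<Lambda> (Ext \<Lambda> \<kappa> F) = src \<Lambda> \<kappa>"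
    using rng_set(4)[OF E] sub \<kappa>(1) by (intro rng_set_eq src_vertex) auto
qed

lemma FE_no_vertex: "\<lbrakk>F \<in> FE \<Lambda>; \<alpha> \<in> F\<rbrakk> \<Longrightarrow> deg \<Lambda> \<alpha> \<noteq> 0"
  unfolding FE_def paths_to_def using deg_zero by fastforce

text \<open>
  The invariant for \<open>\<kappa>\<close>: it does not run through \<open>F\<close>, and what is left of \<open>F\<close> after \<open>\<kappa>\<close>, the set
  \<open>Ext \<kappa> F\<close>, is not in \<open>\<E>\<close>. Suppose that it were lost for all \<open>\<kappa> \<cdot> \<alpha>\<close> with \<open>\<alpha> \<in> G \<in> \<E>\<close>. Replacing each
  \<open>\<alpha>\<close> that has not yet met \<open>F\<close> by \<open>\<alpha>\<close> followed by \<open>Ext (\<kappa> \<cdot> \<alpha>) F\<close> gives a member of \<open>\<E>\<close>. All its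
  elements have prefixes in \<open>Ext \<kappa> F\<close>; cutting back to these prefixes and then enlarging to all of
  \<open>Ext \<kappa> F\<close> shows \<open>Ext \<kappa> F \<in> \<E>\<close>, against the invariant.
\<close>

lemma filter_avoiding:
  assumes sat: "satiated \<Lambda> \<E>" and F: "F \<in> FE \<Lambda>" "F \<notin> \<E>"
  shows "\<exists>x. relative_filter \<E> x \<and> rng_set \<Lambda> F \<in> x \<and> F \<inter> x = {}"
proof -
  define v where "v = rng_set \<Lambda> F"
  note r = rng_set[OF F(1)] and Fp = FE_paths(1)[OF F(1)]
  have v: "v \<in> paths \<Lambda>" "rng \<Lambda> v = v" "src \<Lambda> v = v" "deg \<Lambda> v = 0" using verticesD[OF r(1)] by (auto simp: v_def)
  define I where "I \<kappa> \<longleftrightarrow> rng \<Lambda> \<kappa> = v \<and> \<kappa> \<notin> extensions_of \<Lambda> F \<and> Ext \<Lambda> \<kappa> F \<notin> \<E>" for \<kappa>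
  have "\<exists>x. relative_filter \<E> x \<and> v \<in> x \<and> (\<forall>\<mu>\<in>x. \<exists>\<kappa>. I \<kappa> \<and> \<mu> \<preceq> \<kappa>)"
  proof (rule relative_filter_exists[OF sat v(1)])
    have Fv: "\<nu> \<in> paths \<Lambda>" "rng \<Lambda> \<nu> = v" if "\<nu> \<in> F" for \<nu> using r(2) that by (auto simp: paths_to_def v_def)
    have "min_ext \<Lambda> v \<nu> = {(\<nu>, src \<Lambda> \<nu>)}" if "\<nu> \<in> F" for \<nu>
      using min_ext_of_prefix[of v \<nu>] v Fv[OF that] cmp_rng[of \<nu>] by simp
    then have "Ext \<Lambda> v F = F" using Fv v by (auto simp: Ext_def paths_to_def)
    moreover have "v \<notin> extensions_of \<Lambda> F"
    proof
      assume "v \<in> extensions_of \<Lambda> F"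
      then obtain \<nu> where "\<nu> \<in> F" "\<nu> \<preceq> v" using extensions_iff[OF Fp] by blast
      then show False using FE_no_vertex[OF F(1)] prefix_vertex[of \<nu> v] r(1) v(4) by (auto simp: v_def)
    qed
    ultimately show "I v" using v F(2) by (simp add: I_def)
    fix \<kappa> G assume k: "\<kappa> \<in> paths \<Lambda>" "I \<kappa>" and G: "G \<in> \<E>" "rng_set \<Lambda> G = src \<Lambda> \<kappa>"
    let ?H = "Ext \<Lambda> \<kappa> F"
    have k': "rng \<Lambda> \<kappa> = rng_set \<Lambda> F" "\<kappa> \<notin> extensions_of \<Lambda> F" using k(2) by (auto simp: I_def v_def)
    note H = Ext_exhaustive[OF F(1) k(1) k']
    have Gp: "\<alpha> \<in> paths \<Lambda> \<and> rng \<Lambda> \<alpha> = src \<Lambda> \<kappa> \<and> \<kappa> \<cdot> \<alpha> \<in> paths \<Lambda> \<and> rng \<Lambda> (\<kappa> \<cdot> \<alpha>) = v \<and> src \<Lambda> (\<kappa> \<cdot> \<alpha>) = src \<Lambda> \<alpha>"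
      if "\<alpha> \<in> G" for \<alpha>
      using rng_set(2)[OF satiated_FE[OF sat G(1)]] G(2) that k k'(1) by (auto simp: paths_to_def cmp_closed rng_cmp src_cmp v_def)
    show "\<exists>\<alpha>\<in>G. I (\<kappa> \<cdot> \<alpha>)"
    proof (rule ccontr)
      assume no: "\<not> (\<exists>\<alpha>\<in>G. I (\<kappa> \<cdot> \<alpha>))"
      define G' where "G' = {\<alpha> \<in> G. \<kappa> \<cdot> \<alpha> \<notin> extensions_of \<Lambda> F}"
      define E where "E \<alpha> = Ext \<Lambda> (\<kappa> \<cdot> \<alpha>) F" for \<alpha>
      define K where "K = (G - G') \<union> (\<Union>\<alpha>\<in>G'. left_translate \<Lambda> \<alpha> (E \<alpha>))"
      have E: "E \<alpha> \<in> \<E> \<and> rng_set \<Lambda> (E \<alpha>) = src \<Lambda> \<alpha>" if a: "\<alpha> \<in> G'" for \<alpha>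
      proof -
        have a': "\<alpha> \<in> G" "\<kappa> \<cdot> \<alpha> \<notin> extensions_of \<Lambda> F" using a by (auto simp: G'_def)
        then have "E \<alpha> \<in> \<E>" using no Gp by (auto simp: I_def E_def)
        then show ?thesis
          using Ext_exhaustive(2)[OF F(1), of "\<kappa> \<cdot> \<alpha>"] a' Gp[OF a'(1)] by (simp add: E_def v_def)
      qed
      then have KE: "K \<in> \<E>" unfolding K_def by (intro satiated_substitute[OF sat G(1)]) (auto simp: G'_def)
      have "\<exists>h\<in>?H. h \<preceq> \<eta>" if "\<eta> \<in> K" for \<eta>
      proof -
        consider "\<eta> \<in> G - G'" | \<alpha> \<beta> where "\<alpha> \<in> G'" "\<beta> \<in> E \<alpha>" "rng \<Lambda> \<beta> = src \<Lambda> \<alpha>" "\<eta> = \<alpha> \<cdot> \<beta>"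
          using \<open>\<eta> \<in> K\<close> by (auto simp: K_def left_translate_def)
        then show ?thesis
        proof cases
          case 1 then show ?thesis using Gp[of \<eta>] by (intro H(3)) (auto simp: G'_def)
        next
          case (2 \<alpha> \<beta>)
          then obtain \<nu> \<beta>' where n: "\<nu> \<in> F" "(\<beta>, \<beta>') \<in> min_ext \<Lambda> (\<kappa> \<cdot> \<alpha>) \<nu>" by (auto simp: E_def Ext_def)
          note m = min_extD[OF n(2), simplified]
          have a: "\<alpha> \<in> G" using 2 by (simp add: G'_def)
          have as: "\<kappa> \<cdot> \<alpha> \<cdot> \<beta> = \<kappa> \<cdot> \<eta>" using 2 Gp[OF a] m(1) k by (simp add: cmp_assoc)
          have "\<nu> \<preceq> \<kappa> \<cdot> \<eta>" using m(6) unfolding as MCE_iff by simp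
          then have "\<kappa> \<cdot> \<eta> \<in> extensions_of \<Lambda> F" using n(1) extensions_iff[OF Fp] by blast
          then show ?thesis using 2 Gp[OF a] m(1) by (intro H(3)) (auto simp: cmp_closed rng_cmp)
        qed
      qed
      then obtain h where h: "\<And>\<eta>. \<eta> \<in> K \<Longrightarrow> h \<eta> \<in> ?H \<and> h \<eta> \<preceq> \<eta>" by metis
      have seg: "segment \<Lambda> \<eta> 0 (deg \<Lambda> (h \<eta>)) = h \<eta>" if "\<eta> \<in> K" for \<eta>
      proof -
        have \<eta>: "\<eta> \<in> paths \<Lambda>" "deg \<Lambda> (h \<eta>) \<le> deg \<Lambda> \<eta>" 
          using prefix_paths(2)[OF conjunct2[OF h[OF that]]] prefix_deg[OF conjunct2[OF h[OF that]]] by simp_all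
        show ?thesis using prefix_unique[OF segment_prefix(1)[OF \<eta>]] h[OF that] segment_prefix(2)[OF \<eta>] by simp
      qed
      have pos: "0 < deg \<Lambda> (h \<eta>) \<and> deg \<Lambda> (h \<eta>) \<le> deg \<Lambda> \<eta>" if "\<eta> \<in> K" for \<eta>
        using FE_no_vertex[OF H(1), of "h \<eta>"] h[OF that] prefix_deg[OF conjunct2[OF h[OF that]]]
        by (auto simp: order_less_le le_fun_def)
      have "(\<lambda>\<eta>. segment \<Lambda> \<eta> 0 (deg \<Lambda> (h \<eta>))) ` K \<in> \<E>"
        using pos by (rule satiated_truncate[OF sat KE])
      then have "h ` K \<in> \<E>" using seg by (simp cong: image_cong)
      then have "?H \<in> \<E>" using h by (intro satiated_superset[OF sat _ H(1)]) auto
      then show False using k(2) by (simp add: I_def)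
    qed
  qed
  then obtain x where x: "relative_filter \<E> x" "v \<in> x" "\<forall>\<mu>\<in>x. \<exists>\<kappa>. I \<kappa> \<and> \<mu> \<preceq> \<kappa>" by blast
  have "F \<inter> x = {}"
    using x(3) extensions_iff[OF Fp] by (auto simp: I_def)
  then show ?thesis using x by (auto simp: v_def)
qed

end

section \<open>Adjointable operators on finitely supported vectors\<close>

type_synonym 'x vec = "'x \<Rightarrow>\<^sub>0 complex"

abbreviation coord :: "'x vec \<Rightarrow> 'x \<Rightarrow> complex" where "coord \<equiv> Poly_Mapping.lookup"

abbreviation supp :: "'x vec \<Rightarrow> 'x set" where "supp \<equiv> Poly_Mapping.keys"

definition scale :: "complex \<Rightarrow> 'x vec \<Rightarrow> 'x vec" where
  "scale c f = Poly_Mapping.map ((*) c) f"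

definition ip :: "'x vec \<Rightarrow> 'x vec \<Rightarrow> complex" where
  "ip f g = (\<Sum>x\<in>supp f. cnj (coord f x) * coord g x)"

definition nm :: "'x vec \<Rightarrow> real" where
  "nm f = L2_set (\<lambda>x. cmod (coord f x)) (supp f)"

lemma coord_scale [simp]: "coord (scale c f) x = c * coord f x"
  by (simp add: scale_def Poly_Mapping.map.rep_eq when_def)

lemma ip_superset: "\<lbrakk>finite S; supp f \<subseteq> S\<rbrakk> \<Longrightarrow> ip f g = (\<Sum>x\<in>S. cnj (coord f x) * coord g x)"
  unfolding ip_def by (rule sum.mono_neutral_left) (auto simp: in_keys_iff)

lemma nm_superset: "\<lbrakk>finite S; supp f \<subseteq> S\<rbrakk> \<Longrightarrow> nm f = L2_set (\<lambda>x. cmod (coord f x)) S"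
  unfolding nm_def L2_set_def
  by (rule arg_cong[where f = sqrt], rule sum.mono_neutral_left) (auto simp: in_keys_iff)

lemma supp_add: "supp (f + g) \<subseteq> supp f \<union> supp g"
  by (rule keys_add)

lemma supp_scale: "supp (scale c f) \<subseteq> supp f"
  by (auto simp: in_keys_iff)

lemma ip_add_left: "ip (f + g) h = ip f h + ip g h"
proof -
  have "ip (f + g) h = (\<Sum>x\<in>supp f \<union> supp g. cnj (coord (f + g) x) * coord h x)"
    by (intro ip_superset supp_add) simp
  also have "\<dots> = ip f h + ip g h"
    by (simp add: ip_superset[of "supp f \<union> supp g"] lookup_add algebra_simps sum.distrib)
  finally show ?thesis .
qed

lemma ip_add_right: "ip h (f + g) = ip h f + ip h g"
  by (simp add: ip_def lookup_add distrib_left sum.distrib)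

lemma ip_scale_left: "ip (scale c f) h = cnj c * ip f h"
  using ip_superset[OF _ supp_scale, of f c h] by (simp add: ip_def sum_distrib_left mult.assoc)

lemma ip_scale_right: "ip h (scale c f) = c * ip h f"
  by (simp add: ip_def sum_distrib_left mult_ac)

lemma ip_cnj: "ip f g = cnj (ip g f)"
proof -
  have "ip f g = (\<Sum>x\<in>supp f \<union> supp g. cnj (coord f x) * coord g x)" by (rule ip_superset) auto
  also have "\<dots> = cnj (\<Sum>x\<in>supp f \<union> supp g. cnj (coord g x) * coord f x)" by (simp add: mult.commute)
  also have "(\<Sum>x\<in>supp f \<union> supp g. cnj (coord g x) * coord f x) = ip g f"
    by (rule ip_superset[symmetric]) auto
  finally show ?thesis .
qed

lemma ip_zero [simp]: "ip 0 g = 0" "ip g 0 = 0"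
  by (simp_all add: ip_def)

lemma ip_single: "ip (Poly_Mapping.single x 1) g = coord g x"
  by (simp add: ip_def)

lemma ip_eqI: "(\<And>h. ip h f = ip h g) \<Longrightarrow> f = g"
  by (rule poly_mapping_eqI) (metis ip_single)

lemma nm_nonneg [simp]: "0 \<le> nm f"
  by (simp add: nm_def)

lemma nm_zero [simp]: "nm 0 = 0"
  by (simp add: nm_def)

lemma nm_square: "(nm f)\<^sup>2 = Re (ip f f)"
proof -
  have "Re (cnj z * z) = (cmod z)\<^sup>2" for z using cmod_power2[of z] by (simp add: power2_eq_square)
  then show ?thesis by (simp add: nm_def ip_def L2_set_def sum_nonneg)
qed

lemma nm_eq_zero: "nm f = 0 \<longleftrightarrow> f = 0"
  by (auto simp: nm_def L2_set_eq_0_iff in_keys_iff intro: poly_mapping_eqI)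

lemma nm_add: "nm (f + g) \<le> nm f + nm g"
proof -
  let ?S = "supp f \<union> supp g"
  have "nm (f + g) = L2_set (\<lambda>x. cmod (coord f x + coord g x)) ?S"
    using nm_superset[OF _ supp_add, of f g] by (simp add: lookup_add)
  also have "\<dots> \<le> L2_set (\<lambda>x. cmod (coord f x) + cmod (coord g x)) ?S"
    by (intro L2_set_mono norm_triangle_ineq) auto
  also have "\<dots> \<le> L2_set (\<lambda>x. cmod (coord f x)) ?S + L2_set (\<lambda>x. cmod (coord g x)) ?S"
    by (rule L2_set_triangle_ineq)
  also have "\<dots> = nm f + nm g" by (simp add: nm_superset[of ?S])
  finally show ?thesis .
qed

lemma nm_scale: "nm (scale c f) = cmod c * nm f"
  using nm_superset[OF _ supp_scale, of f c] by (simp add: nm_def norm_mult L2_set_left_distrib[symmetric] L2_set_right_distrib)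

lemma cauchy_schwarz: "cmod (ip f g) \<le> nm f * nm g"
proof -
  let ?S = "supp f \<union> supp g"
  have "cmod (ip f g) = cmod (\<Sum>x\<in>?S. cnj (coord f x) * coord g x)" by (subst ip_superset[of ?S]) auto
  also have "\<dots> \<le> (\<Sum>x\<in>?S. \<bar>cmod (coord f x)\<bar> * \<bar>cmod (coord g x)\<bar>)"
    by (rule order_trans[OF norm_sum]) (simp add: norm_mult)
  also have "\<dots> \<le> L2_set (\<lambda>x. cmod (coord f x)) ?S * L2_set (\<lambda>x. cmod (coord g x)) ?S"
    by (rule L2_set_mult_ineq)
  also have "\<dots> = nm f * nm g" by (simp add: nm_superset[of ?S])
  finally show ?thesis .
qed

text \<open>
  The vectors with finite support do not form a complete space, so a bounded operator on them need
  not have an adjoint. It is stored with an operator as its second component; the involution is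
  then a swap, and linearity follows from the adjoint relation.
\<close>

type_synonym 'x operator = "('x vec \<Rightarrow> 'x vec) \<times> ('x vec \<Rightarrow> 'x vec)"

definition op_bound :: "('x vec \<Rightarrow> 'x vec) \<Rightarrow> real" where
  "op_bound T = Sup ((\<lambda>f. nm (T f)) ` {f. nm f \<le> 1})"

definition adjointable :: "'x operator \<Rightarrow> bool" where
  "adjointable p \<longleftrightarrow> (\<forall>f g. ip (fst p f) g = ip f (snd p g)) \<and> (\<exists>K. \<forall>f. nm (fst p f) \<le> K * nm f)"

definition operators :: "'x operator cstar" where
  "operators = \<lparr>carrier = {p. adjointable p},
     mult = (\<lambda>p q. (fst p \<circ> fst q, snd q \<circ> snd p)),
     one = (id, id),
     zero = (\<lambda>_. 0, \<lambda>_. 0),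
     add = (\<lambda>p q. (\<lambda>f. fst p f + fst q f, \<lambda>f. snd p f + snd q f)),
     smul = (\<lambda>c p. (\<lambda>f. scale c (fst p f), \<lambda>f. scale (cnj c) (snd p f))),
     adj = prod.swap,
     nrm = (\<lambda>p. op_bound (fst p))\<rparr>"

lemma adjointableD:
  assumes "adjointable p"
  shows "ip (fst p f) g = ip f (snd p g)" "ip (snd p f) g = ip f (fst p g)"
proof -
  show a: "ip (fst p f) g = ip f (snd p g)" for f g using assms by (simp add: adjointable_def)
  show "ip (snd p f) g = ip f (fst p g)" using a[of g f] ip_cnj[of "snd p f" g] ip_cnj[of f "fst p g"] by simp
qed

lemma adjoint_bound:
  assumes p: "adjointable p" and K: "\<And>f. nm (fst p f) \<le> K * nm f"
  shows "nm (snd p g) \<le> K * nm g"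
proof (cases "nm (snd p g) = 0")
  case True
  have "0 \<le> K * nm g" using K[of g] nm_nonneg order_trans by blast
  then show ?thesis using True by simp
next
  case False
  have "(nm (snd p g))\<^sup>2 = Re (ip (fst p (snd p g)) g)" using nm_square adjointableD(1)[OF p] by simp
  also have "\<dots> \<le> nm (fst p (snd p g)) * nm g"
    using cauchy_schwarz complex_Re_le_cmod order_trans by blast
  also have "\<dots> \<le> (K * nm (snd p g)) * nm g" by (intro mult_right_mono K) simp
  finally have "nm (snd p g) * nm (snd p g) \<le> (K * nm g) * nm (snd p g)"
    by (simp add: power2_eq_square mult_ac)
  then show ?thesis using False nm_nonneg[of "snd p g"] by simp
qed

lemma adjointable_swap:
  assumes p: "adjointable p" shows "adjointable (prod.swap p)"
proof -
  obtain K where "\<And>f. nm (fst p f) \<le> K * nm f" using p by (auto simp: adjointable_def)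
  then show ?thesis using adjoint_bound[OF p] adjointableD(2)[OF p] by (auto simp: adjointable_def)
qed

lemma adjointable_linear:
  assumes p: "adjointable p"
  shows "fst p (f + g) = fst p f + fst p g" "fst p (scale c f) = scale c (fst p f)"
  by (rule ip_eqI, simp add: adjointableD(2)[OF p, symmetric] ip_add_right ip_scale_right)+

lemma adjointable_zero [simp]: "adjointable p \<Longrightarrow> fst p 0 = 0"
  using adjointable_linear(1)[of p 0 0] by simp

lemma op_bound:
  assumes p: "adjointable p"
  shows "nm (fst p f) \<le> op_bound (fst p) * nm f" "0 \<le> op_bound (fst p)"
proof -
  obtain K where K: "\<And>f. nm (fst p f) \<le> K * nm f" using p by (auto simp: adjointable_def)
  have bdd: "bdd_above ((\<lambda>f. nm (fst p f)) ` {f. nm f \<le> 1})"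
  proof (rule bdd_aboveI2)
    fix f :: "'a vec" assume "f \<in> {f. nm f \<le> 1}"
    then have "K * nm f \<le> \<bar>K\<bar> * 1" by (intro mult_mono) auto
    then show "nm (fst p f) \<le> \<bar>K\<bar>" using K[of f] by linarith
  qed
  have up: "nm (fst p f) \<le> op_bound (fst p)" if "nm f \<le> 1" for f
    unfolding op_bound_def by (rule cSUP_upper[OF _ bdd]) (use that in simp)
  show "0 \<le> op_bound (fst p)" using up[of 0] p by simp
  show "nm (fst p f) \<le> op_bound (fst p) * nm f"
  proof (cases "nm f = 0")
    case True then show ?thesis using p by (simp add: nm_eq_zero)
  next
    case False
    define c where "c = complex_of_real (1 / nm f)"
    have c: "cmod c = 1 / nm f" by (simp add: c_def norm_divide)
    have "nm (fst p (scale c f)) \<le> op_bound (fst p)" using False by (intro up) (simp add: nm_scale c)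
    then have "1 / nm f * nm (fst p f) \<le> op_bound (fst p)" using p by (simp add: adjointable_linear nm_scale c)
    then show ?thesis using False nm_nonneg[of f] by (simp add: field_simps)
  qed
qed

lemma op_bound_le: "\<lbrakk>0 \<le> K; \<And>f. nm (T f) \<le> K * nm f\<rbrakk> \<Longrightarrow> op_bound T \<le> K"
proof -
  assume K: "0 \<le> K" "\<And>f. nm (T f) \<le> K * nm f"
  have "nm (T f) \<le> K" if "nm f \<le> 1" for f
    using order_trans[OF K(2)[of f] mult_left_mono[OF that K(1)]] by simp
  moreover have "{f :: 'a vec. nm f \<le> 1} \<noteq> {}" by (auto intro!: exI[of _ 0])
  ultimately show ?thesis unfolding op_bound_def by (intro cSUP_least) auto
qed

text \<open>
  The norm of \<open>T f\<close> is controlled by \<open>T\<^sup>* T\<close> through Cauchy--Schwarz: its square is the inner product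
  of \<open>f\<close> and \<open>T\<^sup>* T f\<close>.
\<close>

lemma op_bound_square:
  assumes p: "adjointable p"
  shows "op_bound (snd p \<circ> fst p) = (op_bound (fst p))\<^sup>2"
proof -
  let ?a = "op_bound (fst p)" and ?b = "op_bound (snd p)" and ?c = "op_bound (snd p \<circ> fst p)"
  note B = op_bound[OF p] and B' = op_bound[OF adjointable_swap[OF p], simplified]
  have comp: "nm (snd p (fst p f)) \<le> ?b * ?a * nm f" for f
    using order_trans[OF B'(1)[of "fst p f"] mult_left_mono[OF B(1) B'(2)]] by (simp add: mult.assoc)
  have adj: "adjointable (snd p \<circ> fst p, snd p \<circ> fst p)"
    unfolding adjointable_def using comp by (auto simp: adjointableD[OF p])
  note C = op_bound[OF adj, simplified]
  have ac: "?a\<^sup>2 \<le> ?c"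
  proof -
    have "nm (fst p f) \<le> sqrt ?c * nm f" for f
    proof -
      have "(nm (fst p f))\<^sup>2 = Re (ip f (snd p (fst p f)))" by (simp add: nm_square adjointableD[OF p])
      also have "\<dots> \<le> nm f * nm (snd p (fst p f))"
        using cauchy_schwarz complex_Re_le_cmod order_trans by blast
      also have "\<dots> \<le> nm f * (?c * nm f)" using C(1)[of f] by (intro mult_left_mono) auto
      also have "\<dots> = (sqrt ?c * nm f)\<^sup>2" using C(2) by (simp add: power_mult_distrib power2_eq_square[of "nm f"])
      finally show ?thesis by (rule power2_le_imp_le) (use C(2) in simp)
    qed
    then have "?a \<le> sqrt ?c" using C(2) by (intro op_bound_le) auto
    then have "?a\<^sup>2 \<le> (sqrt ?c)\<^sup>2" using B(2) by (intro power_mono)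
    then show ?thesis using C(2) by simp
  qed
  have "?b \<le> ?a" by (rule op_bound_le[OF B(2) adjoint_bound[OF p B(1)]])
  then have "?b * ?a \<le> ?a\<^sup>2" using B(2) by (simp add: power2_eq_square mult_right_mono)
  moreover have "?c \<le> ?b * ?a" using B(2) B'(2) comp by (intro op_bound_le) auto
  ultimately show ?thesis using ac by simp
qed

lemma operators_simps [simp]:
  "carrier operators = {p. adjointable p}"
  "p \<otimes>\<^bsub>operators\<^esub> q = (fst p \<circ> fst q, snd q \<circ> snd p)"
  "\<zero>\<^bsub>operators\<^esub> = (\<lambda>_. 0, \<lambda>_. 0)"
  "p \<oplus>\<^bsub>operators\<^esub> q = (\<lambda>f. fst p f + fst q f, \<lambda>f. snd p f + snd q f)"
  "smul operators c p = (\<lambda>f. scale c (fst p f), \<lambda>f. scale (cnj c) (snd p f))"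
  "adj operators p = prod.swap p"
  "nrm operators p = op_bound (fst p)"
  by (simp_all add: operators_def)

lemma adjointable_mult: "\<lbrakk>adjointable p; adjointable q\<rbrakk> \<Longrightarrow> adjointable (fst p \<circ> fst q, snd q \<circ> snd p)"
proof -
  assume p: "adjointable p" and q: "adjointable q"
  have "nm (fst p (fst q f)) \<le> (op_bound (fst p) * op_bound (fst q)) * nm f" for f
    using order_trans[OF op_bound(1)[OF p] mult_left_mono[OF op_bound(1)[OF q] op_bound(2)[OF p]]] by (simp add: mult.assoc)
  then show ?thesis unfolding adjointable_def by (auto simp: adjointableD(1)[OF p] adjointableD(1)[OF q])
qed

lemma adjointable_add:
  "\<lbrakk>adjointable p; adjointable q\<rbrakk> \<Longrightarrow> adjointable (\<lambda>f. fst p f + fst q f, \<lambda>f. snd p f + snd q f)"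
proof -
  assume p: "adjointable p" and q: "adjointable q"
  have "nm (fst p f + fst q f) \<le> (op_bound (fst p) + op_bound (fst q)) * nm f" for f
    using nm_add[of "fst p f" "fst q f"] op_bound(1)[OF p, of f] op_bound(1)[OF q, of f] by (simp add: distrib_right)
  then show ?thesis unfolding adjointable_def
    by (auto simp: adjointableD(1)[OF p] adjointableD(1)[OF q] ip_add_left ip_add_right)
qed

lemma adjointable_smul:
  "adjointable p \<Longrightarrow> adjointable (\<lambda>f. scale c (fst p f), \<lambda>f. scale (cnj c) (snd p f))"
proof -
  assume p: "adjointable p"
  have "nm (scale c (fst p f)) \<le> (cmod c * op_bound (fst p)) * nm f" for f
    using mult_left_mono[OF op_bound(1)[OF p, of f], of "cmod c"] by (simp add: nm_scale mult.assoc)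
  then show ?thesis unfolding adjointable_def
    by (auto simp: adjointableD(1)[OF p] ip_scale_left ip_scale_right)
qed

lemma adjointable_null: "adjointable (\<lambda>_. 0, \<lambda>_. 0)"
  by (auto simp: adjointable_def intro: exI[of _ 0])

lemma scale_add_right: "scale c (f + g) = scale c f + scale c g"
  by (rule poly_mapping_eqI) (simp add: lookup_add distrib_left)

lemma scale_add_left: "scale (c + d) f = scale c f + scale d f"
  by (rule poly_mapping_eqI) (simp add: lookup_add distrib_right)

lemma scale_scale: "scale c (scale d f) = scale (c * d) f"
  by (rule poly_mapping_eqI) simp

lemma scale_one: "scale 1 f = f"
  by (rule poly_mapping_eqI) simp

lemma scale_minus_one: "scale (-1) f = - f"
  by (rule poly_mapping_eqI) simp

lemma op_bound_eq_zero:
  assumes p: "adjointable p" shows "op_bound (fst p) = 0 \<longleftrightarrow> p = (\<lambda>_. 0, \<lambda>_. 0)"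
proof
  assume "op_bound (fst p) = 0"
  then have "nm (fst p f) = 0" for f using op_bound(1)[OF p, of f] nm_nonneg[of "fst p f"] by simp
  then have f: "fst p f = 0" for f by (simp add: nm_eq_zero)
  have "ip h (snd p g) = ip h 0" for g h using adjointableD(1)[OF p, of h g] f by simp
  then have "snd p g = 0" for g by (rule ip_eqI)
  then show "p = (\<lambda>_. 0, \<lambda>_. 0)" using f by (auto simp: prod_eq_iff)
next
  assume "p = (\<lambda>_. 0, \<lambda>_. 0)"
  then have "op_bound (fst p) \<le> 0" by (intro op_bound_le) auto
  then show "op_bound (fst p) = 0" using op_bound(2)[OF p] by simp
qed

lemma operators_eqI:
  assumes "adjointable p" "adjointable q" "\<And>f. fst p f = fst q f" shows "p = q"
proof -
  have "ip h (snd p g) = ip h (snd q g)" for g h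
    using assms(3) adjointableD(1)[OF assms(1), of h g] adjointableD(1)[OF assms(2), of h g] by simp
  then have "snd p g = snd q g" for g by (rule ip_eqI)
  then show ?thesis using assms(3) by (auto simp: prod_eq_iff)
qed

lemma pre_cstar_operators: "pre_cstar_algebra (operators :: 'x operator cstar)"
proof (intro pre_cstar_algebra.intro pre_cstar_algebra_axioms.intro)
  let ?O = "operators :: 'x operator cstar"
  show "abelian_group ?O"
  proof (rule abelian_groupI)
    fix x assume "x \<in> carrier ?O"
    then show "\<exists>y\<in>carrier ?O. y \<oplus>\<^bsub>?O\<^esub> x = \<zero>\<^bsub>?O\<^esub>"
      using adjointable_smul[of x "-1"]
      by (intro bexI[of _ "smul operators (-1) x"]) (auto simp: scale_minus_one)
  qed (auto simp: adjointable_add adjointable_null add_ac)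
  fix x assume x: "x \<in> carrier ?O"
  then have p: "adjointable x" by simp
  show "nrm ?O (smul ?O c x) = cmod c * nrm ?O x" for c
  proof -
    have le: "op_bound (\<lambda>f. scale d (fst q f)) \<le> cmod d * op_bound (fst q)" if q: "adjointable q" for d q
      using mult_left_mono[OF op_bound(1)[OF q], of "cmod d"] op_bound(2)[OF q]
      by (intro op_bound_le) (auto simp: nm_scale mult.assoc)
    show ?thesis
    proof (cases "c = 0")
      case True
      then show ?thesis using le[OF p, of c] op_bound(2)[OF adjointable_smul[OF p, of c]] by simp
    next
      case False
      have "(\<lambda>f. scale (1 / c) (scale c (fst x f))) = fst x"
        using False by (simp add: scale_scale scale_one)
      then have "op_bound (fst x) \<le> cmod (1 / c) * op_bound (\<lambda>f. scale c (fst x f))"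
        using le[OF adjointable_smul[OF p, of c], of "1 / c"] by simp
      then have "cmod c * op_bound (fst x) \<le> op_bound (\<lambda>f. scale c (fst x f))"
        using False by (simp add: norm_divide field_simps)
      then show ?thesis using le[OF p, of c] by simp
    qed
  qed
  show "nrm ?O x = 0 \<longleftrightarrow> x = \<zero>\<^bsub>?O\<^esub>" using op_bound_eq_zero[OF p] by simp
  show "nrm ?O (adj ?O x \<otimes>\<^bsub>?O\<^esub> x) = (nrm ?O x)\<^sup>2" using op_bound_square[OF p] by simp
  fix y assume "y \<in> carrier ?O"
  then have q: "adjointable y" by simp
  show "nrm ?O (x \<oplus>\<^bsub>?O\<^esub> y) \<le> nrm ?O x + nrm ?O y"
  proof -
    have "nm (fst x f + fst y f) \<le> (op_bound (fst x) + op_bound (fst y)) * nm f" for f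
      using nm_add[of "fst x f" "fst y f"] op_bound(1)[OF p, of f] op_bound(1)[OF q, of f] by (simp add: distrib_right)
    then show ?thesis using op_bound(2)[OF p] op_bound(2)[OF q] by (simp add: op_bound_le)
  qed
  show "nrm ?O (x \<otimes>\<^bsub>?O\<^esub> y) \<le> nrm ?O x * nrm ?O y"
  proof -
    have "nm (fst x (fst y f)) \<le> (op_bound (fst x) * op_bound (fst y)) * nm f" for f
      using order_trans[OF op_bound(1)[OF p] mult_left_mono[OF op_bound(1)[OF q] op_bound(2)[OF p]]] by (simp add: mult.assoc)
    then show ?thesis using op_bound(2)[OF p] op_bound(2)[OF q] by (simp add: op_bound_le)
  qed
qed (auto simp: adjointable_mult adjointable_smul adjointable_swap adjointable_linear
      adjointable_linear[OF adjointable_swap, simplified] scale_add_right scale_add_left scale_scale scale_one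
      fun_eq_iff mult.commute)

section \<open>Operators of partial injections\<close>

definition inverse_maps :: "('x \<Rightarrow> 'x option) \<Rightarrow> ('x \<Rightarrow> 'x option) \<Rightarrow> bool" where
  "inverse_maps \<psi> \<phi> \<longleftrightarrow> (\<forall>x y. \<psi> y = Some x \<longleftrightarrow> \<phi> x = Some y)"

text \<open>
  If \<open>\<psi>\<close> and \<open>\<phi>\<close> are inverse to each other, \<open>pull \<psi>\<close> sends the basis vector at \<open>x\<close> to the one at \<open>\<phi> x\<close>,
  and to \<open>0\<close> if \<open>\<phi> x\<close> is undefined. Its adjoint is \<open>pull \<phi>\<close>.
\<close>

definition pull :: "('x \<Rightarrow> 'x option) \<Rightarrow> 'x vec \<Rightarrow> 'x vec" where
  "pull \<psi> f = Abs_poly_mapping (\<lambda>y. case \<psi> y of None \<Rightarrow> 0 | Some x \<Rightarrow> coord f x)"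

lemma inverse_maps_swap: "inverse_maps \<psi> \<phi> \<Longrightarrow> inverse_maps \<phi> \<psi>"
  by (auto simp: inverse_maps_def)

lemma coord_pull:
  assumes "inverse_maps \<psi> \<phi>"
  shows "coord (pull \<psi> f) y = (case \<psi> y of None \<Rightarrow> 0 | Some x \<Rightarrow> coord f x)"
proof -
  have "{y. (case \<psi> y of None \<Rightarrow> 0 | Some x \<Rightarrow> coord f x) \<noteq> 0} \<subseteq> (\<lambda>x. the (\<phi> x)) ` supp f"
  proof
    fix y assume "y \<in> {y. (case \<psi> y of None \<Rightarrow> 0 | Some x \<Rightarrow> coord f x) \<noteq> 0}"
    then obtain x where x: "\<psi> y = Some x" "coord f x \<noteq> 0" by (auto split: option.splits)
    then have "\<phi> x = Some y" using assms by (simp add: inverse_maps_def)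
    then have "y = the (\<phi> x)" by simp
    moreover have "x \<in> supp f" using x(2) by (simp add: in_keys_iff)
    ultimately show "y \<in> (\<lambda>x. the (\<phi> x)) ` supp f" by (rule image_eqI)
  qed
  then have "finite {y. (case \<psi> y of None \<Rightarrow> 0 | Some x \<Rightarrow> coord f x) \<noteq> 0}"
    by (rule finite_subset) simp
  then show ?thesis by (simp add: pull_def lookup_Abs_poly_mapping)
qed

lemma pull_sum:
  assumes i: "inverse_maps \<psi> \<phi>"
  shows "(\<Sum>y\<in>supp (pull \<psi> f). F y (coord (pull \<psi> f) y)) =
    (\<Sum>x\<in>{x \<in> supp f. \<phi> x \<noteq> None}. F (the (\<phi> x)) (coord f x))"
proof (rule sum.reindex_bij_witness[where i = "\<lambda>x. the (\<phi> x)" and j = "\<lambda>y. the (\<psi> y)"])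
  have iff: "\<psi> y = Some x \<longleftrightarrow> \<phi> x = Some y" for x y using i by (simp add: inverse_maps_def)
  fix y assume y: "y \<in> supp (pull \<psi> f)"
  then obtain x where x: "\<psi> y = Some x" "coord f x \<noteq> 0"
    by (auto simp: in_keys_iff coord_pull[OF i] split: option.splits)
  then show "the (\<phi> (the (\<psi> y))) = y" "the (\<psi> y) \<in> {x \<in> supp f. \<phi> x \<noteq> None}"
    "F (the (\<phi> (the (\<psi> y)))) (coord f (the (\<psi> y))) = F y (coord (pull \<psi> f) y)"
    using iff[of y x] by (simp_all add: in_keys_iff coord_pull[OF i])
next
  have iff: "\<psi> y = Some x \<longleftrightarrow> \<phi> x = Some y" for x y using i by (simp add: inverse_maps_def)
  fix x assume "x \<in> {x \<in> supp f. \<phi> x \<noteq> None}"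
  then obtain y where "\<phi> x = Some y" "coord f x \<noteq> 0" by (auto simp: in_keys_iff)
  then show "the (\<psi> (the (\<phi> x))) = x" "the (\<phi> x) \<in> supp (pull \<psi> f)"
    using iff[of y x] by (simp_all add: in_keys_iff coord_pull[OF i])
qed

lemma nm_pull: "inverse_maps \<psi> \<phi> \<Longrightarrow> nm (pull \<psi> f) \<le> nm f"
  unfolding nm_def L2_set_def real_sqrt_le_iff
  by (subst pull_sum[where F = "\<lambda>_ z. (cmod z)\<^sup>2"]) (auto intro!: sum_mono2)

lemma ip_pull:
  assumes i: "inverse_maps \<psi> \<phi>" shows "ip (pull \<psi> f) g = ip f (pull \<phi> g)"
proof -
  have "ip (pull \<psi> f) g = (\<Sum>x\<in>{x \<in> supp f. \<phi> x \<noteq> None}. cnj (coord f x) * coord g (the (\<phi> x)))"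
    unfolding ip_def by (rule pull_sum[OF i, where F = "\<lambda>y z. cnj z * coord g y"])
  also have "\<dots> = (\<Sum>x\<in>supp f. cnj (coord f x) * coord (pull \<phi> g) x)"
    by (rule sum.mono_neutral_cong_left)
      (auto simp: coord_pull[OF inverse_maps_swap[OF i]] split: option.splits)
  finally show ?thesis by (simp add: ip_def)
qed

lemma adjointable_pull: "inverse_maps \<psi> \<phi> \<Longrightarrow> adjointable (pull \<psi>, pull \<phi>)"
  unfolding adjointable_def using nm_pull ip_pull by (auto intro!: exI[of _ 1])

section \<open>Families in pre-C*-algebras and their completions\<close>

locale completed_evaluation = free_evaluation B G t
  for B :: "'b cstar" (structure) and G :: "'g set" and t :: "'g \<Rightarrow> 'b"
begin

abbreviation (input) "eval_norm \<equiv> (\<lambda>x. nrm B (ev x))"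

sublocale q: cstar_seminorm G eval_norm
  by (rule eval_seminorm)

sublocale C: pre_cstar_algebra q.C
  by (rule q.pre_cstar_C)

text \<open>
  Values of the same polynomial in the generators. The two norms agree on such values, so \<open>corr\<close> is
  the graph of a bijection, and identities between values can be read in either algebra.
\<close>

definition corr :: "(nat \<Rightarrow> 'g free) set \<Rightarrow> 'b \<Rightarrow> bool" where
  "corr a b \<longleftrightarrow> (\<exists>y\<in>Fr. a = q.emb y \<and> b = ev y)"

lemma corr_closed: "corr a b \<Longrightarrow> a \<in> carrier q.C" "corr a b \<Longrightarrow> b \<in> carrier B"
  by (auto simp: corr_def)

lemma corr_gen: "g \<in> G \<Longrightarrow> corr (gen G eval_norm g) (t g)"
  unfolding corr_def by (intro bexI[of _ "letter_word g"]) (simp_all add: gen_def eval_letter)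

lemma corr_zero: "corr \<zero>\<^bsub>q.C\<^esub> \<zero>"
  unfolding corr_def by (intro bexI[of _ 0]) (simp_all add: q.zero_C)

lemma corr_add: "\<lbrakk>corr a b; corr a' b'\<rbrakk> \<Longrightarrow> corr (a \<oplus>\<^bsub>q.C\<^esub> a') (b \<oplus> b')"
  unfolding corr_def by (metis eval_add free_add q.emb_hom(1))

lemma corr_mult: "\<lbrakk>corr a b; corr a' b'\<rbrakk> \<Longrightarrow> corr (a \<otimes>\<^bsub>q.C\<^esub> a') (b \<otimes> b')"
  unfolding corr_def by (metis eval_mult free_mult q.emb_hom(2))

lemma corr_adj: "corr a b \<Longrightarrow> corr (adj q.C a) (adj B b)"
  unfolding corr_def by (metis eval_adj free_adj_closed q.emb_hom(4))

lemma corr_diff: "\<lbrakk>corr a b; corr a' b'\<rbrakk> \<Longrightarrow> corr (a \<ominus>\<^bsub>q.C\<^esub> a') (b \<ominus> b')"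
proof -
  assume "corr a b" "corr a' b'"
  then obtain y y' where y: "y \<in> Fr" "a = q.emb y" "b = ev y" and y': "y' \<in> Fr" "a' = q.emb y'" "b' = ev y'"
    unfolding corr_def by blast
  have "a \<ominus>\<^bsub>q.C\<^esub> a' = q.emb (y - y')" unfolding y y' by (rule q.diff_C(1)) (use y y' in simp_all)
  moreover have "b \<ominus> b' = ev (y - y')" unfolding y y' using y y' by (simp add: eval_diff)
  ultimately show ?thesis unfolding corr_def using y y' by (intro bexI[of _ "y - y'"]) auto
qed

lemma corr_finsum:
  "(\<And>i. i \<in> I \<Longrightarrow> corr (f i) (h i)) \<Longrightarrow> corr (finsum q.C f I) (finsum B h I)"
proof (induction I rule: infinite_finite_induct)
  case (insert i I)
  have "f \<in> I \<rightarrow> carrier q.C" "f i \<in> carrier q.C" "h \<in> I \<rightarrow> carrier B" "h i \<in> carrier B"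
    using insert.prems corr_closed by blast+
  then show ?case using insert by (simp add: C.finsum_insert finsum_insert corr_add)
qed (simp_all add: C.finsum_infinite finsum_infinite C.finsum_empty finsum_empty corr_zero)

lemma corr_mult_list:
  "(\<And>i. i \<in> set xs \<Longrightarrow> corr (f i) (h i)) \<Longrightarrow> corr (mult_list q.C (map f xs)) (mult_list B (map h xs))"
proof (induction xs)
  case (Cons i xs)
  then show ?case by (cases "xs = []") (simp_all add: C.mult_list_Cons mult_list_Cons corr_mult)
qed (simp add: corr_zero)

lemma corr_inj:
  assumes "corr a b" "corr a' b'" shows "a = a' \<longleftrightarrow> b = b'"
proof -
  obtain y where y: "y \<in> Fr" "a \<ominus>\<^bsub>q.C\<^esub> a' = q.emb y" "b \<ominus> b' = ev y"
    using corr_diff[OF assms] unfolding corr_def by blast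
  have "nrm q.C (a \<ominus>\<^bsub>q.C\<^esub> a') = nrm B (b \<ominus> b')" unfolding y(2,3) using y(1) by (rule q.nrm_C_const)
  moreover have "a = a' \<longleftrightarrow> nrm q.C (a \<ominus>\<^bsub>q.C\<^esub> a') = 0" "b = b' \<longleftrightarrow> nrm B (b \<ominus> b') = 0"
    using corr_closed[OF assms(1)] corr_closed[OF assms(2)]
    by (simp_all add: C.nrm_eq_0 C.diff_eq_zero_iff nrm_eq_0 diff_eq_zero_iff)
  ultimately show ?thesis by simp
qed

lemma corr_eqI: "\<lbrakk>corr a b; corr a' b'; b = b'\<rbrakk> \<Longrightarrow> a = a'"
  by (simp add: corr_inj)

end

context k_graph
begin

context
  fixes \<E> and B :: "'b cstar" and t :: "'l \<Rightarrow> 'b"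
  assumes \<E>: "\<E> \<subseteq> FE \<Lambda>" and B: "pre_cstar_algebra B" and t: "relative_CK_family \<Lambda> \<E> B t"
begin

lemma completed: "completed_evaluation B (paths \<Lambda>) t"
  using t B by (intro completed_evaluation.intro free_evaluation.intro free_evaluation_axioms.intro)
    (auto simp: relative_CK_family_def)

interpretation completed_evaluation B "paths \<Lambda>" t by (rule completed)

abbreviation "cgen \<equiv> gen (paths \<Lambda>) (\<lambda>x. nrm B (free_eval B t x))"

lemma corr_gap:
  assumes "F \<in> FE \<Lambda>"
  shows "corr (gap_projection \<Lambda> q.C cgen F) (gap_projection \<Lambda> B t F)"
  unfolding gap_projection_def mult_set_def
  using FE_paths[OF assms] enumeration[OF assms]
  by (intro corr_mult_list corr_diff corr_mult corr_adj corr_gen) auto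

lemma family_in_completion: "relative_CK_family \<Lambda> \<E> q.C cgen"
  unfolding relative_CK_family_def
proof (intro conjI ballI impI)
  note c = corr_gen corr_mult corr_adj corr_zero
  fix \<kappa> assume k: "\<kappa> \<in> paths \<Lambda>"
  show "cgen \<kappa> \<in> carrier q.C" using k by (rule q.gen_closed)
  show "cgen \<kappa> \<otimes>\<^bsub>q.C\<^esub> adj q.C (cgen \<kappa>) \<otimes>\<^bsub>q.C\<^esub> cgen \<kappa> = cgen \<kappa>"
    by (rule corr_eqI[OF c(2)[OF c(2)[OF c(1)[OF k] c(3)[OF c(1)[OF k]]] c(1)[OF k]] c(1)[OF k]]) (use k t in \<open>simp add: relative_CK_family_def\<close>)
  fix \<mu> assume m: "\<mu> \<in> paths \<Lambda>"
  show "cgen \<kappa> \<otimes>\<^bsub>q.C\<^esub> cgen \<mu> = cgen (\<kappa> \<cdot> \<mu>)" if "src \<Lambda> \<kappa> = rng \<Lambda> \<mu>"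
    by (rule corr_eqI[OF c(2)[OF c(1)[OF k] c(1)[OF m]] c(1)[OF cmp_closed[OF k m that]]]) (use k m that t in \<open>simp add: relative_CK_family_def\<close>)
  show "adj q.C (cgen \<kappa>) \<otimes>\<^bsub>q.C\<^esub> cgen \<mu> =
      finsum q.C (\<lambda>p. cgen (fst p) \<otimes>\<^bsub>q.C\<^esub> adj q.C (cgen (snd p))) (min_ext \<Lambda> \<kappa> \<mu>)"
  proof (rule corr_eqI)
    show "corr (adj q.C (cgen \<kappa>) \<otimes>\<^bsub>q.C\<^esub> cgen \<mu>) (adj B (t \<kappa>) \<otimes>\<^bsub>B\<^esub> t \<mu>)" using c k m by simp
    show "corr (finsum q.C (\<lambda>p. cgen (fst p) \<otimes>\<^bsub>q.C\<^esub> adj q.C (cgen (snd p))) (min_ext \<Lambda> \<kappa> \<mu>))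
      (finsum B (\<lambda>p. t (fst p) \<otimes>\<^bsub>B\<^esub> adj B (t (snd p))) (min_ext \<Lambda> \<kappa> \<mu>))"
      by (intro corr_finsum c min_extD)
  qed (use k m t in \<open>simp add: relative_CK_family_def\<close>)
next
  have v: "v \<in> paths \<Lambda>" if "v \<in> vertices \<Lambda>" for v using that by (simp add: vertices_def)
  note c = corr_gen corr_mult corr_adj corr_zero
  fix w assume w: "w \<in> vertices \<Lambda>"
  show "adj q.C (cgen w) = cgen w"
    by (rule corr_eqI[OF c(3)[OF c(1)[OF v[OF w]]] c(1)[OF v[OF w]]]) (use w t in \<open>simp add: relative_CK_family_def\<close>)
  show "cgen w \<otimes>\<^bsub>q.C\<^esub> cgen w = cgen w"
    by (rule corr_eqI[OF c(2)[OF c(1)[OF v[OF w]] c(1)[OF v[OF w]]] c(1)[OF v[OF w]]]) (use w t in \<open>simp add: relative_CK_family_def\<close>)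
  fix u assume u: "u \<in> vertices \<Lambda>" "w \<noteq> u"
  show "cgen w \<otimes>\<^bsub>q.C\<^esub> cgen u = \<zero>\<^bsub>q.C\<^esub>"
    by (rule corr_eqI[OF c(2)[OF c(1)[OF v[OF w]] c(1)[OF v[OF u(1)]]] c(4)]) (use w u t in \<open>simp add: relative_CK_family_def\<close>)
next
  fix E assume E: "E \<in> \<E>"
  show "gap_projection \<Lambda> q.C cgen E = \<zero>\<^bsub>q.C\<^esub>"
    by (rule corr_eqI[OF corr_gap corr_zero]) (use E \<E> t in \<open>auto simp: relative_CK_family_def\<close>)
qed

text \<open>
  The completion is a C*-algebra to which the universal algebra maps; \<open>corr_inj\<close> compares the values
  there with the values in \<open>B\<close>.
\<close>

lemma universal_nonzero:
  shows "\<lbrakk>v \<in> vertices \<Lambda>; t v \<noteq> \<zero>\<^bsub>B\<^esub>\<rbrakk> \<Longrightarrow> CK_gen \<Lambda> \<E> v \<noteq> \<zero>\<^bsub>CK_algebra \<Lambda> \<E>\<^esub>"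
    and "\<lbrakk>F \<in> FE \<Lambda>; gap_projection \<Lambda> B t F \<noteq> \<zero>\<^bsub>B\<^esub>\<rbrakk> \<Longrightarrow>
      gap_projection \<Lambda> (CK_algebra \<Lambda> \<E>) (CK_gen \<Lambda> \<E>) F \<noteq> \<zero>\<^bsub>CK_algebra \<Lambda> \<E>\<^esub>"
proof -
  let ?U = "CK_algebra \<Lambda> \<E>"
  let ?\<pi> = "CK_hom \<Lambda> \<E> q.C cgen"
  note U = cstar_algebra.axioms(1)[OF cstar_algebra_CK_algebra[OF \<E>]]
  note h = CK_hom[OF \<E> q.cstar_algebra_completion family_in_completion]
  interpret star_homomorphism ?U q.C ?\<pi>
    by (intro star_homomorphism.intro star_homomorphism_axioms.intro U q.pre_cstar_C h(1))
  have gU: "CK_gen \<Lambda> \<E> \<kappa> \<in> carrier ?U" if "\<kappa> \<in> paths \<Lambda>" for \<kappa>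
    using CK_gen_family[OF \<E>] that by (simp add: relative_CK_family_def)
  show "CK_gen \<Lambda> \<E> v \<noteq> \<zero>\<^bsub>?U\<^esub>" if v: "v \<in> vertices \<Lambda>" "t v \<noteq> \<zero>\<^bsub>B\<^esub>"
  proof
    assume z: "CK_gen \<Lambda> \<E> v = \<zero>\<^bsub>?U\<^esub>"
    have p: "v \<in> paths \<Lambda>" using v(1) by (simp add: vertices_def)
    have "cgen v = \<zero>\<^bsub>q.C\<^esub>" using h(2)[OF p] z by simp
    then show False using corr_inj[OF corr_gen[OF p] corr_zero] v(2) by simp
  qed
  show "gap_projection \<Lambda> ?U (CK_gen \<Lambda> \<E>) F \<noteq> \<zero>\<^bsub>?U\<^esub>"
    if F: "F \<in> FE \<Lambda>" "gap_projection \<Lambda> B t F \<noteq> \<zero>\<^bsub>B\<^esub>"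
  proof
    assume z: "gap_projection \<Lambda> ?U (CK_gen \<Lambda> \<E>) F = \<zero>\<^bsub>?U\<^esub>"
    have "gap_projection \<Lambda> q.C cgen F = ?\<pi> (gap_projection \<Lambda> ?U (CK_gen \<Lambda> \<E>) F)"
      by (rule gap_hom[symmetric, OF U q.pre_cstar_C h(1) gU F(1) h(2)])
    then have "gap_projection \<Lambda> q.C cgen F = \<zero>\<^bsub>q.C\<^esub>" using z by simp
    then show False using corr_inj[OF corr_gap[OF F(1)] corr_zero] F(2) by simp
  qed
qed

end

end

section \<open>The representation on relative filters\<close>

lemma fst_finsum_operators:
  "(\<And>i. i \<in> I \<Longrightarrow> adjointable (F i)) \<Longrightarrow> fst (finsum operators F I) f = (\<Sum>i\<in>I. fst (F i) f)"
proof -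
  interpret O: pre_cstar_algebra "operators :: 'x operator cstar" by (rule pre_cstar_operators)
  show "(\<And>i. i \<in> I \<Longrightarrow> adjointable (F i)) \<Longrightarrow> fst (finsum operators F I) f = (\<Sum>i\<in>I. fst (F i) f)"
  proof (induction I rule: infinite_finite_induct)
    case (insert i I)
    then have "F \<in> I \<rightarrow> carrier operators" "F i \<in> carrier operators" by auto
    with insert show ?case by (simp add: O.finsum_insert del: operators_simps(1))
  qed (simp_all add: O.finsum_infinite O.finsum_empty)
qed

lemma fst_diff_operators:
  assumes "adjointable p" "adjointable q"
  shows "fst (p \<ominus>\<^bsub>operators\<^esub> q) f = fst p f - fst q f"
proof -
  interpret O: pre_cstar_algebra "operators :: 'x operator cstar" by (rule pre_cstar_operators)
  have "p \<ominus>\<^bsub>operators\<^esub> q = p \<oplus>\<^bsub>operators\<^esub> smul operators (-1) q"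
    using assms by (simp only: a_minus_def) (subst O.smul_minus_one, simp_all)
  then show ?thesis by (simp add: scale_minus_one)
qed

lemma relative_CK_familyI:
  "\<lbrakk>relative_CK_family \<Lambda> {} B t; \<And>E. E \<in> \<E> \<Longrightarrow> gap_projection \<Lambda> B t E = \<zero>\<^bsub>B\<^esub>\<rbrakk> \<Longrightarrow> relative_CK_family \<Lambda> \<E> B t"
  by (simp add: relative_CK_family_def)

context finitely_aligned_k_graph
begin

context
  fixes \<E> :: "'a set set"
  assumes sat: "satiated \<Lambda> \<E>"
begin

definition push_path :: "'a \<Rightarrow> 'a set \<Rightarrow> 'a set option" where
  "push_path \<kappa> y = (if relative_filter \<E> y \<and> src \<Lambda> \<kappa> \<in> y then Some (shift \<kappa> y) else None)"

definition pop_path :: "'a \<Rightarrow> 'a set \<Rightarrow> 'a set option" where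
  "pop_path \<kappa> x = (if relative_filter \<E> x \<and> \<kappa> \<in> x then Some (unshift \<kappa> x) else None)"

text \<open>
  The operator of \<open>\<kappa>\<close> sends the basis vector at a filter \<open>y\<close> to the one at \<open>shift \<kappa> y\<close>; its adjoint
  removes the prefix \<open>\<kappa>\<close>.
\<close>

definition rep :: "'a \<Rightarrow> 'a set operator" where
  "rep \<kappa> = (pull (pop_path \<kappa>), pull (push_path \<kappa>))"

lemma inverse_paths: "\<kappa> \<in> paths \<Lambda> \<Longrightarrow> inverse_maps (pop_path \<kappa>) (push_path \<kappa>)"
  unfolding inverse_maps_def pop_path_def push_path_def
  using shift_unshift[OF sat] unshift_filter[OF sat] unshift_base[OF sat]
    unshift_shift[OF sat] shift_filter[OF sat] shift_base[OF sat] by auto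

lemma adjointable_rep [simp]: "\<kappa> \<in> paths \<Lambda> \<Longrightarrow> adjointable (rep \<kappa>)"
  unfolding rep_def by (intro adjointable_pull inverse_paths)

lemma coord_rep:
  "\<kappa> \<in> paths \<Lambda> \<Longrightarrow> coord (fst (rep \<kappa>) f) y = (case pop_path \<kappa> y of None \<Rightarrow> 0 | Some x \<Rightarrow> coord f x)"
  "\<kappa> \<in> paths \<Lambda> \<Longrightarrow> coord (snd (rep \<kappa>) f) y = (case push_path \<kappa> y of None \<Rightarrow> 0 | Some x \<Rightarrow> coord f x)"
  by (simp_all add: rep_def coord_pull[OF inverse_paths] coord_pull[OF inverse_maps_swap[OF inverse_paths]])

lemma coord_rep_proj:
  assumes "\<kappa> \<in> paths \<Lambda>"
  shows "coord (fst (rep \<kappa>) (snd (rep \<kappa>) f)) y = (if relative_filter \<E> y \<and> \<kappa> \<in> y then coord f y else 0)"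
proof (cases "relative_filter \<E> y \<and> \<kappa> \<in> y")
  case True
  then have "pop_path \<kappa> y = Some (unshift \<kappa> y)" by (simp add: pop_path_def)
  moreover from this have "push_path \<kappa> (unshift \<kappa> y) = Some y"
    using inverse_paths[OF assms] by (simp add: inverse_maps_def)
  ultimately show ?thesis using True assms by (simp add: coord_rep)
next
  case False
  then have "pop_path \<kappa> y = None" by (simp add: pop_path_def)
  then show ?thesis using False assms by (auto simp: coord_rep)
qed

lemma path_maps_vertex:
  assumes v: "v \<in> vertices \<Lambda>"
  shows "pop_path v x = (if relative_filter \<E> x \<and> v \<in> x then Some x else None)" "push_path v x = pop_path v x"
proof -
  have "unshift v x = x" if x: "relative_filter \<E> x" "v \<in> x"
  proof -
    have e: "v \<cdot> \<mu> = \<mu>" if "\<mu> \<in> paths \<Lambda>" "rng \<Lambda> \<mu> = v" for \<mu>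
      using cmp_rng[OF that(1)] that(2) by simp
    have "\<mu> \<in> unshift v x \<longleftrightarrow> \<mu> \<in> x" for \<mu>
    proof
      assume "\<mu> \<in> unshift v x"
      then have "\<mu> \<in> paths \<Lambda>" "rng \<Lambda> \<mu> = v" "v \<cdot> \<mu> \<in> x"
        unfolding unshift_def verticesD(3)[OF v] by auto
      then show "\<mu> \<in> x" using e by simp
    next
      assume \<mu>: "\<mu> \<in> x"
      have "\<mu> \<in> paths \<Lambda>" "rng \<Lambda> \<mu> = v" using relative_filterD(1)[OF x(1) \<mu>] filter_vertex[OF x v \<mu>] .
      then show "\<mu> \<in> unshift v x" using \<mu> e verticesD(3)[OF v] by (simp add: unshift_def)
    qed
    then show ?thesis by blast
  qed
  then show 1: "pop_path v x = (if relative_filter \<E> x \<and> v \<in> x then Some x else None)"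
    by (simp add: pop_path_def)
  show "push_path v x = pop_path v x"
  proof (cases "relative_filter \<E> x \<and> v \<in> x")
    case True
    have "unshift v x = x" using 1 True by (simp add: pop_path_def)
    then have "shift v x = x" using shift_unshift[OF sat, of x v] True by simp
    then show ?thesis unfolding 1 using True verticesD(3)[OF v] by (simp add: push_path_def)
  next
    case False
    then show ?thesis unfolding 1 using verticesD(3)[OF v] by (auto simp: push_path_def)
  qed
qed

lemma push_path_cmp:
  assumes "\<kappa> \<in> paths \<Lambda>" "\<mu> \<in> paths \<Lambda>" "src \<Lambda> \<kappa> = rng \<Lambda> \<mu>"
  shows "push_path (\<kappa> \<cdot> \<mu>) y = (case push_path \<mu> y of None \<Rightarrow> None | Some z \<Rightarrow> push_path \<kappa> z)"
proof (cases "relative_filter \<E> y \<and> src \<Lambda> \<mu> \<in> y")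
  case True
  note m = shift_filter[OF sat assms(2)] shift_base[OF sat assms(2)]
  have "src \<Lambda> \<kappa> \<in> shift \<mu> y"
    using True m relative_filterD(2)[OF _ _ rng_prefix[OF assms(2)]] assms(3) by metis
  then show ?thesis
    using True m shift_shift[OF sat assms] assms by (simp add: push_path_def src_cmp)
next
  case False
  then have "push_path \<mu> y = None" "push_path (\<kappa> \<cdot> \<mu>) y = None"
    using src_cmp[OF assms] by (auto simp: push_path_def)
  then show ?thesis by simp
qed

text \<open>
  With \<open>y = \<alpha>u\<close> for the only pair \<open>(\<alpha>, \<beta>)\<close> of minimal extensions with \<open>\<alpha> \<in> y\<close>, one has
  \<open>\<kappa>y = \<kappa>\<alpha>u = \<mu>\<beta>u\<close>; so removing \<open>\<mu>\<close> from \<open>\<kappa>y\<close> gives \<open>\<beta>u\<close>.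
\<close>

lemma pop_push_path:
  assumes \<kappa>: "\<kappa> \<in> paths \<Lambda>" and \<mu>: "\<mu> \<in> paths \<Lambda>" and p: "p \<in> min_ext \<Lambda> \<kappa> \<mu>"
    and y: "relative_filter \<E> y" "fst p \<in> y"
  shows "push_path \<kappa> y = Some (shift \<kappa> y)" "pop_path \<mu> (shift \<kappa> y) = push_path (snd p) (unshift (fst p) y)"
proof -
  note m = min_extD[OF p] and s = min_ext_src[OF p \<kappa> \<mu>]
  let ?u = "unshift (fst p) y"
  note u = unshift_filter[OF sat y] unshift_base[OF sat y] shift_unshift[OF sat y]
  have r: "src \<Lambda> \<kappa> \<in> y" using relative_filterD(2)[OF y rng_prefix[OF m(1)]] m(3) by simp
  then show "push_path \<kappa> y = Some (shift \<kappa> y)" using y(1) by (simp add: push_path_def)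
  have "shift \<kappa> y = shift (\<kappa> \<cdot> fst p) ?u" using shift_shift[OF sat \<kappa> m(1,3) u(1,2)] u(3) by simp
  also have "\<dots> = shift \<mu> (shift (snd p) ?u)" unfolding m(5)
    using shift_shift[OF sat \<mu> m(2,4) u(1)] u(2) s by simp
  finally have e: "shift \<kappa> y = shift \<mu> (shift (snd p) ?u)" .
  have b: "relative_filter \<E> (shift (snd p) ?u)" "snd p \<in> shift (snd p) ?u"
    using shift_filter[OF sat m(2) u(1)] shift_base[OF sat m(2) u(1)] u(2) s by auto
  have "src \<Lambda> \<mu> \<in> shift (snd p) ?u" using relative_filterD(2)[OF b rng_prefix[OF m(2)]] m(4) by simp
  note f = shift_filter[OF sat \<mu> b(1) this] shift_base[OF sat \<mu> b(1) this] unshift_shift[OF sat \<mu> b(1) this]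
  show "pop_path \<mu> (shift \<kappa> y) = push_path (snd p) ?u"
    unfolding e using f u s by (simp add: pop_path_def push_path_def)
qed

lemma rep_star:
  assumes \<kappa>: "\<kappa> \<in> paths \<Lambda>" and \<mu>: "\<mu> \<in> paths \<Lambda>"
  shows "coord (snd (rep \<kappa>) (fst (rep \<mu>) f)) y =
    (\<Sum>p\<in>min_ext \<Lambda> \<kappa> \<mu>. coord (fst (rep (fst p)) (snd (rep (snd p)) f)) y)"
proof -
  let ?g = "\<lambda>p. coord (fst (rep (fst p)) (snd (rep (snd p)) f)) y"
  have zero: "?g p = 0" if "p \<in> min_ext \<Lambda> \<kappa> \<mu>" "\<not> (relative_filter \<E> y \<and> fst p \<in> y)" for p
    using that min_extD(1)[OF that(1)] by (auto simp: coord_rep pop_path_def)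
  show ?thesis
  proof (cases "relative_filter \<E> y \<and> (\<exists>p\<in>min_ext \<Lambda> \<kappa> \<mu>. fst p \<in> y)")
    case True
    then obtain p where p: "p \<in> min_ext \<Lambda> \<kappa> \<mu>" and y: "relative_filter \<E> y" "fst p \<in> y" by blast
    have only: "p' = p" if p': "p' \<in> min_ext \<Lambda> \<kappa> \<mu>" "fst p' \<in> y" for p'
    proof -
      have "deg \<Lambda> (\<kappa> \<cdot> fst p') = deg \<Lambda> (\<kappa> \<cdot> fst p)" using min_extD(6)[OF p] min_extD(6)[OF p'(1)] by (simp add: MCE_iff)
      then have "deg \<Lambda> (fst p') = deg \<Lambda> (fst p)"
        using deg_cmp[OF \<kappa> min_extD(1,3)[OF p]] deg_cmp[OF \<kappa> min_extD(1,3)[OF p'(1)]] by simp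
      then have "fst p' = fst p" using filter_unique[OF y(1) p'(2) y(2)] by simp
      then show ?thesis using min_ext_eqI[OF p'(1) p \<kappa> \<mu>] by simp
    qed
    have "(\<Sum>p'\<in>min_ext \<Lambda> \<kappa> \<mu>. ?g p') = (\<Sum>p'\<in>{p}. ?g p')"
      by (rule sum.mono_neutral_right) (use p only zero finite_min_ext[OF \<kappa> \<mu>] in auto)
    also have "\<dots> = (case push_path (snd p) (unshift (fst p) y) of None \<Rightarrow> 0 | Some x \<Rightarrow> coord f x)"
      using y min_extD(1,2)[OF p] by (simp add: coord_rep pop_path_def)
    also have "\<dots> = coord (snd (rep \<kappa>) (fst (rep \<mu>) f)) y"
      using pop_push_path[OF \<kappa> \<mu> p y] \<kappa> \<mu> by (simp add: coord_rep)
    finally show ?thesis by simp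
  next
    case False
    then have "(\<Sum>p\<in>min_ext \<Lambda> \<kappa> \<mu>. ?g p) = 0" using zero by (intro sum.neutral) auto
    moreover have "coord (snd (rep \<kappa>) (fst (rep \<mu>) f)) y = 0"
      using False shift_mem_iff[OF sat \<kappa> _ _ \<mu>] \<kappa> \<mu> by (auto simp: coord_rep push_path_def pop_path_def)
    ultimately show ?thesis by simp
  qed
qed

lemma rep_toeplitz: "relative_CK_family \<Lambda> {} operators rep"
  unfolding relative_CK_family_def
proof (intro conjI ballI impI)
  interpret O: pre_cstar_algebra "operators :: 'a set operator cstar" by (rule pre_cstar_operators)
  note cl = O.m_closed[simplified operators_simps(1) mem_Collect_eq]
    O.adj_closed[simplified operators_simps(1) mem_Collect_eq]
  note fs = operators_simps(2,3,6) fst_conv snd_conv o_apply fst_swap snd_swap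
  fix \<kappa> assume k: "\<kappa> \<in> paths \<Lambda>"
  show "rep \<kappa> \<in> carrier operators" using k by simp
  show "rep \<kappa> \<otimes>\<^bsub>operators\<^esub> adj operators (rep \<kappa>) \<otimes>\<^bsub>operators\<^esub> rep \<kappa> = rep \<kappa>"
  proof (rule operators_eqI)
    show "fst (rep \<kappa> \<otimes>\<^bsub>operators\<^esub> adj operators (rep \<kappa>) \<otimes>\<^bsub>operators\<^esub> rep \<kappa>) f = fst (rep \<kappa>) f" for f
      unfolding fs
      by (rule poly_mapping_eqI, unfold coord_rep_proj[OF k]) (auto simp: coord_rep[OF k] pop_path_def)
  qed (use k cl adjointable_rep in blast)+
  fix \<mu> assume m: "\<mu> \<in> paths \<Lambda>"
  show "rep \<kappa> \<otimes>\<^bsub>operators\<^esub> rep \<mu> = rep (\<kappa> \<cdot> \<mu>)" if s: "src \<Lambda> \<kappa> = rng \<Lambda> \<mu>"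
  proof -
    have c: "\<kappa> \<cdot> \<mu> \<in> paths \<Lambda>" using k m s by (rule cmp_closed)
    have "prod.swap (rep \<kappa> \<otimes>\<^bsub>operators\<^esub> rep \<mu>) = prod.swap (rep (\<kappa> \<cdot> \<mu>))"
    proof (rule operators_eqI)
      show "fst (prod.swap (rep \<kappa> \<otimes>\<^bsub>operators\<^esub> rep \<mu>)) f = fst (prod.swap (rep (\<kappa> \<cdot> \<mu>))) f" for f
        unfolding fs using k m c
        by (intro poly_mapping_eqI) (simp add: coord_rep push_path_cmp[OF k m s] split: option.splits)
    qed (use k m c cl adjointable_rep adjointable_swap in blast)+
    then show ?thesis by (metis swap_swap)
  qed
  have ad: "adjointable (rep (fst p) \<otimes>\<^bsub>operators\<^esub> adj operators (rep (snd p)))" if "p \<in> min_ext \<Lambda> \<kappa> \<mu>" for p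
    using min_extD(1,2)[OF that] cl adjointable_rep by blast
  show "adj operators (rep \<kappa>) \<otimes>\<^bsub>operators\<^esub> rep \<mu> =
      finsum operators (\<lambda>p. rep (fst p) \<otimes>\<^bsub>operators\<^esub> adj operators (rep (snd p))) (min_ext \<Lambda> \<kappa> \<mu>)"
  proof (rule operators_eqI)
    have "finsum operators (\<lambda>p. rep (fst p) \<otimes>\<^bsub>operators\<^esub> adj operators (rep (snd p))) (min_ext \<Lambda> \<kappa> \<mu>) \<in> carrier operators"
      by (rule O.finsum_closed) (use ad in \<open>simp add: Pi_iff del: split_paired_All operators_simps(2,6)\<close>)
    then show "adjointable (finsum operators (\<lambda>p. rep (fst p) \<otimes>\<^bsub>operators\<^esub> adj operators (rep (snd p))) (min_ext \<Lambda> \<kappa> \<mu>))"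
      by simp
    show "fst (adj operators (rep \<kappa>) \<otimes>\<^bsub>operators\<^esub> rep \<mu>) f =
      fst (finsum operators (\<lambda>p. rep (fst p) \<otimes>\<^bsub>operators\<^esub> adj operators (rep (snd p))) (min_ext \<Lambda> \<kappa> \<mu>)) f" for f
    proof -
      have "fst (finsum operators (\<lambda>p. rep (fst p) \<otimes>\<^bsub>operators\<^esub> adj operators (rep (snd p))) (min_ext \<Lambda> \<kappa> \<mu>)) f =
        (\<Sum>p\<in>min_ext \<Lambda> \<kappa> \<mu>. fst (rep (fst p) \<otimes>\<^bsub>operators\<^esub> adj operators (rep (snd p))) f)"
        by (rule fst_finsum_operators[OF ad])
      then show ?thesis
        unfolding fs by (simp only:) (rule poly_mapping_eqI, simp add: rep_star[OF k m] lookup_sum)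
    qed
  qed (use k m cl adjointable_rep in blast)
next
  interpret O: pre_cstar_algebra "operators :: 'a set operator cstar" by (rule pre_cstar_operators)
  fix v assume v: "v \<in> vertices \<Lambda>"
  note vp = verticesD(1)[OF v]
  have e: "snd (rep v) = fst (rep v)" proof -
    have "push_path v = pop_path v" using path_maps_vertex(2)[OF v] by (rule ext)
    then show ?thesis by (simp add: rep_def)
  qed
  then show "adj operators (rep v) = rep v" by (cases "rep v") simp
  show "rep v \<otimes>\<^bsub>operators\<^esub> rep v = rep v"
  proof -
    have "fst (rep v) (fst (rep v) f) = fst (rep v) f" for f
      using vp by (intro poly_mapping_eqI) (simp add: coord_rep path_maps_vertex(1)[OF v])
    then have "fst (rep v) \<circ> fst (rep v) = fst (rep v)" by auto
    then show ?thesis using e by (cases "rep v") simp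
  qed
  fix w assume w: "w \<in> vertices \<Lambda>" "v \<noteq> w"
  show "rep v \<otimes>\<^bsub>operators\<^esub> rep w = \<zero>\<^bsub>operators\<^esub>"
  proof (rule operators_eqI)
    show "adjointable (rep v \<otimes>\<^bsub>operators\<^esub> rep w)"
      using adjointable_mult[of "rep v" "rep w"] vp verticesD(1)[OF w(1)] by simp
    show "adjointable \<zero>\<^bsub>operators\<^esub>" by (simp add: adjointable_null)
    fix f
    have "fst (rep v) (fst (rep w) f) = 0"
      using vp verticesD(1,2)[OF w(1)] w(2) filter_vertex[OF _ _ v, of \<E> _ w]
      by (intro poly_mapping_eqI) (auto simp: coord_rep path_maps_vertex(1)[OF v] path_maps_vertex(1)[OF w(1)])
    then show "fst (rep v \<otimes>\<^bsub>operators\<^esub> rep w) f = fst \<zero>\<^bsub>operators\<^esub> f" by simp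
  qed
qed simp

lemma rep_gap:
  assumes v: "v \<in> vertices \<Lambda>" and xs: "set xs \<subseteq> paths_to \<Lambda> v"
  shows "coord (fst (gap_list operators rep v xs) f) y =
    (if relative_filter \<E> y \<and> v \<in> y \<and> set xs \<inter> y = {} then coord f y else 0)"
proof -
  interpret T: toeplitz_family \<Lambda> operators rep
    by (rule toeplitz_familyI[OF finitely_aligned_k_graph_axioms pre_cstar_operators rep_toeplitz])
  show ?thesis
    using xs
  proof (induction xs arbitrary: f)
    case Nil show ?case using verticesD(1)[OF v] by (simp add: coord_rep path_maps_vertex(1)[OF v])
  next
    case (Cons \<nu> xs)
    have \<nu>: "\<nu> \<in> paths \<Lambda>" "rng \<Lambda> \<nu> = v" using Cons.prems by (auto simp: paths_to_def)
    have "v \<in> y" if "relative_filter \<E> y" "\<nu> \<in> y" using relative_filterD(2)[OF that rng_prefix[OF \<nu>(1)]] \<nu>(2) by simp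
    moreover have "coord (fst (rep v \<ominus>\<^bsub>operators\<^esub> rep \<nu> \<otimes>\<^bsub>operators\<^esub> adj operators (rep \<nu>)) g) y =
        coord (fst (rep v) g) y - coord (fst (rep \<nu>) (snd (rep \<nu>) g)) y" for g
      using adjointable_mult[OF adjointable_rep adjointable_swap, of \<nu> "rep \<nu>"] \<nu>(1) verticesD(1)[OF v]
      by (subst fst_diff_operators) (simp_all add: lookup_minus)
    ultimately show ?case
      using Cons \<nu> verticesD(1)[OF v]
      by (simp add: coord_rep_proj) (auto simp: coord_rep path_maps_vertex(1)[OF v])
  qed
qed

text \<open>
  A gap projection multiplies by the indicator function of the filters that start at the vertex and
  avoid the set.
\<close>

lemma rep_gap_projection:
  assumes F: "F \<in> FE \<Lambda>"
  shows "gap_projection \<Lambda> operators rep F = \<zero>\<^bsub>operators\<^esub> \<longleftrightarrow>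
    (\<forall>y. relative_filter \<E> y \<and> rng_set \<Lambda> F \<in> y \<longrightarrow> F \<inter> y \<noteq> {})"
proof -
  interpret T: toeplitz_family \<Lambda> operators rep
    by (rule toeplitz_familyI[OF finitely_aligned_k_graph_axioms pre_cstar_operators rep_toeplitz])
  obtain xs where xs: "set xs = F" using finite_list[OF rng_set(3)[OF F]] by blast
  let ?v = "rng_set \<Lambda> F"
  have v: "?v \<in> vertices \<Lambda>" "set xs \<subseteq> paths_to \<Lambda> ?v" using rng_set[OF F] xs by auto
  have e: "gap_projection \<Lambda> operators rep F = gap_list operators rep ?v xs" by (rule T.gap_projection_eq[OF F xs])
  have ad: "adjointable (gap_list operators rep ?v xs)" using T.gap_closed'[OF v] by simp
  show ?thesis
  proof
    assume "gap_projection \<Lambda> operators rep F = \<zero>\<^bsub>operators\<^esub>"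
    then have "coord (fst (gap_list operators rep ?v xs) f) y = 0" for f y using e by simp
    then have z: "(if relative_filter \<E> y \<and> ?v \<in> y \<and> F \<inter> y = {} then coord (Poly_Mapping.single y 1) y else 0) = 0" for y
      unfolding rep_gap[OF v] xs .
    show "\<forall>y. relative_filter \<E> y \<and> ?v \<in> y \<longrightarrow> F \<inter> y \<noteq> {}"
    proof (intro allI impI notI)
      fix y assume "relative_filter \<E> y \<and> ?v \<in> y" "F \<inter> y = {}"
      then show False using z[of y] by simp
    qed
  next
    assume a: "\<forall>y. relative_filter \<E> y \<and> ?v \<in> y \<longrightarrow> F \<inter> y \<noteq> {}"
    show "gap_projection \<Lambda> operators rep F = \<zero>\<^bsub>operators\<^esub>"
      unfolding e
      by (rule operators_eqI[OF ad])
        (use a in \<open>auto simp: adjointable_null rep_gap[OF v] xs intro!: poly_mapping_eqI\<close>)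
  qed
qed

lemma rep_family: "relative_CK_family \<Lambda> \<E> operators rep"
proof -
  have "gap_projection \<Lambda> operators rep E = \<zero>\<^bsub>operators\<^esub>" if E: "E \<in> \<E>" for E
  proof (subst rep_gap_projection[OF satiated_FE[OF sat E]], intro allI impI, elim conjE)
    fix y assume y: "relative_filter \<E> y" "rng_set \<Lambda> E \<in> y"
    note r = rng_set[OF satiated_FE[OF sat E]]
    obtain \<nu> where n: "\<nu> \<in> E" "rng_set \<Lambda> E \<cdot> \<nu> \<in> y"
      using relative_filterD(4)[OF y E] verticesD(3)[OF r(1)] by auto
    have "\<nu> \<in> paths \<Lambda>" "rng \<Lambda> \<nu> = rng_set \<Lambda> E" using r(2) n(1) by (auto simp: paths_to_def)
    then have "rng_set \<Lambda> E \<cdot> \<nu> = \<nu>" using cmp_rng by metis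
    then show "E \<inter> y \<noteq> {}" using n by auto
  qed
  then show ?thesis by (rule relative_CK_familyI[OF rep_toeplitz])
qed

theorem universal_family_nonzero:
  shows "v \<in> vertices \<Lambda> \<Longrightarrow> CK_gen \<Lambda> \<E> v \<noteq> \<zero>\<^bsub>CK_algebra \<Lambda> \<E>\<^esub>"
    and "F \<in> FE \<Lambda> - \<E> \<Longrightarrow>
      gap_projection \<Lambda> (CK_algebra \<Lambda> \<E>) (CK_gen \<Lambda> \<E>) F \<noteq> \<zero>\<^bsub>CK_algebra \<Lambda> \<E>\<^esub>"
proof -
  have \<E>: "\<E> \<subseteq> FE \<Lambda>" using satiated_FE[OF sat] by blast
  note U = universal_nonzero[OF \<E> pre_cstar_operators rep_family]
  show "CK_gen \<Lambda> \<E> v \<noteq> \<zero>\<^bsub>CK_algebra \<Lambda> \<E>\<^esub>" if v: "v \<in> vertices \<Lambda>"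
  proof (rule U(1)[OF v])
    obtain x where x: "relative_filter \<E> x" "v \<in> x" using filter_at_vertex[OF sat v] by blast
    have "coord (fst (rep v) (Poly_Mapping.single x 1)) x = 1"
      using x verticesD(1)[OF v] by (simp add: coord_rep path_maps_vertex(1)[OF v])
    then show "rep v \<noteq> \<zero>\<^bsub>operators\<^esub>" by auto
  qed
  show "gap_projection \<Lambda> (CK_algebra \<Lambda> \<E>) (CK_gen \<Lambda> \<E>) F \<noteq> \<zero>\<^bsub>CK_algebra \<Lambda> \<E>\<^esub>" if F: "F \<in> FE \<Lambda> - \<E>"
    using filter_avoiding[OF sat, of F] F rep_gap_projection[of F] by (intro U(2)) auto
qed

end

section \<open>Injectivity on the core\<close>

context
  fixes \<E> :: "'a set set"
  assumes \<E>: "\<E> \<subseteq> FE \<Lambda>"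
begin

lemma vertex_in_core:
  assumes v: "v \<in> vertices \<Lambda>" shows "CK_gen \<Lambda> \<E> v \<in> CK_core \<Lambda> \<E>"
proof -
  interpret U: toeplitz_family \<Lambda> "CK_algebra \<Lambda> \<E>" "CK_gen \<Lambda> \<E>" by (rule U_family[OF \<E>])
  have "v \<in> paths \<Lambda>" "deg \<Lambda> v = 0" using v by (auto simp: vertices_def)
  then show ?thesis using gauge_automorphism(2)[OF \<E>] by (simp add: CK_core_def)
qed

lemma gap_in_core:
  assumes F: "F \<in> FE \<Lambda>"
  shows "gap_projection \<Lambda> (CK_algebra \<Lambda> \<E>) (CK_gen \<Lambda> \<E>) F \<in> CK_core \<Lambda> \<E>"
proof -
  let ?U = "CK_algebra \<Lambda> \<E>" and ?s = "CK_gen \<Lambda> \<E>"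
  interpret U: toeplitz_family \<Lambda> ?U ?s by (rule U_family[OF \<E>])
  let ?xs = "SOME xs. distinct xs \<and> set xs = F"
  let ?f = "\<lambda>\<kappa>. ?s (rng_set \<Lambda> F) \<ominus>\<^bsub>?U\<^esub> ?s \<kappa> \<otimes>\<^bsub>?U\<^esub> adj ?U (?s \<kappa>)"
  note en = enumeration[OF F] and Fp = FE_paths[OF F]
  have "gauge \<Lambda> \<E> z (gap_projection \<Lambda> ?U ?s F) = gap_projection \<Lambda> ?U ?s F" if z: "z \<in> torus" for z
  proof -
    interpret star_homomorphism ?U ?U "gauge \<Lambda> \<E> z" by (rule gauge_hom[OF \<E> z])
    have "gauge \<Lambda> \<E> z (?f \<kappa>) = ?f \<kappa>" if k: "\<kappa> \<in> F" for \<kappa>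
    proof -
      have kp: "\<kappa> \<in> paths \<Lambda>" using Fp(1) k by auto
      have "gauge \<Lambda> \<E> z (?s (rng_set \<Lambda> F)) = ?s (rng_set \<Lambda> F)"
        using vertex_in_core[OF rng_set(1)[OF F]] z by (simp add: CK_core_def)
      moreover have "gauge \<Lambda> \<E> z (?s \<kappa> \<otimes>\<^bsub>?U\<^esub> adj ?U (?s \<kappa>)) = ?s \<kappa> \<otimes>\<^bsub>?U\<^esub> adj ?U (?s \<kappa>)"
        using gauge_monomial[OF \<E> z kp kp] weight_balanced[OF \<E> z refl, of \<kappa>] kp by simp
      ultimately show ?thesis using kp Fp(2) by (simp add: hom_diff)
    qed
    then have e: "map (gauge \<Lambda> \<E> z) (map ?f ?xs) = map ?f ?xs" using en by simp
    have "set (map ?f ?xs) \<subseteq> carrier ?U" using en Fp by auto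
    from hom_mult_list[OF this] show ?thesis unfolding e gap_projection_def mult_set_def .
  qed
  moreover have "gap_projection \<Lambda> ?U ?s F \<in> carrier ?U"
    by (rule gap_closed[OF U.pre_cstar_algebra_axioms U.t_closed F])
  ultimately show ?thesis by (simp add: CK_core_def)
qed

end

end

theorem theorem4p2:
  fixes \<Lambda> :: "('l, 'k::finite) kgraph" and \<E> :: "'l set set"
    and B :: "'b cstar" and t :: "'l \<Rightarrow> 'b"
  assumes "finitely_aligned_k_graph \<Lambda>"
    and "\<E> \<subseteq> FE \<Lambda>"
    and "satiated \<Lambda> \<E>"
    and "cstar_algebra B"
    and "relative_CK_family \<Lambda> \<E> B t"
  shows "inj_on (CK_hom \<Lambda> \<E> B t) (CK_core \<Lambda> \<E>) \<longleftrightarrow>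
    (\<forall>v\<in>vertices \<Lambda>. t v \<noteq> \<zero>\<^bsub>B\<^esub>) \<and>
    (\<forall>F\<in>FE \<Lambda> - \<E>. gap_projection \<Lambda> B t F \<noteq> \<zero>\<^bsub>B\<^esub>)"
proof
  interpret finitely_aligned_k_graph \<Lambda> by (rule assms(1))
  let ?U = "CK_algebra \<Lambda> \<E>" and ?s = "CK_gen \<Lambda> \<E>" and ?\<pi> = "CK_hom \<Lambda> \<E> B t"
  interpret U: toeplitz_family \<Lambda> ?U ?s by (rule U_family[OF assms(2)])
  interpret B: cstar_algebra B by (rule assms(4))
  note \<pi> = CK_hom[OF assms(2,4,5)]
  interpret star_homomorphism ?U B ?\<pi>
    by (intro star_homomorphism.intro star_homomorphism_axioms.intro U.pre_cstar_algebra_axioms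
        B.pre_cstar_algebra_axioms \<pi>(1))
  assume inj: "inj_on ?\<pi> (CK_core \<Lambda> \<E>)"
  have zero: "\<zero>\<^bsub>?U\<^esub> \<in> CK_core \<Lambda> \<E>"
    using star_homomorphism.hom_zero[OF gauge_hom[OF assms(2)]] by (simp add: CK_core_def)
  have nz: "?\<pi> a \<noteq> \<zero>\<^bsub>B\<^esub>" if "a \<in> CK_core \<Lambda> \<E>" "a \<noteq> \<zero>\<^bsub>?U\<^esub>" for a
    using inj_onD[OF inj _ that(1) zero] that(2) hom_zero by auto
  show "(\<forall>v\<in>vertices \<Lambda>. t v \<noteq> \<zero>\<^bsub>B\<^esub>) \<and> (\<forall>F\<in>FE \<Lambda> - \<E>. gap_projection \<Lambda> B t F \<noteq> \<zero>\<^bsub>B\<^esub>)"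
  proof (intro conjI ballI)
    fix v assume v: "v \<in> vertices \<Lambda>"
    show "t v \<noteq> \<zero>\<^bsub>B\<^esub>"
      using nz[OF vertex_in_core[OF assms(2) v] universal_family_nonzero(1)[OF assms(3) v]]
        \<pi>(2)[OF verticesD(1)[OF v]] by simp
  next
    fix F assume F: "F \<in> FE \<Lambda> - \<E>"
    have "?\<pi> (gap_projection \<Lambda> ?U ?s F) = gap_projection \<Lambda> B t F"
      by (rule gap_hom[OF U.pre_cstar_algebra_axioms B.pre_cstar_algebra_axioms \<pi>(1) U.t_closed _ \<pi>(2)]) (use F in auto)
    then show "gap_projection \<Lambda> B t F \<noteq> \<zero>\<^bsub>B\<^esub>"
      using nz[OF gap_in_core[OF assms(2)] universal_family_nonzero(2)[OF assms(3) F]] F by auto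
  qed
next
  assume "(\<forall>v\<in>vertices \<Lambda>. t v \<noteq> \<zero>\<^bsub>B\<^esub>) \<and> (\<forall>F\<in>FE \<Lambda> - \<E>. gap_projection \<Lambda> B t F \<noteq> \<zero>\<^bsub>B\<^esub>)"
  then show "inj_on (CK_hom \<Lambda> \<E> B t) (CK_core \<Lambda> \<E>)"
    by (intro finitely_aligned_k_graph.injective_on_core[OF assms(1,2,4,5)]) auto
qed

end
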